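(* Let $L>0$, and let $G\in W^{1,\infty}(0,L)$ and $a\in L^\infty(0,L)$ be real-valued. The one-dimensional system $$\left\{\begin{array}{ll} \partial_t y_1=\Delta y_1 & \text{in }(0,T)\times(0,L),\\ \partial_t y_2=\Delta y_2+G(x)\cdot\nabla y_1+a(x)y_1 & \text{in }(0,T)\times(0,L),\\ y_1=1_{\{0\}} g,\quad y_2=0 & \text{on }(0,T)\times\{0,L\},\\ y_1(0)=y_{1,0},\quad y_2(0)=y_{2,0} & \text{in }(0,L),\end{array}\right.$$ is approximately controllable if and only if $$\int_0^L\left(-\frac12 G'(x)+a(x)\right)|\phi_l(x)|^2\,dx\neq 0,\quad\forall l.$$
   Context: Here $\Omega=(0,L)$, $\partial\Omega=\{0,L\}$, $\Delta=\partial_x^2$ and $\nabla=\partial_x$. $\{-\lambda_l\}_l$ are the distinct (simple) Dirichlet eigenvalues of $\Delta$ on $(0,L)$ and $\phi_l$ is an $L^2(0,L)$-normalized eigenfunction for $-\lambda_l$. Solutions: $g\in L^2(0,T;L^2(\partial\Omega))$ is scalar (only its value at $x=0$ acts) and $y_0=(y_{1,0},y_{2,0})\in H^{-1}(\Omega)^2$. The solution $y=(y_1,y_2)\in C^0([0,T];H^{-1}(\Omega)^2)$ is taken by transposition: for all $\tau\in[0,T]$ and $\zeta\in H^1_0(\Omega)^2$, $\langle y(\tau),\zeta\rangle-\langle y_0,z(0)\rangle=-\int_0^\tau (g\,\overline{\partial_n z_1})(t,0)\,dt$, where $\partial_n$ is the outward normal derivative and $z=(z_1,z_2)$ solves $-\partial_t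 z_1=\Delta z_1-G\,\partial_x z_2+(a-G')z_2$, $-\partial_t z_2=\Delta z_2$ in $(0,\tau)\times\Omega$, $z=0$ on $\partial\Omega$, $z(\tau)=\zeta$. The system is approximately controllable at time $T$ if for all $y_0,y^1\in H^{-1}(\Omega)^2$ and $\epsilon>0$ there is a control $g$ whose solution satisfies $\|y(T)-y^1\|_{H^{-1}(\Omega)^2}\le\epsilon$; it is approximately controllable if this holds for every $T>0$. *)

theory Defs
  imports "HOL-Analysis.Analysis"
begin

text \<open>
  Elements of the function spaces below are honest functions, to be read up to equality almost
  everywhere on the interval; their values outside it are irrelevant.
  The state space is complex, and \<open>Om L\<close> is Lebesgue measure on the interval \<open>(0, L)\<close>.
\<close>

abbreviation Om :: "real \<Rightarrow> real measure" where
  "Om L \<equiv> lebesgue_on {0<..<L}"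

definition L2 :: "'x measure \<Rightarrow> ('x \<Rightarrow> complex) set" where
  "L2 M = {f \<in> borel_measurable M. integrable M (\<lambda>x. (norm (f x))\<^sup>2)}"

definition l2norm :: "'x measure \<Rightarrow> ('x \<Rightarrow> complex) \<Rightarrow> real" where
  "l2norm M f = sqrt (\<integral>x. (norm (f x))\<^sup>2 \<partial>M)"

definition Linf :: "'x measure \<Rightarrow> ('x \<Rightarrow> real) set" where
  "Linf M = {f \<in> borel_measurable M. \<exists>C. AE x in M. \<bar>f x\<bar> \<le> C}"


section \<open>Sobolev spaces on the interval\<close>

definition test_function :: "real \<Rightarrow> (real \<Rightarrow> real) \<Rightarrow> bool" where
  "test_function L \<theta> \<longleftrightarrow>
     (\<forall>n x. (deriv ^^ n) \<theta> field_differentiable at x) \<and>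
     (\<exists>c d. 0 < c \<and> d < L \<and> (\<forall>x. x \<notin> {c..d} \<longrightarrow> \<theta> x = 0))"

definition locally_integrable ::
    "real \<Rightarrow> (real \<Rightarrow> 'a::{banach, second_countable_topology}) \<Rightarrow> bool" where
  "locally_integrable L u \<longleftrightarrow> (\<forall>c d. 0 < c \<longrightarrow> d < L \<longrightarrow> integrable (lebesgue_on {c..d}) u)"

definition has_weak_derivative ::
    "real \<Rightarrow> (real \<Rightarrow> 'a::{banach, second_countable_topology}) \<Rightarrow> (real \<Rightarrow> 'a) \<Rightarrow> bool" where
  "has_weak_derivative L u v \<longleftrightarrow>
     locally_integrable L u \<and> locally_integrable L v \<and>
     (\<forall>\<theta>. test_function L \<theta> \<longrightarrow>
        (\<integral>x. deriv \<theta> x *\<^sub>R u x \<partial>Om L) = - (\<integral>x. \<theta> x *\<^sub>R v x \<partial>Om L))"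

text \<open>
  A chosen representative of the weak derivative; it is determined up to a null set, and
  everything below depends only on its class.
\<close>

definition wderiv ::
    "real \<Rightarrow> (real \<Rightarrow> 'a::{banach, second_countable_topology}) \<Rightarrow> real \<Rightarrow> 'a" where
  "wderiv L u = (SOME v. has_weak_derivative L u v)"

definition W1inf :: "real \<Rightarrow> (real \<Rightarrow> real) set" where
  "W1inf L = {u \<in> Linf (Om L). \<exists>v \<in> Linf (Om L). has_weak_derivative L u v}"

definition H1 :: "real \<Rightarrow> (real \<Rightarrow> complex) set" where
  "H1 L = {u \<in> L2 (Om L). \<exists>v \<in> L2 (Om L). has_weak_derivative L u v}"

definition h1norm :: "real \<Rightarrow> (real \<Rightarrow> complex) \<Rightarrow> real" where
  "h1norm L u = sqrt ((l2norm (Om L) u)\<^sup>2 + (l2norm (Om L) (wderiv L u))\<^sup>2)"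

definition H2 :: "real \<Rightarrow> (real \<Rightarrow> complex) set" where
  "H2 L = {u \<in> H1 L. wderiv L u \<in> H1 L}"

abbreviation laplacian :: "real \<Rightarrow> (real \<Rightarrow> complex) \<Rightarrow> real \<Rightarrow> complex" where
  "laplacian L u \<equiv> wderiv L (wderiv L u)"

text \<open>
  The value at \<open>b \<in> {0, L}\<close> of the representative of \<open>u\<close> that is continuous up to the boundary.
  Such a representative exists for every \<open>u\<close> in \<open>H\<^sup>1\<close> and is unique on \<open>[0, L]\<close>.
\<close>

definition boundary_trace :: "real \<Rightarrow> (real \<Rightarrow> complex) \<Rightarrow> real \<Rightarrow> complex" where
  "boundary_trace L u b =
     (THE c. \<exists>v. continuous_on {0..L} v \<and> (AE x in Om L. v x = u x) \<and> v b = c)"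

definition H10 :: "real \<Rightarrow> (real \<Rightarrow> complex) set" where
  "H10 L = {u \<in> H1 L. boundary_trace L u 0 = 0 \<and> boundary_trace L u L = 0}"

definition normal_derivative_at_0 :: "real \<Rightarrow> (real \<Rightarrow> complex) \<Rightarrow> complex" where
  \<comment> \<open>the outward unit normal at \<open>0\<close> is \<open>-1\<close>\<close>
  "normal_derivative_at_0 L u = - boundary_trace L (wderiv L u) 0"


section \<open>The dual space\<close>

text \<open>
  \<open>H\<^sup>-\<^sup>1\<close> is the space of bounded functionals on \<open>H\<^sup>1\<^sub>0\<close>. They are taken conjugate linear, so that a
  square integrable \<open>f\<close> acts by \<open>\<zeta> \<mapsto> \<integral> f cnj \<zeta>\<close> and the duality bracket is linear in its first
  and conjugate linear in its second argument. The values of a functional outside \<open>H\<^sup>1\<^sub>0\<close> are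
  irrelevant; boundedness forces it to respect equality almost everywhere.
\<close>

type_synonym functional = "(real \<Rightarrow> complex) \<Rightarrow> complex"

definition Hm1 :: "real \<Rightarrow> functional set" where
  "Hm1 L = {F.
     (\<forall>u \<in> H10 L. \<forall>v \<in> H10 L. F (\<lambda>x. u x + v x) = F u + F v) \<and>
     (\<forall>c. \<forall>u \<in> H10 L. F (\<lambda>x. c * u x) = cnj c * F u) \<and>
     (\<exists>C. \<forall>u \<in> H10 L. norm (F u) \<le> C * h1norm L u)}"

definition hm1norm :: "real \<Rightarrow> functional \<Rightarrow> real" where
  "hm1norm L F = (SUP u \<in> {u \<in> H10 L. h1norm L u \<le> 1}. norm (F u))"

definition hm1norm2 :: "real \<Rightarrow> functional \<times> functional \<Rightarrow> real" where
  "hm1norm2 L F = sqrt ((hm1norm L (fst F))\<^sup>2 + (hm1norm L (snd F))\<^sup>2)"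


section \<open>Time-dependent functions\<close>

definition continuous_path ::
    "('a \<Rightarrow> complex) set \<Rightarrow> (('a \<Rightarrow> complex) \<Rightarrow> real) \<Rightarrow> real \<Rightarrow> (real \<Rightarrow> 'a \<Rightarrow> complex) \<Rightarrow> bool" where
  "continuous_path X nrm T u \<longleftrightarrow>
     (\<forall>t \<in> {0..T}. u t \<in> X) \<and>
     (\<forall>t \<in> {0..T}. ((\<lambda>s. nrm (\<lambda>x. u s x - u t x)) \<longlongrightarrow> 0) (at t within {0..T}))"

text \<open>
  The function \<open>z\<close> belongs to \<open>H\<^sup>1(0, T; L\<^sup>2(0, L))\<close> with time derivative \<open>w\<close>: square integrability
  of \<open>w\<close>, and the fundamental theorem of calculus as an identity in \<open>L\<^sup>2(0, L)\<close>.
\<close>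

definition has_time_derivative ::
    "real \<Rightarrow> real \<Rightarrow> (real \<Rightarrow> real \<Rightarrow> complex) \<Rightarrow> (real \<Rightarrow> real \<Rightarrow> complex) \<Rightarrow> bool" where
  "has_time_derivative L T z w \<longleftrightarrow>
     (\<lambda>(t, x). w t x) \<in> L2 (lebesgue_on ({0<..<T} \<times> {0<..<L})) \<and>
     (\<forall>s t. 0 \<le> s \<longrightarrow> s \<le> t \<longrightarrow> t \<le> T \<longrightarrow>
        (AE x in Om L. z t x - z s x = (\<integral>r. w r x \<partial>lebesgue_on {s<..<t})))"


section \<open>The adjoint system\<close>

text \<open>
  Strong solutions, in \<open>C([0, \<tau>]; H\<^sup>1\<^sub>0) \<inter> H\<^sup>1(0, \<tau>; L\<^sup>2) \<inter> L\<^sup>2(0, \<tau>; H\<^sup>2)\<close>, of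
    \<open>- \<partial>\<^sub>t z1 = \<Delta> z1 - G \<partial>\<^sub>x z2 + (a - G') z2\<close>,  \<open>- \<partial>\<^sub>t z2 = \<Delta> z2\<close>,  \<open>z(\<tau>) = \<zeta>\<close>,
  where the boundary condition is contained in \<open>H\<^sup>1\<^sub>0\<close>. The square integrability in time of the
  \<open>H\<^sup>2\<close> norm is not listed, as the two equations imply it.
\<close>

definition adjoint_solution ::
    "real \<Rightarrow> (real \<Rightarrow> real) \<Rightarrow> (real \<Rightarrow> real) \<Rightarrow> real \<Rightarrow>
     (real \<Rightarrow> complex) \<Rightarrow> (real \<Rightarrow> complex) \<Rightarrow>
     (real \<Rightarrow> real \<Rightarrow> complex) \<Rightarrow> (real \<Rightarrow> real \<Rightarrow> complex) \<Rightarrow> bool" where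
  "adjoint_solution L G a \<tau> \<zeta>1 \<zeta>2 z1 z2 \<longleftrightarrow>
     continuous_path (H10 L) (h1norm L) \<tau> z1 \<and>
     continuous_path (H10 L) (h1norm L) \<tau> z2 \<and>
     (AE x in Om L. z1 \<tau> x = \<zeta>1 x) \<and>
     (AE x in Om L. z2 \<tau> x = \<zeta>2 x) \<and>
     (\<exists>w1 w2.
        has_time_derivative L \<tau> z1 w1 \<and>
        has_time_derivative L \<tau> z2 w2 \<and>
        (AE t in lebesgue_on {0<..<\<tau>}.
           z1 t \<in> H2 L \<and> z2 t \<in> H2 L \<and>
           (AE x in Om L.
              - w1 t x = laplacian L (z1 t) x - of_real (G x) * wderiv L (z2 t) x
                         + of_real (a x - wderiv L G x) * z2 t x) \<and>
           (AE x in Om L. - w2 t x = laplacian L (z2 t) x)))"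


section \<open>The controlled system and approximate controllability\<close>

text \<open>
  Controls are functions of time and of the boundary point \<open>b \<in> {0, L}\<close>, but only the value at
  \<open>b = 0\<close> acts on the system.
\<close>

definition control :: "real \<Rightarrow> real \<Rightarrow> (real \<Rightarrow> real \<Rightarrow> complex) \<Rightarrow> bool" where
  "control L T g \<longleftrightarrow> (\<forall>b \<in> {0, L}. (\<lambda>t. g t b) \<in> L2 (lebesgue_on {0<..<T}))"

text \<open>
  Solutions by transposition of
    \<open>\<partial>\<^sub>t y1 = \<Delta> y1\<close>,  \<open>\<partial>\<^sub>t y2 = \<Delta> y2 + G \<partial>\<^sub>x y1 + a y1\<close>
  with \<open>y1 = g\<close> at \<open>0\<close>, \<open>y1 = 0\<close> at \<open>L\<close>, \<open>y2 = 0\<close> at both ends, and initial datum \<open>y0\<close>.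
\<close>

definition transposition_solution ::
    "real \<Rightarrow> (real \<Rightarrow> real) \<Rightarrow> (real \<Rightarrow> real) \<Rightarrow> real \<Rightarrow> functional \<times> functional \<Rightarrow>
     (real \<Rightarrow> real \<Rightarrow> complex) \<Rightarrow> (real \<Rightarrow> functional) \<Rightarrow> (real \<Rightarrow> functional) \<Rightarrow> bool" where
  "transposition_solution L G a T y0 g y1 y2 \<longleftrightarrow>
     continuous_path (Hm1 L) (hm1norm L) T y1 \<and>
     continuous_path (Hm1 L) (hm1norm L) T y2 \<and>
     (\<forall>\<tau> \<in> {0..T}. \<forall>\<zeta>1 \<in> H10 L. \<forall>\<zeta>2 \<in> H10 L. \<forall>z1 z2.
        adjoint_solution L G a \<tau> \<zeta>1 \<zeta>2 z1 z2 \<longrightarrow>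
        (y1 \<tau> \<zeta>1 + y2 \<tau> \<zeta>2) - (fst y0 (z1 0) + snd y0 (z2 0)) =
        - (\<integral>t. g t 0 * cnj (normal_derivative_at_0 L (z1 t)) \<partial>lebesgue_on {0<..<\<tau>}))"

definition approx_controllable_at ::
    "real \<Rightarrow> (real \<Rightarrow> real) \<Rightarrow> (real \<Rightarrow> real) \<Rightarrow> real \<Rightarrow> bool" where
  "approx_controllable_at L G a T \<longleftrightarrow>
     (\<forall>y0 \<in> Hm1 L \<times> Hm1 L. \<forall>yT \<in> Hm1 L \<times> Hm1 L. \<forall>\<epsilon>>0.
        \<exists>g y1 y2. control L T g \<and> transposition_solution L G a T y0 g y1 y2 \<and>
          hm1norm2 L (\<lambda>u. y1 T u - fst yT u, \<lambda>u. y2 T u - snd yT u) \<le> \<epsilon>)"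

definition approx_controllable :: "real \<Rightarrow> (real \<Rightarrow> real) \<Rightarrow> (real \<Rightarrow> real) \<Rightarrow> bool" where
  "approx_controllable L G a \<longleftrightarrow> (\<forall>T>0. approx_controllable_at L G a T)"


section \<open>The Dirichlet spectrum\<close>

definition dirichlet_eigenfunction :: "real \<Rightarrow> complex \<Rightarrow> (real \<Rightarrow> complex) \<Rightarrow> bool" where
  "dirichlet_eigenfunction L \<mu> u \<longleftrightarrow>
     u \<in> H2 L \<inter> H10 L \<and> \<not> (AE x in Om L. u x = 0) \<and>
     (AE x in Om L. laplacian L u x = \<mu> * u x)"

definition dirichlet_eigenvalues :: "real \<Rightarrow> complex set" where
  "dirichlet_eigenvalues L = {\<mu>. \<exists>u. dirichlet_eigenfunction L \<mu> u}"

end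

theory Submission
  imports Defs "HOL-Real_Asymp.Real_Asymp" "HOL-Complex_Analysis.Complex_Analysis"
begin

text \<open>
  Everything is written in the sine basis \<open>e\<^sub>n = es L n\<close>, where \<open>H\<^sup>-\<^sup>1\<close> becomes \<open>\<ell>\<^sup>2\<close> and the system
  is governed by the coupling coefficients \<open>\<beta> m n = \<integral> (- G e\<^sub>m' + (a - G') e\<^sub>m) e\<^sub>n\<close>. Integration
  by parts shows that \<open>\<beta> n n\<close> is the integral in the theorem.

  Suppose all \<open>\<beta> n n \<noteq> 0\<close>. A control that jumps from \<open>0\<close> to \<open>1\<close> at time \<open>c\<close> produces
  \<open>Y - S(t - c) Y\<close>, where \<open>Y\<close> is the stationary state for the boundary value \<open>1\<close> and \<open>S\<close> the
  uncontrolled semigroup. If \<open>(P, Q)\<close> annihilates all states \<open>Y - S(s) Y\<close>, \<open>0 < s \<le> T\<close>, one obtains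
  a series in \<open>exp (- \<lambda>\<^sub>n s)\<close> and \<open>s exp (- \<lambda>\<^sub>n s)\<close> that vanishes on an interval. The
  series is holomorphic for \<open>Re s > 0\<close>, so it vanishes there, and averages over the points
  \<open>s = 1 + \<i> \<delta> k\<close> isolate its coefficients, provided that \<open>\<delta>\<close> avoids all resonances
  \<open>(\<lambda>\<^sub>m - \<lambda>\<^sub>n) \<delta> \<in> 2 \<pi> \<int>\<close>. The coefficients of \<open>s exp (- \<lambda>\<^sub>n s)\<close> are \<open>\<beta> n n\<close> times the
  coordinates of \<open>Q\<close>, up to nonzero factors. So \<open>Q = 0\<close>, then \<open>P = 0\<close>, and combinations of step
  controls reach a dense set.

  Conversely, if \<open>\<beta> n n = 0\<close>, the initial value problem \<open>\<psi>'' + \<lambda>\<^sub>n \<psi> = G e\<^sub>n' - (a - G') e\<^sub>n\<close>,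
  \<open>\<psi>(0) = \<psi>'(0) = 0\<close>, has \<open>\<psi>(L) = 0\<close>. Then \<open>exp (- \<lambda>\<^sub>n (T - t)) (\<psi>, e\<^sub>n)\<close> is an adjoint solution with
  vanishing normal derivative at \<open>0\<close>, so no control affects the pairing of the final state with
  \<open>(\<psi>, e\<^sub>n)\<close>.
\<close>

section \<open>Test functions\<close>

text \<open>The transposition identity is tested against given adjoint solutions, with no solution
  operator at hand. Sufficiency therefore computes the sine coefficients of an arbitrary adjoint
  solution, and necessity exhibits one explicit solution. Step controls are chosen because their
  states are explicit, which avoids estimating the state of a general square integrable control. The
  derivative in the source makes \<beta> m n as large as the frequency of \<open>e\<^sub>m\<close>.
  By Bessel's inequality \<open>\<beta> m n / freq L m\<close> is square summable in each index
  separately, uniformly in the other one, and integration in time gains the inverse of an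
  eigenvalue. Together these make the coupling operator bounded and the double series absolutely
  convergent for Re s > 0. In that double series a pure exponential collects contributions from
  infinitely many off-diagonal terms, so its coefficient says little. The diagonal terms stand out
  by their factor s: along a vertical line they grow linearly while the off-diagonal ones stay
  bounded, so sums of N terms divided by the square of N retain the diagonal alone.\<close>

definition flat :: "nat \<Rightarrow> real \<Rightarrow> real" where
  "flat i x = (if x > 0 then inverse x ^ i * exp (- inverse x) else 0)"

lemma flat_tendsto_0: "((\<lambda>x. inverse x ^ i * exp (- inverse x)) \<longlongrightarrow> 0) (at_right (0::real))"
proof -
  have "((\<lambda>y. y ^ i * exp (- y)) \<longlongrightarrow> 0) (at_top :: real filter)"
    using tendsto_power_div_exp_0[of i] by (simp add: exp_minus field_simps)
  then show ?thesis
    using filterlim_compose filterlim_inverse_at_top_right by blast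
qed

text \<open>The powers of 1/x are part of the family because differentiation raises them; a single
  flat function would not be closed under derivatives. At 0 the exponential beats every power, so
  the formula holds there as well.\<close>

lemma flat_deriv:
  "(flat i has_real_derivative (flat (i + 2) x - real i * flat (Suc i) x)) (at x)"
proof (cases "x = 0")
  case False
  show ?thesis
  proof (cases "x > 0")
    case True
    have "((\<lambda>x. inverse x ^ i * exp (- inverse x)) has_real_derivative
        (flat (i + 2) x - real i * flat (Suc i) x)) (at x)"
      using True
      apply (auto intro!: derivative_eq_intros simp: flat_def)
      apply (cases i; simp add: field_simps power2_eq_square)
      done
    then show ?thesis
      by (rule has_field_derivative_transform_within_open[where S="{0<..}"])
         (use True in \<open>auto simp: flat_def\<close>)
  next
    case neg: False
    have "((\<lambda>x. 0) has_real_derivative (flat (i + 2) x - real i * flat (Suc i) x)) (at x)"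
      using neg by (auto simp: flat_def)
    then show ?thesis
      by (rule has_field_derivative_transform_within_open[where S="{..<0}"])
         (use neg False in \<open>auto simp: flat_def\<close>)
  qed
next
  case True
  have "((\<lambda>y. flat i y / y) \<longlongrightarrow> 0) (at_left 0)"
    by (rule tendsto_eventually, rule eventually_at_leftI[of "-1"]) (auto simp: flat_def)
  moreover have "((\<lambda>y. flat i y / y) \<longlongrightarrow> 0) (at_right 0)"
  proof (rule Lim_transform_eventually[OF flat_tendsto_0[of "Suc i"]])
    show "\<forall>\<^sub>F x in at_right 0. inverse x ^ Suc i * exp (- inverse x) = flat i x / x"
      by (rule eventually_at_rightI[of _ 1]) (auto simp: flat_def divide_inverse)
  qed
  ultimately have "((\<lambda>y. flat i y / y) \<longlongrightarrow> 0) (at 0)"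
    by (simp add: filterlim_split_at)
  then show ?thesis
    using True by (simp add: has_field_derivative_iff flat_def)
qed

text \<open>A class closed under differentiation by construction, so that smoothness of all orders
  follows by induction without a formula for iterated derivatives.\<close>

inductive flat_alg :: "(real \<Rightarrow> real) \<Rightarrow> bool" where
  base: "flat_alg (\<lambda>x. flat i (p * x + q))"
| scale: "flat_alg f \<Longrightarrow> flat_alg (\<lambda>x. c * f x)"
| add: "flat_alg f \<Longrightarrow> flat_alg g \<Longrightarrow> flat_alg (\<lambda>x. f x + g x)"
| mult: "flat_alg f \<Longrightarrow> flat_alg g \<Longrightarrow> flat_alg (\<lambda>x. f x * g x)"

lemma flat_alg_deriv:
  "flat_alg f \<Longrightarrow> \<exists>g. flat_alg g \<and> (\<forall>x. (f has_real_derivative g x) (at x))"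
proof (induction rule: flat_alg.induct)
  case (base i p q)
  have "((\<lambda>x. flat i (p * x + q)) has_real_derivative
      p * (flat (i + 2) (p * x + q) + (- real i) * flat (Suc i) (p * x + q))) (at x)" for x
    by (rule DERIV_cong[OF DERIV_chain2[OF flat_deriv]]) (auto intro!: derivative_eq_intros)
  then show ?case
    by (intro exI[of _ "\<lambda>x. p * (flat (i + 2) (p * x + q) + (- real i) * flat (Suc i) (p * x + q))"]
        conjI allI flat_alg.intros)
next
  case (scale f c)
  then obtain f' where *: "flat_alg f'" "\<And>x. (f has_real_derivative f' x) (at x)" by blast
  show ?case
    by (intro exI[of _ "\<lambda>x. c * f' x"] conjI allI flat_alg.scale DERIV_cmult *)
next
  case (add f g)
  then obtain f' g' where *: "flat_alg f'" "\<And>x. (f has_real_derivative f' x) (at x)"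
     "flat_alg g'" "\<And>x. (g has_real_derivative g' x) (at x)"
    by blast
  show ?case
    by (intro exI[of _ "\<lambda>x. f' x + g' x"] conjI allI flat_alg.add DERIV_add *)
next
  case (mult f g)
  then obtain f' g' where *: "flat_alg f'" "\<And>x. (f has_real_derivative f' x) (at x)"
     "flat_alg g'" "\<And>x. (g has_real_derivative g' x) (at x)"
    by blast
  show ?case
    by (intro exI[of _ "\<lambda>x. f' x * g x + g' x * f x"] conjI allI flat_alg.add flat_alg.mult
        DERIV_mult * mult.hyps)
qed

lemma flat_alg_smooth: "flat_alg f \<Longrightarrow> (deriv ^^ n) f field_differentiable at x"
proof (induction n arbitrary: f)
  case 0
  then show ?case
    using flat_alg_deriv field_differentiable_def by fastforce
next
  case (Suc n)
  obtain g where g: "flat_alg g" "\<And>x. (f has_real_derivative g x) (at x)"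
    using flat_alg_deriv[OF Suc.prems] by blast
  have "deriv f = g"
    using g(2) DERIV_imp_deriv by blast
  then show ?case
    using Suc.IH[OF g(1)] by (simp add: funpow_swap1)
qed

text \<open>The slope \<open>Suc k\<close> steepens both flanks and leaves the support [c, d] fixed;
  this is what lets the bumps tend to an indicator.\<close>

definition bump :: "real \<Rightarrow> real \<Rightarrow> nat \<Rightarrow> real \<Rightarrow> real" where
  "bump c d k x = flat 0 (real (Suc k) * (x - c)) * flat 0 (real (Suc k) * (d - x))"

lemma bump_test_function:
  assumes "0 < c" "c < d" "d < L"
  shows "test_function L (bump c d k)"
proof -
  have "flat_alg (\<lambda>x. flat 0 (real (Suc k) * x + (- real (Suc k) * c)) *
      flat 0 ((- real (Suc k)) * x + real (Suc k) * d))"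
    by (intro flat_alg.intros)
  also have "(\<lambda>x. flat 0 (real (Suc k) * x + (- real (Suc k) * c)) *
      flat 0 ((- real (Suc k)) * x + real (Suc k) * d)) = bump c d k"
    by (auto simp: bump_def fun_eq_iff algebra_simps)
  finally have "flat_alg (bump c d k)" .
  moreover have "bump c d k x = 0" if "x \<notin> {c..d}" for x
  proof -
    have "x - c < 0 \<or> d - x < 0" using that by auto
    then have "real (Suc k) * (x - c) < 0 \<or> real (Suc k) * (d - x) < 0"
      by (simp add: mult_less_0_iff)
    then show ?thesis by (auto simp: bump_def flat_def)
  qed
  ultimately show ?thesis
    unfolding test_function_def using flat_alg_smooth assms by blast
qed

lemma flat_0_bounds: "0 \<le> flat 0 x" "flat 0 x \<le> 1"
  by (auto simp: flat_def)

lemma bump_bounds: "0 \<le> bump c d k x" "bump c d k x \<le> 1"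
  by (auto simp: bump_def flat_0_bounds intro!: mult_le_one)

lemma bump_tendsto: "(\<lambda>k. bump c d k x) \<longlonglongrightarrow> indicator {c<..<d} x"
proof (cases "x \<in> {c<..<d}")
  case True
  then have "x - c > 0" "d - x > 0" by auto
  then have *: "(\<lambda>k. exp (- inverse (real (Suc k) * (x - c))) * exp (- inverse (real (Suc k) * (d - x)))) \<longlonglongrightarrow> 1"
    by real_asymp
  have "bump c d k x = exp (- inverse (real (Suc k) * (x - c))) * exp (- inverse (real (Suc k) * (d - x)))" for k
    using \<open>x - c > 0\<close> \<open>d - x > 0\<close> by (simp add: bump_def flat_def)
  with * True show ?thesis by simp
next
  case False
  then have "x - c \<le> 0 \<or> d - x \<le> 0" by auto
  then have "bump c d k x = 0" for k
    by (auto simp: bump_def flat_def zero_less_mult_iff)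
  with False show ?thesis by simp
qed

lemma test_function_has_deriv:
  assumes "test_function L \<theta>"
  shows "(\<theta> has_real_derivative deriv \<theta> x) (at x)" "continuous_on S \<theta>" "continuous_on S (deriv \<theta>)"
proof -
  have *: "(deriv ^^ n) \<theta> field_differentiable at x" for n x
    using assms by (auto simp: test_function_def)
  show "(\<theta> has_real_derivative deriv \<theta> x) (at x)"
    using *[of 0 x] by (simp add: field_differentiable_derivI)
  show "continuous_on S \<theta>"
    using *[of 0] by (auto intro!: continuous_at_imp_continuous_on field_differentiable_imp_continuous_at)
  show "continuous_on S (deriv \<theta>)"
    using *[of 1] by (auto intro!: continuous_at_imp_continuous_on field_differentiable_imp_continuous_at)
qed

section \<open>The fundamental lemma of the calculus of variations\<close>

lemma integrable_lebesgue_on_subset: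
  assumes "integrable (lebesgue_on S) f" "T \<subseteq> S" "S \<in> sets lebesgue" "T \<in> sets lebesgue"
  shows "integrable (lebesgue_on T) (f :: 'b::euclidean_space \<Rightarrow> 'a::{banach, second_countable_topology})"
  using assms by (metis integrable_restrict_space set_integrable_subset set_integrable_def sets.Int_space_eq2)

lemma integral_lebesgue_on_indicator:
  assumes "S \<in> sets lebesgue" "T \<in> sets lebesgue" "T \<subseteq> S"
  shows "(\<integral>x. indicator T x *\<^sub>R f x \<partial>lebesgue_on S) = (\<integral>x. (f x :: 'a::{banach, second_countable_topology}) \<partial>lebesgue_on (T::real set))"
        "integrable (lebesgue_on S) (\<lambda>x. indicator T x *\<^sub>R f x) \<longleftrightarrow> integrable (lebesgue_on T) f"
proof -
  have *: "(\<lambda>x. indicator S x *\<^sub>R indicator T x *\<^sub>R f x) = (\<lambda>x. indicator T x *\<^sub>R f x)"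
    using assms(3) by (auto simp: fun_eq_iff indicator_def)
  show "(\<integral>x. indicator T x *\<^sub>R f x \<partial>lebesgue_on S) = (\<integral>x. f x \<partial>lebesgue_on T)"
    using assms by (simp add: integral_restrict_space * del: scaleR_scaleR)
  show "integrable (lebesgue_on S) (\<lambda>x. indicator T x *\<^sub>R f x) \<longleftrightarrow> integrable (lebesgue_on T) f"
    using assms by (simp add: integrable_restrict_space * del: scaleR_scaleR)
qed

text \<open>Lebesgue differentiation: almost every value of v is a limit of means over shrinking
  intervals, and these means vanish. Local integrability gives this only on compact subintervals,
  which then exhaust (0, L).\<close>

lemma integrals_zero_imp_AE_zero:
  fixes v :: "real \<Rightarrow> 'a::euclidean_space"
  assumes int: "locally_integrable L v"
    and zero: "\<And>c d. 0 < c \<Longrightarrow> c < d \<Longrightarrow> d < L \<Longrightarrow> (\<integral>x. v x \<partial>lebesgue_on {c<..<d}) = 0"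
  shows "AE x in Om L. v x = 0"
proof -
  have piece: "AE x in lebesgue. x \<in> {c<..<d} \<longrightarrow> v x = 0" if cd: "0 < c" "c < d" "d < L" for c d
  proof -
    define f where "f = (\<lambda>x. indicator {c<..<d} x *\<^sub>R v x)"
    have vi: "integrable (lebesgue_on {c<..<d}) v"
      by (rule integrable_lebesgue_on_subset[of "{c..d}"]) (use int cd in \<open>auto simp: locally_integrable_def\<close>)
    then have fi: "integrable lebesgue f"
      using integral_lebesgue_on_indicator(2)[of UNIV "{c<..<d}" v] by (simp add: f_def lebesgue_on_UNIV_eq)
    have fab: "integrable (lebesgue_on {a..b}) f" for a b
      using fi integrable_lebesgue_on_subset[of UNIV f "{a..b}"] by (simp add: lebesgue_on_UNIV_eq)
    then have hk: "f integrable_on cbox a b" for a b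
      by (simp add: integrable_on_lebesgue_on)
    \<comment> \<open>The cut-off f is supported in (c, d), so its integral over [a, b] is the
      integral of v over the open interval where the two overlap, up to end points.\<close>
    have z: "integral (cbox a b) f = 0" for a b
    proof -
      have "integral (cbox a b) f = (\<integral>x. f x \<partial>lebesgue_on {a..b})"
        using lebesgue_integral_eq_integral[OF fab] by simp
      also have "\<dots> = (\<integral>x. indicator {a..b} x *\<^sub>R f x \<partial>lebesgue)"
        by (simp add: integral_restrict_space)
      also have "\<dots> = (\<integral>x. indicator ({c<..<d} \<inter> {a..b}) x *\<^sub>R v x \<partial>lebesgue)"
        by (rule Bochner_Integration.integral_cong) (auto simp: f_def indicator_def)
      also have "\<dots> = (\<integral>x. indicator ({max a c<..<min b d}) x *\<^sub>R v x \<partial>lebesgue)"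
      proof (rule integral_cong_AE)
        have ii: "integrable lebesgue (\<lambda>x. indicator T x *\<^sub>R v x)" if "T \<subseteq> {c<..<d}" "T \<in> sets lebesgue" for T
        proof -
          have "integrable (lebesgue_on T) v"
            by (rule integrable_lebesgue_on_subset[OF vi]) (use that in auto)
          then show ?thesis
            using integral_lebesgue_on_indicator(2)[of UNIV T v] that by (simp add: lebesgue_on_UNIV_eq)
        qed
        show "(\<lambda>x. indicator ({c<..<d} \<inter> {a..b}) x *\<^sub>R v x) \<in> borel_measurable lebesgue"
          by (rule borel_measurable_integrable, rule ii) auto
        show "(\<lambda>x. indicator {max a c<..<min b d} x *\<^sub>R v x) \<in> borel_measurable lebesgue"
          by (rule borel_measurable_integrable, rule ii) auto
        have "AE x in lebesgue. x \<noteq> a \<and> x \<noteq> (b::real)"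
          by (auto intro!: AE_conjI AE_completion AE_lborel_singleton)
        then show "AE x in lebesgue. indicator ({c<..<d} \<inter> {a..b}) x *\<^sub>R v x = indicator {max a c<..<min b d} x *\<^sub>R v x"
          by eventually_elim (auto simp: indicator_def)
      qed
      also have "\<dots> = (\<integral>x. v x \<partial>lebesgue_on {max a c<..<min b d})"
        by (simp add: integral_restrict_space)
      also have "\<dots> = 0"
      proof (cases "max a c < min b d")
        case True
        then show ?thesis using cd by (intro zero) auto
      next
        case False
        then have "{max a c<..<min b d} = {}" by auto
        then show ?thesis by (simp add: integral_restrict_space)
      qed
      finally show ?thesis .
    qed
    obtain N where N: "negligible N" and
      "\<And>x e. \<lbrakk>x \<notin> N; 0 < e\<rbrakk> \<Longrightarrow> \<exists>d>0. \<forall>h. 0 < h \<and> h < d \<longrightarrow>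
         norm(integral (cbox x (x + h *\<^sub>R One)) f /\<^sub>R h ^ DIM(real) - f x) < e"
      using integrable_ccontinuous_explicit[OF hk] by blast
    then have lim: "\<And>x e. \<lbrakk>x \<notin> N; 0 < e\<rbrakk> \<Longrightarrow> norm (f x) < e"
      unfolding z by simp (metis dense)
    then have "f x = 0" if "x \<notin> N" for x
      by (metis less_irrefl norm_eq_zero that zero_less_norm_iff)
    then have "{x. \<not> (x \<in> {c<..<d} \<longrightarrow> v x = 0)} \<subseteq> N"
      unfolding f_def by fastforce
    then show ?thesis
      using N by (intro AE_I'[of N]) (auto simp: negligible_iff_null_sets)
  qed
  show ?thesis
  proof (cases "L > 0")
    case False
    then show ?thesis by (simp add: AE_restrict_space_iff)
  next
    case True
  \<comment> \<open>Countably many intervals cover (0, L). The 3 keeps each of them nonempty, since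
    2 / (n + 3) < 1.\<close>
  have "AE x in lebesgue. \<forall>n::nat. x \<in> {L / (real n + 3)<..<L - L / (real n + 3)} \<longrightarrow> v x = 0"
  proof (subst AE_all_countable, intro allI piece)
    fix n :: nat
    show "0 < L / (real n + 3)" "L - L / (real n + 3) < L"
      using True by auto
    show "L / (real n + 3) < L - L / (real n + 3)"
      using True by (simp add: field_simps add_pos_nonneg)
  qed
  then have "AE x in lebesgue. x \<in> {0<..<L} \<longrightarrow> v x = 0"
  proof eventually_elim
    case (elim x)
    show ?case
    proof
      assume x: "x \<in> {0<..<L}"
      have "(\<lambda>n::nat. L / (real n + 3)) \<longlonglongrightarrow> 0" by real_asymp
      then have "\<forall>\<^sub>F n in sequentially. L / (real n + 3) < min x (L - x)"
        using x by (intro order_tendstoD(2)) auto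
      then obtain n :: nat where "L / (real n + 3) < min x (L - x)"
        using eventually_happens by fastforce
      then show "v x = 0" using elim[rule_format, of n] by auto
    qed
  qed
  then show ?thesis
    by (simp add: AE_restrict_space_iff)
qed
qed

text \<open>Bumps tend to the indicator of an interval, so dominated convergence turns orthogonality
  to test functions into vanishing integrals over intervals.\<close>

lemma test_orthogonal_imp_AE_zero:
  fixes v :: "real \<Rightarrow> 'a::euclidean_space"
  assumes int: "locally_integrable L v"
    and zero: "\<And>\<theta>. test_function L \<theta> \<Longrightarrow> (\<integral>x. \<theta> x *\<^sub>R v x \<partial>Om L) = 0"
  shows "AE x in Om L. v x = 0"
proof (rule integrals_zero_imp_AE_zero[OF int])
  fix c d :: real assume cd: "0 < c" "c < d" "d < L"
  have vi: "integrable (lebesgue_on {c<..<d}) v"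
    by (rule integrable_lebesgue_on_subset[of "{c..d}"]) (use int cd in \<open>auto simp: locally_integrable_def\<close>)
  have sub: "{c<..<d} \<subseteq> {0<..<L}" using cd by auto
  have iv: "integrable (Om L) (\<lambda>x. indicator {c<..<d} x *\<^sub>R v x)"
    using integral_lebesgue_on_indicator(2)[OF _ _ sub] vi by auto
  have eq: "bump c d k x *\<^sub>R v x = bump c d k x *\<^sub>R (indicator {c<..<d} x *\<^sub>R v x)" for k x
    by (cases "x \<in> {c<..<d}") (auto simp: bump_def flat_def zero_less_mult_iff)
  have "(\<lambda>k. \<integral>x. bump c d k x *\<^sub>R v x \<partial>Om L) \<longlonglongrightarrow> (\<integral>x. indicator {c<..<d} x *\<^sub>R v x \<partial>Om L)"
  proof (rule integral_dominated_convergence[where w="\<lambda>x. norm (indicator {c<..<d} x *\<^sub>R v x)"])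
    show "(\<lambda>x. indicator {c<..<d} x *\<^sub>R v x) \<in> borel_measurable (Om L)"
      using iv by auto
    show "(\<lambda>x. bump c d k x *\<^sub>R v x) \<in> borel_measurable (Om L)" for k
    proof -
      have "bump c d k \<in> borel_measurable (Om L)"
        using test_function_has_deriv(2)[OF bump_test_function[OF cd]]
        by (intro continuous_imp_measurable_on_sets_lebesgue) auto
      then show ?thesis
        unfolding eq by (intro borel_measurable_scaleR borel_measurable_integrable[OF iv])
    qed
    show "integrable (Om L) (\<lambda>x. norm (indicator {c<..<d} x *\<^sub>R v x))"
      using iv by (rule integrable_norm)
    show "AE x in Om L. (\<lambda>k. bump c d k x *\<^sub>R v x) \<longlonglongrightarrow> indicator {c<..<d} x *\<^sub>R v x"
      by (intro AE_I2 tendsto_scaleR bump_tendsto tendsto_const)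
    show "AE x in Om L. norm (bump c d k x *\<^sub>R v x) \<le> norm (indicator {c<..<d} x *\<^sub>R v x)" for k
      unfolding eq norm_scaleR
      by (intro AE_I2 mult_left_le_one_le) (auto simp: bump_bounds)
  qed
  moreover have "(\<integral>x. bump c d k x *\<^sub>R v x \<partial>Om L) = 0" for k
    by (intro zero bump_test_function cd)
  ultimately have "(\<integral>x. indicator {c<..<d} x *\<^sub>R v x \<partial>Om L) = 0"
    by (simp add: LIMSEQ_const_iff)
  then show "(\<integral>x. v x \<partial>lebesgue_on {c<..<d}) = 0"
    using integral_lebesgue_on_indicator(1)[OF _ _ sub, of v] by simp
qed

section \<open>Primitives of integrable functions\<close>

text \<open>The primitive based at 0, total in x. Sobolev functions are handled as a constant plus
  such a primitive, so that weak derivatives and traces reduce to facts about it.\<close>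

definition prim :: "(real \<Rightarrow> 'a::{banach, second_countable_topology}) \<Rightarrow> real \<Rightarrow> 'a" where
  "prim v x = (\<integral>r. v r \<partial>Om x)"

lemma finite_measure_Om: "finite_measure (Om L)"
  by (intro finite_measure_lebesgue_on) simp

lemma sigma_finite_Om: "sigma_finite_measure (Om L)"
  using finite_measure_Om finite_measure.axioms(1) by blast

lemma pair_sigma_finite_Om: "pair_sigma_finite (Om L) (Om M)"
  by (simp add: pair_sigma_finite_def sigma_finite_Om)

lemma prim_eq_indicator:
  assumes "x \<le> L"
  shows "prim v x = (\<integral>r. indicator {0<..<x} r *\<^sub>R v r \<partial>Om L)"
  unfolding prim_def by (rule integral_lebesgue_on_indicator(1)[symmetric]) (use assms in auto)

lemma prim_nonpos [simp]: "x \<le> 0 \<Longrightarrow> prim v x = 0"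
  by (simp add: prim_def integral_restrict_space)

lemma integrable_Om_indicator:
  assumes "integrable (Om L) (v :: real \<Rightarrow> 'a::{banach, second_countable_topology})"
  shows "integrable (Om L) (\<lambda>r. indicator {a<..<x} r *\<^sub>R v r)"
proof (rule Bochner_Integration.integrable_bound[OF assms])
  have "indicator {a<..<x} \<in> borel_measurable (Om L)"
    by (intro measurable_restrict_space1 measurable_completion) simp
  then show "(\<lambda>r. indicator {a<..<x} r *\<^sub>R v r) \<in> borel_measurable (Om L)"
    using assms by (intro borel_measurable_scaleR) auto
qed (auto simp: indicator_def)

lemma integrable_Om_subset: "integrable (Om L) v \<Longrightarrow> x \<le> L \<Longrightarrow> integrable (Om x) (v :: real \<Rightarrow> 'a::{banach, second_countable_topology})"
  by (rule integrable_lebesgue_on_subset) auto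

lemma AE_Om_neq: "AE x in Om L. x \<noteq> c"
  by (auto simp: AE_restrict_space_iff intro: AE_mp[OF AE_completion[OF AE_lborel_singleton]])

lemma prim_diff:
  assumes "integrable (Om L) (v :: real \<Rightarrow> 'a::{banach, second_countable_topology})" "0 \<le> x" "x \<le> y" "y \<le> L"
  shows "prim v y - prim v x = (\<integral>r. v r \<partial>lebesgue_on {x<..<y})"
    and "integrable (lebesgue_on {x<..<y}) v"
proof -
  have sub: "{x<..<y} \<subseteq> {0<..<L}" using assms by auto
  have "prim v y - prim v x = (\<integral>r. indicator {0<..<y} r *\<^sub>R v r - indicator {0<..<x} r *\<^sub>R v r \<partial>Om L)"
    using prim_eq_indicator[of y L v] prim_eq_indicator[of x L v] assms
    by (simp add: integrable_Om_indicator)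
  also have "\<dots> = (\<integral>r. indicator {x<..<y} r *\<^sub>R v r \<partial>Om L)"
  proof (rule integral_cong_AE)
    show "AE r in Om L. indicator {0<..<y} r *\<^sub>R v r - indicator {0<..<x} r *\<^sub>R v r = indicator {x<..<y} r *\<^sub>R v r"
      using AE_Om_neq[where L=L and c=x] by eventually_elim (use assms in \<open>auto simp: indicator_def\<close>)
  qed (use integrable_Om_indicator[OF assms(1)] in auto)
  also have "\<dots> = (\<integral>r. v r \<partial>lebesgue_on {x<..<y})"
    using sub by (rule integral_lebesgue_on_indicator(1)[rotated 2]) auto
  finally show "prim v y - prim v x = (\<integral>r. v r \<partial>lebesgue_on {x<..<y})" .
  show "integrable (lebesgue_on {x<..<y}) v"
    using assms(1) sub by (rule integrable_lebesgue_on_subset) auto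
qed

text \<open>The condition y < x read in the other variable: this is the inner integral after
  exchanging the order in the triangle of \<open>prim_triangle\<close>.\<close>

lemma integral_Om_indicator_flip:
  assumes "integrable (Om L) (f :: real \<Rightarrow> 'a::{banach, second_countable_topology})" "0 \<le> y" "y \<le> L"
  shows "(\<integral>x. indicator {0<..<x} y *\<^sub>R f x \<partial>Om L) = (if 0 < y then prim f L - prim f y else 0)"
proof (cases "0 < y")
  case True
  have "(\<integral>x. indicator {0<..<x} y *\<^sub>R f x \<partial>Om L) = (\<integral>x. indicator {y<..<L} x *\<^sub>R f x \<partial>Om L)"
    using True by (intro Bochner_Integration.integral_cong) (auto simp: indicator_def)
  also have "\<dots> = (\<integral>x. f x \<partial>lebesgue_on {y<..<L})"
    by (rule integral_lebesgue_on_indicator(1)) (use assms in auto)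
  also have "\<dots> = prim f L - prim f y"
    using prim_diff(1)[OF assms(1), of y L] assms by simp
  finally show ?thesis using True by simp
qed simp

lemma triangle_integrable:
  fixes f :: "real \<Rightarrow> real" and v :: "real \<Rightarrow> 'a::{banach, second_countable_topology}"
  assumes f: "integrable (Om L) f" and v: "integrable (Om L) v"
  shows "integrable (Om L \<Otimes>\<^sub>M Om L) (\<lambda>(x, y). (indicator {0<..<x} y * f x) *\<^sub>R v y)"
proof -
  interpret pair_sigma_finite "Om L" "Om L" by (rule pair_sigma_finite_Om)
  have [measurable]: "f \<in> borel_measurable (Om L)" "v \<in> borel_measurable (Om L)"
    using f v by auto
  have [measurable]: "(\<lambda>x. x) \<in> borel_measurable (Om L)"
    by (intro measurable_restrict_space1 measurable_completion) simp
  have m: "(\<lambda>(x, y). (indicator {0<..<x} y * f x) *\<^sub>R v y) \<in> borel_measurable (Om L \<Otimes>\<^sub>M Om L)"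
    unfolding indicator_def greaterThanLessThan_iff by measurable
  have big: "integrable (Om L \<Otimes>\<^sub>M Om L) (\<lambda>(x, y). f x *\<^sub>R v y)"
  proof (rule Fubini_integrable)
    show "(\<lambda>(x, y). f x *\<^sub>R v y) \<in> borel_measurable (Om L \<Otimes>\<^sub>M Om L)"
      by measurable
    show "integrable (Om L) (\<lambda>x. \<integral>y. norm (case (x, y) of (x, y) \<Rightarrow> f x *\<^sub>R v y) \<partial>Om L)"
      using f v by simp
    show "AE x in Om L. integrable (Om L) (\<lambda>y. case (x, y) of (x, y) \<Rightarrow> f x *\<^sub>R v y)"
      using v by simp
  qed
  show ?thesis
    by (rule Bochner_Integration.integrable_bound[OF big m]) (auto simp: indicator_def)
qed

text \<open>Integrating \<open>f x v y\<close> over the square, split along the diagonal.\<close>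

lemma prim_triangle:
  fixes f :: "real \<Rightarrow> real" and v :: "real \<Rightarrow> 'a::{banach, second_countable_topology}"
  assumes f: "integrable (Om L) f" and v: "integrable (Om L) v"
  shows "integrable (Om L) (\<lambda>x. f x *\<^sub>R prim v x)" "integrable (Om L) (\<lambda>x. prim f x *\<^sub>R v x)"
    "(\<integral>x. f x *\<^sub>R prim v x \<partial>Om L) + (\<integral>x. prim f x *\<^sub>R v x \<partial>Om L) = prim f L *\<^sub>R prim v L"
proof -
  interpret pair_sigma_finite "Om L" "Om L" by (rule pair_sigma_finite_Om)
  let ?F = "\<lambda>x y. (indicator {0<..<x} y * f x) *\<^sub>R v y"
  have F: "integrable (Om L \<Otimes>\<^sub>M Om L) (\<lambda>(x, y). ?F x y)"
    by (rule triangle_integrable[OF f v])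
  have inner: "(\<integral>y. ?F x y \<partial>Om L) = f x *\<^sub>R prim v x" if "x \<le> L" for x
    using prim_eq_indicator[OF that, of v] by (simp add: mult.commute flip: scaleR_scaleR)
  have outer: "(\<integral>x. ?F x y \<partial>Om L) = prim f L *\<^sub>R v y - prim f y *\<^sub>R v y" if "0 < y" "y < L" for y
  proof -
    have "integrable (Om L) (\<lambda>x. indicator {0<..<x} y * f x)"
      using integrable_Om_indicator[OF f, of y L]
      by (rule Bochner_Integration.integrable_cong[THEN iffD1, OF refl, rotated])
         (use that in \<open>auto simp: indicator_def\<close>)
    then have "(\<integral>x. ?F x y \<partial>Om L) = (\<integral>x. indicator {0<..<x} y * f x \<partial>Om L) *\<^sub>R v y"
      by (rule integral_scaleR_left)
    also have "(\<integral>x. indicator {0<..<x} y * f x \<partial>Om L) = prim f L - prim f y"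
      using integral_Om_indicator_flip[OF f, of y] that by simp
    finally show ?thesis by (simp add: scaleR_left_diff_distrib)
  qed
  have "integrable (Om L) (\<lambda>x. \<integral>y. ?F x y \<partial>Om L)"
    using integrable_fst'[OF F] by simp
  then show i1: "integrable (Om L) (\<lambda>x. f x *\<^sub>R prim v x)"
    by (rule Bochner_Integration.integrable_cong[THEN iffD1, OF refl, rotated]) (simp add: inner)
  have "integrable (Om L) (\<lambda>y. \<integral>x. ?F x y \<partial>Om L)"
    using integrable_snd[OF F] .
  then have i2: "integrable (Om L) (\<lambda>y. prim f L *\<^sub>R v y - prim f y *\<^sub>R v y)"
    by (rule Bochner_Integration.integrable_cong[THEN iffD1, OF refl, rotated]) (simp add: outer)
  have "integrable (Om L) (\<lambda>y. prim f L *\<^sub>R v y - (prim f L *\<^sub>R v y - prim f y *\<^sub>R v y))"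
    by (intro Bochner_Integration.integrable_diff i2) (use v in auto)
  then show i3: "integrable (Om L) (\<lambda>x. prim f x *\<^sub>R v x)"
    by simp
  have "(\<integral>x. f x *\<^sub>R prim v x \<partial>Om L) = (\<integral>x. \<integral>y. ?F x y \<partial>Om L \<partial>Om L)"
    by (rule Bochner_Integration.integral_cong) (simp_all add: inner)
  also have "\<dots> = (\<integral>y. \<integral>x. ?F x y \<partial>Om L \<partial>Om L)"
    using Fubini_integral[OF F] by simp
  also have "\<dots> = (\<integral>y. prim f L *\<^sub>R v y - prim f y *\<^sub>R v y \<partial>Om L)"
    by (rule Bochner_Integration.integral_cong) (simp_all add: outer)
  also have "\<dots> = prim f L *\<^sub>R prim v L - (\<integral>y. prim f y *\<^sub>R v y \<partial>Om L)"
    using v i3 by (simp add: prim_def)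
  finally show "(\<integral>x. f x *\<^sub>R prim v x \<partial>Om L) + (\<integral>x. prim f x *\<^sub>R v x \<partial>Om L) = prim f L *\<^sub>R prim v L"
    by simp
qed

lemma prim_const: "0 \<le> x \<Longrightarrow> prim (\<lambda>_. c) x = x *\<^sub>R c"
  by (simp add: prim_def measure_restrict_space)

lemma continuous_on_prim:
  fixes v :: "real \<Rightarrow> 'a::{banach, second_countable_topology}"
  assumes v: "integrable (Om L) v"
  shows "continuous_on {0..L} (prim v)"
proof (subst continuous_on_sequentially, intro allI ballI impI, elim conjE)
  fix X a assume a: "a \<in> {0..L}" and X: "\<forall>n. X n \<in> {0..L}" "X \<longlonglongrightarrow> a"
  have "(\<lambda>n. \<integral>r. indicator {0<..<X n} r *\<^sub>R v r \<partial>Om L) \<longlonglongrightarrow> (\<integral>r. indicator {0<..<a} r *\<^sub>R v r \<partial>Om L)"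
  proof (rule integral_dominated_convergence[where w="\<lambda>r. norm (v r)"])
    show "AE r in Om L. (\<lambda>n. indicator {0<..<X n} r *\<^sub>R v r) \<longlonglongrightarrow> indicator {0<..<a} r *\<^sub>R v r"
      using AE_Om_neq[where L=L and c=a]
    proof eventually_elim
      case (elim r)
      show ?case
      proof (cases "r < a")
        case True
        then have "\<forall>\<^sub>F n in sequentially. r < X n" using X by (intro order_tendstoD)
        then have "\<forall>\<^sub>F n in sequentially. indicator {0<..<X n} r *\<^sub>R v r = indicator {0<..<a} r *\<^sub>R v r"
          by eventually_elim (use True in \<open>auto simp: indicator_def\<close>)
        then show ?thesis by (rule tendsto_eventually)
      next
        case False
        then have "a < r" using elim by simp
        then have "\<forall>\<^sub>F n in sequentially. X n < r" using X by (intro order_tendstoD)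
        then have "\<forall>\<^sub>F n in sequentially. indicator {0<..<X n} r *\<^sub>R v r = indicator {0<..<a} r *\<^sub>R v r"
          by eventually_elim (use False in \<open>auto simp: indicator_def\<close>)
        then show ?thesis by (rule tendsto_eventually)
      qed
    qed
  qed (use integrable_Om_indicator[OF v] v in \<open>auto simp: indicator_def\<close>)
  moreover have "prim v (X n) = (\<integral>r. indicator {0<..<X n} r *\<^sub>R v r \<partial>Om L)" for n
    using X(1) by (intro prim_eq_indicator) auto
  moreover have "prim v a = (\<integral>r. indicator {0<..<a} r *\<^sub>R v r \<partial>Om L)"
    using a by (intro prim_eq_indicator) auto
  ultimately show "(prim v \<circ> X) \<longlonglongrightarrow> prim v a"
    by (simp add: o_def)
qed

lemma prim_add:
  fixes v w :: "real \<Rightarrow> 'a::{banach, second_countable_topology}"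
  assumes "integrable (Om L) v" "integrable (Om L) w" "x \<le> L"
  shows "prim (\<lambda>x. v x + w x) x = prim v x + prim w x"
  unfolding prim_def
  by (intro Bochner_Integration.integral_add integrable_Om_subset[OF assms(1,3)] integrable_Om_subset[OF assms(2,3)])

text \<open>A null set contains no interval, so the points of agreement are dense in [0, L] and
  continuity reaches the end points too.\<close>

lemma continuous_AE_eq_imp_eq:
  fixes u v :: "real \<Rightarrow> 'a::metric_space"
  assumes "L > 0" "continuous_on {0..L} u" "continuous_on {0..L} v" "AE x in Om L. u x = v x" "x \<in> {0..L}"
  shows "u x = v x"
proof -
  have dense: "\<exists>y\<in>{0<..<L}. dist y z < d \<and> u y = v y" if "d > 0" "z \<in> {0..L}" for d z
  proof (rule ccontr)
    assume no: "\<not> ?thesis"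
    define a where "a = max 0 (z - d)"
    define b where "b = min L (z + d)"
    have ab: "a < b" using that assms(1) by (auto simp: a_def b_def)
    have "{a<..<b} \<subseteq> {y\<in>{0<..<L}. u y \<noteq> v y}"
      using no by (auto simp: a_def b_def dist_real_def abs_if)
    moreover have "{y\<in>{0<..<L}. u y \<noteq> v y} \<in> null_sets (Om L)" if "{y\<in>{0<..<L}. u y \<noteq> v y} \<in> sets (Om L)"
      using assms(4) that by (subst (asm) AE_iff_null) (auto simp: space_restrict_space)
    moreover obtain N where "N \<in> null_sets (Om L)" "{y\<in>{0<..<L}. u y \<noteq> v y} \<subseteq> N"
      using assms(4) by (auto simp: eventually_ae_filter space_restrict_space)
    ultimately have "{a<..<b} \<subseteq> N" "N \<in> null_sets lebesgue"
      by (auto simp: null_sets_restrict_space)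
    then have "{a<..<b} \<in> null_sets lebesgue"
      by (rule null_sets_subset[rotated 2]) simp_all
    then have "emeasure lborel {a<..<b} = 0" by auto
    then show False using ab by (simp add: emeasure_lborel_Ioo)
  qed
  have "\<exists>y. \<forall>n. y n \<in> {0<..<L} \<and> dist (y n) x < inverse (real (Suc n)) \<and> u (y n) = v (y n)"
    using dense[OF _ assms(5)] by (intro choice allI) (metis inverse_positive_iff_positive of_nat_0_less_iff zero_less_Suc)
  then obtain y where y: "\<And>n. y n \<in> {0<..<L}" "\<And>n. dist (y n) x < inverse (real (Suc n))" "\<And>n. u (y n) = v (y n)"
    by blast
  have "(\<lambda>n. dist (y n) x) \<longlonglongrightarrow> 0"
  proof (rule tendsto_sandwich[OF _ _ tendsto_const LIMSEQ_inverse_real_of_nat])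
    show "\<forall>\<^sub>F n in sequentially. 0 \<le> dist (y n) x" by simp
    show "\<forall>\<^sub>F n in sequentially. dist (y n) x \<le> inverse (real (Suc n))"
      using y(2) by (intro always_eventually allI less_imp_le)
  qed
  then have lim: "y \<longlonglongrightarrow> x"
    using tendsto_dist_iff by blast
  have ev: "\<forall>\<^sub>F n in sequentially. y n \<in> {0..L}"
    using y(1) by (intro always_eventually) (auto simp: less_imp_le)
  have "(\<lambda>n. u (y n)) \<longlonglongrightarrow> u x" "(\<lambda>n. v (y n)) \<longlonglongrightarrow> v x"
    using continuous_on_tendsto_compose[OF assms(2) lim assms(5) ev]
      continuous_on_tendsto_compose[OF assms(3) lim assms(5) ev] by auto
  then show ?thesis
    unfolding y(3) using LIMSEQ_unique by blast
qed

section \<open>Weak derivatives\<close>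

lemma borel_measurable_Om_AE:
  fixes u v :: "real \<Rightarrow> 'a::euclidean_space"
  assumes "u \<in> borel_measurable (Om L)" "AE x in Om L. u x = v x"
  shows "v \<in> borel_measurable (Om L)"
proof -
  have "(\<lambda>x. indicator {0<..<L} x *\<^sub>R u x) \<in> borel_measurable lebesgue"
    using assms(1) by (simp add: borel_measurable_restrict_space_iff)
  moreover have "AE x in lebesgue. indicator {0<..<L} x *\<^sub>R u x = indicator {0<..<L} x *\<^sub>R v x"
    using assms(2) by (simp add: AE_restrict_space_iff) (auto elim!: AE_mp simp: indicator_def)
  ultimately have "(\<lambda>x. indicator {0<..<L} x *\<^sub>R v x) \<in> borel_measurable lebesgue"
    by (rule borel_measurable_AE)
  then show ?thesis
    by (simp add: borel_measurable_restrict_space_iff)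
qed

lemma integrable_Om_AE:
  fixes u v :: "real \<Rightarrow> 'a::euclidean_space"
  assumes "integrable (Om L) u" "AE x in Om L. u x = v x"
  shows "integrable (Om L) v"
  using assms borel_measurable_Om_AE[OF _ assms(2)] by (metis integrable_cong_AE borel_measurable_integrable)

lemma integrable_continuous_Om:
  fixes g :: "real \<Rightarrow> 'a::euclidean_space"
  assumes "continuous_on {0..L} g"
  shows "integrable (Om L) g"
  by (rule integrable_lebesgue_on_subset[OF continuous_imp_integrable_real[OF assms]]) auto

lemma prim_FTC:
  fixes f :: "real \<Rightarrow> 'a::euclidean_space"
  assumes "0 \<le> x" "\<And>t. t \<in> {0..x} \<Longrightarrow> (f has_vector_derivative g t) (at t within {0..x})" "continuous_on {0..x} g"
  shows "prim g x = f x - f 0"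
proof -
  have "prim g x = integral {0<..<x} g"
    unfolding prim_def using integrable_continuous_Om[OF assms(3)]
    by (intro lebesgue_integral_eq_integral) auto
  also have "\<dots> = integral {0..x} g" by (rule integral_open_interval_real[symmetric])
  also have "\<dots> = f x - f 0"
    using fundamental_theorem_of_calculus[of 0 x f g] assms by (simp add: integral_unique)
  finally show ?thesis .
qed

lemma prim_FTC_real:
  fixes f :: "real \<Rightarrow> real"
  assumes "0 \<le> x" "\<And>t. (f has_real_derivative g t) (at t)" "continuous_on {0..x} g"
  shows "prim g x = f x - f 0"
  using assms by (intro prim_FTC) (auto simp: has_real_derivative_iff_has_vector_derivative intro: has_vector_derivative_at_within)

lemma test_function_zero: "test_function L \<theta> \<Longrightarrow> x \<le> 0 \<or> L \<le> x \<Longrightarrow> \<theta> x = 0"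
  unfolding test_function_def by force

lemma prim_deriv_test_function:
  assumes "test_function L \<theta>" "0 \<le> x"
  shows "prim (deriv \<theta>) x = \<theta> x"
  using prim_FTC_real[OF assms(2) test_function_has_deriv(1)[OF assms(1)] test_function_has_deriv(3)[OF assms(1)]]
    test_function_zero[OF assms(1), of 0] by simp

text \<open>\<open>prim_triangle\<close> with the derivative of the test function as f: its
  primitive is the test function itself, which vanishes at L, so the boundary term and the constant
  c disappear.\<close>

lemma has_weak_derivative_prim:
  fixes v :: "real \<Rightarrow> 'a::euclidean_space"
  assumes L: "L > 0" and v: "integrable (Om L) v" and u: "AE x in Om L. u x = c + prim v x"
  shows "has_weak_derivative L u v" "integrable (Om L) u"
proof -
  have cu: "continuous_on {0..L} (\<lambda>x. c + prim v x)"
    using continuous_on_prim[OF v] by (intro continuous_intros)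
  have iu: "integrable (Om L) (\<lambda>x. c + prim v x)"
    using cu by (rule integrable_continuous_Om)
  have u': "AE x in Om L. c + prim v x = u x" using u by auto
  show ui: "integrable (Om L) u"
    by (rule integrable_Om_AE[OF iu u'])
  have loc: "locally_integrable L w" if "integrable (Om L) w" for w :: "real \<Rightarrow> 'a"
    unfolding locally_integrable_def using that by (auto intro: integrable_lebesgue_on_subset)
  have "(\<integral>x. deriv \<theta> x *\<^sub>R u x \<partial>Om L) = - (\<integral>x. \<theta> x *\<^sub>R v x \<partial>Om L)" if \<theta>: "test_function L \<theta>" for \<theta>
  proof -
    have d: "integrable (Om L) (deriv \<theta>)"
      by (intro integrable_continuous_Om test_function_has_deriv(3)[OF \<theta>])
    have pL: "prim (deriv \<theta>) L = 0"
      using prim_deriv_test_function[OF \<theta>, of L] test_function_zero[OF \<theta>, of L] L by simp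
    have "(\<integral>x. deriv \<theta> x *\<^sub>R u x \<partial>Om L) = (\<integral>x. deriv \<theta> x *\<^sub>R c + deriv \<theta> x *\<^sub>R prim v x \<partial>Om L)"
    proof (rule integral_cong_AE)
      show "(\<lambda>x. deriv \<theta> x *\<^sub>R u x) \<in> borel_measurable (Om L)"
        using d ui by (intro borel_measurable_scaleR) auto
      show "(\<lambda>x. deriv \<theta> x *\<^sub>R c + deriv \<theta> x *\<^sub>R prim v x) \<in> borel_measurable (Om L)"
        using d prim_triangle(1)[OF d v] by auto
      show "AE x in Om L. deriv \<theta> x *\<^sub>R u x = deriv \<theta> x *\<^sub>R c + deriv \<theta> x *\<^sub>R prim v x"
        using u by eventually_elim (simp add: scaleR_add_right)
    qed
    also have "\<dots> = prim (deriv \<theta>) L *\<^sub>R c + (\<integral>x. deriv \<theta> x *\<^sub>R prim v x \<partial>Om L)"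
      using d prim_triangle(1)[OF d v] by (simp add: prim_def)
    also have "\<dots> = - (\<integral>x. prim (deriv \<theta>) x *\<^sub>R v x \<partial>Om L)"
      using prim_triangle(3)[OF d v] pL by (simp add: eq_neg_iff_add_eq_0)
    also have "(\<integral>x. prim (deriv \<theta>) x *\<^sub>R v x \<partial>Om L) = (\<integral>x. \<theta> x *\<^sub>R v x \<partial>Om L)"
      by (rule Bochner_Integration.integral_cong) (auto simp: prim_deriv_test_function[OF \<theta>])
    finally show ?thesis .
  qed
  with loc[OF ui] loc[OF v] show "has_weak_derivative L u v"
    unfolding has_weak_derivative_def by blast
qed

text \<open>The support of a test function is compact in the open interval, and there local
  integrability is integrability. The derivative has the same support because the complement of
  [c, d] is open.\<close>

lemma test_function_scaleR_integrable:
  fixes v :: "real \<Rightarrow> 'a::euclidean_space"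
  assumes \<theta>: "test_function L \<theta>" and v: "locally_integrable L v"
  shows "integrable (Om L) (\<lambda>x. \<theta> x *\<^sub>R v x)" "integrable (Om L) (\<lambda>x. deriv \<theta> x *\<^sub>R v x)"
proof -
  obtain c d where cd: "0 < c" "d < L" "\<And>x. x \<notin> {c..d} \<Longrightarrow> \<theta> x = 0"
    using \<theta> unfolding test_function_def by metis
  have d0: "deriv \<theta> x = 0" if "x \<notin> {c..d}" for x
  proof -
    have "((\<lambda>x. 0) has_real_derivative deriv \<theta> x) (at x)"
    proof (rule has_field_derivative_transform_within_open[OF test_function_has_deriv(1)[OF \<theta>]])
      show "open (- {c..d})" by (simp add: open_Compl)
    qed (use that cd(3) in auto)
    then show ?thesis using DERIV_unique DERIV_const by blast
  qed
  have gen: "integrable (Om L) (\<lambda>x. g x *\<^sub>R v x)"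
    if g: "continuous_on UNIV g" "\<And>x. x \<notin> {c..d} \<Longrightarrow> g x = (0::real)" for g
  proof -
    have "continuous_on {c..d} g" using g(1) continuous_on_subset by blast
    then have gm: "g \<in> borel_measurable (lebesgue_on {c..d})" and "bounded (g ` {c..d})"
      by (auto intro: continuous_imp_measurable_on_sets_lebesgue compact_imp_bounded compact_continuous_image)
    then obtain B where "\<forall>y\<in>g ` {c..d}. norm y \<le> B"
      unfolding bounded_iff by blast
    then have B: "\<bar>g x\<bar> \<le> B" if "x \<in> {c..d}" for x
      using that by auto
    have vi: "integrable (lebesgue_on {c..d}) v"
      using v cd by (auto simp: locally_integrable_def)
    have "integrable (lebesgue_on {c..d}) (\<lambda>x. g x *\<^sub>R v x)"
    proof (rule Bochner_Integration.integrable_bound)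
      show "integrable (lebesgue_on {c..d}) (\<lambda>x. B *\<^sub>R v x)" using vi by simp
      show "(\<lambda>x. g x *\<^sub>R v x) \<in> borel_measurable (lebesgue_on {c..d})"
        using gm vi by (intro borel_measurable_scaleR) auto
      show "AE x in lebesgue_on {c..d}. norm (g x *\<^sub>R v x) \<le> norm (B *\<^sub>R v x)"
        using B by (intro AE_I2) (force intro!: mult_right_mono)
    qed
    moreover have sub: "{c..d} \<subseteq> {0<..<L}" using cd by auto
    ultimately have "integrable (Om L) (\<lambda>x. indicator {c..d} x *\<^sub>R (g x *\<^sub>R v x))"
      using integral_lebesgue_on_indicator(2)[of "{0<..<L}" "{c..d}" "\<lambda>x. g x *\<^sub>R v x"] by simp
    also have "(\<lambda>x. indicator {c..d} x *\<^sub>R (g x *\<^sub>R v x)) = (\<lambda>x. g x *\<^sub>R v x)"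
      using g(2) by (auto simp: fun_eq_iff indicator_def)
    finally show ?thesis .
  qed
  show "integrable (Om L) (\<lambda>x. \<theta> x *\<^sub>R v x)"
    by (rule gen) (use test_function_has_deriv(2)[OF \<theta>] cd(3) in auto)
  show "integrable (Om L) (\<lambda>x. deriv \<theta> x *\<^sub>R v x)"
    by (rule gen) (use test_function_has_deriv(3)[OF \<theta>] d0 in auto)
qed

lemma weak_derivative_unique:
  fixes v w :: "real \<Rightarrow> 'a::euclidean_space"
  assumes "has_weak_derivative L u v" "has_weak_derivative L u w"
  shows "AE x in Om L. v x = w x"
proof -
  have l: "locally_integrable L v" "locally_integrable L w"
    using assms by (auto simp: has_weak_derivative_def)
  have "AE x in Om L. v x - w x = 0"
  proof (rule test_orthogonal_imp_AE_zero)
    show "locally_integrable L (\<lambda>x. v x - w x)"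
      using l by (auto simp: locally_integrable_def)
    fix \<theta> assume \<theta>: "test_function L \<theta>"
    have "(\<integral>x. deriv \<theta> x *\<^sub>R u x \<partial>Om L) = - (\<integral>x. \<theta> x *\<^sub>R v x \<partial>Om L)"
      "(\<integral>x. deriv \<theta> x *\<^sub>R u x \<partial>Om L) = - (\<integral>x. \<theta> x *\<^sub>R w x \<partial>Om L)"
      using assms \<theta> unfolding has_weak_derivative_def by blast+
    then have "(\<integral>x. \<theta> x *\<^sub>R v x \<partial>Om L) = (\<integral>x. \<theta> x *\<^sub>R w x \<partial>Om L)" by simp
    then show "(\<integral>x. \<theta> x *\<^sub>R (v x - w x) \<partial>Om L) = 0"
      using test_function_scaleR_integrable(1)[OF \<theta> l(1)] test_function_scaleR_integrable(1)[OF \<theta> l(2)]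
      by (simp add: scaleR_diff_right)
  qed
  then show ?thesis by simp
qed

section \<open>The du Bois-Reymond lemma\<close>

lemma smooth_lincomb:
  fixes f g :: "real \<Rightarrow> real"
  assumes "\<And>n x. (deriv ^^ n) f field_differentiable at x" "\<And>n x. (deriv ^^ n) g field_differentiable at x"
  shows "(deriv ^^ n) (\<lambda>x. f x + k * g x) = (\<lambda>x. (deriv ^^ n) f x + k * (deriv ^^ n) g x)"
proof (induction n)
  case (Suc n)
  have "deriv (\<lambda>x. (deriv ^^ n) f x + k * (deriv ^^ n) g x) x = deriv ((deriv ^^ n) f) x + k * deriv ((deriv ^^ n) g) x" for x
    by (rule DERIV_imp_deriv)
      (intro DERIV_add DERIV_cmult field_differentiable_derivI assms)
  then show ?case by (simp add: Suc.IH)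
qed simp

lemma test_function_lincomb:
  assumes "test_function L f" "test_function L g"
  shows "test_function L (\<lambda>x. f x + k * g x)"
proof -
  have d: "\<And>n x. (deriv ^^ n) f field_differentiable at x" "\<And>n x. (deriv ^^ n) g field_differentiable at x"
    using assms by (auto simp: test_function_def)
  obtain c d c' d' where cd: "0 < c" "d < L" "\<And>x. x \<notin> {c..d} \<Longrightarrow> f x = 0"
     "0 < c'" "d' < L" "\<And>x. x \<notin> {c'..d'} \<Longrightarrow> g x = 0"
    using assms unfolding test_function_def by metis
  have "0 < min c c'" "max d d' < L" using cd by auto
  moreover have "f x + k * g x = 0" if "x \<notin> {min c c'..max d d'}" for x
  proof -
    have "x \<notin> {c..d}" "x \<notin> {c'..d'}" using that by auto
    then show ?thesis using cd(3)[of x] cd(6)[of x] by simp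
  qed
  moreover have "(deriv ^^ n) (\<lambda>x. f x + k * g x) field_differentiable at x" for n x
    unfolding smooth_lincomb[OF d]
    by (intro field_differentiable_add field_differentiable_mult field_differentiable_const d)
  ultimately show ?thesis unfolding test_function_def by blast
qed

text \<open>Mean zero is exactly what makes the primitive from 0 vanish again to the right of the
  support.\<close>

lemma test_function_antiderivative:
  assumes \<eta>: "test_function L \<eta>" and zero: "prim \<eta> L = 0" and L: "L > 0"
  obtains \<theta> where "test_function L \<theta>" "deriv \<theta> = \<eta>"
proof -
  obtain c d where cd: "0 < c" "d < L" "\<And>x. x \<notin> {c..d} \<Longrightarrow> \<eta> x = 0"
    using \<eta> unfolding test_function_def by metis
  have "\<exists>F. \<forall>x :: real. - \<infinity> < x \<longrightarrow> x < \<infinity> \<longrightarrow> (F has_vector_derivative \<eta> x) (at x)"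
    by (intro einterval_antiderivative DERIV_isCont[OF test_function_has_deriv(1)[OF \<eta>]]) simp
  then obtain F where F: "\<And>x. (F has_real_derivative \<eta> x) (at x)"
    by (auto simp: has_real_derivative_iff_has_vector_derivative)
  define \<theta> where "\<theta> = (\<lambda>x. F x - F 0)"
  have \<theta>: "(\<theta> has_real_derivative \<eta> x) (at x)" for x
    unfolding \<theta>_def using F[of x] by (auto intro!: derivative_eq_intros)
  then have d: "deriv \<theta> = \<eta>" using DERIV_imp_deriv by blast
  have const: "\<theta> a = \<theta> b" if "a < b" "\<And>x. a < x \<Longrightarrow> x < b \<Longrightarrow> \<eta> x = 0" for a b
    using MVT2[OF that(1), of \<theta> \<eta>] \<theta> that(2) by auto
  have "prim \<eta> L = \<theta> L - \<theta> 0"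
    by (rule prim_FTC_real) (use L \<theta> test_function_has_deriv(2)[OF \<eta>] in auto)
  then have \<theta>L: "\<theta> L = 0" "\<theta> 0 = 0" using zero by (auto simp: \<theta>_def)
  have "\<theta> x = 0" if "x \<notin> {c..d}" for x
  proof (cases "x < c")
    case True
    then show ?thesis
      using const[of x 0] const[of 0 x] cd \<theta>L by (cases x "0::real" rule: linorder_cases) auto
  next
    case False
    then have "d < x" using that by auto
    then show ?thesis
      using const[of x L] const[of L x] cd \<theta>L by (cases x L rule: linorder_cases) auto
  qed
  moreover have "(deriv ^^ n) \<theta> field_differentiable at x" for n x
  proof (cases n)
    case 0
    then show ?thesis using \<theta> field_differentiable_def by auto
  next
    case (Suc m)
    then show ?thesis using \<eta> d by (simp add: funpow_swap1 test_function_def)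
  qed
  ultimately have "test_function L \<theta>" using cd(1,2) unfolding test_function_def by blast
  then show ?thesis using d that by blast
qed

text \<open>The difference w of u and the primitive is orthogonal to all derivatives of test
  functions. Every test function differs from a multiple of one fixed bump \<eta> by such a
  derivative, so w is constant.\<close>

lemma weak_derivative_imp_prim:
  fixes v :: "real \<Rightarrow> 'a::euclidean_space"
  assumes L: "L > 0" and uv: "has_weak_derivative L u v" and v: "integrable (Om L) v"
  obtains c where "AE x in Om L. u x = c + prim v x"
proof -
  define w where "w = (\<lambda>x. u x - prim v x)"
  have pv: "has_weak_derivative L (prim v) v"
    by (rule has_weak_derivative_prim[OF L v, of _ 0]) simp
  have l: "locally_integrable L u" "locally_integrable L (prim v)"
    using uv pv by (auto simp: has_weak_derivative_def)
  have lw: "locally_integrable L w"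
    using l by (auto simp: locally_integrable_def w_def)
  have w: "(\<integral>x. deriv \<theta> x *\<^sub>R w x \<partial>Om L) = 0" if \<theta>: "test_function L \<theta>" for \<theta>
    using test_function_scaleR_integrable(2)[OF \<theta> l(1)] test_function_scaleR_integrable(2)[OF \<theta> l(2)] uv pv \<theta>
    by (simp add: w_def scaleR_diff_right has_weak_derivative_def)
  define \<eta> where "\<eta> = bump (L/3) (2*L/3) 0"
  have \<eta>: "test_function L \<eta>" unfolding \<eta>_def using L by (intro bump_test_function) auto
  have \<eta>i: "integrable (Om L) \<eta>"
    by (intro integrable_continuous_Om test_function_has_deriv(2)[OF \<eta>])
  have "prim \<eta> L \<noteq> 0"
  proof
    assume "prim \<eta> L = 0"
    then have "AE x in Om L. \<eta> x = 0"
      using \<eta>i unfolding prim_def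
      by (subst (asm) integral_nonneg_eq_0_iff_AE) (auto simp: \<eta>_def bump_bounds)
    then have "\<eta> (L/2) = 0"
      using continuous_AE_eq_imp_eq[OF L test_function_has_deriv(2)[OF \<eta>] continuous_on_const[of _ 0], of "L/2"] L by simp
    then show False using L by (auto simp: \<eta>_def bump_def flat_def field_simps)
  qed
  \<comment> \<open>The \<eta>-weighted mean of w, the only value the constant can have.\<close>
  define c where "c = (\<integral>x. \<eta> x *\<^sub>R w x \<partial>Om L) /\<^sub>R prim \<eta> L"
  have "AE x in Om L. w x - c = 0"
  proof (rule test_orthogonal_imp_AE_zero)
    show "locally_integrable L (\<lambda>x. w x - c)"
      using lw by (auto simp: locally_integrable_def intro!: Bochner_Integration.integrable_diff
        integrable_const finite_measure_lebesgue_on)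
    fix \<xi> assume \<xi>: "test_function L \<xi>"
    define k where "k = prim \<xi> L / prim \<eta> L"
    have \<xi>i: "integrable (Om L) \<xi>"
      by (intro integrable_continuous_Om test_function_has_deriv(2)[OF \<xi>])
    have t: "test_function L (\<lambda>x. \<xi> x + (- k) * \<eta> x)"
      by (rule test_function_lincomb[OF \<xi> \<eta>])
    have "prim (\<lambda>x. \<xi> x + (- k) * \<eta> x) L = 0"
      using \<xi>i \<eta>i \<open>prim \<eta> L \<noteq> 0\<close> by (simp add: prim_def k_def)
    then obtain \<theta> where \<theta>: "test_function L \<theta>" "deriv \<theta> = (\<lambda>x. \<xi> x + (- k) * \<eta> x)"
      using test_function_antiderivative[OF t _ L] by blast
    have i: "integrable (Om L) (\<lambda>x. \<xi> x *\<^sub>R w x)" "integrable (Om L) (\<lambda>x. \<eta> x *\<^sub>R w x)"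
      using test_function_scaleR_integrable(1) \<xi> \<eta> lw by blast+
    have "0 = (\<integral>x. \<xi> x *\<^sub>R w x - k *\<^sub>R (\<eta> x *\<^sub>R w x) \<partial>Om L)"
      using w[OF \<theta>(1)] by (simp add: \<theta>(2) scaleR_diff_left)
    also have "\<dots> = (\<integral>x. \<xi> x *\<^sub>R w x \<partial>Om L) - k *\<^sub>R (\<integral>x. \<eta> x *\<^sub>R w x \<partial>Om L)"
      using i by (simp del: scaleR_scaleR)
    also have "k *\<^sub>R (\<integral>x. \<eta> x *\<^sub>R w x \<partial>Om L) = prim \<xi> L *\<^sub>R c"
      by (simp add: k_def c_def divide_inverse)
    also have "\<dots> = (\<integral>x. \<xi> x *\<^sub>R c \<partial>Om L)"
      using \<xi>i by (simp add: prim_def)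
    finally show "(\<integral>x. \<xi> x *\<^sub>R (w x - c) \<partial>Om L) = 0"
      using i \<xi>i by (simp add: scaleR_diff_right)
  qed
  then have "AE x in Om L. u x = c + prim v x"
    by (auto simp: w_def algebra_simps elim!: AE_mp)
  then show ?thesis using that by blast
qed

section \<open>Square integrable functions and Sobolev spaces\<close>

lemma L2D:
  assumes "f \<in> L2 M"
  shows "f \<in> borel_measurable M" "integrable M (\<lambda>x. (norm (f x))\<^sup>2)"
  using assms by (auto simp: L2_def)

lemma L2_norm_mult_integrable:
  assumes "f \<in> L2 M" "g \<in> L2 M"
  shows "integrable M (\<lambda>x. norm (f x) * norm (g x))"
proof (rule Bochner_Integration.integrable_bound)
  show "integrable M (\<lambda>x. (norm (f x))\<^sup>2 + (norm (g x))\<^sup>2)"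
    using assms by (auto dest: L2D)
  show "(\<lambda>x. norm (f x) * norm (g x)) \<in> borel_measurable M"
    using L2D(1)[OF assms(1)] L2D(1)[OF assms(2)] by measurable
  have "a * b \<le> a\<^sup>2 + b\<^sup>2" if "a \<ge> 0" "b \<ge> 0" for a b :: real
  proof -
    have "2 * (a * b) \<le> a\<^sup>2 + b\<^sup>2" using sum_squares_bound[of a b] by (simp add: mult.assoc)
    then show ?thesis using mult_nonneg_nonneg[OF that] by linarith
  qed
  then show "AE x in M. norm (norm (f x) * norm (g x)) \<le> norm ((norm (f x))\<^sup>2 + (norm (g x))\<^sup>2)"
    by (intro AE_I2) auto
qed

lemma L2_mult_integrable:
  assumes "f \<in> L2 M" "g \<in> L2 M"
  shows "integrable M (\<lambda>x. f x * g x)"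
  by (rule Bochner_Integration.integrable_bound[OF L2_norm_mult_integrable[OF assms]])
     (use L2D(1)[OF assms(1)] L2D(1)[OF assms(2)] in \<open>auto simp: norm_mult\<close>)

lemma L2_dominated:
  assumes "f \<in> L2 M" "g \<in> borel_measurable M" "AE x in M. norm (g x) \<le> C * norm (f x)"
  shows "g \<in> L2 M"
proof -
  have "integrable M (\<lambda>x. (norm (g x))\<^sup>2)"
  proof (rule Bochner_Integration.integrable_bound)
    show "integrable M (\<lambda>x. C\<^sup>2 * (norm (f x))\<^sup>2)" using L2D(2)[OF assms(1)] by simp
    show "AE x in M. norm ((norm (g x))\<^sup>2) \<le> norm (C\<^sup>2 * (norm (f x))\<^sup>2)"
      using assms(3)
    proof eventually_elim
      case (elim x)
      then have "(norm (g x))\<^sup>2 \<le> (C * norm (f x))\<^sup>2" by (intro power_mono) auto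
      then show ?case by (simp add: power_mult_distrib)
    qed
  qed (use assms in measurable)
  then show ?thesis using assms(2) by (simp add: L2_def)
qed

lemma L2_cmult: "f \<in> L2 M \<Longrightarrow> (\<lambda>x. c * f x) \<in> L2 M"
  by (rule L2_dominated[where C="norm c"])
    (auto simp: norm_mult intro: borel_measurable_times borel_measurable_const L2D(1))

lemma L2_add:
  assumes "f \<in> L2 M" "g \<in> L2 M"
  shows "(\<lambda>x. f x + g x) \<in> L2 M"
proof -
  have "integrable M (\<lambda>x. (norm (f x + g x))\<^sup>2)"
  proof (rule Bochner_Integration.integrable_bound)
    show "integrable M (\<lambda>x. 2 * (norm (f x))\<^sup>2 + 2 * (norm (g x))\<^sup>2)"
      using L2D(2)[OF assms(1)] L2D(2)[OF assms(2)] by simp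
    have "(norm (a + b))\<^sup>2 \<le> 2 * (norm a)\<^sup>2 + 2 * (norm b)\<^sup>2" for a b :: complex
    proof -
      have "(norm (a + b))\<^sup>2 \<le> (norm a + norm b)\<^sup>2" by (intro power_mono norm_triangle_ineq) auto
      also have "\<dots> \<le> 2 * (norm a)\<^sup>2 + 2 * (norm b)\<^sup>2"
        using sum_squares_bound[of "norm a" "norm b"] by (simp add: power2_sum)
      finally show ?thesis .
    qed
    then show "AE x in M. norm ((norm (f x + g x))\<^sup>2) \<le> norm (2 * (norm (f x))\<^sup>2 + 2 * (norm (g x))\<^sup>2)"
      by (intro AE_I2) auto
    show "(\<lambda>x. (norm (f x + g x))\<^sup>2) \<in> borel_measurable M"
      using L2D(1)[OF assms(1)] L2D(1)[OF assms(2)] by measurable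
  qed
  then show ?thesis
    using L2D(1)[OF assms(1)] L2D(1)[OF assms(2)] by (simp add: L2_def)
qed

lemma L2_diff: "f \<in> L2 M \<Longrightarrow> g \<in> L2 M \<Longrightarrow> (\<lambda>x. f x - g x) \<in> L2 M"
  using L2_add[of f M "\<lambda>x. -1 * g x"] L2_cmult[of g M "-1"] by simp

lemma L2_zero: "(\<lambda>x. 0) \<in> L2 M"
  by (simp add: L2_def)

lemma l2norm_nonneg: "0 \<le> l2norm M f"
  by (simp add: l2norm_def)

lemma l2norm_square: "(l2norm M f)\<^sup>2 = (\<integral>x. (norm (f x))\<^sup>2 \<partial>M)"
  by (simp add: l2norm_def)

lemma l2norm_cong_AE:
  assumes "AE x in M. f x = g x" "f \<in> borel_measurable M" "g \<in> borel_measurable M"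
  shows "l2norm M f = l2norm M g"
  unfolding l2norm_def using assms by (intro arg_cong[where f=sqrt] integral_cong_AE) auto

lemma l2norm_mono:
  assumes "f \<in> borel_measurable M" "g \<in> L2 M" "AE x in M. norm (f x) \<le> norm (g x)"
  shows "l2norm M f \<le> l2norm M g"
proof -
  have "f \<in> L2 M" by (rule L2_dominated[OF assms(2,1), of 1]) (use assms(3) in simp)
  moreover have "AE x in M. (norm (f x))\<^sup>2 \<le> (norm (g x))\<^sup>2"
    using assms(3) by eventually_elim (simp add: power_mono)
  ultimately have "(\<integral>x. (norm (f x))\<^sup>2 \<partial>M) \<le> (\<integral>x. (norm (g x))\<^sup>2 \<partial>M)"
    by (intro integral_mono_AE L2D(2) assms(2))
  then show ?thesis by (simp add: l2norm_def)
qed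

text \<open>The quadratic in t below is nonnegative; evaluation at its minimum t = B / C gives the
  claim. If C = 0 it is affine in t, which forces B = 0.\<close>

lemma L2_Cauchy_Schwarz:
  assumes f: "f \<in> L2 M" and g: "g \<in> L2 M"
  shows "(\<integral>x. norm (f x) * norm (g x) \<partial>M) \<le> l2norm M f * l2norm M g"
proof -
  define A where "A = (\<integral>x. (norm (f x))\<^sup>2 \<partial>M)"
  define B where "B = (\<integral>x. norm (f x) * norm (g x) \<partial>M)"
  define C where "C = (\<integral>x. (norm (g x))\<^sup>2 \<partial>M)"
  have nn: "A \<ge> 0" "B \<ge> 0" "C \<ge> 0" by (simp_all add: A_def B_def C_def)
  have q: "0 \<le> A - 2 * t * B + t\<^sup>2 * C" for t
  proof -
    have "0 \<le> (\<integral>x. (norm (f x) - t * norm (g x))\<^sup>2 \<partial>M)" by simp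
    also have "\<dots> = (\<integral>x. (norm (f x))\<^sup>2 - 2 * t * (norm (f x) * norm (g x)) + t\<^sup>2 * (norm (g x))\<^sup>2 \<partial>M)"
      by (simp add: power2_diff power_mult_distrib algebra_simps)
    also have "\<dots> = A - 2 * t * B + t\<^sup>2 * C"
      using L2D(2)[OF f] L2D(2)[OF g] L2_norm_mult_integrable[OF f g] by (simp add: A_def B_def C_def)
    finally show ?thesis .
  qed
  have "B\<^sup>2 \<le> A * C"
  proof (cases "C = 0")
    case True
    have "B = 0"
    proof (rule ccontr)
      assume "B \<noteq> 0"
      then show False using q[of "(A + 1) / (2 * B)"] True nn by (simp add: field_simps)
    qed
    then show ?thesis using nn by simp
  next
    case False
    then have "C > 0" using nn by simp
    have "0 \<le> A - 2 * (B / C) * B + (B / C)\<^sup>2 * C" by (rule q)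
    also have "\<dots> = (A * C - B\<^sup>2) / C" using \<open>C > 0\<close> by (simp add: field_simps power2_eq_square)
    finally show ?thesis using \<open>C > 0\<close> by (simp add: zero_le_divide_iff)
  qed
  then have "sqrt (B\<^sup>2) \<le> sqrt (A * C)" by (rule real_sqrt_le_mono)
  then show ?thesis using nn by (simp add: l2norm_def real_sqrt_mult A_def B_def C_def)
qed

lemma L2_integral_mult_le:
  assumes f: "f \<in> L2 M" and g: "g \<in> L2 M"
  shows "norm (\<integral>x. f x * g x \<partial>M) \<le> l2norm M f * l2norm M g"
proof -
  have "norm (\<integral>x. f x * g x \<partial>M) \<le> (\<integral>x. norm (f x * g x) \<partial>M)" by (rule integral_norm_bound)
  also have "\<dots> \<le> l2norm M f * l2norm M g"
    using L2_Cauchy_Schwarz[OF f g] by (simp add: norm_mult)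
  finally show ?thesis .
qed

lemma L2_const: "finite_measure M \<Longrightarrow> (\<lambda>x. c) \<in> L2 M"
  by (simp add: L2_def finite_measure.integrable_const)

lemma L2_bounded:
  assumes "finite_measure M" "f \<in> borel_measurable M" "AE x in M. norm (f x) \<le> C"
  shows "f \<in> L2 M"
  by (rule L2_dominated[OF L2_const[OF assms(1), of 1] assms(2), of C]) (use assms(3) in simp)

lemma L2_integrable:
  assumes "finite_measure M" "f \<in> L2 M"
  shows "integrable M f"
  using L2_mult_integrable[OF L2_const[OF assms(1), of 1] assms(2)] by simp

lemma L2_bounded_scaleR:
  fixes g :: "'x \<Rightarrow> real"
  assumes "f \<in> L2 M" "g \<in> borel_measurable M" "AE x in M. \<bar>g x\<bar> \<le> C"
  shows "(\<lambda>x. g x *\<^sub>R f x) \<in> L2 M"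
proof (rule L2_dominated[OF assms(1)])
  show "(\<lambda>x. g x *\<^sub>R f x) \<in> borel_measurable M"
    by (intro borel_measurable_scaleR assms(2) L2D(1)[OF assms(1)])
  show "AE x in M. norm (g x *\<^sub>R f x) \<le> C * norm (f x)"
    using assms(3) by eventually_elim (simp add: mult_right_mono)
qed

lemma L2_continuous:
  assumes c: "continuous_on {0..L} f"
  shows "f \<in> L2 (Om L)"
proof -
  have m: "f \<in> borel_measurable (Om L)"
    by (rule borel_measurable_integrable[OF integrable_continuous_Om[OF c]])
  have "bounded (f ` {0..L})" using c by (intro compact_imp_bounded compact_continuous_image) auto
  then obtain B where B: "\<forall>y\<in>f ` {0..L}. norm y \<le> B" unfolding bounded_iff by blast
  show ?thesis
    by (rule L2_bounded[OF finite_measure_Om m, of B]) (use B in \<open>auto intro!: AE_I2\<close>)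
qed

lemma L2_cong_AE:
  assumes "f \<in> L2 (Om L)" "AE x in Om L. f x = g x"
  shows "g \<in> L2 (Om L)"
proof (rule L2_dominated[OF assms(1), of _ 1])
  show "g \<in> borel_measurable (Om L)" by (rule borel_measurable_Om_AE[OF L2D(1)[OF assms(1)] assms(2)])
  show "AE x in Om L. norm (g x) \<le> 1 * norm (f x)" using assms(2) by eventually_elim simp
qed

lemma L2_Om_integrable: "f \<in> L2 (Om L) \<Longrightarrow> integrable (Om L) f"
  by (rule L2_integrable[OF finite_measure_Om])

lemma integral_norm_le_l2norm:
  assumes "f \<in> L2 (Om L)" "L > 0"
  shows "(\<integral>x. norm (f x) \<partial>Om L) \<le> sqrt L * l2norm (Om L) f"
  using L2_Cauchy_Schwarz[OF L2_const[OF finite_measure_Om, of 1] assms(1)] assms(2)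
  by (simp add: l2norm_def measure_restrict_space)

lemma norm_prim_le:
  assumes "f \<in> L2 (Om L)" "L > 0" "x \<le> L"
  shows "norm (prim f x) \<le> sqrt L * l2norm (Om L) f"
proof -
  have "norm (prim f x) \<le> (\<integral>r. norm (indicator {0<..<x} r *\<^sub>R f r) \<partial>Om L)"
    unfolding prim_eq_indicator[OF assms(3)] by (rule integral_norm_bound)
  also have "\<dots> \<le> (\<integral>r. norm (f r) \<partial>Om L)"
    using integrable_Om_indicator[OF L2_Om_integrable[OF assms(1)]] L2_Om_integrable[OF assms(1)]
    by (intro integral_mono integrable_norm) (auto simp: indicator_def)
  finally show ?thesis using integral_norm_le_l2norm[OF assms(1,2)] by linarith
qed

text \<open>Stated for arbitrary coefficients a so that one identity serves twice: with the Fourier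
  coefficients it is Bessel's inequality, and comparison of two choices gives best
  approximation.\<close>

lemma orthonormal_expansion:
  fixes e :: "nat \<Rightarrow> 'x \<Rightarrow> real" and f :: "'x \<Rightarrow> complex" and a :: "nat \<Rightarrow> complex"
  assumes fin: "finite_measure M" and m: "\<And>i. e i \<in> borel_measurable M" and b: "\<And>i x. \<bar>e i x\<bar> \<le> B"
    and on: "\<And>i j. (\<integral>x. e i x * e j x \<partial>M) = (if i = j then 1 else 0)"
    and f: "f \<in> L2 M" and I: "finite I"
  shows "(\<integral>x. (norm (f x - (\<Sum>i\<in>I. e i x *\<^sub>R a i)))\<^sup>2 \<partial>M) =
    (\<integral>x. (norm (f x))\<^sup>2 \<partial>M) - (\<Sum>i\<in>I. (norm (\<integral>x. e i x *\<^sub>R f x \<partial>M))\<^sup>2)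
      + (\<Sum>i\<in>I. (norm ((\<integral>x. e i x *\<^sub>R f x \<partial>M) - a i))\<^sup>2)"
proof -
  define c where "c i = (\<integral>x. e i x *\<^sub>R f x \<partial>M)" for i
  have ef: "integrable M (\<lambda>x. e i x *\<^sub>R f x)" for i
    by (rule L2_integrable[OF fin]) (rule L2_bounded_scaleR[OF f m AE_I2[OF b]])
  have ee: "integrable M (\<lambda>x. e i x * e j x)" for i j
  proof (rule finite_measure.integrable_const_bound[OF fin])
    show "AE x in M. norm (e i x * e j x) \<le> B * B"
      using b by (intro AE_I2) (auto simp: abs_mult intro!: mult_mono order_trans[OF abs_ge_zero])
    show "(\<lambda>x. e i x * e j x) \<in> borel_measurable M" using m by measurable
  qed
  have i1: "integrable M (\<lambda>x. e i x * (f x \<bullet> a i))" and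
    s1: "(\<integral>x. e i x * (f x \<bullet> a i) \<partial>M) = c i \<bullet> a i" for i
  proof -
    have "integrable M (\<lambda>x. (e i x *\<^sub>R f x) \<bullet> a i)" using ef by (rule integrable_inner_left[rotated])
    then show "integrable M (\<lambda>x. e i x * (f x \<bullet> a i))" by simp
    have "(\<integral>x. (e i x *\<^sub>R f x) \<bullet> a i \<partial>M) = c i \<bullet> a i"
      unfolding c_def using ef by (rule integral_inner_left[rotated])
    then show "(\<integral>x. e i x * (f x \<bullet> a i) \<partial>M) = c i \<bullet> a i" by simp
  qed
  have pt: "(norm (f x - (\<Sum>i\<in>I. e i x *\<^sub>R a i)))\<^sup>2 =
     (norm (f x))\<^sup>2 - 2 * (\<Sum>i\<in>I. e i x * (f x \<bullet> a i)) + (\<Sum>i\<in>I. \<Sum>j\<in>I. (e i x * e j x) * (a i \<bullet> a j))" for x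
  proof -
    let ?s = "\<Sum>i\<in>I. e i x *\<^sub>R a i"
    have "(norm (f x - ?s))\<^sup>2 = (norm (f x))\<^sup>2 - 2 * (f x \<bullet> ?s) + ?s \<bullet> ?s"
      by (simp add: power2_norm_eq_inner inner_diff_left inner_diff_right inner_commute)
    moreover have "?s \<bullet> ?s = (\<Sum>i\<in>I. \<Sum>j\<in>I. (e i x * e j x) * (a i \<bullet> a j))"
      by (subst inner_sum_left, subst inner_sum_right) (simp add: ac_simps)
    ultimately show ?thesis by (simp add: inner_sum_right)
  qed
  have "(\<integral>x. (norm (f x - (\<Sum>i\<in>I. e i x *\<^sub>R a i)))\<^sup>2 \<partial>M) =
     (\<integral>x. (norm (f x))\<^sup>2 \<partial>M) - 2 * (\<Sum>i\<in>I. c i \<bullet> a i)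
      + (\<Sum>i\<in>I. \<Sum>j\<in>I. (\<integral>x. e i x * e j x \<partial>M) * (a i \<bullet> a j))"
    unfolding pt using L2D(2)[OF f] i1 ee by (simp add: s1)
  also have "(\<Sum>i\<in>I. \<Sum>j\<in>I. (\<integral>x. e i x * e j x \<partial>M) * (a i \<bullet> a j)) = (\<Sum>i\<in>I. (norm (a i))\<^sup>2)"
    unfolding on using I by (intro sum.cong) (auto simp: if_distrib[of "\<lambda>y. y * _"] sum.delta' power2_norm_eq_inner cong: if_cong)
  finally show ?thesis
    unfolding c_def[symmetric]
    by (simp add: power2_norm_eq_inner inner_diff_left inner_diff_right sum.distrib sum_subtractf
      sum_distrib_left inner_commute algebra_simps)
qed

lemma bessel:
  fixes e :: "nat \<Rightarrow> 'x \<Rightarrow> real" and f :: "'x \<Rightarrow> complex"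
  assumes "finite_measure M" "\<And>i. e i \<in> borel_measurable M" "\<And>i x. \<bar>e i x\<bar> \<le> B"
    and "\<And>i j. (\<integral>x. e i x * e j x \<partial>M) = (if i = j then 1 else 0)"
    and "f \<in> L2 M" and "finite I"
  shows "(\<Sum>i\<in>I. (norm (\<integral>x. e i x *\<^sub>R f x \<partial>M))\<^sup>2) \<le> (\<integral>x. (norm (f x))\<^sup>2 \<partial>M)"
proof -
  have "0 \<le> (\<integral>x. (norm (f x - (\<Sum>i\<in>I. e i x *\<^sub>R (\<integral>x. e i x *\<^sub>R f x \<partial>M))))\<^sup>2 \<partial>M)"
    by simp
  then show ?thesis
    unfolding orthonormal_expansion[OF assms(1-4) assms(5,6)] by simp
qed

text \<open>The choice behind \<open>wderiv\<close> might pick any weak derivative; uniqueness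
  almost everywhere forces the pick to be square integrable.\<close>

lemma H1_weak_derivative:
  assumes "u \<in> H1 L"
  shows "has_weak_derivative L u (wderiv L u)" "wderiv L u \<in> L2 (Om L)"
proof -
  obtain v where v: "v \<in> L2 (Om L)" "has_weak_derivative L u v"
    using assms by (auto simp: H1_def)
  show "has_weak_derivative L u (wderiv L u)"
    unfolding wderiv_def using v(2) by (rule someI[where P="has_weak_derivative L u"])
  from weak_derivative_unique[OF v(2) this] show "wderiv L u \<in> L2 (Om L)"
    by (rule L2_cong_AE[OF v(1)])
qed

lemma boundary_trace_eq:
  assumes L: "L > 0" and v: "continuous_on {0..L} v" and uv: "AE x in Om L. u x = v x" and b: "b \<in> {0..L}"
  shows "boundary_trace L u b = v b"
  unfolding boundary_trace_def
proof (rule the_equality)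
  show "\<exists>w. continuous_on {0..L} w \<and> (AE x in Om L. w x = u x) \<and> w b = v b"
    using v uv by (auto elim!: AE_mp intro!: exI[of _ v])
  fix c assume "\<exists>w. continuous_on {0..L} w \<and> (AE x in Om L. w x = u x) \<and> w b = c"
  then obtain w where w: "continuous_on {0..L} w" "AE x in Om L. w x = u x" "w b = c" by blast
  have "AE x in Om L. w x = v x" using w(2) uv by eventually_elim simp
  then show "c = v b" using continuous_AE_eq_imp_eq[OF L w(1) v _ b] w(3) by simp
qed

text \<open>Together with \<open>H1E\<close> this identifies the Sobolev space with constants plus
  primitives of square integrable functions, with the trace at 0 as the constant.\<close>

lemma H1I:
  assumes L: "L > 0" and v: "v \<in> L2 (Om L)" and u: "AE x in Om L. u x = c + prim v x"
  shows "u \<in> H1 L" "AE x in Om L. wderiv L u x = v x"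
    "boundary_trace L u 0 = c" "boundary_trace L u L = c + prim v L"
proof -
  have vi: "integrable (Om L) v" by (rule L2_Om_integrable[OF v])
  have cont: "continuous_on {0..L} (\<lambda>x. c + prim v x)"
    by (intro continuous_intros continuous_on_prim[OF vi])
  have "AE x in Om L. c + prim v x = u x" using u by auto
  from L2_cong_AE[OF L2_continuous[OF cont] this] have "u \<in> L2 (Om L)" .
  with v has_weak_derivative_prim(1)[OF L vi u] show H: "u \<in> H1 L" by (auto simp: H1_def)
  show "AE x in Om L. wderiv L u x = v x"
    by (rule weak_derivative_unique[OF H1_weak_derivative(1)[OF H] has_weak_derivative_prim(1)[OF L vi u]])
  show "boundary_trace L u 0 = c" "boundary_trace L u L = c + prim v L"
    using boundary_trace_eq[OF L cont u, of 0] boundary_trace_eq[OF L cont u, of L] L by simp_all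
qed

lemma H1E:
  assumes L: "L > 0" and u: "u \<in> H1 L"
  shows "AE x in Om L. u x = boundary_trace L u 0 + prim (wderiv L u) x"
    "boundary_trace L u L = boundary_trace L u 0 + prim (wderiv L u) L"
proof -
  have v: "wderiv L u \<in> L2 (Om L)" using H1_weak_derivative(2)[OF u] .
  obtain c where c: "AE x in Om L. u x = c + prim (wderiv L u) x"
    using weak_derivative_imp_prim[OF L H1_weak_derivative(1)[OF u] L2_Om_integrable[OF v]] .
  show "AE x in Om L. u x = boundary_trace L u 0 + prim (wderiv L u) x"
    using c H1I(3)[OF L v c] by simp
  show "boundary_trace L u L = boundary_trace L u 0 + prim (wderiv L u) L"
    using H1I(3,4)[OF L v c] by simp
qed

lemma H10I:
  assumes L: "L > 0" and v: "v \<in> L2 (Om L)" and u: "AE x in Om L. u x = prim v x" and "prim v L = 0"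
  shows "u \<in> H10 L" "AE x in Om L. wderiv L u x = v x"
proof -
  have "AE x in Om L. u x = 0 + prim v x" using u by simp
  from H1I[OF L v this] assms(4) show "u \<in> H10 L" "AE x in Om L. wderiv L u x = v x"
    by (auto simp: H10_def)
qed

lemma H10E:
  assumes L: "L > 0" and u: "u \<in> H10 L"
  shows "u \<in> H1 L" "u \<in> L2 (Om L)" "wderiv L u \<in> L2 (Om L)" "AE x in Om L. u x = prim (wderiv L u) x" "prim (wderiv L u) L = 0"
  using H1E[OF L, of u] u H1_weak_derivative(2) by (auto simp: H10_def H1_def)

lemma H10_lincomb:
  assumes L: "L > 0" and u: "u \<in> H10 L" and w: "w \<in> H10 L"
  shows "(\<lambda>x. u x + c * w x) \<in> H10 L"
    "AE x in Om L. wderiv L (\<lambda>x. u x + c * w x) x = wderiv L u x + c * wderiv L w x"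
proof -
  note U = H10E[OF L u] and W = H10E[OF L w]
  have v: "(\<lambda>x. wderiv L u x + c * wderiv L w x) \<in> L2 (Om L)"
    by (intro L2_add L2_cmult U W)
  have p: "prim (\<lambda>x. wderiv L u x + c * wderiv L w x) x = prim (wderiv L u) x + c * prim (wderiv L w) x" if "x \<le> L" for x
  proof -
    have "prim (\<lambda>x. wderiv L u x + c * wderiv L w x) x = prim (wderiv L u) x + prim (\<lambda>x. c * wderiv L w x) x"
      by (rule prim_add[of L]) (use L2_Om_integrable U(3) W(3) L2_cmult that in auto)
    then show ?thesis by (simp add: prim_def)
  qed
  have "AE x in Om L. x \<le> L" by (intro AE_I2) auto
  then have ae: "AE x in Om L. u x + c * w x = prim (\<lambda>x. wderiv L u x + c * wderiv L w x) x"
    using U(4) W(4) by eventually_elim (simp add: p)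
  show "(\<lambda>x. u x + c * w x) \<in> H10 L"
    "AE x in Om L. wderiv L (\<lambda>x. u x + c * w x) x = wderiv L u x + c * wderiv L w x"
    using H10I[OF L v ae] U(5) W(5) p[of L] by auto
qed

lemma H10_zero: "L > 0 \<Longrightarrow> (\<lambda>x. 0) \<in> H10 L"
  by (rule H10I(1)[OF _ L2_zero]) (auto simp: prim_def)

lemma H10_cmult: "L > 0 \<Longrightarrow> u \<in> H10 L \<Longrightarrow> (\<lambda>x. c * u x) \<in> H10 L"
  using H10_lincomb(1)[of L "\<lambda>x. 0" u c] H10_zero by simp

lemma H10_wderiv_cmult:
  assumes "L > 0" "u \<in> H10 L"
  shows "AE x in Om L. wderiv L (\<lambda>x. c * u x) x = c * wderiv L u x"
proof -
  have z: "AE x in Om L. wderiv L (\<lambda>x. 0 :: complex) x = 0"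
    using H10I(2)[OF assms(1) L2_zero, of "\<lambda>x. 0"] by (simp add: prim_def)
  show ?thesis
    using H10_lincomb(2)[OF assms(1) H10_zero[OF assms(1)] assms(2), of c] z by (auto elim!: AE_mp)
qed

section \<open>The sine basis\<close>

text \<open>The shift by \<open>Suc\<close> lets index 0 denote the lowest Dirichlet mode, so no
  index is exceptional.\<close>

definition freq :: "real \<Rightarrow> nat \<Rightarrow> real" where
  "freq L n = real (Suc n) * pi / L"

definition es :: "real \<Rightarrow> nat \<Rightarrow> real \<Rightarrow> real" where
  "es L n x = sqrt (2 / L) * sin (freq L n * x)"

definition ec :: "real \<Rightarrow> nat \<Rightarrow> real \<Rightarrow> real" where
  "ec L n x = sqrt (2 / L) * cos (freq L n * x)"

text \<open>The cosines \<open>ec\<close> miss the constants; with the constant mode placed at index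
  0 the system is complete in the square integrable functions.\<close>

definition ec0 :: "real \<Rightarrow> nat \<Rightarrow> real \<Rightarrow> real" where
  "ec0 L n x = (case n of 0 \<Rightarrow> 1 / sqrt L | Suc m \<Rightarrow> ec L m x)"

lemma freq_pos: "L > 0 \<Longrightarrow> freq L n > 0"
  by (simp add: freq_def)

lemma freq_times_L: "L > 0 \<Longrightarrow> freq L n * L = real (Suc n) * pi"
  by (simp add: freq_def)

lemma freq_inj: "L > 0 \<Longrightarrow> freq L n = freq L m \<longleftrightarrow> n = m"
  by (simp add: freq_def)

lemma es_boundary: "es L n 0 = 0" "L > 0 \<Longrightarrow> es L n L = 0"
proof -
  show "es L n 0 = 0" by (simp add: es_def)
  assume "L > 0"
  then show "es L n L = 0"
    using sin_npi[of "Suc n"] by (simp only: es_def freq_times_L)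
qed

lemma es_deriv: "(es L n has_real_derivative freq L n * ec L n x) (at x)"
  unfolding es_def ec_def by (auto intro!: derivative_eq_intros)

lemma ec_deriv: "(ec L n has_real_derivative - freq L n * es L n x) (at x)"
  unfolding es_def ec_def by (auto intro!: derivative_eq_intros)

lemma continuous_on_es [continuous_intros]: "continuous_on S (es L n)"
  unfolding es_def by (intro continuous_intros)

lemma continuous_on_ec [continuous_intros]: "continuous_on S (ec L n)"
  unfolding ec_def by (intro continuous_intros)

lemma continuous_on_ec0 [continuous_intros]: "continuous_on S (ec0 L n)"
  unfolding ec0_def by (cases n) (auto intro: continuous_intros)

lemma abs_es_le: "L > 0 \<Longrightarrow> \<bar>es L n x\<bar> \<le> sqrt (2 / L)"
  unfolding es_def by (simp add: abs_mult mult_left_le)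

lemma abs_ec_le: "L > 0 \<Longrightarrow> \<bar>ec L n x\<bar> \<le> sqrt (2 / L)"
  unfolding ec_def by (simp add: abs_mult mult_left_le)

lemma abs_ec0_le: "L > 0 \<Longrightarrow> \<bar>ec0 L n x\<bar> \<le> sqrt (2 / L)"
  unfolding ec0_def using abs_ec_le[of L]
  by (auto split: nat.split simp: real_sqrt_divide intro!: divide_right_mono)

lemma borel_measurable_continuous_Om: "continuous_on UNIV (f :: real \<Rightarrow> 'a::euclidean_space) \<Longrightarrow> f \<in> borel_measurable (Om L)"
  by (rule borel_measurable_integrable, rule integrable_continuous_Om, rule continuous_on_subset) auto

lemma borel_measurable_es: "es L n \<in> borel_measurable (Om M)"
  by (intro borel_measurable_continuous_Om continuous_intros)

lemma borel_measurable_ec0: "ec0 L n \<in> borel_measurable (Om M)"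
  by (intro borel_measurable_continuous_Om continuous_intros)

text \<open>The frequency is an integer, possibly negative, because the product formulas produce
  differences of indices.\<close>

lemma prim_cos_int:
  assumes "L > 0"
  shows "prim (\<lambda>x. cos (real_of_int k * pi / L * x)) L = (if k = 0 then L else 0)"
proof (cases "k = 0")
  case True
  then show ?thesis using assms by (simp add: prim_const)
next
  case False
  let ?w = "real_of_int k * pi / L"
  have w: "?w \<noteq> 0" using False assms by simp
  have "prim (\<lambda>x. cos (?w * x)) L = sin (?w * L) / ?w - sin (?w * 0) / ?w"
    by (rule prim_FTC_real) (use assms w in \<open>auto intro!: derivative_eq_intros continuous_intros\<close>)
  also have "?w * L = real_of_int k * pi" using assms by simp
  also have "sin (real_of_int k * pi) = 0"
    by (simp add: sin_zero_iff_int2)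
  finally show ?thesis using False by simp
qed

lemma integrable_cos_mult: "integrable (Om L) (\<lambda>x. cos (c * x) :: real)"
  by (intro integrable_continuous_Om continuous_intros)

lemma integral_cos_combination:
  "(\<integral>x. k * (cos (a * x) + cos (b * x)) \<partial>Om L) = k * (prim (\<lambda>x. cos (a * x)) L + prim (\<lambda>x. cos (b * x)) L)"
  "(\<integral>x. k * (cos (a * x) - cos (b * x)) \<partial>Om L) = k * (prim (\<lambda>x. cos (a * x)) L - prim (\<lambda>x. cos (b * x :: real)) L)"
  using integrable_cos_mult[of L a] integrable_cos_mult[of L b] by (simp_all add: prim_def)

lemma es_orthonormal:
  assumes "L > 0"
  shows "(\<integral>x. es L i x * es L j x \<partial>Om L) = (if i = j then 1 else 0)"
proof -
  have "es L i x * es L j x = (1 / L) * (cos (real_of_int (int i - int j) * pi / L * x) - cos (real_of_int (int i + int j + 2) * pi / L * x))" for x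
  proof -
    have "es L i x * es L j x = (2 / L) * (sin (freq L i * x) * sin (freq L j * x))"
      using assms by (simp add: es_def field_simps flip: power2_eq_square)
    also have "\<dots> = (1 / L) * (cos (freq L i * x - freq L j * x) - cos (freq L i * x + freq L j * x))"
      by (simp add: sin_times_sin diff_divide_distrib)
    also have "freq L i * x - freq L j * x = real_of_int (int i - int j) * pi / L * x"
      by (simp add: freq_def algebra_simps diff_divide_distrib add_divide_distrib)
    also have "freq L i * x + freq L j * x = real_of_int (int i + int j + 2) * pi / L * x"
      by (simp add: freq_def algebra_simps diff_divide_distrib add_divide_distrib)
    finally show ?thesis .
  qed
  then have "(\<integral>x. es L i x * es L j x \<partial>Om L) =
      (1 / L) * (prim (\<lambda>x. cos (real_of_int (int i - int j) * pi / L * x)) L - prim (\<lambda>x. cos (real_of_int (int i + int j + 2) * pi / L * x)) L)"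
    by (simp only: integral_cos_combination)
  then show ?thesis
    unfolding prim_cos_int[OF assms] using assms by auto
qed

lemma ec0_orthonormal:
  assumes "L > 0"
  shows "(\<integral>x. ec0 L i x * ec0 L j x \<partial>Om L) = (if i = j then 1 else 0)"
proof -
  define c where "c i = (if i = 0 then 1 / sqrt L else sqrt (2 / L))" for i :: nat
  have ec0: "ec0 L i x = c i * cos (real i * pi / L * x)" for i x
    by (cases i) (auto simp: ec0_def ec_def c_def freq_def)
  have "ec0 L i x * ec0 L j x = (c i * c j / 2) * (cos (real_of_int (int i - int j) * pi / L * x) + cos (real_of_int (int i + int j) * pi / L * x))" for x
  proof -
    have "ec0 L i x * ec0 L j x = (c i * c j) * (cos (real i * pi / L * x) * cos (real j * pi / L * x))"
      by (simp add: ec0)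
    also have "\<dots> = (c i * c j / 2) * (cos (real i * pi / L * x - real j * pi / L * x) + cos (real i * pi / L * x + real j * pi / L * x))"
      by (simp add: cos_times_cos)
    also have "real i * pi / L * x - real j * pi / L * x = real_of_int (int i - int j) * pi / L * x"
      by (simp add: algebra_simps diff_divide_distrib)
    also have "real i * pi / L * x + real j * pi / L * x = real_of_int (int i + int j) * pi / L * x"
      by (simp add: algebra_simps add_divide_distrib)
    finally show ?thesis .
  qed
  then have "(\<integral>x. ec0 L i x * ec0 L j x \<partial>Om L) =
      (c i * c j / 2) * (prim (\<lambda>x. cos (real_of_int (int i - int j) * pi / L * x)) L + prim (\<lambda>x. cos (real_of_int (int i + int j) * pi / L * x)) L)"
    by (simp only: integral_cos_combination)
  also have "\<dots> = (if i = j then 1 else 0)"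
    unfolding prim_cos_int[OF assms] using assms
    by (auto simp: c_def power_divide real_sqrt_divide simp flip: power2_eq_square)
  finally show ?thesis .
qed

lemma ec_orthonormal:
  assumes "L > 0"
  shows "(\<integral>x. ec L i x * ec L j x \<partial>Om L) = (if i = j then 1 else 0)"
  using ec0_orthonormal[OF assms, of "Suc i" "Suc j"] by (simp add: ec0_def)

section \<open>Density of cosine sums and Parseval's identity\<close>

definition cos_sum :: "real \<Rightarrow> (real \<Rightarrow> real) \<Rightarrow> bool" where
  "cos_sum L g \<longleftrightarrow> (\<exists>b N. \<forall>M\<ge>N. \<forall>x. g x = (\<Sum>n<M. b n * cos (real n * pi / L * x)))"

lemma cos_sum_cos: "cos_sum L (\<lambda>x. c * cos (real k * pi / L * x))"
  unfolding cos_sum_def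
proof (intro exI[of _ "\<lambda>n. if n = k then c else 0"] exI[of _ "Suc k"] allI impI)
  fix M x assume "Suc k \<le> M"
  then show "c * cos (real k * pi / L * x) = (\<Sum>n<M. (if n = k then c else 0) * cos (real n * pi / L * x))"
    by (simp add: if_distrib[of "\<lambda>y. y * _"] cong: if_cong)
qed

lemma cos_sum_add: "cos_sum L f \<Longrightarrow> cos_sum L g \<Longrightarrow> cos_sum L (\<lambda>x. f x + g x)"
proof -
  assume "cos_sum L f" "cos_sum L g"
  then obtain b N b' N' where *: "\<And>M x. M \<ge> N \<Longrightarrow> f x = (\<Sum>n<M. b n * cos (real n * pi / L * x))"
     "\<And>M x. M \<ge> N' \<Longrightarrow> g x = (\<Sum>n<M. b' n * cos (real n * pi / L * x))"
    unfolding cos_sum_def by blast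
  show ?thesis
    unfolding cos_sum_def
  proof (intro exI[of _ "\<lambda>n. b n + b' n"] exI[of _ "max N N'"] allI impI)
    fix M x assume M: "max N N' \<le> M"
    show "f x + g x = (\<Sum>n<M. (b n + b' n) * cos (real n * pi / L * x))"
      using *(1)[of M x] *(2)[of M x] M by (simp add: sum.distrib distrib_right)
  qed
qed

lemma cos_sum_sum: "finite I \<Longrightarrow> (\<And>i. i \<in> I \<Longrightarrow> cos_sum L (f i)) \<Longrightarrow> cos_sum L (\<lambda>x. \<Sum>i\<in>I. f i x)"
proof (induction I rule: finite_induct)
  case empty
  then show ?case using cos_sum_cos[of L 0 0] by simp
qed (auto intro: cos_sum_add)

lemma cos_sum_scale_cos:
  assumes "cos_sum L g"
  shows "cos_sum L (\<lambda>x. c * cos (pi / L * x) * g x)"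
proof -
  obtain b N where "\<And>M x. M \<ge> N \<Longrightarrow> g x = (\<Sum>n<M. b n * cos (real n * pi / L * x))"
    using assms unfolding cos_sum_def by blast
  then have g: "g = (\<lambda>x. \<Sum>n<N. b n * cos (real n * pi / L * x))" by auto
  have t: "cos_sum L (\<lambda>x. (c * b n) * (cos (pi / L * x) * cos (real n * pi / L * x)))" for n
  proof (cases n)
    case 0
    then show ?thesis using cos_sum_cos[of L "c * b n" 1] by simp
  next
    case (Suc m)
    have "(c * b n) * (cos (pi / L * x) * cos (real n * pi / L * x)) =
       (c * b n / 2) * cos (real m * pi / L * x) + (c * b n / 2) * cos (real (Suc n) * pi / L * x)" for x
    proof -
      have "cos (pi / L * x) * cos (real n * pi / L * x) = cos (real n * pi / L * x) * cos (pi / L * x)" by simp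
      also have "\<dots> = (cos (real n * pi / L * x - pi / L * x) + cos (real n * pi / L * x + pi / L * x)) / 2"
        by (rule cos_times_cos)
      also have "real n * pi / L * x - pi / L * x = real m * pi / L * x"
        by (simp add: Suc algebra_simps add_divide_distrib diff_divide_distrib)
      also have "real n * pi / L * x + pi / L * x = real (Suc n) * pi / L * x"
        by (simp add: algebra_simps add_divide_distrib)
      finally have eq: "cos (pi / L * x) * cos (real n * pi / L * x) =
        (cos (real m * pi / L * x) + cos (real (Suc n) * pi / L * x)) / 2" .
      show ?thesis unfolding eq by (simp only: distrib_left times_divide_eq_right times_divide_eq_left add_divide_distrib)
    qed
    then show ?thesis
      using cos_sum_add[OF cos_sum_cos[of L "c * b n / 2" m] cos_sum_cos[of L "c * b n / 2" "Suc n"]] by simp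
  qed
  have "cos_sum L (\<lambda>x. \<Sum>n<N. (c * b n) * (cos (pi / L * x) * cos (real n * pi / L * x)))"
    by (rule cos_sum_sum[OF _ t]) simp
  then show ?thesis unfolding g by (simp add: sum_distrib_left mult_ac)
qed

lemma cos_sum_poly: "cos_sum L (\<lambda>x. poly p (cos (pi / L * x)))"
proof (induction p)
  case 0
  then show ?case using cos_sum_cos[of L 0 0] by simp
next
  case (pCons a p)
  show ?case
    using cos_sum_add[OF cos_sum_cos[of L a 0] cos_sum_scale_cos[OF pCons.IH, of 1]] by simp
qed

text \<open>Stone-Weierstrass for the polynomials in \<open>cos (pi / L * x)\<close>: this function
  is injective on [0, L] and so separates points, and the product formula turns its powers into
  cosine sums.\<close>

lemma cos_sum_dense:
  assumes L: "L > 0" and f: "continuous_on {0..L} f" and e: "e > 0"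
  obtains g where "cos_sum L g" "\<And>x. x \<in> {0..L} \<Longrightarrow> \<bar>f x - g x\<bar> < e"
proof -
  define R where "R = range (\<lambda>p x. poly p (cos (pi / L * x)))"
  interpret function_ring_on R "{0..L}"
  proof
    show "compact {0..L}" by simp
    show "continuous_on {0..L} f" if "f \<in> R" for f
      using that L by (auto simp: R_def intro!: continuous_intros)
    show "(\<lambda>x. f x + g x) \<in> R" if "f \<in> R" "g \<in> R" for f g
      using that by (force simp: R_def simp flip: poly_add)
    show "(\<lambda>x. f x * g x) \<in> R" if "f \<in> R" "g \<in> R" for f g
      using that by (force simp: R_def simp flip: poly_mult)
    show "(\<lambda>_. c) \<in> R" for c
      by (auto simp: R_def image_iff intro!: exI[of _ "[:c:]"])
    show "\<exists>f\<in>R. f x \<noteq> f y" if "x \<in> {0..L}" "y \<in> {0..L}" "x \<noteq> y" for x y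
    proof
      show "(\<lambda>x. poly [:0, 1:] (cos (pi / L * x))) \<in> R" unfolding R_def by (rule rangeI)
      have range: "0 \<le> pi / L * z" "pi / L * z \<le> pi" if "z \<in> {0..L}" for z
        using that L by (auto simp: field_simps)
      have "pi / L * x \<noteq> pi / L * y" using that L by simp
      then have "cos (pi / L * x) \<noteq> cos (pi / L * y)"
        using cos_inj_pi[OF range[OF that(1)] range[OF that(2)]] by blast
      then show "poly [:0, 1:] (cos (pi / L * x)) \<noteq> poly [:0, 1:] (cos (pi / L * y))" by simp
    qed
  qed
  obtain g where "g \<in> R" "\<forall>x\<in>{0..L}. \<bar>f x - g x\<bar> < e"
    using Stone_Weierstrass_basic[OF f e] by blast
  moreover from this obtain p where "g = (\<lambda>x. poly p (cos (pi / L * x)))" by (auto simp: R_def)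
  ultimately show ?thesis using cos_sum_poly[of L p] by (intro that[of g]) auto
qed

text \<open>Two approximations: f by its truncation to a ball, and the truncation by continuous
  functions that converge almost everywhere. Projecting the latter to the same ball supplies the
  dominating constant.\<close>

lemma L2_approx_continuous:
  assumes f: "f \<in> L2 (Om L)" and e: "e > 0"
  obtains g where "continuous_on UNIV g" "(\<integral>x. (norm (f x - g x))\<^sup>2 \<partial>Om L) < e"
proof -
  have "(\<lambda>x. indicator {0<..<L} x *\<^sub>R f x) \<in> borel_measurable lebesgue"
    using L2D(1)[OF f] by (simp add: borel_measurable_restrict_space_iff)
  then have "f measurable_on {0<..<L}"
    using L2D(1)[OF f] by (subst measurable_on_iff_borel_measurable) auto
  then obtain N g where N: "negligible N" and g: "\<And>n. continuous_on UNIV (g n)"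
    and lim: "\<And>x. x \<notin> N \<Longrightarrow> (\<lambda>n. g n x) \<longlonglongrightarrow> (if x \<in> {0<..<L} then f x else 0)"
    unfolding measurable_on_def by blast
  have aeN: "AE x in Om L. x \<notin> N"
    using N by (auto simp: AE_restrict_space_iff negligible_iff_null_sets intro!: AE_I'[of N])
  \<comment> \<open>The projection onto a closed ball is continuous, so h stays continuous while it
    becomes bounded.\<close>
  define h where "h k n = (\<lambda>x. closest_point (cball (0::complex) k) (g n x))" for k n
  have hc: "continuous_on UNIV (h k n)" if "k > 0" for k n
    unfolding h_def using that
    by (intro continuous_on_compose2[OF continuous_on_closest_point g]) auto
  have hb: "norm (h k n x) \<le> k" if "k > 0" for k n x
    using closest_point_in_set[of "cball (0::complex) k" "g n x"] that by (simp add: h_def)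
  define F where "F k = (\<lambda>x. closest_point (cball (0::complex) (real (Suc k))) (f x))" for k
  have Fm: "F k \<in> borel_measurable (Om L)" for k
    unfolding F_def
    by (rule borel_measurable_continuous_on[OF continuous_on_closest_point L2D(1)[OF f]]) auto
  have Fb: "norm (F k x) \<le> real (Suc k)" for k x
    using closest_point_in_set[of "cball (0::complex) (real (Suc k))" "f x"] by (simp add: F_def)
  have Fle: "norm (f x - F k x) \<le> norm (f x)" for k x
    using closest_point_le[of "cball (0::complex) (real (Suc k))" 0 "f x"] by (simp add: F_def dist_norm)
  have Flim: "(\<lambda>k. F k x) \<longlonglongrightarrow> f x" for x
  proof (rule tendsto_eventually)
    show "\<forall>\<^sub>F k in sequentially. F k x = f x"
      using eventually_ge_at_top[of "nat \<lceil>norm (f x)\<rceil>"]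
    proof eventually_elim
      case (elim k)
      then have "norm (f x) \<le> real (Suc k)" by linarith
      then show ?case unfolding F_def by (intro closest_point_self) simp
    qed
  qed
  have "(\<lambda>k. \<integral>x. (norm (f x - F k x))\<^sup>2 \<partial>Om L) \<longlonglongrightarrow> (\<integral>x. 0 \<partial>Om L)"
  proof (rule integral_dominated_convergence[where w="\<lambda>x. (norm (f x))\<^sup>2"])
    show "AE x in Om L. (\<lambda>k. (norm (f x - F k x))\<^sup>2) \<longlonglongrightarrow> 0"
    proof (intro AE_I2)
      fix x
      have "(\<lambda>k. (norm (f x - F k x))\<^sup>2) \<longlonglongrightarrow> (norm (f x - f x))\<^sup>2"
        by (intro tendsto_intros Flim)
      then show "(\<lambda>k. (norm (f x - F k x))\<^sup>2) \<longlonglongrightarrow> 0" by simp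
    qed
    show "AE x in Om L. norm ((norm (f x - F k x))\<^sup>2) \<le> (norm (f x))\<^sup>2" for k
      using Fle by (intro AE_I2) (auto intro!: power_mono)
    show "(\<lambda>x. (norm (f x - F k x))\<^sup>2) \<in> borel_measurable (Om L)" for k
      using L2D(1)[OF f] Fm by measurable
  qed (use L2D[OF f] in auto)
  then have "\<forall>\<^sub>F k in sequentially. (\<integral>x. (norm (f x - F k x))\<^sup>2 \<partial>Om L) < e / 4"
    using e by (intro order_tendstoD(2)) auto
  then obtain k where k: "(\<integral>x. (norm (f x - F k x))\<^sup>2 \<partial>Om L) < e / 4"
    using eventually_happens by fastforce
  let ?K = "real (Suc k)"
  have "(\<lambda>n. \<integral>x. (norm (F k x - h ?K n x))\<^sup>2 \<partial>Om L) \<longlonglongrightarrow> (\<integral>x. 0 \<partial>Om L)"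
  proof (rule integral_dominated_convergence[where w="\<lambda>x. (2 * ?K)\<^sup>2"])
    have "AE x in Om L. x \<in> {0<..<L}" by (intro AE_I2) auto
    with aeN show "AE x in Om L. (\<lambda>n. (norm (F k x - h ?K n x))\<^sup>2) \<longlonglongrightarrow> 0"
    proof eventually_elim
      case (elim x)
      have "(\<lambda>n. h ?K n x) \<longlonglongrightarrow> F k x"
        unfolding h_def F_def
        by (rule isCont_tendsto_compose[OF continuous_at_closest_point]) (use lim[of x] elim in auto)
      then have "(\<lambda>n. (norm (F k x - h ?K n x))\<^sup>2) \<longlonglongrightarrow> (norm (F k x - F k x))\<^sup>2"
        by (intro tendsto_intros)
      then show ?case by simp
    qed
    show "AE x in Om L. norm ((norm (F k x - h ?K n x))\<^sup>2) \<le> (2 * ?K)\<^sup>2" for n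
    proof (intro AE_I2)
      fix x
      have "norm (F k x - h ?K n x) \<le> norm (F k x) + norm (h ?K n x)" by (rule norm_triangle_ineq4)
      also have "\<dots> \<le> 2 * ?K" using Fb[of k x] hb[of ?K n x] by simp
      finally show "norm ((norm (F k x - h ?K n x))\<^sup>2) \<le> (2 * ?K)\<^sup>2"
        by (simp only: real_norm_def abs_power2) (rule power_mono, auto)
    qed
    show "(\<lambda>x. (norm (F k x - h ?K n x))\<^sup>2) \<in> borel_measurable (Om L)" for n
    proof -
      have "h ?K n \<in> borel_measurable (Om L)"
        by (intro borel_measurable_continuous_Om hc) simp
      then show ?thesis using Fm[of k] by measurable
    qed
  qed (auto simp: finite_measure.integrable_const[OF finite_measure_Om])
  then have "\<forall>\<^sub>F n in sequentially. (\<integral>x. (norm (F k x - h ?K n x))\<^sup>2 \<partial>Om L) < e / 4"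
    using e by (intro order_tendstoD(2)) auto
  then obtain n where n: "(\<integral>x. (norm (F k x - h ?K n x))\<^sup>2 \<partial>Om L) < e / 4"
    using eventually_happens by fastforce
  have Fk: "F k \<in> L2 (Om L)"
    by (rule L2_bounded[OF finite_measure_Om Fm]) (use Fb in auto)
  have hk: "h ?K n \<in> L2 (Om L)"
    by (rule L2_continuous) (rule continuous_on_subset[OF hc], auto)
  have "(\<integral>x. (norm (f x - h ?K n x))\<^sup>2 \<partial>Om L) \<le> (\<integral>x. 2 * (norm (f x - F k x))\<^sup>2 + 2 * (norm (F k x - h ?K n x))\<^sup>2 \<partial>Om L)"
  proof (rule integral_mono)
    show "integrable (Om L) (\<lambda>x. (norm (f x - h ?K n x))\<^sup>2)"
      by (rule L2D(2)[OF L2_diff[OF f hk]])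
    show "integrable (Om L) (\<lambda>x. 2 * (norm (f x - F k x))\<^sup>2 + 2 * (norm (F k x - h ?K n x))\<^sup>2)"
      using L2D(2)[OF L2_diff[OF f Fk]] L2D(2)[OF L2_diff[OF Fk hk]] by simp
    fix x
    have "norm (f x - h ?K n x) \<le> norm (f x - F k x) + norm (F k x - h ?K n x)"
      using norm_triangle_ineq[of "f x - F k x" "F k x - h ?K n x"] by simp
    then have "(norm (f x - h ?K n x))\<^sup>2 \<le> (norm (f x - F k x) + norm (F k x - h ?K n x))\<^sup>2"
      by (intro power_mono) auto
    also have "\<dots> \<le> 2 * (norm (f x - F k x))\<^sup>2 + 2 * (norm (F k x - h ?K n x))\<^sup>2"
      using sum_squares_bound[of "norm (f x - F k x)" "norm (F k x - h ?K n x)"] by (simp add: power2_sum)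
    finally show "(norm (f x - h ?K n x))\<^sup>2 \<le> 2 * (norm (f x - F k x))\<^sup>2 + 2 * (norm (F k x - h ?K n x))\<^sup>2" .
  qed
  also have "\<dots> = 2 * (\<integral>x. (norm (f x - F k x))\<^sup>2 \<partial>Om L) + 2 * (\<integral>x. (norm (F k x - h ?K n x))\<^sup>2 \<partial>Om L)"
    using L2D(2)[OF L2_diff[OF f Fk]] L2D(2)[OF L2_diff[OF Fk hk]] by simp
  also have "\<dots> < e" using k n by simp
  finally show ?thesis using that hc[of ?K n] by simp
qed

section \<open>Fourier coefficients and the dual space\<close>

lemma cos_sum_ec0:
  assumes "cos_sum L g" and L: "L > 0"
  shows "\<exists>b N. \<forall>M\<ge>N. \<forall>x. g x = (\<Sum>n<M. b n * ec0 L n x)"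
proof -
  obtain b N where b: "\<And>M x. M \<ge> N \<Longrightarrow> g x = (\<Sum>n<M. b n * cos (real n * pi / L * x))"
    using assms(1) unfolding cos_sum_def by blast
  define k where "k n = (if n = 0 then sqrt L else sqrt (L / 2))" for n :: nat
  have e: "cos (real n * pi / L * x) = k n * ec0 L n x" for n x
    using L by (cases n) (auto simp: ec0_def ec_def k_def freq_def real_sqrt_divide)
  have "g x = (\<Sum>n<M. (b n * k n) * ec0 L n x)" if "M \<ge> N" for M x
    unfolding b[OF that] by (intro sum.cong refl) (simp only: e mult.assoc)
  then show ?thesis by (intro exI[of _ "\<lambda>n. b n * k n"] exI[of _ N] allI impI)
qed

lemma L2_approx_cos:
  assumes L: "L > 0" and f: "f \<in> L2 (Om L)" and e: "e > 0"
  shows "\<exists>a N. \<forall>M\<ge>N. (\<integral>x. (norm (f x - (\<Sum>n<M. ec0 L n x *\<^sub>R a n)))\<^sup>2 \<partial>Om L) < e"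
proof -
  obtain g where g: "continuous_on UNIV g" "(\<integral>x. (norm (f x - g x))\<^sup>2 \<partial>Om L) < e / 4"
    using L2_approx_continuous[OF f, of "e / 4"] e by auto
  \<comment> \<open>Real and imaginary part err by less than d each, which contributes 8 d^2 L = e /
    4 to the square of the norm; the continuous approximation contributes less than e / 2.\<close>
  define d where "d = sqrt (e / (32 * L))"
  have d: "d > 0" using e L by (simp add: d_def)
  have "continuous_on {0..L} g" by (rule continuous_on_subset[OF g(1)]) simp
  then have gc: "continuous_on {0..L} (\<lambda>x. Re (g x))" "continuous_on {0..L} (\<lambda>x. Im (g x))"
    by (auto intro!: continuous_intros)
  obtain r where r: "cos_sum L r" "\<And>x. x \<in> {0..L} \<Longrightarrow> \<bar>Re (g x) - r x\<bar> < d"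
    using cos_sum_dense[OF L gc(1) d] by blast
  obtain i where i: "cos_sum L i" "\<And>x. x \<in> {0..L} \<Longrightarrow> \<bar>Im (g x) - i x\<bar> < d"
    using cos_sum_dense[OF L gc(2) d] by blast
  obtain b N where b: "\<And>M x. M \<ge> N \<Longrightarrow> r x = (\<Sum>n<M. b n * ec0 L n x)"
    using cos_sum_ec0[OF r(1) L] by blast
  obtain b' N' where b': "\<And>M x. M \<ge> N' \<Longrightarrow> i x = (\<Sum>n<M. b' n * ec0 L n x)"
    using cos_sum_ec0[OF i(1) L] by blast
  define a where "a n = Complex (b n) (b' n)" for n
  show ?thesis
  proof (intro exI[of _ a] exI[of _ "max N N'"] allI impI)
    fix M assume M: "M \<ge> max N N'"
    define P where "P x = (\<Sum>n<M. ec0 L n x *\<^sub>R a n)" for x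
    have P: "P x = Complex (r x) (i x)" for x
      using M b[of M x] b'[of M x] by (simp add: P_def a_def complex_eq_iff mult.commute)
    have Pc: "continuous_on {0..L} P"
      unfolding P_def by (intro continuous_intros)
    have P2: "P \<in> L2 (Om L)" by (rule L2_continuous[OF Pc])
    have g2: "g \<in> L2 (Om L)" by (rule L2_continuous) (rule continuous_on_subset[OF g(1)], simp)
    have "(\<integral>x. (norm (f x - P x))\<^sup>2 \<partial>Om L) \<le> (\<integral>x. 2 * (norm (f x - g x))\<^sup>2 + 8 * d\<^sup>2 \<partial>Om L)"
    proof (rule integral_mono)
      show "integrable (Om L) (\<lambda>x. (norm (f x - P x))\<^sup>2)" by (rule L2D(2)[OF L2_diff[OF f P2]])
      show "integrable (Om L) (\<lambda>x. 2 * (norm (f x - g x))\<^sup>2 + 8 * d\<^sup>2)"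
        using L2D(2)[OF L2_diff[OF f g2]] by (simp add: finite_measure.integrable_const[OF finite_measure_Om])
      fix x assume "x \<in> space (Om L)"
      then have x: "x \<in> {0..L}" by auto
      have "norm (g x - P x) \<le> \<bar>Re (g x - P x)\<bar> + \<bar>Im (g x - P x)\<bar>" by (rule cmod_le)
      also have "\<dots> \<le> 2 * d" using r(2)[OF x] i(2)[OF x] by (simp add: P)
      finally have gp: "(norm (g x - P x))\<^sup>2 \<le> (2 * d)\<^sup>2" by (intro power_mono) auto
      have "norm (f x - P x) \<le> norm (f x - g x) + norm (g x - P x)"
        using norm_triangle_ineq[of "f x - g x" "g x - P x"] by simp
      then have "(norm (f x - P x))\<^sup>2 \<le> (norm (f x - g x) + norm (g x - P x))\<^sup>2"
        by (intro power_mono) auto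
      also have "\<dots> \<le> 2 * (norm (f x - g x))\<^sup>2 + 2 * (norm (g x - P x))\<^sup>2"
        using sum_squares_bound[of "norm (f x - g x)" "norm (g x - P x)"] by (simp add: power2_sum)
      also have "\<dots> \<le> 2 * (norm (f x - g x))\<^sup>2 + 8 * d\<^sup>2" using gp by (simp add: power_mult_distrib)
      finally show "(norm (f x - P x))\<^sup>2 \<le> 2 * (norm (f x - g x))\<^sup>2 + 8 * d\<^sup>2" .
    qed
    also have "\<dots> = 2 * (\<integral>x. (norm (f x - g x))\<^sup>2 \<partial>Om L) + 8 * d\<^sup>2 * L"
      using L2D(2)[OF L2_diff[OF f g2]] L
      by (simp add: finite_measure.integrable_const[OF finite_measure_Om] measure_restrict_space)
    also have "\<dots> < e" using g(2) L e by (simp add: d_def)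
    finally show "(\<integral>x. (norm (f x - (\<Sum>n<M. ec0 L n x *\<^sub>R a n)))\<^sup>2 \<partial>Om L) < e"
      unfolding P_def .
  qed
qed

text \<open>The Fourier partial sums are best approximations, so they are at least as good as the
  cosine sums of \<open>L2_approx_cos\<close> from the same index on.\<close>

lemma parseval_ec0:
  assumes L: "L > 0" and f: "f \<in> L2 (Om L)"
  shows "(\<lambda>N. \<integral>x. (norm (f x - (\<Sum>n<N. ec0 L n x *\<^sub>R (\<integral>y. ec0 L n y *\<^sub>R f y \<partial>Om L))))\<^sup>2 \<partial>Om L) \<longlonglongrightarrow> 0"
proof (rule LIMSEQ_I)
  fix e :: real assume e: "e > 0"
  obtain a N where a: "\<And>M. M \<ge> N \<Longrightarrow> (\<integral>x. (norm (f x - (\<Sum>n<M. ec0 L n x *\<^sub>R a n)))\<^sup>2 \<partial>Om L) < e"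
    using L2_approx_cos[OF L f e] by blast
  note oe = orthonormal_expansion[OF finite_measure_Om borel_measurable_ec0 abs_ec0_le[OF L] ec0_orthonormal[OF L] f finite_lessThan]
  show "\<exists>no. \<forall>n\<ge>no. norm ((\<integral>x. (norm (f x - (\<Sum>m<n. ec0 L m x *\<^sub>R (\<integral>y. ec0 L m y *\<^sub>R f y \<partial>Om L))))\<^sup>2 \<partial>Om L) - 0) < e"
  proof (intro exI[of _ N] allI impI)
    fix n assume n: "n \<ge> N"
    have "(\<integral>x. (norm (f x - (\<Sum>m<n. ec0 L m x *\<^sub>R (\<integral>y. ec0 L m y *\<^sub>R f y \<partial>Om L))))\<^sup>2 \<partial>Om L)
       \<le> (\<integral>x. (norm (f x - (\<Sum>m<n. ec0 L m x *\<^sub>R a m)))\<^sup>2 \<partial>Om L)"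
      unfolding oe by (simp add: sum_nonneg)
    also have "\<dots> < e" by (rule a[OF n])
    finally show "norm ((\<integral>x. (norm (f x - (\<Sum>m<n. ec0 L m x *\<^sub>R (\<integral>y. ec0 L m y *\<^sub>R f y \<partial>Om L))))\<^sup>2 \<partial>Om L) - 0) < e"
      by simp
  qed
qed

definition coef :: "real \<Rightarrow> nat \<Rightarrow> (real \<Rightarrow> complex) \<Rightarrow> complex" where
  "coef L n u = (\<integral>x. es L n x *\<^sub>R u x \<partial>Om L)"

lemma es_scaleR_integrable: "L > 0 \<Longrightarrow> u \<in> L2 (Om L) \<Longrightarrow> integrable (Om L) (\<lambda>x. es L n x *\<^sub>R u x)"
  by (rule L2_Om_integrable, rule L2_bounded_scaleR[OF _ borel_measurable_es]) (auto intro: abs_es_le)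

lemma ec_scaleR_integrable: "L > 0 \<Longrightarrow> u \<in> L2 (Om L) \<Longrightarrow> integrable (Om L) (\<lambda>x. ec L n x *\<^sub>R u x)"
  by (rule L2_Om_integrable, rule L2_bounded_scaleR)
     (auto intro!: abs_ec_le borel_measurable_continuous_Om continuous_intros)

lemma coef_lincomb:
  assumes "L > 0" "u \<in> L2 (Om L)" "v \<in> L2 (Om L)"
  shows "coef L n (\<lambda>x. u x + c * v x) = coef L n u + c * coef L n v"
proof -
  have "coef L n (\<lambda>x. u x + c * v x) = (\<integral>x. es L n x *\<^sub>R u x + es L n x *\<^sub>R (c * v x) \<partial>Om L)"
    by (simp only: coef_def scaleR_add_right)
  also have "\<dots> = coef L n u + (\<integral>x. es L n x *\<^sub>R (c * v x) \<partial>Om L)"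
    unfolding coef_def
    by (intro Bochner_Integration.integral_add es_scaleR_integrable L2_cmult assms)
  also have "(\<integral>x. es L n x *\<^sub>R (c * v x) \<partial>Om L) = c * coef L n v"
    by (simp add: coef_def flip: mult_scaleR_right)
  finally show ?thesis .
qed

lemma coef_cong_AE:
  assumes "AE x in Om L. u x = v x" "u \<in> L2 (Om L)" "v \<in> L2 (Om L)"
  shows "coef L n u = coef L n v"
  unfolding coef_def
proof (rule integral_cong_AE)
  show "AE x in Om L. es L n x *\<^sub>R u x = es L n x *\<^sub>R v x" using assms(1) by eventually_elim simp
qed (use L2D(1)[OF assms(2)] L2D(1)[OF assms(3)] borel_measurable_es in \<open>auto intro!: borel_measurable_scaleR\<close>)

lemma prim_ec_deriv:
  assumes "0 \<le> x"
  shows "prim (\<lambda>y. - freq L n * es L n y) x = ec L n x - ec L n 0"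
  by (rule prim_FTC_real[OF assms ec_deriv]) (intro continuous_intros)

text \<open>Integration by parts without boundary terms, because the primitive vanishes at both
  ends; the value of \<open>ec\<close> at 0 only multiplies the integral of v, which is
  zero.\<close>

lemma integral_es_prim:
  assumes L: "L > 0" and v: "v \<in> L2 (Om L)" and "prim v L = 0"
  shows "(\<integral>x. ec L n x *\<^sub>R v x \<partial>Om L) = freq L n *\<^sub>R coef L n (prim v)"
proof -
  let ?f = "\<lambda>y. - freq L n * es L n y"
  have fi: "integrable (Om L) ?f" by (intro integrable_continuous_Om continuous_intros)
  have vi: "integrable (Om L) v" by (rule L2_Om_integrable[OF v])
  have "(\<integral>x. prim ?f x *\<^sub>R v x \<partial>Om L) = (\<integral>x. ec L n x *\<^sub>R v x - ec L n 0 *\<^sub>R v x \<partial>Om L)"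
  proof (rule Bochner_Integration.integral_cong[OF refl])
    fix x assume "x \<in> space (Om L)"
    then have x: "0 \<le> x" by auto
    show "prim ?f x *\<^sub>R v x = ec L n x *\<^sub>R v x - ec L n 0 *\<^sub>R v x"
      by (simp only: prim_ec_deriv[OF x] scaleR_diff_left)
  qed
  also have "\<dots> = (\<integral>x. ec L n x *\<^sub>R v x \<partial>Om L)"
    using ec_scaleR_integrable[OF L v, of n] vi assms(3) by (simp add: prim_def)
  finally have "(\<integral>x. ec L n x *\<^sub>R v x \<partial>Om L) = - (\<integral>x. ?f x *\<^sub>R prim v x \<partial>Om L)"
    using prim_triangle(3)[OF fi vi] assms(3) by (simp add: add_eq_0_iff)
  also have "\<dots> = freq L n *\<^sub>R coef L n (prim v)"
    by (simp add: coef_def flip: scaleR_scaleR)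
  finally show ?thesis .
qed

lemma H10_deriv_coef:
  assumes L: "L > 0" and u: "u \<in> H10 L"
  shows "(\<integral>x. ec L n x *\<^sub>R wderiv L u x \<partial>Om L) = freq L n *\<^sub>R coef L n u"
proof -
  note U = H10E[OF L u]
  have "coef L n u = coef L n (prim (wderiv L u))"
    by (rule coef_cong_AE[OF U(4,2) L2_continuous[OF continuous_on_prim[OF L2_Om_integrable[OF U(3)]]]])
  then show ?thesis using integral_es_prim[OF L U(3,5)] by simp
qed

lemma H10_bessel:
  assumes L: "L > 0" and u: "u \<in> H10 L"
  shows "(\<Sum>n<N. (freq L n * norm (coef L n u))\<^sup>2) \<le> (l2norm (Om L) (wderiv L u))\<^sup>2"
proof -
  have "(\<Sum>n<N. (norm (\<integral>x. ec L n x *\<^sub>R wderiv L u x \<partial>Om L))\<^sup>2) \<le> (\<integral>x. (norm (wderiv L u x))\<^sup>2 \<partial>Om L)"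
    by (rule bessel[OF finite_measure_Om _ abs_ec_le[OF L] ec_orthonormal[OF L] H10E(3)[OF L u] finite_lessThan])
      (auto intro!: borel_measurable_continuous_Om continuous_intros)
  then show ?thesis
    using freq_pos[OF L] by (simp add: H10_deriv_coef[OF L u] l2norm_square abs_of_pos)
qed

text \<open>The sine series converges in the Sobolev norm: it is the cosine expansion of the
  derivative, whose constant mode vanishes because u is zero at both ends.\<close>

lemma H10_parseval:
  assumes L: "L > 0" and u: "u \<in> H10 L"
  shows "(\<lambda>N. l2norm (Om L) (\<lambda>x. wderiv L u x - (\<Sum>n<N. coef L n u * of_real (freq L n * ec L n x)))) \<longlonglongrightarrow> 0"
proof -
  let ?w = "wderiv L u"
  note U = H10E[OF L u]
  have 0: "(\<integral>y. ec0 L 0 y *\<^sub>R ?w y \<partial>Om L) = 0"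
    using U(5) by (simp add: ec0_def prim_def)
  have S: "(\<integral>y. ec0 L (Suc n) y *\<^sub>R ?w y \<partial>Om L) = freq L n *\<^sub>R coef L n u" for n
    using H10_deriv_coef[OF L u, of n] by (simp add: ec0_def)
  have eq: "(\<Sum>n<Suc N. ec0 L n x *\<^sub>R (\<integral>y. ec0 L n y *\<^sub>R ?w y \<partial>Om L)) = (\<Sum>n<N. coef L n u * of_real (freq L n * ec L n x))" for N x
    unfolding sum.lessThan_Suc_shift 0 S by (simp add: ec0_def scaleR_conv_of_real mult_ac)
  have "(\<lambda>N. \<integral>x. (norm (?w x - (\<Sum>n<N. coef L n u * of_real (freq L n * ec L n x))))\<^sup>2 \<partial>Om L) \<longlonglongrightarrow> 0"
    using LIMSEQ_Suc[OF parseval_ec0[OF L U(3)]] unfolding eq .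
  from tendsto_real_sqrt[OF this] show ?thesis by (simp add: l2norm_def)
qed

text \<open>Poincare's inequality, from the pointwise bound on a primitive by
  Cauchy-Schwarz.\<close>

lemma h1norm_le_deriv:
  assumes L: "L > 0" and u: "u \<in> H10 L"
  shows "h1norm L u \<le> (1 + L) * l2norm (Om L) (wderiv L u)" "l2norm (Om L) (wderiv L u) \<le> h1norm L u"
proof -
  note U = H10E[OF L u]
  let ?d = "l2norm (Om L) (wderiv L u)"
  have d: "?d \<ge> 0" by (rule l2norm_nonneg)
  have c: "(\<lambda>x. complex_of_real (sqrt L * ?d)) \<in> L2 (Om L)" by (rule L2_const[OF finite_measure_Om])
  have "AE x in Om L. x \<le> L" by (intro AE_I2) auto
  then have "AE x in Om L. norm (u x) \<le> norm (complex_of_real (sqrt L * ?d))"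
    using U(4) by eventually_elim (use norm_prim_le[OF U(3) L] d L in \<open>simp add: norm_mult\<close>)
  then have "l2norm (Om L) u \<le> l2norm (Om L) (\<lambda>x. complex_of_real (sqrt L * ?d))"
    by (rule l2norm_mono[OF L2D(1)[OF U(2)] c])
  also have "\<dots> = sqrt (L * (sqrt L * ?d)\<^sup>2)"
    using L by (simp add: l2norm_def measure_restrict_space norm_mult power_mult_distrib)
  also have "\<dots> = L * ?d"
    using L d by (simp add: power_mult_distrib real_sqrt_mult flip: power2_eq_square)
  finally have a: "l2norm (Om L) u \<le> L * ?d" .
  have "h1norm L u \<le> l2norm (Om L) u + ?d"
    unfolding h1norm_def by (rule sqrt_sum_squares_le_sum[OF l2norm_nonneg d])
  then show "h1norm L u \<le> (1 + L) * ?d" using a by (simp add: distrib_right)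
  show "?d \<le> h1norm L u"
    unfolding h1norm_def using d by (intro real_le_rsqrt) simp
qed

lemma sine_sum_H10:
  assumes L: "L > 0"
  shows "(\<lambda>x. \<Sum>n<N. c n * of_real (es L n x)) \<in> H10 L"
    "AE x in Om L. wderiv L (\<lambda>x. \<Sum>n<N. c n * of_real (es L n x)) x = (\<Sum>n<N. c n * of_real (freq L n * ec L n x))"
proof -
  let ?v = "\<lambda>x. \<Sum>n<N. c n * of_real (freq L n * ec L n x)"
  let ?u = "\<lambda>x. \<Sum>n<N. c n * complex_of_real (es L n x)"
  have vc: "continuous_on S ?v" for S by (intro continuous_intros)
  have e: "(es L n has_real_derivative freq L n * ec L n t) (at t within S)" for n t S
    by (rule has_field_derivative_at_within[OF es_deriv])
  have d: "(?u has_vector_derivative ?v t) (at t within S)" for t S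
    by (intro has_vector_derivative_sum has_vector_derivative_mult_right has_vector_derivative_of_real e)
  have p: "prim ?v x = ?u x" if "0 \<le> x" for x
    using prim_FTC[OF that d vc] by (simp add: es_boundary)
  have a: "AE x in Om L. ?u x = prim ?v x" by (intro AE_I2 p[symmetric]) auto
  have b: "prim ?v L = 0" using p[of L] L by (simp add: es_boundary)
  show "?u \<in> H10 L" "AE x in Om L. wderiv L ?u x = ?v x"
    by (rule H10I[OF L L2_continuous[OF vc] a b])+
qed

lemma es_H10: "L > 0 \<Longrightarrow> (\<lambda>x. complex_of_real (es L n x)) \<in> H10 L"
  using sine_sum_H10(1)[of L "\<lambda>m. if m = n then 1 else 0" "Suc n"]
  by (simp add: if_distrib[of "\<lambda>y. y * _"] cong: if_cong)

section \<open>Functionals on the sine basis\<close>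

lemma Hm1_lincomb:
  assumes F: "F \<in> Hm1 L" and "u \<in> H10 L" "v \<in> H10 L" and L: "L > 0"
  shows "F (\<lambda>x. u x + c * v x) = F u + cnj c * F v"
  using F assms(2,3) H10_cmult[OF L assms(3), of c] by (simp add: Hm1_def)

lemma Hm1_zero: "F \<in> Hm1 L \<Longrightarrow> L > 0 \<Longrightarrow> F (\<lambda>x. 0) = 0"
  using Hm1_lincomb[of F L "\<lambda>x. 0" "\<lambda>x. 0" 1] H10_zero by simp

lemma Hm1_sine_sum:
  assumes F: "F \<in> Hm1 L" and L: "L > 0"
  shows "F (\<lambda>x. \<Sum>n<N. c n * of_real (es L n x)) = (\<Sum>n<N. F (\<lambda>x. of_real (es L n x)) * cnj (c n))"
proof (induction N)
  case 0
  then show ?case using Hm1_zero[OF assms] by simp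
next
  case (Suc N)
  have "F (\<lambda>x. \<Sum>n<Suc N. c n * of_real (es L n x)) = F (\<lambda>x. (\<Sum>n<N. c n * of_real (es L n x)) + c N * of_real (es L N x))"
    by simp
  also have "\<dots> = F (\<lambda>x. \<Sum>n<N. c n * of_real (es L n x)) + cnj (c N) * F (\<lambda>x. of_real (es L N x))"
    by (rule Hm1_lincomb[OF F sine_sum_H10(1)[OF L] es_H10[OF L] L])
  finally show ?case by (simp add: Suc.IH mult.commute)
qed

lemma Hm1_bounded:
  assumes F: "F \<in> Hm1 L"
  obtains C where "C \<ge> 0" "\<And>u. u \<in> H10 L \<Longrightarrow> norm (F u) \<le> C * h1norm L u"
proof -
  obtain C where C: "\<forall>u\<in>H10 L. norm (F u) \<le> C * h1norm L u"
    using F by (auto simp: Hm1_def)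
  show ?thesis
  proof (rule that[of "\<bar>C\<bar>"])
    fix u assume "u \<in> H10 L"
    then have "norm (F u) \<le> C * h1norm L u" using C by blast
    also have "\<dots> \<le> \<bar>C\<bar> * h1norm L u"
      by (intro mult_right_mono) (auto simp: h1norm_def)
    finally show "norm (F u) \<le> \<bar>C\<bar> * h1norm L u" .
  qed simp
qed

text \<open>Sine partial sums converge to u in the Sobolev norm and F is bounded there, so F is
  determined by its values on the sines.\<close>

lemma Hm1_sums:
  assumes F: "F \<in> Hm1 L" and L: "L > 0" and u: "u \<in> H10 L"
  shows "(\<lambda>n. F (\<lambda>x. of_real (es L n x)) * cnj (coef L n u)) sums F u"
proof -
  obtain C where C: "C \<ge> 0" "\<And>u. u \<in> H10 L \<Longrightarrow> norm (F u) \<le> C * h1norm L u"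
    using Hm1_bounded[OF F] by blast
  define S where "S N = (\<lambda>x. \<Sum>n<N. coef L n u * complex_of_real (es L n x))" for N
  have S: "S N \<in> H10 L" "AE x in Om L. wderiv L (S N) x = (\<Sum>n<N. coef L n u * of_real (freq L n * ec L n x))" for N
    unfolding S_def by (rule sine_sum_H10[OF L])+
  define d where "d N = l2norm (Om L) (\<lambda>x. wderiv L u x - (\<Sum>n<N. coef L n u * of_real (freq L n * ec L n x)))" for N
  have d: "d \<longlonglongrightarrow> 0" unfolding d_def by (rule H10_parseval[OF L u])
  have b: "norm (F (S N) - F u) \<le> C * ((1 + L) * d N)" for N
  proof -
    let ?w = "\<lambda>x. u x + (-1) * S N x"
    have w: "?w \<in> H10 L" "AE x in Om L. wderiv L ?w x = wderiv L u x + (-1) * wderiv L (S N) x"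
      using H10_lincomb[OF L u S(1)] by blast+
    have "l2norm (Om L) (wderiv L ?w) = d N"
      unfolding d_def
    proof (rule l2norm_cong_AE)
      show "AE x in Om L. wderiv L ?w x = wderiv L u x - (\<Sum>n<N. coef L n u * of_real (freq L n * ec L n x))"
        using w(2) S(2)[of N] by eventually_elim simp
      show "wderiv L ?w \<in> borel_measurable (Om L)" by (rule L2D(1)[OF H10E(3)[OF L w(1)]])
      show "(\<lambda>x. wderiv L u x - (\<Sum>n<N. coef L n u * of_real (freq L n * ec L n x))) \<in> borel_measurable (Om L)"
        by (intro borel_measurable_diff L2D(1)[OF H10E(3)[OF L u]] borel_measurable_continuous_Om continuous_intros)
    qed
    then have "h1norm L ?w \<le> (1 + L) * d N" using h1norm_le_deriv(1)[OF L w(1)] by simp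
    then have "norm (F ?w) \<le> C * ((1 + L) * d N)" using C(2)[OF w(1)] mult_left_mono[OF _ C(1)] order_trans by blast
    moreover have "F ?w = F u - F (S N)"
      using Hm1_lincomb[OF F u S(1) L, of "-1" N] by simp
    ultimately show ?thesis by (simp add: norm_minus_commute)
  qed
  have "(\<lambda>N. F (S N)) \<longlonglongrightarrow> F u"
  proof (rule LIM_zero_cancel, rule Lim_null_comparison)
    show "\<forall>\<^sub>F N in sequentially. norm (F (S N) - F u) \<le> C * ((1 + L) * d N)" using b by simp
    show "(\<lambda>N. C * ((1 + L) * d N)) \<longlonglongrightarrow> 0"
      using tendsto_mult_right_zero[OF tendsto_mult_right_zero[OF d]] .
  qed
  then show ?thesis
    unfolding sums_def S_def Hm1_sine_sum[OF F L] .
qed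

text \<open>Duality: on a suitable finite sine sum, F takes the value X of the partial sum while the
  derivative has norm sqrt X, so boundedness of F bounds X.\<close>

lemma Hm1_square_summable:
  assumes F: "F \<in> Hm1 L" and L: "L > 0"
  shows "summable (\<lambda>n. (norm (F (\<lambda>x. of_real (es L n x)) / freq L n))\<^sup>2)"
proof -
  obtain C where C: "C \<ge> 0" "\<And>u. u \<in> H10 L \<Longrightarrow> norm (F u) \<le> C * h1norm L u"
    using Hm1_bounded[OF F] by blast
  define f where "f n = F (\<lambda>x. of_real (es L n x))" for n
  have "(\<Sum>n<N. (norm (f n / freq L n))\<^sup>2) \<le> (C * (1 + L))\<^sup>2" for N
  proof -
    define X where "X = (\<Sum>n<N. (norm (f n / freq L n))\<^sup>2)"
    \<comment> \<open>The coefficients of the representative of the truncated functional for the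
      inner product of derivatives.\<close>
    define c where "c n = f n / of_real ((freq L n)\<^sup>2)" for n
    let ?u = "\<lambda>x. \<Sum>n<N. c n * complex_of_real (es L n x)"
    have u: "?u \<in> H10 L" "AE x in Om L. wderiv L ?u x = (\<Sum>n<N. c n * of_real (freq L n * ec L n x))"
      using sine_sum_H10[OF L] by blast+
    have "f n * cnj (c n) = of_real ((norm (f n / freq L n))\<^sup>2)" for n
      by (simp add: c_def norm_divide power_divide complex_norm_square[symmetric] mult.commute flip: complex_norm_square)
    then have Fu: "F ?u = of_real X"
      unfolding Hm1_sine_sum[OF F L] by (simp add: f_def X_def)
    have "(l2norm (Om L) (wderiv L ?u))\<^sup>2 = (\<integral>x. (norm (0 - (\<Sum>n<N. ec L n x *\<^sub>R (- (freq L n *\<^sub>R c n)))))\<^sup>2 \<partial>Om L)"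
      unfolding l2norm_square
    proof (rule integral_cong_AE)
      show "AE x in Om L. (norm (wderiv L ?u x))\<^sup>2 = (norm (0 - (\<Sum>n<N. ec L n x *\<^sub>R (- (freq L n *\<^sub>R c n)))))\<^sup>2"
        using u(2) by eventually_elim (simp add: scaleR_conv_of_real mult_ac sum_negf)
      show "(\<lambda>x. (norm (wderiv L ?u x))\<^sup>2) \<in> borel_measurable (Om L)"
        using L2D(2)[OF H10E(3)[OF L u(1)]] by simp
      show "(\<lambda>x. (norm (0 - (\<Sum>n<N. ec L n x *\<^sub>R (- (freq L n *\<^sub>R c n)))))\<^sup>2) \<in> borel_measurable (Om L)"
        by (intro borel_measurable_continuous_Om continuous_intros)
    qed
    also have "\<dots> = (\<Sum>n<N. (norm (freq L n *\<^sub>R c n))\<^sup>2)"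
      by (subst orthonormal_expansion[OF finite_measure_Om _ abs_ec_le[OF L] ec_orthonormal[OF L] L2_zero finite_lessThan])
         (auto intro!: borel_measurable_continuous_Om continuous_intros)
    also have "\<dots> = X"
    proof -
      have "norm (freq L n *\<^sub>R c n) = norm (f n / freq L n)" for n
        using freq_pos[OF L, of n] by (simp add: c_def norm_divide norm_mult power2_eq_square)
      then show ?thesis unfolding X_def by simp
    qed
    finally have l: "l2norm (Om L) (wderiv L ?u) = sqrt X"
      using l2norm_nonneg by (metis real_sqrt_unique)
    have X0: "X \<ge> 0" unfolding X_def by (intro sum_nonneg) simp
    have "X = norm (F ?u)" using Fu X0 by simp
    also have "\<dots> \<le> C * h1norm L ?u" by (rule C(2)[OF u(1)])
    also have "\<dots> \<le> C * ((1 + L) * sqrt X)"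
      using h1norm_le_deriv(1)[OF L u(1)] C(1) l by (intro mult_left_mono) auto
    finally have "sqrt X * sqrt X \<le> (C * (1 + L)) * sqrt X" using X0 by (simp add: mult_ac)
    then have "sqrt X \<le> C * (1 + L)"
      using X0 C(1) L by (cases "X = 0") (simp_all add: mult_le_cancel_right del: real_sqrt_mult_self)
    then have "(sqrt X)\<^sup>2 \<le> (C * (1 + L))\<^sup>2" using X0 by (intro power_mono) auto
    then show ?thesis using X0 by (simp add: X_def)
  qed
  then show ?thesis
    unfolding f_def[symmetric] by (intro summableI_nonneg_bounded[of _ "(C * (1 + L))\<^sup>2"]) auto
qed

section \<open>The Hilbert space of square summable sequences\<close>

text \<open>A type of its own gives access to Hilbert space arguments through the classes
  \<open>real_inner\<close> and \<open>complete_space\<close>. The class inner product is real,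
  namely the real part of the complex pairing \<open>cinner\<close> below.\<close>

typedef ell2 = "{f :: nat \<Rightarrow> complex. summable (\<lambda>n. (norm (f n))\<^sup>2)}"
  morphisms nth Ell2
  by (rule exI[of _ "\<lambda>_. 0"]) simp

lemma nth_summable: "summable (\<lambda>n. (norm (nth x n))\<^sup>2)"
  using nth[of x] by simp

lemma nth_Ell2: "summable (\<lambda>n. (norm (f n))\<^sup>2) \<Longrightarrow> nth (Ell2 f) = f"
  by (rule Ell2_inverse) simp

lemma ell2_eqI: "(\<And>n. nth x n = nth y n) \<Longrightarrow> x = y"
  using nth_inject by blast

lemma square_summable_add:
  fixes f g :: "nat \<Rightarrow> complex"
  assumes "summable (\<lambda>n. (norm (f n))\<^sup>2)" "summable (\<lambda>n. (norm (g n))\<^sup>2)"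
  shows "summable (\<lambda>n. (norm (f n + g n))\<^sup>2)"
proof (rule summable_comparison_test')
  show "summable (\<lambda>n. 2 * (norm (f n))\<^sup>2 + 2 * (norm (g n))\<^sup>2)"
    using assms by (intro summable_add summable_mult)
  fix n
  have "(norm (f n + g n))\<^sup>2 \<le> (norm (f n) + norm (g n))\<^sup>2"
    by (intro power_mono norm_triangle_ineq) auto
  also have "\<dots> \<le> 2 * (norm (f n))\<^sup>2 + 2 * (norm (g n))\<^sup>2"
    using sum_squares_bound[of "norm (f n)" "norm (g n)"] by (simp add: power2_sum)
  finally show "norm ((norm (f n + g n))\<^sup>2) \<le> 2 * (norm (f n))\<^sup>2 + 2 * (norm (g n))\<^sup>2" by simp
qed

lemma square_summable_cmult:
  fixes f :: "nat \<Rightarrow> complex"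
  shows "summable (\<lambda>n. (norm (f n))\<^sup>2) \<Longrightarrow> summable (\<lambda>n. (norm (c * f n))\<^sup>2)"
  using summable_mult[of "\<lambda>n. (norm (f n))\<^sup>2" "(norm c)\<^sup>2"] by (simp add: norm_mult power_mult_distrib)

lemma square_summable_bounded:
  fixes f g :: "nat \<Rightarrow> complex"
  assumes "summable (\<lambda>n. (norm (f n))\<^sup>2)" "\<And>n. norm (g n) \<le> C * norm (f n)"
  shows "summable (\<lambda>n. (norm (g n))\<^sup>2)"
proof (rule summable_comparison_test')
  show "summable (\<lambda>n. C\<^sup>2 * (norm (f n))\<^sup>2)" using assms(1) by (rule summable_mult)
  fix n
  have "(norm (g n))\<^sup>2 \<le> (C * norm (f n))\<^sup>2" by (intro power_mono assms) auto
  then show "norm ((norm (g n))\<^sup>2) \<le> C\<^sup>2 * (norm (f n))\<^sup>2" by (simp add: power_mult_distrib)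
qed

lemma square_summable_mult:
  fixes f g :: "nat \<Rightarrow> complex"
  assumes "summable (\<lambda>n. (norm (f n))\<^sup>2)" "summable (\<lambda>n. (norm (g n))\<^sup>2)"
  shows "summable (\<lambda>n. norm (f n) * norm (g n))"
proof (rule summable_comparison_test')
  show "summable (\<lambda>n. (norm (f n))\<^sup>2 + (norm (g n))\<^sup>2)" using assms by (rule summable_add)
  fix n
  have "2 * (norm (f n) * norm (g n)) \<le> (norm (f n))\<^sup>2 + (norm (g n))\<^sup>2"
    using sum_squares_bound[of "norm (f n)" "norm (g n)"] by (simp add: mult.assoc)
  moreover have "0 \<le> norm (f n) * norm (g n)" by simp
  ultimately show "norm (norm (f n) * norm (g n)) \<le> (norm (f n))\<^sup>2 + (norm (g n))\<^sup>2"
    by (simp only: real_norm_def abs_of_nonneg)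
qed

instantiation ell2 :: real_vector
begin

definition "0 = Ell2 (\<lambda>_. 0)"
definition "x + y = Ell2 (\<lambda>n. nth x n + nth y n)"
definition "- x = Ell2 (\<lambda>n. - nth x n)"
definition "x - y = Ell2 (\<lambda>n. nth x n - nth y n)"
definition "scaleR r x = Ell2 (\<lambda>n. r *\<^sub>R nth x n)"

lemma nth_zero: "nth 0 n = 0"
  unfolding zero_ell2_def by (subst nth_Ell2) auto

lemma nth_add: "nth (x + y) n = nth x n + nth y n"
  unfolding plus_ell2_def by (subst nth_Ell2) (auto intro: square_summable_add nth_summable)

lemma nth_uminus: "nth (- x) n = - nth x n"
  unfolding uminus_ell2_def by (subst nth_Ell2) (auto intro: nth_summable)

lemma nth_diff: "nth (x - y) n = nth x n - nth y n"
proof -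
  have "summable (\<lambda>n. (norm (nth x n + - nth y n))\<^sup>2)"
    by (rule square_summable_add) (auto intro: nth_summable)
  then show ?thesis unfolding minus_ell2_def by (subst nth_Ell2) auto
qed

lemma nth_scaleR: "nth (scaleR r x) n = r *\<^sub>R nth x n"
proof -
  have "summable (\<lambda>n. (norm (of_real r * nth x n))\<^sup>2)"
    by (rule square_summable_cmult) (rule nth_summable)
  then show ?thesis unfolding scaleR_ell2_def by (subst nth_Ell2) (auto simp: scaleR_conv_of_real)
qed

lemmas nth_simps = nth_zero nth_add nth_uminus nth_diff nth_scaleR

instance
proof
  fix x y z :: ell2 and r s :: real
  show "x + y + z = x + (y + z)" "x + y = y + x" "0 + x = x" "- x + x = 0" "x - y = x + - y"
    "r *\<^sub>R (x + y) = r *\<^sub>R x + r *\<^sub>R y" "(r + s) *\<^sub>R x = r *\<^sub>R x + s *\<^sub>R x" "r *\<^sub>R s *\<^sub>R x = (r * s) *\<^sub>R x" "1 *\<^sub>R x = x"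
    by (rule ell2_eqI; simp add: nth_simps algebra_simps)+
qed

end

instantiation ell2 :: real_inner
begin

definition "inner x y = (\<Sum>n. nth x n \<bullet> nth y n)"
definition "norm (x :: ell2) = sqrt (inner x x)"
definition "sgn (x :: ell2) = x /\<^sub>R (norm x)"
definition "dist (x :: ell2) y = norm (x - y)"
definition "(uniformity :: (ell2 \<times> ell2) filter) = (INF e\<in>{0 <..}. principal {(x, y). dist x y < e})"
definition "open (U :: ell2 set) = (\<forall>x\<in>U. eventually (\<lambda>(x', y). x' = x \<longrightarrow> y \<in> U) uniformity)"

lemma inner_summable: "summable (\<lambda>n. nth x n \<bullet> nth y n)"
  by (rule summable_comparison_test'[OF square_summable_mult[OF nth_summable[of x] nth_summable[of y]]])
     (simp add: Cauchy_Schwarz_ineq2)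

instance
proof
  fix x y z :: ell2 and r s :: real
  show "x \<bullet> y = y \<bullet> x" by (simp add: inner_ell2_def inner_commute)
  show "(x + y) \<bullet> z = x \<bullet> z + y \<bullet> z"
    unfolding inner_ell2_def by (subst suminf_add[OF inner_summable inner_summable]) (simp add: nth_simps inner_add_left)
  show "r *\<^sub>R x \<bullet> y = r * (x \<bullet> y)"
    unfolding inner_ell2_def by (subst suminf_mult[OF inner_summable, symmetric]) (simp add: nth_simps)
  show "0 \<le> x \<bullet> x" unfolding inner_ell2_def by (rule suminf_nonneg[OF inner_summable]) simp
  show "x \<bullet> x = 0 \<longleftrightarrow> x = 0"
  proof
    assume "x \<bullet> x = 0"
    then have "nth x n \<bullet> nth x n = 0" for n
      unfolding inner_ell2_def using suminf_eq_zero_iff[OF inner_summable[of x x]] by simp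
    then show "x = 0" by (intro ell2_eqI) (simp add: nth_zero)
  qed (simp add: inner_ell2_def nth_zero)
  show "norm x = sqrt (x \<bullet> x)" by (rule norm_ell2_def)
  show "sgn x = x /\<^sub>R norm x" by (rule sgn_ell2_def)
  show "dist x y = norm (x - y)" by (rule dist_ell2_def)
  show "uniformity = (INF e\<in>{0 <..}. principal {(x, y). dist (x::ell2) y < e})" by (rule uniformity_ell2_def)
  show "open U = (\<forall>x\<in>U. eventually (\<lambda>(x', y). x' = x \<longrightarrow> y \<in> U) uniformity)" for U :: "ell2 set" by (rule open_ell2_def)
qed

end

lemma norm_ell2_square: "(norm (x :: ell2))\<^sup>2 = (\<Sum>n. (norm (nth x n))\<^sup>2)"
  by (simp add: power2_norm_eq_inner inner_ell2_def)

lemma sum_norm_nth_le: "(\<Sum>n<N. (norm (nth x n))\<^sup>2) \<le> (norm x)\<^sup>2"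
  unfolding norm_ell2_square by (rule sum_le_suminf[OF nth_summable]) auto

lemma norm_nth_le: "norm (nth x n) \<le> norm x"
proof -
  have "(norm (nth x n))\<^sup>2 \<le> (\<Sum>i<Suc n. (norm (nth x i))\<^sup>2)" by (simp add: sum_nonneg)
  also have "\<dots> \<le> (norm x)\<^sup>2" by (rule sum_norm_nth_le)
  finally show ?thesis by (rule power2_le_imp_le) simp
qed

text \<open>Coordinates converge, and the Cauchy bound passes to the limit in every finite partial
  sum of squares, hence to the norm.\<close>

instance ell2 :: complete_space
proof
  fix X :: "nat \<Rightarrow> ell2" assume X: "Cauchy X"
  define f where "f n = lim (\<lambda>k. nth (X k) n)" for n
  have "Cauchy (\<lambda>k. nth (X k) n)" for n
  proof (rule metric_CauchyI)
    fix e :: real assume "e > 0"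
    then obtain M where M: "\<forall>m\<ge>M. \<forall>k\<ge>M. dist (X m) (X k) < e"
      using metric_CauchyD[OF X \<open>e > 0\<close>] by blast
    have "dist (nth (X m) n) (nth (X k) n) < e" if "m \<ge> M" "k \<ge> M" for m k
      using norm_nth_le[of "X m - X k" n] M[rule_format, OF that] by (simp add: dist_norm nth_diff)
    then show "\<exists>M. \<forall>m\<ge>M. \<forall>k\<ge>M. dist (nth (X m) n) (nth (X k) n) < e" by blast
  qed
  then have "convergent (\<lambda>k. nth (X k) n)" for n
    by (rule Cauchy_convergent)
  then have f: "(\<lambda>k. nth (X k) n) \<longlonglongrightarrow> f n" for n
    unfolding f_def convergent_LIMSEQ_iff .
  have close: "(\<Sum>n<N. (norm (nth (X m) n - f n))\<^sup>2) \<le> e\<^sup>2"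
    if M: "\<forall>m\<ge>M. \<forall>k\<ge>M. dist (X m) (X k) < e" and "m \<ge> M" for M m e N
  proof (rule LIMSEQ_le_const2)
    show "(\<lambda>k. \<Sum>n<N. (norm (nth (X m) n - nth (X k) n))\<^sup>2) \<longlonglongrightarrow> (\<Sum>n<N. (norm (nth (X m) n - f n))\<^sup>2)"
      by (intro tendsto_intros f)
    have "(\<Sum>n<N. (norm (nth (X m) n - nth (X k) n))\<^sup>2) \<le> e\<^sup>2" if "k \<ge> M" for k
    proof -
      have "(\<Sum>n<N. (norm (nth (X m) n - nth (X k) n))\<^sup>2) \<le> (norm (X m - X k))\<^sup>2"
        using sum_norm_nth_le[where x="X m - X k" and N=N] by (simp add: nth_diff)
      also have "\<dots> \<le> e\<^sup>2"
        using M[rule_format, OF \<open>m \<ge> M\<close> that] by (intro power_mono) (auto simp: dist_norm)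
      finally show ?thesis .
    qed
    then show "\<exists>K. \<forall>k\<ge>K. (\<Sum>n<N. (norm (nth (X m) n - nth (X k) n))\<^sup>2) \<le> e\<^sup>2" by blast
  qed
  have sd: "summable (\<lambda>n. (norm (nth (X m) n - f n))\<^sup>2)"
    if M: "\<forall>m\<ge>M. \<forall>k\<ge>M. dist (X m) (X k) < e" and "m \<ge> M" for M m e
    by (rule summableI_nonneg_bounded[of _ "e\<^sup>2"]) (auto intro: close[OF that])
  obtain M0 where M0: "\<forall>m\<ge>M0. \<forall>k\<ge>M0. dist (X m) (X k) < 1"
    using metric_CauchyD[OF X, of 1] by auto
  have "summable (\<lambda>n. (norm (nth (X M0) n + - (nth (X M0) n - f n)))\<^sup>2)"
    by (rule square_summable_add[OF nth_summable]) (use sd[OF M0 order_refl] in \<open>simp add: norm_minus_commute\<close>)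
  then have fs: "summable (\<lambda>n. (norm (f n))\<^sup>2)" by simp
  have "X \<longlonglongrightarrow> Ell2 f"
  proof (rule metric_LIMSEQ_I)
    fix e :: real assume e: "e > 0"
    then obtain M where M: "\<forall>m\<ge>M. \<forall>k\<ge>M. dist (X m) (X k) < e / 2"
      using metric_CauchyD[OF X, of "e / 2"] by auto
    have "dist (X m) (Ell2 f) < e" if "m \<ge> M" for m
    proof -
      have "(norm (X m - Ell2 f))\<^sup>2 \<le> (e / 2)\<^sup>2"
        unfolding norm_ell2_square nth_diff nth_Ell2[OF fs]
        by (rule suminf_le_const[OF sd[OF M that] close[OF M that]])
      then have "norm (X m - Ell2 f) \<le> e / 2" by (rule power2_le_imp_le) (use e in simp)
      then show ?thesis using e by (simp add: dist_norm)
    qed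
    then show "\<exists>no. \<forall>n\<ge>no. dist (X n) (Ell2 f) < e" by blast
  qed
  then show "convergent X" by (auto simp: convergent_def)
qed

text \<open>The projection theorem for a subspace that may fail to be closed: by the parallelogram
  identity a minimising sequence is Cauchy, and x minus its limit is orthogonal to the subspace,
  hence zero.\<close>

lemma orthogonal_complement_trivial_imp_dense:
  fixes S :: "'a::{real_inner, complete_space} set"
  assumes S: "subspace S" and triv: "\<And>r. (\<And>v. v \<in> S \<Longrightarrow> v \<bullet> r = 0) \<Longrightarrow> r = 0"
    and e: "e > 0"
  obtains v where "v \<in> S" "norm (x - v) < e"
proof -
  define d where "d = (INF v\<in>S. norm (x - v))"
  have ne: "S \<noteq> {}" using subspace_0[OF S] by blast
  have dle: "d \<le> norm (x - v)" if "v \<in> S" for v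
    unfolding d_def using that by (intro cINF_lower) (auto intro!: bdd_belowI[of _ 0])
  have d0: "d \<ge> 0" unfolding d_def using ne by (intro cINF_greatest) auto
  have "\<exists>v\<in>S. norm (x - v) < d + inverse (real (Suc k))" for k
  proof -
    have "d < d + inverse (real (Suc k))" by simp
    then show ?thesis unfolding d_def by (subst (asm) cINF_less_iff) (auto simp: ne intro!: bdd_belowI[of _ 0])
  qed
  then obtain v where v: "\<And>k. v k \<in> S" "\<And>k. norm (x - v k) < d + inverse (real (Suc k))" by metis
  have par: "(norm (v j - v k))\<^sup>2 \<le> 2 * (norm (x - v j))\<^sup>2 + 2 * (norm (x - v k))\<^sup>2 - 4 * d\<^sup>2" for j k
  proof -
    have m: "(1/2) *\<^sub>R (v j + v k) \<in> S" using v(1) S by (intro subspace_scale subspace_add)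
    have "(norm (v j - v k))\<^sup>2 + 4 * (norm (x - (1/2) *\<^sub>R (v j + v k)))\<^sup>2 = 2 * (norm (x - v j))\<^sup>2 + 2 * (norm (x - v k))\<^sup>2"
      by (simp add: power2_norm_eq_inner inner_diff_left inner_diff_right inner_add_left inner_add_right inner_commute algebra_simps)
    moreover have "d\<^sup>2 \<le> (norm (x - (1/2) *\<^sub>R (v j + v k)))\<^sup>2"
      using dle[OF m] d0 by (intro power_mono)
    ultimately show ?thesis by linarith
  qed
  have lim: "(\<lambda>k. (norm (x - v k))\<^sup>2) \<longlonglongrightarrow> d\<^sup>2"
  proof (rule tendsto_power, rule tendsto_sandwich[OF _ _ tendsto_const])
    show "(\<lambda>k. d + inverse (real (Suc k))) \<longlonglongrightarrow> d"
      using tendsto_add[OF tendsto_const LIMSEQ_inverse_real_of_nat, of d] by simp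
  qed (use v dle in \<open>auto intro!: always_eventually less_imp_le\<close>)
  have "Cauchy v"
  proof (rule metric_CauchyI)
    fix e :: real assume e: "e > 0"
    then have "\<forall>\<^sub>F k in sequentially. (norm (x - v k))\<^sup>2 < d\<^sup>2 + e\<^sup>2 / 4"
      by (intro order_tendstoD(2)[OF lim]) simp
    then obtain M where M: "\<And>k. k \<ge> M \<Longrightarrow> (norm (x - v k))\<^sup>2 < d\<^sup>2 + e\<^sup>2 / 4"
      unfolding eventually_sequentially by blast
    have "dist (v j) (v k) < e" if "j \<ge> M" "k \<ge> M" for j k
    proof -
      have "(norm (v j - v k))\<^sup>2 < e\<^sup>2" using par[of j k] M[OF that(1)] M[OF that(2)] by linarith
      then show ?thesis using e
        unfolding dist_norm by (intro power2_less_imp_less[of "norm (v j - v k)" e]) auto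
    qed
    then show "\<exists>M. \<forall>j\<ge>M. \<forall>k\<ge>M. dist (v j) (v k) < e" by blast
  qed
  then obtain l where l: "v \<longlonglongrightarrow> l" using Cauchy_convergent convergent_def by blast
  have "(\<lambda>k. (norm (x - v k))\<^sup>2) \<longlonglongrightarrow> (norm (x - l))\<^sup>2" by (intro tendsto_intros l)
  then have nl: "(norm (x - l))\<^sup>2 = d\<^sup>2" using LIMSEQ_unique[OF lim] by simp
  have "w \<bullet> (x - l) = 0" if w: "w \<in> S" for w
  proof -
    have q: "d\<^sup>2 \<le> d\<^sup>2 - 2 * t * (w \<bullet> (x - l)) + t\<^sup>2 * (norm w)\<^sup>2" for t
    proof -
      have "(\<lambda>k. (norm (x - (v k + t *\<^sub>R w)))\<^sup>2) \<longlonglongrightarrow> (norm (x - (l + t *\<^sub>R w)))\<^sup>2" by (intro tendsto_intros l)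
      moreover have "d\<^sup>2 \<le> (norm (x - (v k + t *\<^sub>R w)))\<^sup>2" for k
        using v(1) w S d0 by (intro power_mono dle subspace_add subspace_scale)
      ultimately have "d\<^sup>2 \<le> (norm (x - (l + t *\<^sub>R w)))\<^sup>2" by (intro LIMSEQ_le_const) auto
      also have "\<dots> = (norm (x - l))\<^sup>2 - 2 * t * (w \<bullet> (x - l)) + t\<^sup>2 * (norm w)\<^sup>2"
        by (simp add: power2_norm_eq_inner inner_diff_left inner_diff_right inner_add_left inner_add_right inner_commute power2_eq_square[of t] algebra_simps)
      finally show ?thesis unfolding nl .
    qed
    define b where "b = w \<bullet> (x - l)"
    have "b = 0"
    proof (rule ccontr)
      assume b: "b \<noteq> 0"
      then have "w \<noteq> 0" by (auto simp: b_def)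
      then have W: "(norm w)\<^sup>2 > 0" by simp
      \<comment> \<open>The minimiser b / |w|^2 of the quadratic in t would push the distance below
        its infimum.\<close>
      have "2 * (b / (norm w)\<^sup>2) * b - (b / (norm w)\<^sup>2)\<^sup>2 * (norm w)\<^sup>2 = b\<^sup>2 / (norm w)\<^sup>2"
        using W by (simp add: field_simps power2_eq_square)
      moreover have "b\<^sup>2 / (norm w)\<^sup>2 > 0" using b W by simp
      ultimately show False using q[of "b / (norm w)\<^sup>2"] unfolding b_def[symmetric] by linarith
    qed
    then show ?thesis by (simp add: b_def)
  qed
  then have "x = l" using triv[of "x - l"] by simp
  then obtain k where "dist (v k) x < e"
    using metric_LIMSEQ_D[OF l e] by auto
  then show ?thesis using v(1) that by (metis dist_norm norm_minus_commute)
qed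

section \<open>Uniqueness for exponential sums\<close>

definition eigval :: "real \<Rightarrow> nat \<Rightarrow> real" where
  "eigval L n = (freq L n)\<^sup>2"

lemma eigval_pos: "L > 0 \<Longrightarrow> eigval L n > 0"
  using freq_pos[of L n] by (simp add: eigval_def)

lemma eigval_eq: "eigval L n = (pi / L)\<^sup>2 * (real (Suc n))\<^sup>2"
  by (simp add: eigval_def freq_def power_mult_distrib power_divide)

lemma eigval_inj: "L > 0 \<Longrightarrow> eigval L m = eigval L n \<longleftrightarrow> m = n"
  using freq_pos[of L m] freq_pos[of L n] freq_inj[of L m n] by (simp add: eigval_def power2_eq_iff)

text \<open>For real \<open>s\<close> this is \<open>\<integral>\<^sub>0\<^sup>s exp (- eigval n (s - r)) exp (- eigval m r) dr\<close>.\<close>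

definition kk :: "real \<Rightarrow> nat \<Rightarrow> nat \<Rightarrow> complex \<Rightarrow> complex" where
  "kk L m n s = (if m = n then s * exp (- of_real (eigval L n) * s)
    else (exp (- of_real (eigval L n) * s) - exp (- of_real (eigval L m) * s)) / of_real (eigval L m - eigval L n))"

lemma kk_sym: "kk L m n = kk L n m"
proof
  fix s :: complex
  have swap: "x / complex_of_real (p - q) = (- x) / complex_of_real (q - p)" for x p q
  proof -
    have "complex_of_real (q - p) = - complex_of_real (p - q)" by simp
    then show ?thesis by (simp only: divide_minus_left divide_minus_right minus_minus)
  qed
  show "kk L m n s = kk L n m s"
    unfolding kk_def by (subst swap) (simp only: minus_diff_eq, auto)
qed

lemma norm_exp_eigval: "norm (exp (- complex_of_real a * s)) = exp (- a * Re s)"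
  by simp

text \<open>The mean value inequality on the right half plane, where the derivative of exp (- z) has
  modulus at most 1.\<close>

lemma norm_one_minus_exp_le:
  assumes "Re z \<ge> 0"
  shows "norm (1 - exp (- z)) \<le> norm z"
proof -
  have "norm (exp (- 0) - exp (- z)) \<le> 1 * norm (0 - z)"
  proof (rule field_differentiable_bound[where S="{z. Re z \<ge> 0}" and f="\<lambda>z. exp (- z)" and f'="\<lambda>z. - exp (- z)"])
    show "convex {z. Re z \<ge> 0}" by (simp add: convex_halfspace_Re_ge)
    show "((\<lambda>z. exp (- z)) has_field_derivative - exp (- z)) (at z within {z. Re z \<ge> 0})" for z :: complex
      by (auto intro!: derivative_eq_intros)
  qed (use assms in auto)
  then show ?thesis by simp
qed

text \<open>With the slower exponential factored out, the small divisor b - a cancels against the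
  difference, so close eigenvalues cause no loss.\<close>

lemma kk_bound_aux:
  assumes ab: "a < b" and s: "Re s \<ge> \<sigma>" "\<sigma> \<ge> 0" and a: "a \<ge> 0"
  shows "norm ((exp (- complex_of_real a * s) - exp (- complex_of_real b * s)) / of_real (b - a)) \<le> norm s * exp (- \<sigma> * a)"
proof -
  have eq: "exp (- complex_of_real a * s) - exp (- complex_of_real b * s) = exp (- complex_of_real a * s) * (1 - exp (- (of_real (b - a) * s)))"
    by (simp add: right_diff_distrib mult_exp_exp algebra_simps)
  have "norm (1 - exp (- (of_real (b - a) * s))) \<le> norm (of_real (b - a) * s)"
    using ab s by (intro norm_one_minus_exp_le) simp
  also have "\<dots> = (b - a) * norm s" by (simp only: norm_mult norm_of_real) (use ab in simp)
  finally have 1: "norm (1 - exp (- (of_real (b - a) * s))) \<le> (b - a) * norm s" .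
  have 2: "norm (exp (- complex_of_real a * s)) \<le> exp (- \<sigma> * a)"
    unfolding norm_exp_eigval using mult_left_mono[OF s(1) a] by (simp add: mult.commute)
  have "norm (exp (- complex_of_real a * s)) * norm (1 - exp (- (of_real (b - a) * s))) \<le> exp (- \<sigma> * a) * ((b - a) * norm s)"
    by (intro mult_mono 1 2) auto
  moreover have "norm (of_real (b - a) :: complex) = b - a" by (simp only: norm_of_real) (use ab in simp)
  ultimately show ?thesis
    unfolding eq norm_divide norm_mult using ab
    by (simp only:) (subst pos_divide_le_eq, simp, simp only: mult_ac)
qed

lemma kk_bound_min:
  assumes L: "L > 0" and s: "Re s \<ge> \<sigma>" "\<sigma> \<ge> 0"
  shows "norm (kk L m n s) \<le> norm s * exp (- \<sigma> * min (eigval L m) (eigval L n))"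
proof -
  have main: "norm (kk L m n s) \<le> norm s * exp (- \<sigma> * min (eigval L m) (eigval L n))" if le: "eigval L n \<le> eigval L m" for m n
  proof (cases "m = n")
    case True
    have "exp (- eigval L n * Re s) \<le> exp (- \<sigma> * eigval L n)"
      using mult_left_mono[OF s(1) less_imp_le[OF eigval_pos[OF L, of n]]] by (simp add: mult.commute)
    then show ?thesis using True by (simp add: kk_def norm_mult mult_left_mono)
  next
    case False
    then have "eigval L n < eigval L m" using le eigval_inj[OF L] by (metis order_le_less)
    from kk_bound_aux[OF this s] less_imp_le[OF eigval_pos[OF L, of n]] False le
    show ?thesis by (simp add: kk_def min_absorb2)
  qed
  show ?thesis
    using main[of n m] main[of m n] by (cases "eigval L n \<le> eigval L m") (simp_all add: kk_sym[of L m n] min.commute)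
qed

text \<open>The minimum of the eigenvalues is traded for a sum, so that a double series splits into
  two, each with decay in a single index.\<close>

lemma kk_bound:
  assumes L: "L > 0" and s: "Re s \<ge> \<sigma>" "\<sigma> \<ge> 0"
  shows "norm (kk L m n s) \<le> norm s * (exp (- \<sigma> * eigval L n) + exp (- \<sigma> * eigval L m))"
proof -
  have "exp (- \<sigma> * min (eigval L m) (eigval L n)) \<le> exp (- \<sigma> * eigval L n) + exp (- \<sigma> * eigval L m)"
    by (cases "eigval L m \<le> eigval L n") (simp_all add: min_def)
  from order_trans[OF kk_bound_min[OF assms, of m n] mult_left_mono[OF this norm_ge_zero]] show ?thesis .
qed

text \<open>The bound is independent of s: off the diagonal nothing grows along vertical
  lines.\<close>

lemma kk_bound_diff:
  assumes L: "L > 0" and s: "Re s \<ge> 0" and "m \<noteq> n"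
  shows "norm (kk L m n s) \<le> 2 / \<bar>eigval L m - eigval L n\<bar>"
proof -
  have 1: "norm (exp (- complex_of_real (eigval L k) * s)) \<le> 1" for k
    unfolding norm_exp_eigval using mult_nonneg_nonneg[OF less_imp_le[OF eigval_pos[OF L, of k]] s] by simp
  have "norm (exp (- complex_of_real (eigval L n) * s) - exp (- complex_of_real (eigval L m) * s)) \<le> 2"
    using norm_triangle_ineq4[of "exp (- complex_of_real (eigval L n) * s)" "exp (- complex_of_real (eigval L m) * s)"] 1[of n] 1[of m] by linarith
  moreover have "norm (complex_of_real (eigval L m - eigval L n)) = \<bar>eigval L m - eigval L n\<bar>" by (rule norm_of_real)
  ultimately show ?thesis using assms(3) unfolding kk_def by (simp only: if_False norm_divide) (intro divide_right_mono, auto)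
qed

lemma mult_exp_minus_le:
  assumes "(a::real) > 0"
  shows "t * exp (- a * t) \<le> 1 / a"
proof -
  have "a * t \<le> exp (a * t)" using exp_ge_add_one_self[of "a * t"] by linarith
  then have "a * t * exp (- (a * t)) \<le> exp (a * t) * exp (- (a * t))" by (rule mult_right_mono) simp
  then have "a * (t * exp (- a * t)) \<le> 1" by (simp add: exp_minus mult.assoc)
  then show ?thesis using assms by (simp add: field_simps)
qed

text \<open>Two regimes make the bound uniform in m and t. Eigenvalues that differ by a factor of at
  least 2 have a large gap; otherwise they are comparable and t exp (- a t) is at most 1 /
  a.\<close>

lemma kk_real_bound:
  assumes L: "L > 0" and t: "t \<ge> 0"
  shows "norm (kk L m n (of_real t)) \<le> 4 / eigval L n"
proof -
  define a where "a = eigval L n"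
  define b where "b = eigval L m"
  have ab: "a > 0" "b > 0" using eigval_pos[OF L] by (simp_all add: a_def b_def)
  show ?thesis
  proof (cases "b \<ge> 2 * a \<or> a \<ge> 2 * b")
    case True
    then have d: "\<bar>b - a\<bar> \<ge> a / 2" "m \<noteq> n" using ab by (auto simp: a_def b_def)
    have "norm (kk L m n (of_real t)) \<le> 2 / \<bar>b - a\<bar>"
      unfolding a_def b_def using t by (intro kk_bound_diff[OF L _ d(2)]) simp
    also have "\<dots> \<le> 2 / (a / 2)"
      using d(1) ab by (intro divide_left_mono mult_pos_pos) linarith+
    finally show ?thesis by (simp add: a_def)
  next
    case False
    then have m: "min b a \<ge> a / 2" "min b a > 0" using ab by auto
    have "norm (kk L m n (of_real t)) \<le> norm (complex_of_real t) * exp (- t * min b a)"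
      unfolding a_def b_def using t by (intro kk_bound_min[OF L]) auto
    also have "\<dots> = t * exp (- min b a * t)" using t by (simp add: mult.commute)
    also have "\<dots> \<le> 1 / min b a" by (rule mult_exp_minus_le[OF m(2)])
    also have "\<dots> \<le> 1 / (a / 2)" using m ab by (intro divide_left_mono) auto
    also have "\<dots> \<le> 4 / a" using ab by (simp add: field_simps)
    finally show ?thesis by (simp add: a_def)
  qed
qed

lemma kk_zero [simp]: "kk L m n 0 = 0"
  by (simp add: kk_def)

lemma kk_holomorphic: "kk L m n holomorphic_on S"
proof (cases "m = n")
  case True
  then have "kk L m n = (\<lambda>s. s * exp (- of_real (eigval L n) * s))" by (auto simp: kk_def)
  then show ?thesis by (auto intro!: holomorphic_intros)
next
  case False
  then have "kk L m n = (\<lambda>s. (exp (- of_real (eigval L n) * s) - exp (- of_real (eigval L m) * s)) * inverse (of_real (eigval L m - eigval L n)))"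
    by (auto simp: kk_def divide_inverse)
  then show ?thesis by (simp only:) (intro holomorphic_intros)
qed

text \<open>The mode n decays at its own rate while it is driven by the decaying mode m.\<close>

lemma kk_deriv:
  assumes "L > 0"
  shows "(kk L m n has_field_derivative (exp (- of_real (eigval L m) * s) - of_real (eigval L n) * kk L m n s)) (at s)"
proof (cases "m = n")
  case True
  then have "kk L m n = (\<lambda>s. s * exp (- of_real (eigval L n) * s))" by (auto simp: kk_def)
  then show ?thesis using True by (auto intro!: derivative_eq_intros simp: algebra_simps)
next
  case False
  define d where "d = complex_of_real (eigval L m - eigval L n)"
  have d: "d \<noteq> 0" using False eigval_inj[OF assms] by (simp add: d_def)
  have kk: "kk L m n = (\<lambda>s. (exp (- of_real (eigval L n) * s) - exp (- of_real (eigval L m) * s)) / d)"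
    using False by (auto simp: kk_def d_def)
  have m: "complex_of_real (eigval L m) = d + of_real (eigval L n)" by (simp add: d_def)
  show ?thesis
    unfolding kk using d
    by (auto intro!: derivative_eq_intros simp: field_simps) (simp add: m algebra_simps)
qed

section \<open>Averages of series along a vertical line\<close>

lemma holomorphic_on_suminf:
  assumes S: "open S" and f: "\<And>i. f i holomorphic_on S"
    and M: "\<And>z. z \<in> S \<Longrightarrow> \<exists>d>0. cball z d \<subseteq> S \<and> (\<exists>M. summable M \<and> (\<forall>i. \<forall>w\<in>cball z d. norm (f i w) \<le> M i))"
  shows "(\<lambda>z. \<Sum>i::nat. f i z) holomorphic_on S"
proof (rule holomorphic_uniform_sequence[OF S, where f="\<lambda>n z. \<Sum>i<n. f i z"])
  show "(\<lambda>z. \<Sum>i<n. f i z) holomorphic_on S" for n by (intro holomorphic_intros f)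
  fix z assume "z \<in> S"
  from M[OF this] obtain d M where d: "d > 0" "cball z d \<subseteq> S" "summable M" "\<forall>i. \<forall>w\<in>cball z d. norm (f i w) \<le> M i"
    by blast
  then have "uniform_limit (cball z d) (\<lambda>n z. \<Sum>i<n. f i z) (\<lambda>z. \<Sum>i. f i z) sequentially"
    by (intro Weierstrass_m_test[where M=M]) auto
  then show "\<exists>d>0. cball z d \<subseteq> S \<and> uniform_limit (cball z d) (\<lambda>n z. \<Sum>i<n. f i z) (\<lambda>z. \<Sum>i. f i z) sequentially"
    using d by blast
qed

text \<open>Tannery's theorem: the averages of the terms are majorised independently of N, so
  averaging commutes with the infinite sum in the limit.\<close>

lemma suminf_average_tendsto:
  fixes t :: "nat \<Rightarrow> nat \<Rightarrow> complex" and w :: "nat \<Rightarrow> nat \<Rightarrow> complex"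
  assumes t: "\<And>k. summable (\<lambda>i. t i k)"
    and lim: "\<And>i. (\<lambda>N. \<Sum>k<N. w N k * t i k) \<longlonglongrightarrow> l i"
    and M: "summable M" "\<And>i N. norm (\<Sum>k<N. w N k * t i k) \<le> M i"
  shows "(\<lambda>N. \<Sum>k<N. w N k * (\<Sum>i. t i k)) \<longlonglongrightarrow> (\<Sum>i. l i)"
proof -
  have "(\<lambda>N. \<Sum>i. \<Sum>k<N. w N k * t i k) \<longlonglongrightarrow> (\<Sum>i. l i)"
    using tannerys_theorem[where a="\<lambda>i N. \<Sum>k<N. w N k * t i k" and F=sequentially and M=M and b=l] lim M
    by (simp add: case_prod_unfold)
  moreover have "(\<Sum>i. \<Sum>k<N. w N k * t i k) = (\<Sum>k<N. w N k * (\<Sum>i. t i k))" for N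
    using t by (subst suminf_sum) (auto intro!: summable_mult sum.cong suminf_mult)
  ultimately show ?thesis by simp
qed

lemma norm_geometric_sum_le:
  fixes \<rho> :: complex
  assumes "norm \<rho> = 1" "\<rho> \<noteq> 1"
  shows "norm (\<Sum>k<N. \<rho> ^ k) \<le> 2 / norm (1 - \<rho>)"
proof -
  have "(1 - \<rho>) * (\<Sum>k<N. \<rho> ^ k) = 1 - \<rho> ^ N" by (rule one_diff_power_eq[symmetric])
  then have "norm (1 - \<rho>) * norm (\<Sum>k<N. \<rho> ^ k) = norm (1 - \<rho> ^ N)" by (metis norm_mult)
  also have "\<dots> \<le> 2" using norm_triangle_ineq4[of 1 "\<rho> ^ N"] assms(1) by (simp add: norm_power)
  finally show ?thesis using assms(2) by (simp add: field_simps)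
qed

lemma norm_arith_geometric_sum_le:
  fixes \<rho> :: complex
  assumes "norm \<rho> = 1" "\<rho> \<noteq> 1"
  shows "norm (\<Sum>k<N. of_nat k * \<rho> ^ k) \<le> (2 * real N + 2) / norm (1 - \<rho>)"
proof -
  have "(1 - \<rho>) * (\<Sum>k<N. of_nat k * \<rho> ^ k) = (\<Sum>k<Suc N. \<rho> ^ k) - 1 - of_nat N * \<rho> ^ N" for N
    by (induction N) (simp_all add: algebra_simps)
  then have "norm (1 - \<rho>) * norm (\<Sum>k<N. of_nat k * \<rho> ^ k) = norm ((\<Sum>k<Suc N. \<rho> ^ k) - 1 - of_nat N * \<rho> ^ N)"
    by (metis norm_mult)
  also have "\<dots> \<le> norm (\<Sum>k<Suc N. \<rho> ^ k) + 1 + norm (of_nat N * \<rho> ^ N)"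
    using norm_triangle_ineq4[of "(\<Sum>k<Suc N. \<rho> ^ k) - 1" "of_nat N * \<rho> ^ N"] norm_triangle_ineq4[of "\<Sum>k<Suc N. \<rho> ^ k" 1] by simp
  also have "norm (\<Sum>k<Suc N. \<rho> ^ k) \<le> (\<Sum>k<Suc N. norm (\<rho> ^ k))" by (rule norm_sum)
  also have "\<dots> = real N + 1" using assms(1) by (simp add: norm_power)
  finally show ?thesis using assms by (simp add: field_simps norm_mult norm_power)
qed

text \<open>Away from 1 the geometric sums stay bounded and those with weight k grow at most
  linearly, so only the resonant phase 1 survives. Division by the square of N is the scale that
  sees linear growth alone.\<close>

lemma averages_tendsto:
  fixes \<rho> :: complex
  assumes \<rho>: "norm \<rho> = 1"
  shows "(\<lambda>N. (\<Sum>k<N. \<rho> ^ k) / of_nat N) \<longlonglongrightarrow> (if \<rho> = 1 then 1 else 0)"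
    "(\<lambda>N. (\<Sum>k<N. \<rho> ^ k) / (of_nat N)\<^sup>2) \<longlonglongrightarrow> 0"
    "(\<lambda>N. (\<Sum>k<N. of_nat k * \<rho> ^ k) / (of_nat N)\<^sup>2) \<longlonglongrightarrow> (if \<rho> = 1 then 1 / 2 else 0)"
proof -
  have N: "\<forall>\<^sub>F N in sequentially. N > (0::nat)" by (rule eventually_gt_at_top)
  show "(\<lambda>N. (\<Sum>k<N. \<rho> ^ k) / of_nat N) \<longlonglongrightarrow> (if \<rho> = 1 then 1 else 0)"
  proof (cases "\<rho> = 1")
    case True
    have "\<forall>\<^sub>F N in sequentially. (\<Sum>k<N. \<rho> ^ k) / of_nat N = 1"
      using N by eventually_elim (simp add: True)
    then show ?thesis using True by (simp add: tendsto_eventually)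
  next
    case False
    have "(\<lambda>N. (\<Sum>k<N. \<rho> ^ k) / of_nat N) \<longlonglongrightarrow> 0"
    proof (rule Lim_null_comparison)
      show "\<forall>\<^sub>F N in sequentially. norm ((\<Sum>k<N. \<rho> ^ k) / of_nat N) \<le> (2 / norm (1 - \<rho>)) / real N"
        using norm_geometric_sum_le[OF \<rho> False]
        by (intro always_eventually allI) (simp only: norm_divide norm_of_nat, intro divide_right_mono, auto)
      show "(\<lambda>N. (2 / norm (1 - \<rho>)) / real N) \<longlonglongrightarrow> 0" by (rule lim_const_over_n)
    qed
    then show ?thesis using False by simp
  qed
  show "(\<lambda>N. (\<Sum>k<N. \<rho> ^ k) / (of_nat N)\<^sup>2) \<longlonglongrightarrow> 0"
  proof (rule Lim_null_comparison)
    show "\<forall>\<^sub>F N in sequentially. norm ((\<Sum>k<N. \<rho> ^ k) / (of_nat N)\<^sup>2) \<le> 1 / real N"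
      using N
    proof eventually_elim
      case (elim N)
      have "norm (\<Sum>k<N. \<rho> ^ k) \<le> (\<Sum>k<N. norm (\<rho> ^ k))" by (rule norm_sum)
      also have "\<dots> = real N" using \<rho> by (simp add: norm_power)
      finally show ?case using elim by (simp add: norm_divide norm_power norm_mult field_simps power2_eq_square)
    qed
    show "(\<lambda>N. 1 / real N) \<longlonglongrightarrow> 0" by (rule lim_const_over_n)
  qed
  show "(\<lambda>N. (\<Sum>k<N. of_nat k * \<rho> ^ k) / (of_nat N)\<^sup>2) \<longlonglongrightarrow> (if \<rho> = 1 then 1 / 2 else 0)"
  proof (cases "\<rho> = 1")
    case True
    have S: "(\<Sum>k<N. complex_of_nat k) = of_real (real N * (real N - 1) / 2)" for N
      by (induction N) (simp_all add: field_simps)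
    have eq: "(\<Sum>k<N. of_nat k * \<rho> ^ k) / (of_nat N)\<^sup>2 = complex_of_real (real N * (real N - 1) / 2 / (real N)\<^sup>2)" for N
      by (simp only: True power_one mult_1_right S of_real_divide of_real_power of_real_of_nat_eq)
    have "(\<lambda>N. real N * (real N - 1) / 2 / (real N)\<^sup>2) \<longlonglongrightarrow> 1 / 2" by real_asymp
    from tendsto_of_real[OF this]
    have "(\<lambda>N. complex_of_real (real N * (real N - 1) / 2 / (real N)\<^sup>2)) \<longlonglongrightarrow> of_real (1 / 2)" .
    moreover have "complex_of_real (1 / 2) = 1 / 2" by simp
    ultimately show ?thesis unfolding eq using True by (simp only: if_True simp_thms)
  next
    case False
    have "(\<lambda>N. (\<Sum>k<N. of_nat k * \<rho> ^ k) / (of_nat N)\<^sup>2) \<longlonglongrightarrow> 0"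
    proof (rule Lim_null_comparison)
      show "\<forall>\<^sub>F N in sequentially. norm ((\<Sum>k<N. of_nat k * \<rho> ^ k) / (of_nat N)\<^sup>2) \<le> ((2 * real N + 2) / norm (1 - \<rho>)) / (real N)\<^sup>2"
        using norm_arith_geometric_sum_le[OF \<rho> False]
        by (intro always_eventually allI) (simp only: norm_divide norm_power norm_of_nat, intro divide_right_mono, auto)
      have "norm (1 - \<rho>) > 0" using False by simp
      then show "(\<lambda>N. ((2 * real N + 2) / norm (1 - \<rho>)) / (real N)\<^sup>2) \<longlonglongrightarrow> 0" by real_asymp
    qed
    then show ?thesis using False by simp
  qed
qed

text \<open>All eigenvalues are squares of integers times one constant, so a single irrational ratio
  excludes every resonance at once.\<close>

lemma exists_nonresonant_step:
  assumes L: "L > 0"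
  obtains \<delta> where "\<delta> > 0" "\<And>n j. n \<noteq> j \<Longrightarrow> exp (\<i> * of_real ((eigval L j - eigval L n) * \<delta>)) \<noteq> 1"
    "\<And>j. exp (\<i> * of_real (eigval L j * \<delta>)) \<noteq> 1"
proof -
  have "\<not> {0<..<1::real} \<subseteq> \<rat>"
  proof
    assume "{0<..<1::real} \<subseteq> \<rat>"
    then have "countable {0<..<1::real}" by (rule countable_subset[OF _ countable_rat])
    then show False using uncountable_open_interval[of 0 "1::real"] by simp
  qed
  then obtain x :: real where "x \<in> {0<..<1}" "x \<notin> \<rat>" by blast
  then have x: "x > 0" "x \<notin> \<rat>" by auto
  \<comment> \<open>The factor \<open>(L / pi)\<^sup>2\<close> cancels the common constant of the
    eigenvalues, and 2 pi x turns a resonance into rationality of x.\<close>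
  define \<delta> where "\<delta> = 2 * pi * x * (L / pi)\<^sup>2"
  have irr: "exp (\<i> * of_real (2 * pi * x * of_int d)) \<noteq> 1" if "d \<noteq> 0" for d :: int
  proof
    assume "exp (\<i> * of_real (2 * pi * x * of_int d)) = 1"
    then obtain n :: int where "2 * pi * x * of_int d = of_int (2 * n) * pi"
      by (auto simp: exp_eq_1)
    then have "x * of_int d = of_int n" by simp
    then have "x = of_int n / of_int d" using that by (simp add: field_simps)
    then show False using x(2) by simp
  qed
  have eigval\<delta>: "eigval L n * \<delta> = 2 * pi * x * of_int (int ((Suc n)\<^sup>2))" for n
    using L by (simp add: \<delta>_def eigval_eq power_divide)
  show ?thesis
  proof (rule that[of \<delta>])
    show "\<delta> > 0" using L x by (simp add: \<delta>_def)
    show "exp (\<i> * of_real (eigval L j * \<delta>)) \<noteq> 1" for j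
      unfolding eigval\<delta> by (rule irr) simp
    show "exp (\<i> * of_real ((eigval L j - eigval L n) * \<delta>)) \<noteq> 1" if "n \<noteq> j" for n j
    proof -
      have "(eigval L j - eigval L n) * \<delta> = 2 * pi * x * of_int (int ((Suc j)\<^sup>2) - int ((Suc n)\<^sup>2))"
        by (simp only: left_diff_distrib eigval\<delta> of_int_diff right_diff_distrib)
      moreover have "(Suc j)\<^sup>2 \<noteq> (Suc n)\<^sup>2" using that by (metis power2_eq_iff_nonneg nat.inject zero_le)
      then have "int ((Suc j)\<^sup>2) - int ((Suc n)\<^sup>2) \<noteq> 0" by (metis eq_iff_diff_eq_0 of_nat_eq_iff)
      ultimately show ?thesis using irr by metis
    qed
  qed
qed

lemma infsum_eq_suminf:
  fixes f :: "nat \<Rightarrow> 'a::banach"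
  assumes "summable (\<lambda>n. norm (f n))"
  shows "infsum f UNIV = suminf f"
  using has_sum_imp_sums[OF has_sum_infsum[OF norm_summable_imp_summable_on[OF assms]]] sums_unique by fastforce

text \<open>Absolute convergence makes the sums by rows, by columns and along
  \<open>prod_decode\<close> agree. The single index form is the one that the results on holomorphic
  sums and on averages take.\<close>

lemma double_series:
  fixes f :: "nat \<Rightarrow> nat \<Rightarrow> complex"
  assumes row: "\<And>m. summable (\<lambda>n. norm (f m n))" and tot: "summable (\<lambda>m. \<Sum>n. norm (f m n))"
  shows "summable (\<lambda>i. norm (f (fst (prod_decode i)) (snd (prod_decode i))))"
    and "(\<Sum>i. f (fst (prod_decode i)) (snd (prod_decode i))) = (\<Sum>m. \<Sum>n. f m n)"
    and "(\<Sum>m. \<Sum>n. f m n) = (\<Sum>n. \<Sum>m. f m n)"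
    and "\<And>n. summable (\<lambda>m. norm (f m n))"
    and "summable (\<lambda>n. \<Sum>m. norm (f m n))"
proof -
  let ?F = "\<lambda>p. f (fst p) (snd p)"
  have rowi: "infsum (\<lambda>n. norm (f m n)) UNIV = (\<Sum>n. norm (f m n))" for m
    using row[of m] by (intro infsum_eq_suminf) simp
  have "summable (\<lambda>m. norm (\<Sum>n. norm (f m n)))"
    using tot row by (simp add: suminf_nonneg)
  then have abs: "(\<lambda>p. norm (?F p)) summable_on (UNIV \<times> UNIV)"
    by (subst Infinite_Sum.abs_summable_on_Sigma_iff)
       (auto simp: rowi summable_on_UNIV_nonneg_real_iff row suminf_nonneg)
  have bij: "bij_betw prod_decode UNIV (UNIV \<times> UNIV :: (nat \<times> nat) set)" by (simp add: bij_prod_decode)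
  have "(\<lambda>i. norm (?F (prod_decode i))) summable_on UNIV"
    using abs by (subst summable_on_reindex_bij_betw[OF bij, where f="\<lambda>p. norm (?F p)"])
  then show s1: "summable (\<lambda>i. norm (f (fst (prod_decode i)) (snd (prod_decode i))))"
    by (subst (asm) summable_on_UNIV_nonneg_real_iff) auto
  have sum: "?F summable_on (UNIV \<times> UNIV)" using abs by (rule Infinite_Sum.abs_summable_summable)
  have in1: "infsum (f m) UNIV = (\<Sum>n. f m n)" for m by (rule infsum_eq_suminf[OF row])
  have n1: "summable (\<lambda>m. norm (\<Sum>n. f m n))"
    by (rule summable_comparison_test'[OF tot]) (simp add: summable_norm row)
  have "(\<Sum>i. ?F (prod_decode i)) = infsum (\<lambda>i. ?F (prod_decode i)) UNIV"
    using infsum_eq_suminf[of "\<lambda>i. ?F (prod_decode i)"] s1 by simp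
  also have "\<dots> = infsum ?F (UNIV \<times> UNIV)" by (rule infsum_reindex_bij_betw[OF bij])
  also have i1: "\<dots> = infsum (\<lambda>m. infsum (f m) UNIV) UNIV"
    using infsum_Sigma'_banach[of "\<lambda>m n. f m n" UNIV "\<lambda>_. UNIV"] sum by (simp add: case_prod_unfold)
  also have i2: "\<dots> = (\<Sum>m. \<Sum>n. f m n)" unfolding in1 by (rule infsum_eq_suminf[OF n1])
  finally show "(\<Sum>i. f (fst (prod_decode i)) (snd (prod_decode i))) = (\<Sum>m. \<Sum>n. f m n)" .
  have "(\<lambda>p. norm (?F (snd p, fst p))) summable_on (UNIV \<times> UNIV)"
    using abs summable_on_reindex_bij_betw[of "\<lambda>p::nat\<times>nat. (snd p, fst p)" "UNIV \<times> UNIV" "UNIV \<times> UNIV" "\<lambda>p. norm (?F p)"]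
      surjI[of "\<lambda>p::nat\<times>nat. (snd p, fst p)" "\<lambda>p. (snd p, fst p)"]
    by (auto simp: bij_betw_def inj_on_def)
  then have abs2: "(\<lambda>p. norm (case p of (n, m) \<Rightarrow> f m n)) summable_on (UNIV \<times> UNIV)" by (simp add: case_prod_unfold)
  note abs3 = abs2[unfolded Infinite_Sum.abs_summable_on_Sigma_iff prod.case]
  have c: "(\<lambda>m. norm (f m n)) summable_on UNIV" for n using abs3 by blast
  have c2: "(\<lambda>n. norm (\<Sum>\<^sub>\<infinity>m. norm (f m n))) summable_on UNIV" using abs3 by blast
  show col: "summable (\<lambda>m. norm (f m n))" for n
    using c[of n] by (subst (asm) summable_on_UNIV_nonneg_real_iff) auto
  have coli: "infsum (\<lambda>m. norm (f m n)) UNIV = (\<Sum>m. norm (f m n))" for n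
    using col[of n] by (intro infsum_eq_suminf) simp
  show tot2: "summable (\<lambda>n. \<Sum>m. norm (f m n))"
    using c2 unfolding coli by (subst (asm) summable_on_UNIV_nonneg_real_iff) (simp_all add: suminf_nonneg col)
  have n2: "summable (\<lambda>n. norm (\<Sum>m. f m n))"
    by (rule summable_comparison_test'[OF tot2]) (simp add: summable_norm col)
  have in2: "infsum (\<lambda>m. f m n) UNIV = (\<Sum>m. f m n)" for n by (rule infsum_eq_suminf[OF col])
  have "infsum (\<lambda>m. infsum (f m) UNIV) UNIV = infsum (\<lambda>n. infsum (\<lambda>m. f m n) UNIV) UNIV"
    using infsum_swap_banach[of "\<lambda>m n. f m n" UNIV UNIV] sum by (simp add: case_prod_unfold)
  also have "\<dots> = (\<Sum>n. \<Sum>m. f m n)" unfolding in2 by (rule infsum_eq_suminf[OF n2])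
  finally show "(\<Sum>m. \<Sum>n. f m n) = (\<Sum>n. \<Sum>m. f m n)" using i2 by simp
qed

text \<open>For majorants that are easier to sum over the first index first.\<close>

lemma double_series_encoded_swap:
  fixes f :: "nat \<Rightarrow> nat \<Rightarrow> complex"
  assumes "\<And>n. summable (\<lambda>m. norm (f m n))" and "summable (\<lambda>n. \<Sum>m. norm (f m n))"
  shows "summable (\<lambda>i. norm (f (fst (prod_decode i)) (snd (prod_decode i))))"
proof -
  have "summable (\<lambda>n. norm (f m n))" "summable (\<lambda>m. \<Sum>n. norm (f m n))" for m
    using double_series(4,5)[of "\<lambda>n m. f m n"] assms by auto
  then show ?thesis by (rule double_series(1))
qed

text \<open>The summability of \<gamma> is weighted by exponentials for each \<sigma> > 0, which
  matches convergence in the open half plane and leaves the unweighted sum free. The second claim is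
  extracted after the first has been used to remove \<gamma>.\<close>

lemma exp_family_unique:
  fixes \<alpha> :: "nat \<Rightarrow> complex" and \<gamma> :: "nat \<Rightarrow> nat \<Rightarrow> complex"
  assumes L: "L > 0" and T: "T > 0"
    and \<alpha>: "summable (\<lambda>n. norm (\<alpha> n))"
    and \<gamma>: "\<And>\<sigma>. \<sigma> > 0 \<Longrightarrow> summable (\<lambda>i. norm (\<gamma> (fst (prod_decode i)) (snd (prod_decode i))) *
        (exp (- \<sigma> * eigval L (snd (prod_decode i))) + exp (- \<sigma> * eigval L (fst (prod_decode i)))))"
    and eq: "\<And>s. 0 < s \<Longrightarrow> s < T \<Longrightarrow> (\<Sum>n. \<alpha> n * exp (- of_real (eigval L n) * of_real s)) +
        (\<Sum>i. \<gamma> (fst (prod_decode i)) (snd (prod_decode i)) * kk L (fst (prod_decode i)) (snd (prod_decode i)) (of_real s)) = \<kappa>"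
  shows "\<gamma> j j = 0" and "(\<And>m n. \<gamma> m n = 0) \<Longrightarrow> \<alpha> j = 0"
proof -
  define a where "a n s = \<alpha> n * exp (- of_real (eigval L n) * s)" for n s
  define g where "g i s = \<gamma> (fst (prod_decode i)) (snd (prod_decode i)) * kk L (fst (prod_decode i)) (snd (prod_decode i)) s" for i s
  define H where "H = {s. Re s > 0}"
  have H: "open H" "connected H"
    unfolding H_def by (simp add: open_halfspace_Re_gt, intro convex_connected convex_halfspace_Re_gt)
  define w where "w \<sigma> i = norm (\<gamma> (fst (prod_decode i)) (snd (prod_decode i))) *
        (exp (- \<sigma> * eigval L (snd (prod_decode i))) + exp (- \<sigma> * eigval L (fst (prod_decode i))))" for \<sigma> i
  have w: "summable (w \<sigma>)" if "\<sigma> > 0" for \<sigma> unfolding w_def by (rule \<gamma>[OF that])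
  have ab: "norm (a n s) \<le> norm (\<alpha> n)" if "Re s \<ge> 0" for n s
    unfolding a_def norm_mult norm_exp_eigval using that eigval_pos[OF L, of n] by (intro mult_left_le) auto
  have gb: "norm (g i s) \<le> norm s * w \<sigma> i" if "Re s \<ge> \<sigma>" "\<sigma> \<ge> 0" for i s \<sigma>
    unfolding g_def w_def norm_mult
    using mult_left_mono[OF kk_bound[OF L that, of "fst (prod_decode i)" "snd (prod_decode i)"] norm_ge_zero[of "\<gamma> (fst (prod_decode i)) (snd (prod_decode i))"]]
    by (simp only: mult_ac)
  define F where "F s = (\<Sum>n. a n s) + (\<Sum>i. g i s) - \<kappa>" for s
  have "(\<lambda>s. \<Sum>n. a n s) holomorphic_on H"
  proof (rule holomorphic_on_suminf[OF H(1)])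
    show "a n holomorphic_on H" for n unfolding a_def by (intro holomorphic_intros)
    fix z assume "z \<in> H"
    then obtain d where d: "d > 0" "cball z d \<subseteq> H" using H(1) open_contains_cball by blast
    then have "\<forall>n. \<forall>x\<in>cball z d. norm (a n x) \<le> norm (\<alpha> n)"
      using ab by (fastforce simp: H_def)
    then show "\<exists>d>0. cball z d \<subseteq> H \<and> (\<exists>M. summable M \<and> (\<forall>i. \<forall>w\<in>cball z d. norm (a i w) \<le> M i))"
      using d \<alpha> by blast
  qed
  moreover have "(\<lambda>s. \<Sum>i. g i s) holomorphic_on H"
  proof (rule holomorphic_on_suminf[OF H(1)])
    show "g n holomorphic_on H" for n unfolding g_def by (intro holomorphic_intros kk_holomorphic)
    fix z assume z: "z \<in> H"
    define d where "d = Re z / 2"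
    have d: "d > 0" using z by (simp add: d_def H_def)
    have x: "Re x \<ge> d" "norm x \<le> norm z + d" if "x \<in> cball z d" for x
    proof -
      have "norm (z - x) \<le> d" using that by (simp add: dist_norm)
      moreover have "Re (z - x) \<le> norm (z - x)" by (rule complex_Re_le_cmod)
      ultimately show "Re x \<ge> d" by (simp add: d_def)
      show "norm x \<le> norm z + d"
        using \<open>norm (z - x) \<le> d\<close> norm_triangle_ineq4[of z "z - x"] by simp
    qed
    have "norm (g i x) \<le> (norm z + d) * w d i" if "x \<in> cball z d" for i x
    proof -
      have "norm (g i x) \<le> norm x * w d i" using x(1)[OF that] d by (intro gb) auto
      also have "\<dots> \<le> (norm z + d) * w d i" using x(2)[OF that] by (intro mult_right_mono) (auto simp: w_def)
      finally show ?thesis .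
    qed
    moreover have "summable (\<lambda>i. (norm z + d) * w d i)" using w[OF d] by (rule summable_mult)
    moreover have "cball z d \<subseteq> H" using x(1) d by (force simp: H_def)
    ultimately show "\<exists>d>0. cball z d \<subseteq> H \<and> (\<exists>M. summable M \<and> (\<forall>i. \<forall>w\<in>cball z d. norm (g i w) \<le> M i))"
      using d by blast
  qed
  ultimately have Fh: "F holomorphic_on H" unfolding F_def by (intro holomorphic_intros)
  define U where "U = complex_of_real ` {0<..<T}"
  have F0: "F s = 0" if "s \<in> H" for s
  proof (rule analytic_continuation[OF Fh H, of U "of_real (T / 2)"])
    show "U \<subseteq> H" by (auto simp: U_def H_def)
    show "complex_of_real (T / 2) \<in> H" using T by (simp add: H_def)
    have "connected U" unfolding U_def by (intro connected_continuous_image continuous_intros convex_connected) simp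
    moreover have T2: "complex_of_real (T / 2) \<in> U" unfolding U_def using T by (intro imageI) simp
    moreover have "complex_of_real (T / 3) \<in> U" unfolding U_def using T by (intro imageI) simp
    moreover have "complex_of_real (T / 3) \<noteq> of_real (T / 2)" using T by (simp only: of_real_eq_iff)
    ultimately show "complex_of_real (T / 2) islimpt U"
      by (intro connected_imp_perfect) auto
    show "F z = 0" if "z \<in> U" for z
      using that eq by (auto simp: F_def U_def a_def g_def)
  qed (rule that)
  obtain \<delta> where \<delta>: "\<delta> > 0" "\<And>n j. n \<noteq> j \<Longrightarrow> exp (\<i> * of_real ((eigval L j - eigval L n) * \<delta>)) \<noteq> 1"
    "\<And>j. exp (\<i> * of_real (eigval L j * \<delta>)) \<noteq> 1"
    using exists_nonresonant_step[OF L] by blast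
  \<comment> \<open>On the line Re s = 1 the moduli of the exponentials do not depend on k, so the
    weights for \<sigma> = 1 serve for all sample points.\<close>
  define s where "s k = 1 + \<i> * of_real (\<delta> * real k)" for k
  \<comment> \<open>Multiplication by \<open>r ^ k\<close> undoes the rotation of the exponential
    with index j; \<rho> n is the rotation that mode n keeps, equal to 1 for n = j only.\<close>
  define r where "r = exp (\<i> * of_real (eigval L j * \<delta>))"
  define \<rho> where "\<rho> n = exp (\<i> * of_real ((eigval L j - eigval L n) * \<delta>))" for n
  have s: "Re (s k) = 1" "s k \<in> H" for k by (simp_all add: s_def H_def)
  have r: "norm r = 1" "r \<noteq> 1" using \<delta>(3) by (simp_all add: r_def)
  have \<rho>: "norm (\<rho> n) = 1" "\<rho> n = 1 \<longleftrightarrow> n = j" for n using \<delta>(2)[of n j] by (auto simp: \<rho>_def)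
  have step: "r ^ k * exp (- of_real (eigval L n) * s k) = exp (- of_real (eigval L n)) * \<rho> n ^ k" for k n
    by (simp add: r_def \<rho>_def s_def mult_exp_exp flip: exp_of_nat_mult) (simp add: algebra_simps)
  have total: "(\<Sum>n. a n (s k)) + (\<Sum>i. g i (s k)) = \<kappa>" for k
    using F0[OF s(2)[of k]] by (simp add: F_def)
  have sa: "summable (\<lambda>n. a n (s k))" for k
    by (rule summable_comparison_test'[OF \<alpha>]) (rule ab, simp add: s)
  have sg: "summable (\<lambda>i. g i (s k))" for k
    by (rule summable_comparison_test'[OF summable_mult[OF w[of 1], of "norm (s k)"]]) (auto intro: gb simp: s)
  have a_avg: "(\<Sum>k<N. r ^ k / c * a n (s k)) = \<alpha> n * exp (- of_real (eigval L n)) * ((\<Sum>k<N. \<rho> n ^ k) / c)" for N n c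
  proof -
    have "r ^ k / c * a n (s k) = \<alpha> n * exp (- of_real (eigval L n)) * (\<rho> n ^ k / c)" for k
      using step[of k n] by (simp add: a_def field_simps)
    then have "(\<Sum>k<N. r ^ k / c * a n (s k)) = (\<Sum>k<N. \<alpha> n * exp (- of_real (eigval L n)) * (\<rho> n ^ k / c))"
      by (simp only:)
    then show ?thesis by (simp only: sum_distrib_left[symmetric] sum_divide_distrib[symmetric])
  qed
  have a_avg_le: "norm (\<Sum>k<N. r ^ k / c * a n (s k)) \<le> norm (\<alpha> n)" if "real N \<le> norm c" for N n c
  proof -
    have "norm (\<Sum>k<N. r ^ k / c * a n (s k)) \<le> (\<Sum>k<N. norm (\<alpha> n) / norm c)"
    proof (rule sum_norm_le)
      fix k
      show "norm (r ^ k / c * a n (s k)) \<le> norm (\<alpha> n) / norm c"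
        using ab[of "s k" n] s r by (simp add: norm_mult norm_divide norm_power divide_right_mono)
    qed
    also have "\<dots> = norm (\<alpha> n) * (real N / norm c)" by simp
    also have "\<dots> \<le> norm (\<alpha> n) * 1" using that by (intro mult_left_mono) (auto simp: divide_le_eq_1)
    finally show ?thesis by simp
  qed
  \<comment> \<open>The constant \<kappa> acts like an exponential with eigenvalue 0; it is averaged
    away since r differs from 1.\<close>
  have \<kappa>2: "(\<lambda>N. \<Sum>k<N. r ^ k / (of_nat N)\<^sup>2 * \<kappa>) \<longlonglongrightarrow> 0"
    using tendsto_mult_right[OF averages_tendsto(2)[OF r(1)], of \<kappa>]
    by (simp add: sum_distrib_right sum_divide_distrib)
  have \<kappa>1: "(\<lambda>N. \<Sum>k<N. r ^ k / of_nat N * \<kappa>) \<longlonglongrightarrow> 0"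
    using tendsto_mult_right[OF averages_tendsto(1)[OF r(1)], of \<kappa>] r(2)
    by (simp add: sum_distrib_right sum_divide_distrib)
  have sq: "real N \<le> norm ((of_nat N :: complex)\<^sup>2)" for N
  proof -
    have "norm ((of_nat N :: complex)\<^sup>2) = (real N)\<^sup>2" by (simp only: norm_power norm_of_nat)
    moreover have "real N \<le> (real N)\<^sup>2" by (cases N) (simp_all add: power2_eq_square)
    ultimately show ?thesis by simp
  qed
  let ?i = "prod_encode (j, j)"
  show "\<gamma> j j = 0"
  proof -
    \<comment> \<open>The surviving limit: the part of s k that grows is \<i> \<delta> k, and the
      sum of k below N over the square of N tends to 1/2.\<close>
    define l where "l i = (if i = ?i then \<gamma> j j * exp (- of_real (eigval L j)) * (\<i> * of_real \<delta> / 2) else 0)" for i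
    have A: "(\<lambda>N. \<Sum>k<N. r ^ k / (of_nat N)\<^sup>2 * (\<Sum>n. a n (s k))) \<longlonglongrightarrow> (\<Sum>n. 0)"
    proof (rule suminf_average_tendsto[OF sa _ \<alpha> a_avg_le[OF sq]])
      show "(\<lambda>N. \<Sum>k<N. r ^ k / (of_nat N)\<^sup>2 * a n (s k)) \<longlonglongrightarrow> 0" for n
        unfolding a_avg using tendsto_mult_left[OF averages_tendsto(2)[OF \<rho>(1)[of n]], of "\<alpha> n * exp (- of_real (eigval L n))"] by simp
    qed
    have G: "(\<lambda>N. \<Sum>k<N. r ^ k / (of_nat N)\<^sup>2 * (\<Sum>i. g i (s k))) \<longlonglongrightarrow> (\<Sum>i. l i)"
    proof (rule suminf_average_tendsto[OF sg _ summable_mult[OF w[of 1], of "1 + \<delta>"]])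
      \<comment> \<open>Each of the N terms is at most linear in N, so the square of N in the
        denominator leaves a majorant independent of N.\<close>
      show "norm (\<Sum>k<N. r ^ k / (of_nat N)\<^sup>2 * g i (s k)) \<le> (1 + \<delta>) * w 1 i" for i N
      proof -
        have "norm (\<Sum>k<N. r ^ k / (of_nat N)\<^sup>2 * g i (s k)) \<le> (\<Sum>k<N. ((1 + \<delta>) * real N * w 1 i) / (real N)\<^sup>2)"
        proof (rule sum_norm_le)
          fix k assume k: "k \<in> {..<N}"
          have "norm (s k) \<le> 1 + \<delta> * real k"
            using norm_triangle_ineq[of 1 "\<i> * of_real (\<delta> * real k)"] \<delta>(1) by (simp add: s_def norm_mult)
          also have "\<dots> \<le> real N + \<delta> * real N"
            using k \<delta>(1) by (intro add_mono mult_left_mono) auto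
          finally have "norm (s k) \<le> (1 + \<delta>) * real N" by (simp add: algebra_simps)
          then have "norm (s k) * w 1 i \<le> (1 + \<delta>) * real N * w 1 i"
            by (rule mult_right_mono) (simp add: w_def)
          with gb[of 1 "s k" i] have "norm (g i (s k)) \<le> (1 + \<delta>) * real N * w 1 i" by (simp add: s)
          then show "norm (r ^ k / (of_nat N)\<^sup>2 * g i (s k)) \<le> ((1 + \<delta>) * real N * w 1 i) / (real N)\<^sup>2"
            using r by (simp add: norm_mult norm_divide norm_power divide_right_mono)
        qed
        also have "\<dots> \<le> (1 + \<delta>) * w 1 i"
          using \<delta>(1) by (cases "N = 0") (auto simp: power2_eq_square w_def)
        finally show ?thesis .
      qed
      fix i
      obtain m n where i: "prod_decode i = (m, n)" by (cases "prod_decode i")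
      then have ii: "i = ?i \<longleftrightarrow> m = j \<and> n = j" by (metis prod_decode_inverse prod_encode_inverse Pair_inject)
      show "(\<lambda>N. \<Sum>k<N. r ^ k / (of_nat N)\<^sup>2 * g i (s k)) \<longlonglongrightarrow> l i"
      proof (cases "m = n")
        case False
        \<comment> \<open>Off the diagonal a bound independent of k suffices for decay like 1 /
          N.\<close>
        define B where "B = norm (\<gamma> m n) * (2 / \<bar>eigval L m - eigval L n\<bar>)"
        have B: "norm (g i (s k)) \<le> B" for k
        proof -
          have "norm (g i (s k)) = norm (\<gamma> m n) * norm (kk L m n (s k))" by (simp add: g_def norm_mult i)
          also have "\<dots> \<le> B"
            unfolding B_def using s(1)[of k] by (intro mult_left_mono kk_bound_diff[OF L _ False]) auto
          finally show ?thesis .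
        qed
        have "(\<lambda>N. \<Sum>k<N. r ^ k / (of_nat N)\<^sup>2 * g i (s k)) \<longlonglongrightarrow> 0"
        proof (rule Lim_null_comparison)
          show "\<forall>\<^sub>F N in sequentially. norm (\<Sum>k<N. r ^ k / (of_nat N)\<^sup>2 * g i (s k)) \<le> B / real N"
          proof (intro always_eventually allI)
            fix N
            have "norm (\<Sum>k<N. r ^ k / (of_nat N)\<^sup>2 * g i (s k)) \<le> (\<Sum>k<N. B / (real N)\<^sup>2)"
              using B r by (intro sum_norm_le) (simp add: norm_mult norm_divide norm_power divide_right_mono)
            also have "\<dots> = B / real N" by (simp add: power2_eq_square)
            finally show "norm (\<Sum>k<N. r ^ k / (of_nat N)\<^sup>2 * g i (s k)) \<le> B / real N" .
          qed
          show "(\<lambda>N. B / real N) \<longlonglongrightarrow> 0" by (rule lim_const_over_n)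
        qed
        then show ?thesis using False ii by (auto simp: l_def)
      next
        case True
        let ?e = "\<gamma> n n * exp (- of_real (eigval L n))"
        \<comment> \<open>Splitting s k into 1 and \<i> \<delta> k gives one geometric sum, which
          vanishes on this scale, and one weighted by k, which detects n = j.\<close>
        have "r ^ k / c * g i (s k) = ?e * (\<rho> n ^ k / c) + ?e * (\<i> * of_real \<delta>) * (of_nat k * \<rho> n ^ k / c)" for k c
        proof -
          have "r ^ k / c * g i (s k) = \<gamma> n n * s k * (r ^ k * exp (- of_real (eigval L n) * s k)) / c"
            using i True by (simp add: g_def kk_def)
          also have "\<dots> = \<gamma> n n * s k * (exp (- of_real (eigval L n)) * \<rho> n ^ k) / c" unfolding step ..
          finally show ?thesis by (simp add: s_def algebra_simps add_divide_distrib)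
        qed
        then have eqn: "(\<Sum>k<N. r ^ k / (of_nat N)\<^sup>2 * g i (s k)) =
            ?e * ((\<Sum>k<N. \<rho> n ^ k) / (of_nat N)\<^sup>2) + ?e * (\<i> * of_real \<delta>) * ((\<Sum>k<N. of_nat k * \<rho> n ^ k) / (of_nat N)\<^sup>2)" for N
          by (simp only: sum.distrib sum_distrib_left[symmetric] sum_divide_distrib[symmetric])
        have "(\<lambda>N. \<Sum>k<N. r ^ k / (of_nat N)\<^sup>2 * g i (s k)) \<longlonglongrightarrow>
           ?e * 0 + ?e * (\<i> * of_real \<delta>) * (if \<rho> n = 1 then 1 / 2 else 0)"
          unfolding eqn by (intro tendsto_intros averages_tendsto \<rho>)
        then show ?thesis using True ii \<rho>(2)[of n] by (auto simp: l_def)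
      qed
    qed simp_all
    have "(\<lambda>N. (\<Sum>k<N. r ^ k / (of_nat N)\<^sup>2 * (\<Sum>n. a n (s k))) + (\<Sum>k<N. r ^ k / (of_nat N)\<^sup>2 * (\<Sum>i. g i (s k)))) \<longlonglongrightarrow> (\<Sum>n. 0) + (\<Sum>i. l i)"
      by (rule tendsto_add[OF A G])
    then have "(\<lambda>N. \<Sum>k<N. r ^ k / (of_nat N)\<^sup>2 * \<kappa>) \<longlonglongrightarrow> (\<Sum>i. l i)"
      unfolding sum.distrib[symmetric] distrib_left[symmetric] total by simp
    then have "(\<Sum>i. l i) = 0" using \<kappa>2 LIMSEQ_unique by blast
    moreover have "(\<Sum>i. l i) = \<gamma> j j * exp (- of_real (eigval L j)) * (\<i> * of_real \<delta> / 2)"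
      unfolding l_def by (rule sums_unique[symmetric]) (rule sums_single)
    ultimately show ?thesis using \<delta>(1) by simp
  qed
  \<comment> \<open>With the growing terms gone, ordinary means with 1 / N isolate the remaining
    exponentials.\<close>
  assume "\<And>m n. \<gamma> m n = 0"
  then have g0: "(\<Sum>i. g i (s k)) = 0" for k by (simp add: g_def)
  define l where "l n = (if n = j then \<alpha> j * exp (- of_real (eigval L j)) else 0)" for n
  have "(\<lambda>N. \<Sum>k<N. r ^ k / of_nat N * (\<Sum>n. a n (s k))) \<longlonglongrightarrow> (\<Sum>n. l n)"
  proof (rule suminf_average_tendsto[OF sa _ \<alpha> a_avg_le])
    show "(\<lambda>N. \<Sum>k<N. r ^ k / of_nat N * a n (s k)) \<longlonglongrightarrow> l n" for n
      unfolding a_avg using tendsto_mult_left[OF averages_tendsto(1)[OF \<rho>(1)[of n]], of "\<alpha> n * exp (- of_real (eigval L n))"] \<rho>(2)[of n]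
      by (auto simp: l_def)
  qed simp
  then have "(\<lambda>N. \<Sum>k<N. r ^ k / of_nat N * \<kappa>) \<longlonglongrightarrow> (\<Sum>n. l n)"
    using total g0 by simp
  then have "(\<Sum>n. l n) = 0" using \<kappa>1 LIMSEQ_unique by blast
  moreover have "(\<Sum>n. l n) = \<alpha> j * exp (- of_real (eigval L j))"
    unfolding l_def by (rule sums_unique[symmetric]) (rule sums_single)
  ultimately show "\<alpha> j = 0" by simp
qed

section \<open>The coupled heat semigroup\<close>

lemma summable_inverse_eigval:
  assumes "L > 0"
  shows "summable (\<lambda>n. 1 / eigval L n)"
proof -
  have "summable (\<lambda>n. inverse (real n ^ 2))" by (rule inverse_power_summable) simp
  then have "summable (\<lambda>n. (L / pi)\<^sup>2 * inverse (real (Suc n) ^ 2))"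
    by (intro summable_mult) (subst summable_Suc_iff)
  moreover have "(\<lambda>n. (L / pi)\<^sup>2 * inverse (real (Suc n) ^ 2)) = (\<lambda>n. 1 / eigval L n)"
    using assms by (simp add: eigval_eq field_simps del: of_nat_Suc)
  ultimately show ?thesis by (simp only:)
qed

lemma suminf_Cauchy_Schwarz:
  fixes a b :: "nat \<Rightarrow> real"
  assumes a: "summable (\<lambda>n. (a n)\<^sup>2)" "(\<Sum>n. (a n)\<^sup>2) \<le> A" and b: "summable (\<lambda>n. (b n)\<^sup>2)" "(\<Sum>n. (b n)\<^sup>2) \<le> B"
  shows "summable (\<lambda>n. \<bar>a n\<bar> * \<bar>b n\<bar>)" "(\<Sum>n. \<bar>a n\<bar> * \<bar>b n\<bar>) \<le> sqrt A * sqrt B"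
proof -
  have p: "(\<Sum>n<N. \<bar>a n\<bar> * \<bar>b n\<bar>) \<le> sqrt A * sqrt B" for N
  proof -
    have "(\<Sum>n<N. \<bar>a n\<bar> * \<bar>b n\<bar>)\<^sup>2 \<le> (\<Sum>n<N. \<bar>a n\<bar>\<^sup>2) * (\<Sum>n<N. \<bar>b n\<bar>\<^sup>2)" by (rule Cauchy_Schwarz_ineq_sum)
    also have "\<dots> = (\<Sum>n<N. (a n)\<^sup>2) * (\<Sum>n<N. (b n)\<^sup>2)" by simp
    also have "\<dots> \<le> A * B"
    proof (intro mult_mono)
      show "(\<Sum>n<N. (a n)\<^sup>2) \<le> A" using order_trans[OF sum_le_suminf[OF a(1)] a(2)] by simp
      show "(\<Sum>n<N. (b n)\<^sup>2) \<le> B" using order_trans[OF sum_le_suminf[OF b(1)] b(2)] by simp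
      show "0 \<le> A" using order_trans[OF suminf_nonneg[OF a(1)] a(2)] by simp
    qed (simp add: sum_nonneg)
    finally have "sqrt ((\<Sum>n<N. \<bar>a n\<bar> * \<bar>b n\<bar>)\<^sup>2) \<le> sqrt (A * B)" by (rule real_sqrt_le_mono)
    then show ?thesis by (simp add: real_sqrt_mult sum_nonneg)
  qed
  show s: "summable (\<lambda>n. \<bar>a n\<bar> * \<bar>b n\<bar>)" by (rule summableI_nonneg_bounded[OF _ p]) simp
  show "(\<Sum>n. \<bar>a n\<bar> * \<bar>b n\<bar>) \<le> sqrt A * sqrt B" by (rule suminf_le_const[OF s p])
qed

lemma summableI_square_bounded:
  fixes a :: "nat \<Rightarrow> real"
  assumes "\<And>N. (\<Sum>n<N. (a n)\<^sup>2) \<le> A"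
  shows "summable (\<lambda>n. (a n)\<^sup>2)" "(\<Sum>n. (a n)\<^sup>2) \<le> A"
proof -
  show s: "summable (\<lambda>n. (a n)\<^sup>2)" by (rule summableI_nonneg_bounded[OF _ assms]) simp
  show "(\<Sum>n. (a n)\<^sup>2) \<le> A" by (rule suminf_le_const[OF s assms])
qed

lemma continuous_on_suminf:
  fixes f :: "nat \<Rightarrow> 'a::topological_space \<Rightarrow> 'b::banach"
  assumes "\<And>n. continuous_on S (f n)" "\<And>n x. x \<in> S \<Longrightarrow> norm (f n x) \<le> M n" "summable M"
  shows "continuous_on S (\<lambda>x. \<Sum>n. f n x)"
proof (rule uniform_limit_theorem)
  show "uniform_limit S (\<lambda>n x. \<Sum>i<n. f i x) (\<lambda>x. \<Sum>n. f n x) sequentially"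
    by (rule Weierstrass_m_test[OF assms(2,3)])
  show "\<forall>\<^sub>F n in sequentially. continuous_on S (\<lambda>x. \<Sum>i<n. f i x)"
    by (intro always_eventually allI continuous_intros assms(1))
qed simp

text \<open>The square summable majorant makes the series of squared coordinate differences converge
  uniformly, which lifts coordinatewise continuity to the norm.\<close>

lemma continuous_on_ell2:
  fixes X :: "real \<Rightarrow> ell2"
  assumes c: "\<And>n. continuous_on S (\<lambda>t. nth (X t) n)" and b: "\<And>n t. t \<in> S \<Longrightarrow> norm (nth (X t) n) \<le> b n"
    and s: "summable (\<lambda>n. (b n)\<^sup>2)"
  shows "continuous_on S X"
  unfolding continuous_on_def
proof
  fix t assume t: "t \<in> S"
  have "continuous_on S (\<lambda>r. \<Sum>n. (norm (nth (X r) n - nth (X t) n))\<^sup>2)"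
  proof (rule continuous_on_suminf)
    show "continuous_on S (\<lambda>r. (norm (nth (X r) n - nth (X t) n))\<^sup>2)" for n by (intro continuous_intros c)
    show "summable (\<lambda>n. 4 * (b n)\<^sup>2)" using s by (rule summable_mult)
    show "norm ((norm (nth (X r) n - nth (X t) n))\<^sup>2) \<le> 4 * (b n)\<^sup>2" if "r \<in> S" for n r
    proof -
      have "norm (nth (X r) n - nth (X t) n) \<le> 2 * b n"
        using norm_triangle_ineq4[of "nth (X r) n" "nth (X t) n"] b[OF that, of n] b[OF t, of n] by simp
      then have "(norm (nth (X r) n - nth (X t) n))\<^sup>2 \<le> (2 * b n)\<^sup>2" by (intro power_mono) auto
      then show ?thesis by (simp add: power_mult_distrib)
    qed
  qed
  then have "((\<lambda>r. \<Sum>n. (norm (nth (X r) n - nth (X t) n))\<^sup>2) \<longlongrightarrow> (\<Sum>n. (norm (nth (X t) n - nth (X t) n))\<^sup>2)) (at t within S)"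
    using t by (auto simp: continuous_on_def)
  then have "((\<lambda>r. (norm (X r - X t))\<^sup>2) \<longlongrightarrow> 0) (at t within S)"
    by (simp add: norm_ell2_square nth_diff)
  from tendsto_real_sqrt[OF this] have "((\<lambda>r. norm (X r - X t)) \<longlongrightarrow> 0) (at t within S)" by simp
  then show "(X \<longlongrightarrow> X t) (at t within S)"
    using Lim_null tendsto_norm_zero_iff by blast
qed

text \<open>Multiplication by complex scalars, which the real vector space classes do not
  carry.\<close>

definition scl :: "complex \<Rightarrow> ell2 \<Rightarrow> ell2" where
  "scl c x = Ell2 (\<lambda>n. c * nth x n)"

lemma nth_scl: "nth (scl c x) n = c * nth x n"
  unfolding scl_def by (subst nth_Ell2) (auto intro: square_summable_cmult nth_summable)

definition cinner :: "ell2 \<Rightarrow> ell2 \<Rightarrow> complex" where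
  "cinner x y = (\<Sum>n. nth x n * cnj (nth y n))"

lemma cinner_summable: "summable (\<lambda>n. norm (nth x n * cnj (nth y n)))"
  using square_summable_mult[OF nth_summable[of x] nth_summable[of y]] by (simp add: norm_mult)

lemma cinner_add: "cinner (x + y) z = cinner x z + cinner y z"
  unfolding cinner_def using cinner_summable[of x z] cinner_summable[of y z]
  by (subst suminf_add) (auto simp: nth_simps distrib_right dest: summable_norm_cancel)

lemma cinner_diff: "cinner (x - y) z = cinner x z - cinner y z"
  using cinner_add[of "x - y" y z] by simp

text \<open>Real orthogonality to all complex multiples of a vector thus amounts to vanishing of the
  complex pairing.\<close>

lemma inner_scl: "scl c x \<bullet> y = Re (c * cinner x y)"
proof -
  have "nth (scl c x) n \<bullet> nth y n = Re (c * (nth x n * cnj (nth y n)))" for n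
    by (simp add: nth_scl inner_complex_def algebra_simps)
  moreover have f: "summable (\<lambda>n. nth x n * cnj (nth y n))"
    by (rule summable_norm_cancel[OF cinner_summable])
  ultimately have "scl c x \<bullet> y = (\<Sum>n. Re (c * (nth x n * cnj (nth y n))))"
    by (simp only: inner_ell2_def)
  also have "\<dots> = Re (\<Sum>n. c * (nth x n * cnj (nth y n)))"
    by (rule bounded_linear.suminf[OF bounded_linear_Re summable_mult[OF f], symmetric])
  also have "\<dots> = Re (c * cinner x y)"
    unfolding cinner_def by (simp only: suminf_mult[OF f])
  finally show ?thesis .
qed

lemma exp_eigval_le_1: "L > 0 \<Longrightarrow> t \<ge> 0 \<Longrightarrow> norm (exp (- complex_of_real (eigval L n) * of_real t)) \<le> 1"
  using eigval_pos[of L n] by (simp only: norm_exp_eigval Re_complex_of_real) simp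

definition heat :: "real \<Rightarrow> real \<Rightarrow> ell2 \<Rightarrow> ell2" where
  "heat L t x = Ell2 (\<lambda>n. exp (- of_real (eigval L n) * of_real t) * nth x n)"

lemma nth_heat:
  assumes "L > 0" "t \<ge> 0"
  shows "nth (heat L t x) n = exp (- of_real (eigval L n) * of_real t) * nth x n"
    "norm (nth (heat L t x) n) \<le> norm (nth x n)"
proof -
  have b: "norm (exp (- of_real (eigval L n) * of_real t) * nth x n) \<le> 1 * norm (nth x n)" for n
    unfolding norm_mult by (intro mult_right_mono exp_eigval_le_1 assms) simp
  show 1: "nth (heat L t x) n = exp (- of_real (eigval L n) * of_real t) * nth x n"
    unfolding heat_def by (subst nth_Ell2) (rule square_summable_bounded[OF nth_summable[of x] b], simp)
  show "norm (nth (heat L t x) n) \<le> norm (nth x n)" unfolding 1 using b[of n] by simp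
qed

lemma heat_0: "L > 0 \<Longrightarrow> heat L 0 x = x"
  by (rule ell2_eqI) (simp add: nth_heat)

lemma continuous_on_heat: "L > 0 \<Longrightarrow> continuous_on {0..} (\<lambda>t. heat L t x)"
proof (rule continuous_on_ell2[where b="\<lambda>n. norm (nth x n)"])
  assume L: "L > 0"
  show "continuous_on {0..} (\<lambda>t. nth (heat L t x) n)" for n
  proof (subst continuous_on_cong[OF refl])
    show "continuous_on {0..} (\<lambda>t. exp (- of_real (eigval L n) * complex_of_real t) * nth x n)"
      by (intro continuous_intros)
  qed (simp add: nth_heat L)
  show "norm (nth (heat L t x) n) \<le> norm (nth x n)" if "t \<in> {0..}" for n t
    using nth_heat(2)[OF L] that by simp
qed (rule nth_summable)

text \<open>The division by \<open>freq L m\<close> compensates the derivative of the sine with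
  index m inside \<beta>. The two bounds are Bessel's inequality in one index, uniform in the other;
  they are derived for the actual system by a later \<open>sublocale\<close>.\<close>

locale coupling =
  fixes L C :: real and \<beta> :: "nat \<Rightarrow> nat \<Rightarrow> real"
  assumes L: "L > 0"
    and row: "\<And>n M. (\<Sum>m<M. (\<beta> m n / freq L m)\<^sup>2) \<le> C"
    and col: "\<And>m N. (\<Sum>n<N. (\<beta> m n / freq L m)\<^sup>2) \<le> C"
begin

definition bb :: "nat \<Rightarrow> nat \<Rightarrow> real" where "bb m n = \<beta> m n / freq L m"

lemma C_nonneg: "C \<ge> 0"
  using row[of _ 0] by simp

lemma bb_row: "summable (\<lambda>m. (bb m n)\<^sup>2)" "(\<Sum>m. (bb m n)\<^sup>2) \<le> C"
  using summableI_square_bounded[of "\<lambda>m. bb m n" C] row by (auto simp: bb_def)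

lemma bb_col: "summable (\<lambda>n. (bb m n)\<^sup>2)" "(\<Sum>n. (bb m n)\<^sup>2) \<le> C"
  using summableI_square_bounded[of "\<lambda>n. bb m n" C] col by (auto simp: bb_def)

lemma bb_square_le: "(bb m n)\<^sup>2 \<le> C"
proof -
  have "(bb m n)\<^sup>2 \<le> (\<Sum>n<Suc n. (bb m n)\<^sup>2)" by (simp add: sum_nonneg)
  then show ?thesis using col[of m "Suc n"] by (simp add: bb_def)
qed

text \<open>The squared norm of row m in a time independent majorant of the coupling operator; the 4
  comes from \<open>kk_real_bound\<close>.\<close>

definition q :: "nat \<Rightarrow> real" where "q m = (\<Sum>n. (4 * bb m n / freq L n)\<^sup>2)"

lemma q_term: "(4 * bb m n / freq L n)\<^sup>2 = 16 * (bb m n)\<^sup>2 * (1 / eigval L n)"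
  by (simp add: power_divide power_mult_distrib eigval_def)

lemma q_summable_inner: "summable (\<lambda>n. (4 * bb m n / freq L n)\<^sup>2)"
proof (rule summable_comparison_test')
  show "summable (\<lambda>n. 16 * C * (1 / eigval L n))" by (rule summable_mult[OF summable_inverse_eigval[OF L]])
  show "norm ((4 * bb m n / freq L n)\<^sup>2) \<le> 16 * C * (1 / eigval L n)" for n
    unfolding q_term using bb_square_le[of m n] eigval_pos[OF L, of n] by (simp add: divide_right_mono)
qed

lemma q_nonneg: "q m \<ge> 0"
  unfolding q_def by (rule suminf_nonneg[OF q_summable_inner]) simp

text \<open>Summation over m first uses the bound \<open>row\<close>, and the inverse eigenvalues
  then sum over n. So the coupling operator has a Hilbert-Schmidt majorant uniform in time.\<close>

lemma q_summable: "summable q"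
proof (rule summableI_nonneg_bounded[OF q_nonneg])
  fix M
  have "(\<Sum>m<M. q m) = (\<Sum>n. \<Sum>m<M. (4 * bb m n / freq L n)\<^sup>2)"
    unfolding q_def by (rule suminf_sum[OF q_summable_inner, symmetric])
  also have "\<dots> \<le> (\<Sum>n. 16 * C * (1 / eigval L n))"
  proof (rule suminf_le)
    show "(\<Sum>m<M. (4 * bb m n / freq L n)\<^sup>2) \<le> 16 * C * (1 / eigval L n)" for n
    proof -
      have "(\<Sum>m<M. (4 * bb m n / freq L n)\<^sup>2) = 16 * (\<Sum>m<M. (bb m n)\<^sup>2) * (1 / eigval L n)"
        unfolding q_term by (simp add: sum_distrib_left sum_divide_distrib)
      also have "\<dots> \<le> 16 * C * (1 / eigval L n)"
        using row[of n M] eigval_pos[OF L, of n] by (intro mult_right_mono) (auto simp: bb_def)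
      finally show ?thesis .
    qed
    show "summable (\<lambda>n. \<Sum>m<M. (4 * bb m n / freq L n)\<^sup>2)" by (intro summable_sum q_summable_inner)
    show "summable (\<lambda>n. 16 * C * (1 / eigval L n))" by (rule summable_mult[OF summable_inverse_eigval[OF L]])
  qed
  finally show "(\<Sum>m<M. q m) \<le> (\<Sum>n. 16 * C * (1 / eigval L n))" .
qed

text \<open>Coordinates of functionals are divided by frequencies, so the matrix entry \<beta> m n
  acquires the ratio \<open>freq L n / freq L m\<close>; here \<open>bb\<close> already contains the
  denominator.\<close>

definition Kterm :: "real \<Rightarrow> ell2 \<Rightarrow> nat \<Rightarrow> nat \<Rightarrow> complex" where
  "Kterm t x m n = of_real (bb m n * freq L n) * kk L m n (of_real t) * nth x n"

lemma Kterm_bound: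
  assumes "t \<ge> 0"
  shows "norm (Kterm t x m n) \<le> \<bar>4 * bb m n / freq L n\<bar> * \<bar>norm (nth x n)\<bar>"
proof -
  have f: "freq L n > 0" by (rule freq_pos[OF L])
  have "norm (Kterm t x m n) = \<bar>bb m n\<bar> * freq L n * norm (kk L m n (of_real t)) * norm (nth x n)"
    using f by (simp add: Kterm_def norm_mult abs_mult)
  also have "\<dots> \<le> \<bar>bb m n\<bar> * freq L n * (4 / eigval L n) * norm (nth x n)"
    using kk_real_bound[OF L assms, of m n] f by (intro mult_right_mono mult_left_mono) auto
  also have "\<bar>bb m n\<bar> * freq L n * (4 / eigval L n) = \<bar>4 * bb m n / freq L n\<bar>"
    using f by (simp add: eigval_def power2_eq_square abs_mult field_simps)
  finally show ?thesis by simp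
qed

lemma Kterm_sum_le:
  assumes t: "t \<ge> 0"
  shows "summable (\<lambda>n. norm (Kterm t x m n))" "(\<Sum>n. norm (Kterm t x m n)) \<le> sqrt (q m) * norm x"
proof -
  have "(\<Sum>n. (norm (nth x n))\<^sup>2) \<le> (norm x)\<^sup>2" by (simp add: norm_ell2_square)
  note cs = suminf_Cauchy_Schwarz[OF q_summable_inner order_refl nth_summable[of x] this, of m]
  show s: "summable (\<lambda>n. norm (Kterm t x m n))"
    by (rule summable_comparison_test'[OF cs(1)]) (use Kterm_bound[OF t] in simp)
  have "(\<Sum>n. norm (Kterm t x m n)) \<le> (\<Sum>n. \<bar>4 * bb m n / freq L n\<bar> * \<bar>norm (nth x n)\<bar>)"
    by (rule suminf_le[OF Kterm_bound[OF t] s cs(1)])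
  also have "\<dots> \<le> sqrt (q m) * norm x" using cs(2) by (simp add: q_def)
  finally show "(\<Sum>n. norm (Kterm t x m n)) \<le> sqrt (q m) * norm x" .
qed

text \<open>The off-diagonal entry of the semigroup of the triangular system: the second component
  produced in time t by an initial first component x.\<close>

definition K :: "real \<Rightarrow> ell2 \<Rightarrow> ell2" where
  "K t x = Ell2 (\<lambda>m. \<Sum>n. Kterm t x m n)"

lemma norm_suminf_Kterm_le: "t \<ge> 0 \<Longrightarrow> norm (\<Sum>n. Kterm t x m n) \<le> sqrt (q m) * norm x"
  using summable_norm[OF Kterm_sum_le(1)] Kterm_sum_le(2) order_trans by blast

lemma sqrt_q_square_summable: "summable (\<lambda>m. (sqrt (q m) * c)\<^sup>2)"
  using summable_mult2[OF q_summable, of "c\<^sup>2"] q_nonneg by (simp add: power_mult_distrib)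

lemma nth_K:
  assumes "t \<ge> 0"
  shows "nth (K t x) m = (\<Sum>n. Kterm t x m n)"
  unfolding K_def
proof (subst nth_Ell2)
  show "summable (\<lambda>m. (norm (\<Sum>n. Kterm t x m n))\<^sup>2)"
    by (rule summable_comparison_test'[OF sqrt_q_square_summable[of "norm x"]])
       (simp add: power_mono norm_suminf_Kterm_le[OF assms])
qed simp

lemma K_0: "K 0 x = 0"
  by (rule ell2_eqI) (simp add: nth_K nth_simps Kterm_def)

lemma continuous_on_K: "continuous_on {0..} (\<lambda>t. K t x)"
proof (rule continuous_on_ell2[where b="\<lambda>m. sqrt (q m) * norm x"])
  show "continuous_on {0..} (\<lambda>t. nth (K t x) m)" for m
  proof (subst continuous_on_cong[OF refl])
    have "continuous_on UNIV (kk L m n)" for n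
      by (rule holomorphic_on_imp_continuous_on[OF kk_holomorphic])
    then have k: "continuous_on S (\<lambda>t. kk L m n (complex_of_real t))" for n S
      by (rule continuous_on_compose2) (auto intro!: continuous_intros)
    have "(\<Sum>n. (norm (nth x n))\<^sup>2) \<le> (norm x)\<^sup>2" by (simp add: norm_ell2_square)
    note cs = suminf_Cauchy_Schwarz(1)[OF q_summable_inner order_refl nth_summable[of x] this, of m]
    show "continuous_on {0..} (\<lambda>t. \<Sum>n. Kterm t x m n)"
    proof (rule continuous_on_suminf[OF _ _ cs])
      show "continuous_on {0..} (\<lambda>t. Kterm t x m n)" for n
        unfolding Kterm_def by (intro continuous_intros k)
      show "norm (Kterm t x m n) \<le> \<bar>4 * bb m n / freq L n\<bar> * \<bar>norm (nth x n)\<bar>" if "t \<in> {0..}" for n t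
        using Kterm_bound that by simp
    qed
  qed (simp add: nth_K)
  show "norm (nth (K t x) n) \<le> sqrt (q n) * norm x" if "t \<in> {0..}" for n t
    using that by (simp add: nth_K norm_suminf_Kterm_le)
qed (rule sqrt_q_square_summable)

lemma K_pairing_series:
  assumes t: "t \<ge> 0"
  shows "\<And>m. summable (\<lambda>n. norm (Kterm t x m n * cnj (nth y m)))"
    "summable (\<lambda>m. \<Sum>n. norm (Kterm t x m n * cnj (nth y m)))"
    "cinner (K t x) y = (\<Sum>m. \<Sum>n. Kterm t x m n * cnj (nth y m))"
proof -
  show r: "summable (\<lambda>n. norm (Kterm t x m n * cnj (nth y m)))" for m
    unfolding norm_mult by (rule summable_mult2[OF Kterm_sum_le(1)[OF t]])
  have "(\<Sum>m. (sqrt (q m) * norm x)\<^sup>2) \<le> (\<Sum>m. (sqrt (q m) * norm x)\<^sup>2)" by simp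
  have yy: "(\<Sum>n. (norm (nth y n))\<^sup>2) \<le> (norm y)\<^sup>2" by (simp add: norm_ell2_square)
  note cs = suminf_Cauchy_Schwarz(1)[OF sqrt_q_square_summable order_refl nth_summable[of y] yy, of "norm x"]
  show "summable (\<lambda>m. \<Sum>n. norm (Kterm t x m n * cnj (nth y m)))"
  proof (rule summable_comparison_test'[OF cs])
    fix m
    have "(\<Sum>n. norm (Kterm t x m n * cnj (nth y m))) = (\<Sum>n. norm (Kterm t x m n)) * norm (nth y m)"
      unfolding norm_mult complex_mod_cnj by (rule suminf_mult2[OF Kterm_sum_le(1)[OF t], symmetric])
    also have "\<dots> \<le> \<bar>sqrt (q m) * norm x\<bar> * \<bar>norm (nth y m)\<bar>"
      using Kterm_sum_le(2)[OF t, of x m] by (simp add: mult_right_mono)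
    finally show "norm (\<Sum>n. norm (Kterm t x m n * cnj (nth y m))) \<le> \<bar>sqrt (q m) * norm x\<bar> * \<bar>norm (nth y m)\<bar>"
      using suminf_nonneg[OF r[of m]] by simp
  qed
  show "cinner (K t x) y = (\<Sum>m. \<Sum>n. Kterm t x m n * cnj (nth y m))"
    unfolding cinner_def nth_K[OF t]
    by (intro suminf_cong suminf_mult2 summable_norm_cancel[OF Kterm_sum_le(1)[OF t]])
qed

text \<open>The transposed form of the operator, obtained by exchanging the absolutely convergent
  sums; it is the form to compare with adjoint solutions.\<close>

lemma cinner_K:
  assumes t: "t \<ge> 0"
  shows "cinner (K t x) y = (\<Sum>n. nth x n * (\<Sum>m. of_real (bb m n * freq L n) * kk L m n (of_real t) * cnj (nth y m)))"
proof -
  note ds = double_series[OF K_pairing_series(1,2)[OF t, where x=x and y=y]]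
  have "cinner (K t x) y = (\<Sum>n. \<Sum>m. Kterm t x m n * cnj (nth y m))"
    unfolding K_pairing_series(3)[OF t] by (rule ds(3))
  also have "\<dots> = (\<Sum>n. nth x n * (\<Sum>m. of_real (bb m n * freq L n) * kk L m n (of_real t) * cnj (nth y m)))"
  proof (rule suminf_cong)
    fix n
    let ?g = "\<lambda>m. of_real (bb m n * freq L n) * kk L m n (of_real t) * cnj (nth y m)"
    have eq: "(\<lambda>m. Kterm t x m n * cnj (nth y m)) = (\<lambda>m. nth x n * ?g m)"
      by (simp add: Kterm_def fun_eq_iff mult_ac)
    show "(\<Sum>m. Kterm t x m n * cnj (nth y m)) = nth x n * (\<Sum>m. ?g m)"
    \<comment> \<open>Summability over m is known only with the factor \<open>nth x n\<close>, which
      can be divided out when it is nonzero.\<close>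
    proof (cases "nth x n = 0")
      case False
      have "summable (\<lambda>m. nth x n * ?g m)"
        using summable_norm_cancel[OF ds(4)[of n]] unfolding eq .
      then have "summable ?g" using False by (rule summable_mult_D)
      then show ?thesis unfolding eq by (rule suminf_mult)
    qed (simp add: eq)
  qed
  finally show ?thesis .
qed

lemma exp_minus_eigval_le:
  assumes "\<sigma> > 0"
  shows "exp (- \<sigma> * eigval L n) \<le> (1 / \<sigma>) * (1 / eigval L n)"
proof -
  have p: "\<sigma> * eigval L n > 0" using assms eigval_pos[OF L, of n] by simp
  have "exp (- \<sigma> * eigval L n) = inverse (exp (\<sigma> * eigval L n))" by (simp add: exp_minus)
  also have "\<dots> \<le> inverse (\<sigma> * eigval L n)"
    using p exp_ge_add_one_self[of "\<sigma> * eigval L n"] by (intro le_imp_inverse_le) linarith+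
  finally show ?thesis by (simp add: field_simps)
qed

text \<open>The profile \<open>(Y1, Y2)\<close> is the steady state for the constant control, so the hypothesis says
  that \<open>(P, Q)\<close> annihilates everything reachable with step controls.\<close>

lemma annihilator_trivial:
  assumes T: "T > 0" and diag: "\<And>j. \<beta> j j \<noteq> 0" and c0: "c0 \<noteq> 0" and Y1: "\<And>n. nth Y1 n = of_real (c0 / eigval L n)"
    and ann: "\<And>c s. 0 < s \<Longrightarrow> s \<le> T \<Longrightarrow> scl c (Y1 - heat L s Y1) \<bullet> P + scl c (Y2 - (heat L s Y2 + K s Y1)) \<bullet> Q = 0"
  shows "P = 0" "Q = 0"
proof -
  define \<alpha> where "\<alpha> n = nth Y1 n * cnj (nth P n) + nth Y2 n * cnj (nth Q n)" for n
  define \<gamma> where "\<gamma> m n = of_real (bb m n * freq L n) * nth Y1 n * cnj (nth Q m)" for m n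
  have sY: "summable (\<lambda>n. norm (nth Y1 n * cnj (nth P n)))" "summable (\<lambda>n. norm (nth Y2 n * cnj (nth Q n)))"
    by (rule cinner_summable)+
  have \<alpha>: "summable (\<lambda>n. norm (\<alpha> n))"
    unfolding \<alpha>_def by (rule summable_comparison_test'[OF summable_add[OF sY]]) (simp add: norm_triangle_ineq)
  have f0: "freq L n > 0" for n by (rule freq_pos[OF L])
  have n\<gamma>: "norm (\<gamma> m n) = \<bar>bb m n\<bar> * \<bar>norm (nth Q m)\<bar> * (\<bar>c0\<bar> / freq L n)" for m n
    using f0[of n] by (simp add: \<gamma>_def Y1 norm_mult norm_divide abs_mult eigval_def power2_eq_square)
  have QQ: "(\<Sum>n. (norm (nth Q n))\<^sup>2) \<le> (norm Q)\<^sup>2" by (simp add: norm_ell2_square)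
  have \<gamma>: "summable (\<lambda>i. norm (\<gamma> (fst (prod_decode i)) (snd (prod_decode i))) *
        (exp (- \<sigma> * eigval L (snd (prod_decode i))) + exp (- \<sigma> * eigval L (fst (prod_decode i)))))" if \<sigma>: "\<sigma> > 0" for \<sigma>
  proof -
    \<comment> \<open>The two weights call for opposite orders of summation. With decay in n,
      Cauchy-Schwarz in m against Q comes first; with decay in m, it is Cauchy-Schwarz in n against
      1 / \<open>freq L n\<close>.\<close>
    define fA where "fA m n = complex_of_real (norm (\<gamma> m n) * exp (- \<sigma> * eigval L n))" for m n
    define fB where "fB m n = complex_of_real (norm (\<gamma> m n) * exp (- \<sigma> * eigval L m))" for m n
    have "summable (\<lambda>i. norm (fA (fst (prod_decode i)) (snd (prod_decode i))))"
    proof (rule double_series_encoded_swap)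
      note cs = suminf_Cauchy_Schwarz[OF bb_row nth_summable[of Q] QQ]
      have nA: "norm (fA m n) = (\<bar>bb m n\<bar> * \<bar>norm (nth Q m)\<bar>) * (\<bar>c0\<bar> / freq L n * exp (- \<sigma> * eigval L n))" for m n
        unfolding fA_def norm_of_real n\<gamma> using f0[of n] by (simp add: abs_mult)
      show "summable (\<lambda>m. norm (fA m n))" for n unfolding nA by (rule summable_mult2[OF cs(1)])
      have eq: "(\<Sum>m. norm (fA m n)) = (\<Sum>m. \<bar>bb m n\<bar> * \<bar>norm (nth Q m)\<bar>) * (\<bar>c0\<bar> / freq L n * exp (- \<sigma> * eigval L n))" for n
        unfolding nA by (rule suminf_mult2[OF cs(1), symmetric])
      show "summable (\<lambda>n. \<Sum>m. norm (fA m n))"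
      proof (rule summable_comparison_test')
        show "summable (\<lambda>n. (sqrt C * sqrt ((norm Q)\<^sup>2)) * (\<bar>c0\<bar> / freq L 0 * (1 / \<sigma>)) * (1 / eigval L n))"
          by (rule summable_mult[OF summable_inverse_eigval[OF L]])
        fix n
        have "freq L 0 \<le> freq L n" using L by (simp add: freq_def divide_right_mono)
        then have "\<bar>c0\<bar> / freq L n \<le> \<bar>c0\<bar> / freq L 0" by (intro divide_left_mono mult_pos_pos f0) auto
        then have X: "\<bar>c0\<bar> / freq L n * exp (- \<sigma> * eigval L n) \<le> \<bar>c0\<bar> / freq L 0 * ((1 / \<sigma>) * (1 / eigval L n))"
          using f0[of 0] by (intro mult_mono exp_minus_eigval_le[OF \<sigma>]) auto
        have nn: "0 \<le> (\<Sum>m. \<bar>bb m n\<bar> * \<bar>norm (nth Q m)\<bar>)" by (rule suminf_nonneg[OF cs(1)]) simp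
        have "(\<Sum>m. norm (fA m n)) \<le> (sqrt C * sqrt ((norm Q)\<^sup>2)) * (\<bar>c0\<bar> / freq L 0 * ((1 / \<sigma>) * (1 / eigval L n)))"
          unfolding eq using f0[of n] C_nonneg by (intro mult_mono[OF cs(2) X]) auto
        moreover have "0 \<le> (\<Sum>m. norm (fA m n))" unfolding eq
          using nn f0[of n] by (intro mult_nonneg_nonneg) auto
        ultimately show "norm (\<Sum>m. norm (fA m n)) \<le> (sqrt C * sqrt ((norm Q)\<^sup>2)) * (\<bar>c0\<bar> / freq L 0 * (1 / \<sigma>)) * (1 / eigval L n)"
          by (simp only: real_norm_def abs_of_nonneg mult.assoc)
      qed
    qed
    moreover have "summable (\<lambda>i. norm (fB (fst (prod_decode i)) (snd (prod_decode i))))"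
    proof (rule double_series(1))
      have il: "summable (\<lambda>n. (1 / freq L n)\<^sup>2)" using summable_inverse_eigval[OF L] by (simp add: eigval_def power_divide)
      note cs = suminf_Cauchy_Schwarz[OF bb_col il order_refl]
      have nB: "norm (fB m n) = (\<bar>bb m n\<bar> * \<bar>1 / freq L n\<bar>) * (\<bar>c0\<bar> * norm (nth Q m) * exp (- \<sigma> * eigval L m))" for m n
        unfolding fB_def norm_of_real n\<gamma> using f0[of n] by (simp add: abs_mult)
      show "summable (\<lambda>n. norm (fB m n))" for m unfolding nB by (rule summable_mult2[OF cs(1)])
      have eq: "(\<Sum>n. norm (fB m n)) = (\<Sum>n. \<bar>bb m n\<bar> * \<bar>1 / freq L n\<bar>) * (\<bar>c0\<bar> * norm (nth Q m) * exp (- \<sigma> * eigval L m))" for m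
        unfolding nB by (rule suminf_mult2[OF cs(1), symmetric])
      let ?D = "sqrt C * sqrt (\<Sum>n. (1 / freq L n)\<^sup>2)"
      have D: "?D \<ge> 0" using C_nonneg suminf_nonneg[OF il] by simp
      show "summable (\<lambda>m. \<Sum>n. norm (fB m n))"
      proof (rule summable_comparison_test')
        show "summable (\<lambda>m. ?D * (\<bar>c0\<bar> * norm Q * (1 / \<sigma>)) * (1 / eigval L m))"
          by (rule summable_mult[OF summable_inverse_eigval[OF L]])
        fix m
        have X: "\<bar>c0\<bar> * norm (nth Q m) * exp (- \<sigma> * eigval L m) \<le> \<bar>c0\<bar> * norm Q * ((1 / \<sigma>) * (1 / eigval L m))"
          by (intro mult_mono exp_minus_eigval_le[OF \<sigma>] norm_nth_le) auto
        have nn: "0 \<le> (\<Sum>n. \<bar>bb m n\<bar> * \<bar>1 / freq L n\<bar>)" by (rule suminf_nonneg[OF cs(1)]) simp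
        have "(\<Sum>n. norm (fB m n)) \<le> ?D * (\<bar>c0\<bar> * norm Q * ((1 / \<sigma>) * (1 / eigval L m)))"
          unfolding eq using D by (intro mult_mono[OF cs(2) X]) auto
        moreover have "0 \<le> (\<Sum>n. norm (fB m n))" unfolding eq using nn by (intro mult_nonneg_nonneg) auto
        ultimately show "norm (\<Sum>n. norm (fB m n)) \<le> ?D * (\<bar>c0\<bar> * norm Q * (1 / \<sigma>)) * (1 / eigval L m)"
          by (simp only: real_norm_def abs_of_nonneg mult.assoc)
      qed
    qed
    ultimately have "summable (\<lambda>i. norm (fA (fst (prod_decode i)) (snd (prod_decode i))) + norm (fB (fst (prod_decode i)) (snd (prod_decode i))))"
      by (rule summable_add)
    then show ?thesis by (simp add: fA_def fB_def norm_mult distrib_left del: norm_of_real of_real_mult add: norm_of_real[where 'a=complex])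
  qed
  have eq: "(\<Sum>n. \<alpha> n * exp (- of_real (eigval L n) * of_real s)) +
        (\<Sum>i. \<gamma> (fst (prod_decode i)) (snd (prod_decode i)) * kk L (fst (prod_decode i)) (snd (prod_decode i)) (of_real s)) =
        cinner Y1 P + cinner Y2 Q" if s: "0 < s" "s < T" for s
  proof -
    \<comment> \<open>Taking the conjugate of z as the scalar in \<open>ann\<close> turns the real
      identity into |z|^2 = 0, so the complex pairing itself vanishes.\<close>
    define z where "z = cinner (Y1 - heat L s Y1) P + cinner (Y2 - (heat L s Y2 + K s Y1)) Q"
    have "Re (cnj z * z) = 0"
      using ann[of s "cnj z"] s unfolding inner_scl by (simp add: z_def distrib_left)
    then have "z = 0" by (simp add: complex_eq_iff)
    then have z: "cinner Y1 P + cinner Y2 Q = cinner (heat L s Y1) P + cinner (heat L s Y2) Q + cinner (K s Y1) Q"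
      by (simp add: z_def cinner_diff cinner_add algebra_simps)
    let ?e = "\<lambda>n. exp (- of_real (eigval L n) * complex_of_real s)"
    have "cinner (heat L s Y1) P + cinner (heat L s Y2) Q =
        (\<Sum>n. nth (heat L s Y1) n * cnj (nth P n) + nth (heat L s Y2) n * cnj (nth Q n))"
      unfolding cinner_def by (rule suminf_add; rule summable_norm_cancel[OF cinner_summable])
    also have "\<dots> = (\<Sum>n. \<alpha> n * ?e n)"
      using s by (simp add: nth_heat[OF L] \<alpha>_def algebra_simps)
    finally have h: "cinner (heat L s Y1) P + cinner (heat L s Y2) Q = (\<Sum>n. \<alpha> n * ?e n)" .
    have s0: "s \<ge> 0" using s by simp
    have g: "Kterm s Y1 m n * cnj (nth Q m) = \<gamma> m n * kk L m n (of_real s)" for m n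
      by (simp add: Kterm_def \<gamma>_def)
    have "cinner (K s Y1) Q = (\<Sum>i. \<gamma> (fst (prod_decode i)) (snd (prod_decode i)) * kk L (fst (prod_decode i)) (snd (prod_decode i)) (of_real s))"
      unfolding K_pairing_series(3)[OF s0] g[symmetric]
      by (rule double_series(2)[OF K_pairing_series(1,2)[OF s0, where x=Y1 and y=Q], symmetric])
    then show ?thesis using z h by simp
  qed
  have g0: "\<gamma> j j = 0" for j by (rule exp_family_unique(1)[OF L T \<alpha> \<gamma> eq])
  \<comment> \<open>All other factors of \<gamma> j j are nonzero: the diagonal of \<beta>, the
    frequencies and the coordinates of \<open>Y1\<close>.\<close>
  then have Q0: "nth Q j = 0" for j
    using g0[of j] diag[of j] c0 f0[of j] eigval_pos[OF L, of j] by (auto simp: \<gamma>_def bb_def Y1)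
  then show "Q = 0" by (intro ell2_eqI) (simp add: nth_simps)
  \<comment> \<open>With Q = 0 the double series is identically zero, and \<alpha> involves P
    only.\<close>
  have a0: "\<alpha> j = 0" for j by (rule exp_family_unique(2)[OF L T \<alpha> \<gamma> eq]) (simp_all add: \<gamma>_def Q0)
  then have "nth P j = 0" for j
    using a0[of j] c0 eigval_pos[OF L, of j] Q0[of j] by (auto simp: \<alpha>_def Y1)
  then show "P = 0" by (intro ell2_eqI) (simp add: nth_simps)
qed

end

section \<open>Time derivatives\<close>

text \<open>A passage to Borel versions: Fubini's theorem is applied to the product of Borel
  measures, while the definitions use the completed one.\<close>

lemma lebesgue_integral_transfer:
  fixes f g :: "real \<Rightarrow> 'a::euclidean_space"
  assumes g: "g \<in> borel_measurable lborel" and fg: "AE x in lborel. f x = g x"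
  shows "integral\<^sup>L lebesgue f = integral\<^sup>L lborel g" "integrable lebesgue f \<longleftrightarrow> integrable lborel g"
proof -
  have g': "g \<in> borel_measurable lebesgue" using g by (rule measurable_completion)
  have gf: "AE x in lebesgue. g x = f x" using AE_completion[OF fg] by eventually_elim simp
  have f': "f \<in> borel_measurable lebesgue" by (rule borel_measurable_AE[OF g' gf])
  have "integral\<^sup>L lebesgue f = integral\<^sup>L lebesgue g"
    using gf by (intro integral_cong_AE f' g') auto
  then show "integral\<^sup>L lebesgue f = integral\<^sup>L lborel g" using integral_completion[OF g] by simp
  have "integrable lebesgue f \<longleftrightarrow> integrable lebesgue g"
    using gf by (intro integrable_cong_AE f' g') auto
  then show "integrable lebesgue f \<longleftrightarrow> integrable lborel g" using integrable_completion[OF g] by simp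
qed

text \<open>The function w is measurable for the completed planar measure only, so its sections may
  fail to be measurable. The Borel version agrees with it along almost every section in both
  directions.\<close>

lemma L2_product_borel_version:
  fixes w :: "real \<Rightarrow> real \<Rightarrow> complex"
  assumes w: "(\<lambda>(t, x). w t x) \<in> L2 (lebesgue_on ({0<..<T} \<times> {0<..<L}))"
  obtains w0 where "w0 \<in> borel_measurable (lborel \<Otimes>\<^sub>M lborel)" "integrable (lborel \<Otimes>\<^sub>M lborel) w0"
    "AE t in lborel. AE x in lborel. indicator ({0<..<T} \<times> {0<..<L}) (t, x) *\<^sub>R w t x = w0 (t, x)"
    "AE x in lborel. AE t in lborel. indicator ({0<..<T} \<times> {0<..<L}) (t, x) *\<^sub>R w t x = w0 (t, x)"
    "AE t in lborel. integrable lborel (\<lambda>x. (norm (w0 (t, x)))\<^sup>2)"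
proof -
  let ?S = "{0<..<T} \<times> {0<..<L}"
  have S: "?S \<in> sets lborel" by (simp add: open_Times)
  have S': "?S \<in> sets lebesgue" using S by (simp add: sets_completionI_sets)
  let ?w = "\<lambda>p. indicator ?S p *\<^sub>R (case p of (t, x) \<Rightarrow> w t x)"
  have "(\<lambda>(t, x). w t x) measurable_on ?S"
    using L2D(1)[OF w] S' by (simp add: measurable_on_iff_borel_measurable)
  then obtain N g where N: "negligible N" and g: "\<And>n. continuous_on UNIV (g n)"
    and lim: "\<And>p. p \<notin> N \<Longrightarrow> (\<lambda>n. g n p) \<longlonglongrightarrow> (if p \<in> ?S then (case p of (t, x) \<Rightarrow> w t x) else 0)"
    unfolding measurable_on_def by blast
  \<comment> \<open>A limit of continuous functions, hence Borel everywhere, that agrees with w off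
    the null set where convergence is uncontrolled.\<close>
  define w0 where "w0 p = lim (\<lambda>n. g n p)" for p
  have m0: "w0 \<in> borel_measurable lborel"
    unfolding w0_def by (intro borel_measurable_lim_metric) (simp add: borel_measurable_continuous_onI g)
  have eqN: "?w p = w0 p" if "p \<notin> N" for p
    using limI[OF lim[OF that]] by (auto simp: w0_def indicator_def)
  have "AE p in lebesgue. ?w p = w0 p"
    using N eqN by (intro AE_I'[of N]) (auto simp: negligible_iff_null_sets)
  then have ae: "AE p in lborel. ?w p = w0 p" by (simp only: AE_completion_iff)
  have ae': "AE p in lebesgue. w0 p = ?w p" using AE_completion[OF ae] by eventually_elim simp
  have "integrable (lebesgue_on ?S) (\<lambda>p. (norm (case p of (t, x) \<Rightarrow> w t x))\<^sup>2)"
    using L2D(2)[OF w] by (simp add: case_prod_unfold)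
  then have "integrable lebesgue (\<lambda>p. indicator ?S p *\<^sub>R (norm (case p of (t, x) \<Rightarrow> w t x))\<^sup>2)"
    using S' by (subst (asm) integrable_restrict_space) auto
  moreover have mm: "w0 \<in> borel_measurable lebesgue" using m0 by (rule measurable_completion)
  ultimately have "integrable lebesgue (\<lambda>p. (norm (w0 p))\<^sup>2)"
  proof (subst integrable_cong_AE)
    show "AE p in lebesgue. (norm (w0 p))\<^sup>2 = indicator ?S p *\<^sub>R (norm (case p of (t, x) \<Rightarrow> w t x))\<^sup>2"
      using ae' by eventually_elim (auto simp: indicator_def)
  qed auto
  then have sq: "integrable lborel (\<lambda>p. (norm (w0 p))\<^sup>2)"
    using m0 by (subst (asm) integrable_completion) auto
  \<comment> \<open>Square integrability on a set of finite measure gives integrability through a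
    \<le> a^2 + 1.\<close>
  have "integrable lborel (\<lambda>p. (norm (w0 p))\<^sup>2 + indicator ?S p)"
  proof (intro Bochner_Integration.integrable_add sq)
    have "emeasure lborel ?S < \<infinity>"
      by (intro emeasure_bounded_finite bounded_Times) auto
    then show "integrable lborel (indicator ?S :: real \<times> real \<Rightarrow> real)" using S by simp
  qed
  then have i0: "integrable lborel w0"
  proof (rule Bochner_Integration.integrable_bound[OF _ m0])
    show "AE p in lborel. norm (w0 p) \<le> norm ((norm (w0 p))\<^sup>2 + indicator ?S p)"
      using ae
    proof eventually_elim
      case (elim p)
      have "a \<le> a\<^sup>2 + 1" for a :: real
      proof -
        have "2 * a \<le> a\<^sup>2 + 1" using sum_squares_bound[of a 1] by simp
        moreover have "0 \<le> a\<^sup>2" by simp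
        ultimately show ?thesis by linarith
      qed
      then show ?case using elim by (cases "p \<in> ?S") auto
    qed
  qed
  have aeP: "AE p in lborel \<Otimes>\<^sub>M lborel. ?w p = w0 p" using ae by (simp only: lborel_prod)
  show ?thesis
  proof (rule that[of w0])
    show "w0 \<in> borel_measurable (lborel \<Otimes>\<^sub>M lborel)" using m0 by (simp only: lborel_prod)
    show "integrable (lborel \<Otimes>\<^sub>M lborel) w0" using i0 by (simp only: lborel_prod)
    show "AE t in lborel. AE x in lborel. indicator ?S (t, x) *\<^sub>R w t x = w0 (t, x)"
      using lborel_pair.AE_pair[OF aeP] by simp
    \<comment> \<open>Exchanging the two almost everywhere quantifiers takes a measurable
      exceptional set, so the exceptional set is enlarged to a Borel null set.\<close>
    obtain N0 where N0: "N0 \<in> null_sets (lborel \<Otimes>\<^sub>M lborel)" "{p. ?w p \<noteq> w0 p} \<subseteq> N0"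
      using aeP by (auto simp: eventually_ae_filter space_pair_measure)
    have "AE p in lborel \<Otimes>\<^sub>M lborel. p \<notin> N0" using N0(1) by (rule AE_not_in)
    from lborel_pair.AE_pair[OF this] have pr: "AE t in lborel. AE x in lborel. (t, x) \<notin> N0" .
    have "{p \<in> space (lborel \<Otimes>\<^sub>M lborel). (fst p, snd p) \<notin> N0} = space (lborel \<Otimes>\<^sub>M lborel) - N0" by auto
    moreover have "space (lborel \<Otimes>\<^sub>M lborel) - N0 \<in> sets (lborel \<Otimes>\<^sub>M lborel)"
      by (rule sets.Diff[OF sets.top null_setsD2[OF N0(1)]])
    ultimately have "{p \<in> space (lborel \<Otimes>\<^sub>M lborel). (fst p, snd p) \<notin> N0} \<in> sets (lborel \<Otimes>\<^sub>M lborel)"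
      by (simp only:)
    then have "AE x in lborel. AE t in lborel. (t, x) \<notin> N0"
      using pr lborel_pair.AE_commute[of "\<lambda>t x. (t, x) \<notin> N0"] by simp
    then show "AE x in lborel. AE t in lborel. indicator ?S (t, x) *\<^sub>R w t x = w0 (t, x)"
    proof eventually_elim
      case (elim x)
      then show ?case
      proof eventually_elim
        case (elim t)
        show ?case
        proof (rule ccontr)
          assume "\<not> ?case"
          then have "(t, x) \<in> {p. ?w p \<noteq> w0 p}" by simp
          then show False using N0(2) elim by blast
        qed
      qed
    qed
    have "integrable (lborel \<Otimes>\<^sub>M lborel) (\<lambda>p. (norm (w0 p))\<^sup>2)" using sq by (simp only: lborel_prod)
    from lborel_pair.AE_integrable_fst'[OF this]
    show "AE t in lborel. integrable lborel (\<lambda>x. (norm (w0 (t, x)))\<^sup>2)" .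
  qed
qed

lemma AE_lebesgue_on_iff: "S \<in> sets lebesgue \<Longrightarrow> (AE x in lebesgue_on S. P x) \<longleftrightarrow> (AE x in lborel. x \<in> S \<longrightarrow> P x)"
  for S :: "real set"
  by (simp add: AE_restrict_space_iff AE_completion_iff)

text \<open>The fundamental theorem in the definition holds for almost every x with an exceptional
  set that may depend on the times. Pairing with a fixed weight e and exchanging the integrals
  yields a scalar identity for all times.\<close>

lemma time_derivative_pairing:
  assumes L: "L > 0" and zw: "has_time_derivative L T z w" and e: "continuous_on {0..L} (e :: real \<Rightarrow> real)"
    and z: "\<And>t. t \<in> {0..T} \<Longrightarrow> z t \<in> L2 (Om L)"
  shows "AE t in lebesgue_on {0<..<T}. w t \<in> L2 (Om L)"
    and "integrable (lebesgue_on {0<..<T}) (\<lambda>r. \<integral>x. e x *\<^sub>R w r x \<partial>Om L)"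
    and "\<And>s t. 0 \<le> s \<Longrightarrow> s \<le> t \<Longrightarrow> t \<le> T \<Longrightarrow>
      (\<integral>x. e x *\<^sub>R z t x \<partial>Om L) - (\<integral>x. e x *\<^sub>R z s x \<partial>Om L) = (\<integral>r. (\<integral>x. e x *\<^sub>R w r x \<partial>Om L) \<partial>lebesgue_on {s<..<t})"
proof -
  let ?S = "{0<..<T} \<times> {0<..<L}"
  obtain w0 where w0: "w0 \<in> borel_measurable (lborel \<Otimes>\<^sub>M lborel)" "integrable (lborel \<Otimes>\<^sub>M lborel) w0"
    and tx: "AE t in lborel. AE x in lborel. indicator ?S (t, x) *\<^sub>R w t x = w0 (t, x)"
    and xt: "AE x in lborel. AE t in lborel. indicator ?S (t, x) *\<^sub>R w t x = w0 (t, x)"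
    and sq: "AE t in lborel. integrable lborel (\<lambda>x. (norm (w0 (t, x)))\<^sup>2)"
    using L2_product_borel_version[of w T L] zw unfolding has_time_derivative_def by blast
  have m1: "(\<lambda>x. w0 (t, x)) \<in> borel_measurable lborel" for t using w0(1) by measurable
  have m2: "(\<lambda>t. w0 (t, x)) \<in> borel_measurable lborel" for x using w0(1) by measurable
  have "AE t in lborel. t \<in> {0<..<T} \<longrightarrow> w t \<in> L2 (Om L)"
    using tx sq
  proof eventually_elim
    case (elim t)
    show ?case
    proof
      assume t: "t \<in> {0<..<T}"
      have a: "AE x in lebesgue. w0 (t, x) = indicator {0<..<L} x *\<^sub>R w t x"
        using AE_completion[OF elim(1)] by eventually_elim (use t in \<open>auto simp: indicator_def\<close>)
      have "(\<lambda>x. indicator {0<..<L} x *\<^sub>R w t x) \<in> borel_measurable lebesgue"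
        by (rule borel_measurable_AE[OF measurable_completion[OF m1] a])
      then have wm: "w t \<in> borel_measurable (Om L)" by (simp add: borel_measurable_restrict_space_iff)
      have "integrable lebesgue (\<lambda>x. indicator {0<..<L} x *\<^sub>R (norm (w t x))\<^sup>2)"
      proof (subst lebesgue_integral_transfer(2)[where g="\<lambda>x. (norm (w0 (t, x)))\<^sup>2"])
        show "(\<lambda>x. (norm (w0 (t, x)))\<^sup>2) \<in> borel_measurable lborel" using m1[of t] by measurable
        show "AE x in lborel. indicator {0<..<L} x *\<^sub>R (norm (w t x))\<^sup>2 = (norm (w0 (t, x)))\<^sup>2"
          using elim(1) by eventually_elim (use t in \<open>auto simp: indicator_def split: if_splits\<close>)
      qed (rule elim(2))
      then have "integrable (Om L) (\<lambda>x. (norm (w t x))\<^sup>2)" by (subst integrable_restrict_space) auto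
      then show "w t \<in> L2 (Om L)" using wm by (simp add: L2_def)
    qed
  qed
  then show "AE t in lebesgue_on {0<..<T}. w t \<in> L2 (Om L)" by (simp add: AE_lebesgue_on_iff)
  \<comment> \<open>The weight is frozen outside [0, L], which makes it continuous and bounded on
    the whole line, in particular Borel.\<close>
  define e' where "e' x = e (max 0 (min L x))" for x
  have e': "e' x = e x" if "x \<in> {0<..<L}" for x using that by (simp add: e'_def)
  have e'c: "continuous_on UNIV e'"
    unfolding e'_def by (rule continuous_on_compose2[OF e]) (use L in \<open>auto intro!: continuous_intros\<close>)
  have e'm: "e' \<in> borel_measurable lborel" using e'c by (simp add: borel_measurable_continuous_onI)
  have "bounded (e ` {0..L})" using e by (intro compact_imp_bounded compact_continuous_image) auto
  then obtain B where B: "\<forall>y\<in>e ` {0..L}. norm y \<le> B" unfolding bounded_iff by blast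
  have e'b: "\<bar>e' x\<bar> \<le> B" for x using B L by (simp add: e'_def)
  define W where "W r = (\<integral>x. e' x *\<^sub>R w0 (r, x) \<partial>lborel)" for r
  have bound: "integrable (lborel \<Otimes>\<^sub>M lborel) (\<lambda>p. (indicator A (fst p) * e' (snd p)) *\<^sub>R w0 p)" if "A \<in> sets borel" for A
  proof (rule Bochner_Integration.integrable_bound)
    show "integrable (lborel \<Otimes>\<^sub>M lborel) (\<lambda>p. B *\<^sub>R w0 p)" using w0(2) by simp
    show "(\<lambda>p. (indicator A (fst p) * e' (snd p)) *\<^sub>R w0 p) \<in> borel_measurable (lborel \<Otimes>\<^sub>M lborel)"
      using w0(1) e'm that by measurable
    show "AE p in lborel \<Otimes>\<^sub>M lborel. norm ((indicator A (fst p) * e' (snd p)) *\<^sub>R w0 p) \<le> norm (B *\<^sub>R w0 p)"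
    proof (intro AE_I2)
      fix p
      have "\<bar>indicator A (fst p) * e' (snd p)\<bar> \<le> B"
        using e'b[of "snd p"] order_trans[OF abs_ge_zero e'b[of "snd p"]] by (auto simp: indicator_def)
      then have "\<bar>indicator A (fst p) * e' (snd p)\<bar> * norm (w0 p) \<le> B * norm (w0 p)"
        by (rule mult_right_mono) simp
      also have "\<dots> \<le> \<bar>B\<bar> * norm (w0 p)" by (intro mult_right_mono) auto
      finally show "norm ((indicator A (fst p) * e' (snd p)) *\<^sub>R w0 p) \<le> norm (B *\<^sub>R w0 p)" by simp
    qed
  qed
  have Wm: "W \<in> borel_measurable lborel" and Wi: "integrable lborel W"
  proof -
    have "integrable lborel (\<lambda>r. \<integral>x. (indicator UNIV r * e' x) *\<^sub>R w0 (r, x) \<partial>lborel)"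
      using lborel_pair.integrable_fst'[OF bound[of UNIV]] by simp
    then show "integrable lborel W" by (simp add: W_def[abs_def])
    then show "W \<in> borel_measurable lborel" by simp
  qed
  have Weq: "AE r in lborel. r \<in> {0<..<T} \<longrightarrow> (\<integral>x. e x *\<^sub>R w r x \<partial>Om L) = W r"
    using tx
  proof eventually_elim
    case (elim r)
    show ?case
    proof
      assume r: "r \<in> {0<..<T}"
      have "(\<integral>x. e x *\<^sub>R w r x \<partial>Om L) = (\<integral>x. indicator {0<..<L} x *\<^sub>R (e x *\<^sub>R w r x) \<partial>lebesgue)"
        by (simp add: integral_restrict_space)
      also have "\<dots> = W r"
        unfolding W_def
      proof (rule lebesgue_integral_transfer(1))
        show "(\<lambda>x. e' x *\<^sub>R w0 (r, x)) \<in> borel_measurable lborel" using e'm m1[of r] by measurable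
        show "AE x in lborel. indicator {0<..<L} x *\<^sub>R (e x *\<^sub>R w r x) = e' x *\<^sub>R w0 (r, x)"
          using elim by eventually_elim (use r e' in \<open>auto simp: indicator_def split: if_splits\<close>)
      qed
      finally show "(\<integral>x. e x *\<^sub>R w r x \<partial>Om L) = W r" .
    qed
  qed
  have int: "(\<integral>r. (\<integral>x. e x *\<^sub>R w r x \<partial>Om L) \<partial>lebesgue_on {s<..<t}) = (\<integral>r. indicator {s<..<t} r *\<^sub>R W r \<partial>lborel)"
    and inti: "integrable (lebesgue_on {s<..<t}) (\<lambda>r. \<integral>x. e x *\<^sub>R w r x \<partial>Om L)"
    if st: "0 \<le> s" "t \<le> T" for s t
  proof -
    have a: "AE r in lborel. indicator {s<..<t} r *\<^sub>R (\<integral>x. e x *\<^sub>R w r x \<partial>Om L) = indicator {s<..<t} r *\<^sub>R W r"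
      using Weq by eventually_elim (use st in \<open>auto simp: indicator_def\<close>)
    have m: "(\<lambda>r. indicator {s<..<t} r *\<^sub>R W r) \<in> borel_measurable lborel" using Wm by measurable
    show "(\<integral>r. (\<integral>x. e x *\<^sub>R w r x \<partial>Om L) \<partial>lebesgue_on {s<..<t}) = (\<integral>r. indicator {s<..<t} r *\<^sub>R W r \<partial>lborel)"
      using lebesgue_integral_transfer(1)[OF m a] by (simp add: integral_restrict_space)
    have "integrable lborel (\<lambda>r. indicator {s<..<t} r *\<^sub>R W r)"
      by (rule integrable_mult_indicator[OF _ Wi]) simp
    then show "integrable (lebesgue_on {s<..<t}) (\<lambda>r. \<integral>x. e x *\<^sub>R w r x \<partial>Om L)"
      using lebesgue_integral_transfer(2)[OF m a] by (simp add: integrable_restrict_space)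
  qed
  show "integrable (lebesgue_on {0<..<T}) (\<lambda>r. \<integral>x. e x *\<^sub>R w r x \<partial>Om L)" by (rule inti) auto
  fix s t assume st: "0 \<le> s" "s \<le> t" "t \<le> T"
  have zi: "integrable (Om L) (\<lambda>x. e x *\<^sub>R z r x)" if "r \<in> {0..T}" for r
  proof (rule L2_Om_integrable, rule L2_bounded_scaleR[OF z[OF that]])
    show "e \<in> borel_measurable (Om L)" by (rule borel_measurable_integrable[OF integrable_continuous_Om[OF e]])
    show "AE x in Om L. \<bar>e x\<bar> \<le> B" using B by (intro AE_I2) auto
  qed
  have "(\<integral>x. e x *\<^sub>R z t x \<partial>Om L) - (\<integral>x. e x *\<^sub>R z s x \<partial>Om L) = (\<integral>x. e x *\<^sub>R z t x - e x *\<^sub>R z s x \<partial>Om L)"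
    using zi[of t] zi[of s] st by simp
  also have "\<dots> = (\<integral>x. indicator {0<..<L} x *\<^sub>R (e x *\<^sub>R z t x - e x *\<^sub>R z s x) \<partial>lebesgue)"
    by (simp add: integral_restrict_space)
  also have "\<dots> = (\<integral>x. (\<integral>r. (indicator {s<..<t} r * e' x) *\<^sub>R w0 (r, x) \<partial>lborel) \<partial>lborel)"
  proof (rule lebesgue_integral_transfer(1))
    show "(\<lambda>x. \<integral>r. (indicator {s<..<t} r * e' x) *\<^sub>R w0 (r, x) \<partial>lborel) \<in> borel_measurable lborel"
      using lborel_pair.integrable_snd[of "\<lambda>r x. (indicator {s<..<t} r * e' x) *\<^sub>R w0 (r, x)"] bound[of "{s<..<t}"]
      by (simp add: case_prod_unfold)
    have "AE x in Om L. z t x - z s x = (\<integral>r. w r x \<partial>lebesgue_on {s<..<t})"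
      using zw st unfolding has_time_derivative_def by blast
    then have "AE x in lborel. x \<in> {0<..<L} \<longrightarrow> z t x - z s x = (\<integral>r. w r x \<partial>lebesgue_on {s<..<t})"
      by (simp add: AE_lebesgue_on_iff)
    with xt show "AE x in lborel. indicator {0<..<L} x *\<^sub>R (e x *\<^sub>R z t x - e x *\<^sub>R z s x) = (\<integral>r. (indicator {s<..<t} r * e' x) *\<^sub>R w0 (r, x) \<partial>lborel)"
    proof eventually_elim
      case (elim x)
      show ?case
      proof (cases "x \<in> {0<..<L}")
        case True
        have "(\<integral>r. w r x \<partial>lebesgue_on {s<..<t}) = (\<integral>r. indicator {s<..<t} r *\<^sub>R w r x \<partial>lebesgue)"
          by (simp add: integral_restrict_space)
        also have "\<dots> = (\<integral>r. indicator {s<..<t} r *\<^sub>R w0 (r, x) \<partial>lborel)"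
        proof (rule lebesgue_integral_transfer(1))
          show "(\<lambda>r. indicator {s<..<t} r *\<^sub>R w0 (r, x)) \<in> borel_measurable lborel" using m2[of x] by measurable
          show "AE r in lborel. indicator {s<..<t} r *\<^sub>R w r x = indicator {s<..<t} r *\<^sub>R w0 (r, x)"
            using elim(1) by eventually_elim (use True st in \<open>auto simp: indicator_def split: if_splits\<close>)
        qed
        finally have "e x *\<^sub>R (z t x - z s x) = e' x *\<^sub>R (\<integral>r. indicator {s<..<t} r *\<^sub>R w0 (r, x) \<partial>lborel)"
          using elim(2) True e' by simp
        also have "\<dots> = (\<integral>r. e' x *\<^sub>R (indicator {s<..<t} r *\<^sub>R w0 (r, x)) \<partial>lborel)"
          by (rule integral_scaleR_right[symmetric])
        finally show ?thesis using True by (simp add: scaleR_diff_right mult.commute)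
      next
        case False
        have "AE r in lborel. (indicator {s<..<t} r * e' x) *\<^sub>R w0 (r, x) = 0"
          using elim(1) by eventually_elim (use False in \<open>auto simp: indicator_def\<close>)
        then have "(\<integral>r. (indicator {s<..<t} r * e' x) *\<^sub>R w0 (r, x) \<partial>lborel) = 0"
          by (rule integral_eq_zero_AE)
        then show ?thesis using False by simp
      qed
    qed
  qed
  also have "\<dots> = (\<integral>r. (\<integral>x. (indicator {s<..<t} r * e' x) *\<^sub>R w0 (r, x) \<partial>lborel) \<partial>lborel)"
    using lborel_pair.Fubini_integral[of "\<lambda>r x. (indicator {s<..<t} r * e' x) *\<^sub>R w0 (r, x)"] bound[of "{s<..<t}"]
    by (simp add: case_prod_unfold)
  also have "\<dots> = (\<integral>r. indicator {s<..<t} r *\<^sub>R W r \<partial>lborel)"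
    unfolding W_def by (simp flip: scaleR_scaleR)
  also have "\<dots> = (\<integral>r. (\<integral>x. e x *\<^sub>R w r x \<partial>Om L) \<partial>lebesgue_on {s<..<t})"
    using int st by simp
  finally show "(\<integral>x. e x *\<^sub>R z t x \<partial>Om L) - (\<integral>x. e x *\<^sub>R z s x \<partial>Om L) = (\<integral>r. (\<integral>x. e x *\<^sub>R w r x \<partial>Om L) \<partial>lebesgue_on {s<..<t})" .
qed

section \<open>Scalar linear equations in time\<close>

lemma integral_equation_derivative:
  fixes p g :: "real \<Rightarrow> complex"
  assumes g: "continuous_on {0..T} g"
    and eq: "\<And>t. 0 \<le> t \<Longrightarrow> t \<le> T \<Longrightarrow> p t - p 0 = (\<integral>r. g r \<partial>lebesgue_on {0<..<t})"
    and t: "t \<in> {0..T}"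
  shows "(p has_vector_derivative g t) (at t within {0..T})"
proof -
  have p: "p r = p 0 + integral {0..r} g" if "r \<in> {0..T}" for r
  proof -
    have "continuous_on {0..r} g" using g that by (auto intro: continuous_on_subset)
    then have "(\<integral>r. g r \<partial>lebesgue_on {0<..<r}) = integral {0<..<r} g"
      by (intro lebesgue_integral_eq_integral integrable_continuous_Om) auto
    then show ?thesis using eq[of r] that integral_open_interval_real[of 0 r g] by (simp add: algebra_simps)
  qed
  have "((\<lambda>r. p 0 + integral {0..r} g) has_vector_derivative 0 + g t) (at t within {0..T})"
    by (intro has_vector_derivative_add has_vector_derivative_const integral_has_vector_derivative[OF g t])
  then have "((\<lambda>r. p 0 + integral {0..r} g) has_vector_derivative g t) (at t within {0..T})" by simp
  from has_vector_derivative_transform[OF t p this] show ?thesis .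
qed

text \<open>An integrating factor makes the solution constant. The condition sits at the final time
  because the adjoint system runs backwards.\<close>

lemma linear_ode_zero:
  fixes d :: "real \<Rightarrow> complex" and k :: real
  assumes d: "\<And>t. t \<in> {0..T} \<Longrightarrow> (d has_vector_derivative of_real k * d t) (at t within {0..T})"
    and "d T = 0" and t: "t \<in> {0..T}"
  shows "d t = 0"
proof -
  define f where "f r = of_real (exp (- k * r)) * d r" for r
  have "(f has_vector_derivative 0) (at r within {0..T})" if "r \<in> {0..T}" for r
  proof -
    have "((\<lambda>r. of_real (exp (- k * r))) has_vector_derivative of_real (- k * exp (- k * r))) (at r within {0..T})"
      by (rule has_vector_derivative_of_real) (auto intro!: derivative_eq_intros)
    from has_vector_derivative_mult[OF this d[OF that]]
    show ?thesis by (simp add: f_def[abs_def] algebra_simps)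
  qed
  then have "(f has_derivative (\<lambda>_. 0)) (at r within {0..T})" if "r \<in> {0..T}" for r
    using that by (auto simp: has_vector_derivative_def)
  then have "\<exists>c. \<forall>r\<in>{0..T}. f r = c"
    by (intro has_derivative_zero_constant) auto
  then have "f t = f T" using t by auto
  then show ?thesis using assms(2) by (simp add: f_def)
qed

section \<open>The dual space in coordinates\<close>

lemma integration_by_parts:
  fixes f :: "real \<Rightarrow> real" and v :: "real \<Rightarrow> 'a::euclidean_space"
  assumes f: "integrable (Om L) f" and v: "integrable (Om L) v"
  shows "(\<integral>x. (a + prim f x) *\<^sub>R v x \<partial>Om L) + (\<integral>x. f x *\<^sub>R (b + prim v x) \<partial>Om L) =
    (a + prim f L) *\<^sub>R (b + prim v L) - a *\<^sub>R b"
proof -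
  note tri = prim_triangle[OF f v]
  have "(\<integral>x. (a + prim f x) *\<^sub>R v x \<partial>Om L) = a *\<^sub>R prim v L + (\<integral>x. prim f x *\<^sub>R v x \<partial>Om L)"
    using v tri(2) by (simp add: scaleR_add_left prim_def)
  moreover have "(\<integral>x. f x *\<^sub>R (b + prim v x) \<partial>Om L) = prim f L *\<^sub>R b + (\<integral>x. f x *\<^sub>R prim v x \<partial>Om L)"
    using f tri(1) by (simp add: scaleR_add_right prim_def)
  ultimately show ?thesis using tri(3) by (simp add: scaleR_add_left scaleR_add_right algebra_simps)
qed

lemma integral_Om_cong_AE:
  fixes f g :: "real \<Rightarrow> 'a::euclidean_space"
  assumes "AE x in Om L. f x = g x" "f \<in> borel_measurable (Om L)"
  shows "(\<integral>x. f x \<partial>Om L) = (\<integral>x. g x \<partial>Om L)"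
  using assms by (intro integral_cong_AE borel_measurable_Om_AE[OF assms(2,1)]) auto

lemma prim_es_deriv: "0 \<le> x \<Longrightarrow> prim (\<lambda>y. freq L n * ec L n y) x = es L n x"
  using prim_FTC_real[OF _ es_deriv, of x L n] by (simp add: es_boundary continuous_intros)

lemma H2_H1_deriv:
  assumes L: "L > 0" and u: "u \<in> H2 L"
  shows "laplacian L u \<in> L2 (Om L)"
    "AE x in Om L. wderiv L u x = boundary_trace L (wderiv L u) 0 + prim (laplacian L u) x"
  using u H1_weak_derivative(2)[of "wderiv L u" L] H1E(1)[OF L, of "wderiv L u"] by (auto simp: H2_def)

text \<open>Green's formula with a general weight. Weight \<open>es\<close> gives the eigenvalue
  relation, weight 1 - x / L isolates the normal derivative at 0.\<close>

lemma H2_pairing: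
  assumes L: "L > 0" and u: "u \<in> H2 L" and f: "continuous_on {0..L} f"
  shows "(\<integral>x. (a + prim f x) *\<^sub>R laplacian L u x \<partial>Om L) + (\<integral>x. f x *\<^sub>R wderiv L u x \<partial>Om L) =
    (a + prim f L) *\<^sub>R (boundary_trace L (wderiv L u) 0 + prim (laplacian L u) L) - a *\<^sub>R boundary_trace L (wderiv L u) 0"
proof -
  let ?b = "boundary_trace L (wderiv L u) 0"
  note H = H2_H1_deriv[OF L u]
  have fi: "integrable (Om L) f" by (rule integrable_continuous_Om[OF f])
  have u': "wderiv L u \<in> L2 (Om L)" using u H1_weak_derivative(2)[of u L] by (simp add: H2_def)
  have "(\<integral>x. f x *\<^sub>R wderiv L u x \<partial>Om L) = (\<integral>x. f x *\<^sub>R (?b + prim (laplacian L u) x) \<partial>Om L)"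
  proof (rule integral_Om_cong_AE)
    show "AE x in Om L. f x *\<^sub>R wderiv L u x = f x *\<^sub>R (?b + prim (laplacian L u) x)"
      using H(2) by eventually_elim simp
    show "(\<lambda>x. f x *\<^sub>R wderiv L u x) \<in> borel_measurable (Om L)"
      using fi L2D(1)[OF u'] by (intro borel_measurable_scaleR) auto
  qed
  then show ?thesis using integration_by_parts[OF fi L2_Om_integrable[OF H(1)], of a ?b] by simp
qed

lemma H2_coef_laplacian:
  assumes L: "L > 0" and u: "u \<in> H2 L" "u \<in> H10 L"
  shows "coef L n (laplacian L u) = - of_real (eigval L n) * coef L n u"
proof -
  let ?f = "\<lambda>y. freq L n * ec L n y"
  have fc: "continuous_on {0..L} ?f" by (intro continuous_intros)
  have "(\<integral>x. (0 + prim ?f x) *\<^sub>R laplacian L u x \<partial>Om L) = coef L n (laplacian L u)"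
    unfolding coef_def by (intro Bochner_Integration.integral_cong) (auto simp: prim_es_deriv)
  moreover have "(\<integral>x. ?f x *\<^sub>R wderiv L u x \<partial>Om L) = freq L n *\<^sub>R (freq L n *\<^sub>R coef L n u)"
    using H10_deriv_coef[OF L u(2), of n] by (simp flip: scaleR_scaleR)
  ultimately show ?thesis
  proof -
    assume a: "(\<integral>x. (0 + prim ?f x) *\<^sub>R laplacian L u x \<partial>Om L) = coef L n (laplacian L u)"
      and b: "(\<integral>x. ?f x *\<^sub>R wderiv L u x \<partial>Om L) = freq L n *\<^sub>R (freq L n *\<^sub>R coef L n u)"
    have p: "prim ?f L = 0" using prim_es_deriv[of L L n] L by (simp add: es_boundary)
    have "coef L n (laplacian L u) + freq L n *\<^sub>R (freq L n *\<^sub>R coef L n u) = 0"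
      using H2_pairing[OF L u(1) fc, of 0, unfolded a b p] by (simp only: add_0 scaleR_zero_left diff_self)
    then have "coef L n (laplacian L u) = - (freq L n *\<^sub>R (freq L n *\<^sub>R coef L n u))"
      by (simp only: eq_neg_iff_add_eq_0)
    then show ?thesis by (simp add: scaleR_conv_of_real eigval_def power2_eq_square mult.assoc)
  qed
qed

text \<open>The weight is 1 at 0 and 0 at L, so only the trace at 0 remains; its slope is constant
  and multiplies the integral of the derivative of u, which is zero.\<close>

lemma H2_trace_pairing:
  assumes L: "L > 0" and u: "u \<in> H2 L" "u \<in> H10 L"
  shows "(\<integral>x. (1 - x / L) *\<^sub>R laplacian L u x \<partial>Om L) = normal_derivative_at_0 L u"
proof -
  let ?f = "\<lambda>y::real. - (1 / L)"
  have p: "prim ?f x = - (x / L)" if "0 \<le> x" for x using prim_const[OF that, of "- (1 / L)"] by simp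
  have "(\<integral>x. (1 + prim ?f x) *\<^sub>R laplacian L u x \<partial>Om L) = (\<integral>x. (1 - x / L) *\<^sub>R laplacian L u x \<partial>Om L)"
    by (intro Bochner_Integration.integral_cong) (auto simp: p)
  moreover have "(\<integral>x. ?f x *\<^sub>R wderiv L u x \<partial>Om L) = 0"
    using H10E(5)[OF L u(2)] by (simp add: prim_def)
  ultimately show ?thesis
    using H2_pairing[OF L u(1) continuous_on_const, of 1 "- (1 / L)"] p[of L] L
    by (simp add: normal_derivative_at_0_def)
qed

lemma norm_coef_le:
  assumes "L > 0" "u \<in> H10 L"
  shows "freq L n * norm (coef L n u) \<le> h1norm L u"
proof -
  have "(freq L n * norm (coef L n u))\<^sup>2 \<le> (\<Sum>n<Suc n. (freq L n * norm (coef L n u))\<^sup>2)"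
    by (simp add: sum_nonneg)
  also have "\<dots> \<le> (l2norm (Om L) (wderiv L u))\<^sup>2" by (rule H10_bessel[OF assms])
  finally have "freq L n * norm (coef L n u) \<le> l2norm (Om L) (wderiv L u)"
    by (rule power2_le_imp_le) (rule l2norm_nonneg)
  then show ?thesis using h1norm_le_deriv(2)[OF assms] by simp
qed

text \<open>These are the cosine coefficients of the derivative of u, which is why the Sobolev norm
  controls the norm of the sequence.\<close>

definition hat :: "real \<Rightarrow> (real \<Rightarrow> complex) \<Rightarrow> ell2" where
  "hat L u = Ell2 (\<lambda>n. of_real (freq L n) * coef L n u)"

lemma hat:
  assumes L: "L > 0" and u: "u \<in> H10 L"
  shows "nth (hat L u) n = of_real (freq L n) * coef L n u" "norm (hat L u) \<le> h1norm L u"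
proof -
  have e: "(norm (of_real (freq L n) * coef L n u))\<^sup>2 = (freq L n * norm (coef L n u))\<^sup>2" for n
    by (simp add: norm_mult power_mult_distrib)
  have s: "summable (\<lambda>n. (norm (of_real (freq L n) * coef L n u))\<^sup>2)"
    unfolding e by (rule summableI_square_bounded(1)[OF H10_bessel[OF L u]])
  show 1: "nth (hat L u) n = of_real (freq L n) * coef L n u" for n
    unfolding hat_def by (simp add: nth_Ell2[OF s])
  have "(norm (hat L u))\<^sup>2 \<le> (l2norm (Om L) (wderiv L u))\<^sup>2"
    unfolding norm_ell2_square 1 e by (rule summableI_square_bounded(2)[OF H10_bessel[OF L u]])
  then have "norm (hat L u) \<le> l2norm (Om L) (wderiv L u)"
    by (rule power2_le_imp_le) (rule l2norm_nonneg)
  then show "norm (hat L u) \<le> h1norm L u" using h1norm_le_deriv(2)[OF L u] by simp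
qed

definition Psi :: "real \<Rightarrow> ell2 \<Rightarrow> functional" where
  "Psi L x u = cinner x (hat L u)"

text \<open>Division by the frequency balances the multiplication in \<open>hat\<close>, so that
  \<open>Psi L\<close> undoes \<open>coords L\<close>.\<close>

definition coords :: "real \<Rightarrow> functional \<Rightarrow> ell2" where
  "coords L F = Ell2 (\<lambda>n. F (\<lambda>x. of_real (es L n x)) / of_real (freq L n))"

lemma norm_cinner_le: "norm (cinner x y) \<le> norm x * norm y"
proof -
  have "norm (cinner x y) \<le> (\<Sum>n. norm (nth x n * cnj (nth y n)))"
    unfolding cinner_def by (rule summable_norm[OF cinner_summable])
  also have "\<dots> = (\<Sum>n. \<bar>norm (nth x n)\<bar> * \<bar>norm (nth y n)\<bar>)" by (simp add: norm_mult)
  also have "\<dots> \<le> sqrt ((norm x)\<^sup>2) * sqrt ((norm y)\<^sup>2)"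
    by (rule suminf_Cauchy_Schwarz(2)) (simp_all add: nth_summable norm_ell2_square)
  finally show ?thesis by simp
qed

lemma cinner_scl: "cinner (scl c x) y = c * cinner x y"
  unfolding cinner_def nth_scl mult.assoc
  by (rule suminf_mult[OF summable_norm_cancel[OF cinner_summable]])

lemma Psi_diff: "Psi L (x - y) u = Psi L x u - Psi L y u"
  by (simp add: Psi_def cinner_diff)

lemma Psi_add: "Psi L (x + y) u = Psi L x u + Psi L y u"
  by (simp add: Psi_def cinner_add)

lemma Psi_scl: "Psi L (scl c x) u = c * Psi L x u"
  by (simp add: Psi_def cinner_scl)

lemma Psi_bound: "L > 0 \<Longrightarrow> u \<in> H10 L \<Longrightarrow> norm (Psi L x u) \<le> norm x * h1norm L u"
  unfolding Psi_def by (rule order_trans[OF norm_cinner_le]) (intro mult_left_mono hat norm_ge_zero)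

lemma Psi_Hm1:
  assumes L: "L > 0"
  shows "Psi L x \<in> Hm1 L"
proof -
  have lin: "Psi L x (\<lambda>y. u y + c * v y) = Psi L x u + cnj c * Psi L x v" if u: "u \<in> H10 L" and v: "v \<in> H10 L" for u v c
  proof -
    have "Psi L x (\<lambda>y. u y + c * v y) = (\<Sum>n. nth x n * cnj (nth (hat L u) n) + cnj c * (nth x n * cnj (nth (hat L v) n)))"
      unfolding Psi_def cinner_def hat(1)[OF L u] hat(1)[OF L v] hat(1)[OF L H10_lincomb(1)[OF L u v]]
        coef_lincomb[OF L H10E(2)[OF L u] H10E(2)[OF L v]]
      by (intro suminf_cong) (simp add: algebra_simps)
    also have "\<dots> = Psi L x u + cnj c * Psi L x v"
      unfolding Psi_def cinner_def
      by (simp only: suminf_mult[OF summable_norm_cancel[OF cinner_summable], symmetric]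
        suminf_add[OF summable_norm_cancel[OF cinner_summable] summable_mult[OF summable_norm_cancel[OF cinner_summable]], symmetric])
    finally show ?thesis .
  qed
  have z: "Psi L x (\<lambda>y. 0) = 0"
    unfolding Psi_def cinner_def hat(1)[OF L H10_zero[OF L]] by (simp add: coef_def)
  have "\<exists>C. \<forall>u\<in>H10 L. norm (Psi L x u) \<le> C * h1norm L u" using Psi_bound[OF L] by blast
  moreover have "Psi L x (\<lambda>y. u y + v y) = Psi L x u + Psi L x v" if "u \<in> H10 L" "v \<in> H10 L" for u v
    using lin[OF that, of 1] by simp
  moreover have "Psi L x (\<lambda>y. c * v y) = cnj c * Psi L x v" if "v \<in> H10 L" for v c
    using lin[OF H10_zero[OF L] that, of c] z by simp
  ultimately show ?thesis unfolding Hm1_def by blast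
qed

text \<open>The zero function witnesses that the supremum defining the dual norm runs over a
  nonempty set.\<close>

lemma h1norm_zero_le:
  assumes L: "L > 0"
  shows "h1norm L (\<lambda>x. 0) \<le> 1"
proof -
  have "h1norm L (\<lambda>x. 0) \<le> (1 + L) * l2norm (Om L) (wderiv L (\<lambda>x. 0))"
    by (rule h1norm_le_deriv(1)[OF L H10_zero[OF L]])
  also have "l2norm (Om L) (wderiv L (\<lambda>x. 0 :: complex)) = l2norm (Om L) (\<lambda>x. 0)"
  proof (rule l2norm_cong_AE)
    show "AE x in Om L. wderiv L (\<lambda>x. 0) x = (0 :: complex)"
      using H10I(2)[OF L L2_zero, of "\<lambda>x. 0"] by (simp add: prim_def)
  qed (use L2D(1)[OF H10E(3)[OF L H10_zero[OF L]]] in auto)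
  finally show ?thesis by (simp add: l2norm_def)
qed

lemma hm1norm_le:
  assumes L: "L > 0" and b: "\<And>u. u \<in> H10 L \<Longrightarrow> norm (F u) \<le> C * h1norm L u" and C: "C \<ge> 0"
  shows "hm1norm L F \<le> C"
  unfolding hm1norm_def
proof (rule cSUP_least)
  have "h1norm L (\<lambda>x. 0) \<le> 1" by (rule h1norm_zero_le[OF L])
  then show "{u \<in> H10 L. h1norm L u \<le> 1} \<noteq> {}" using H10_zero[OF L] by blast
  fix u assume u: "u \<in> {u \<in> H10 L. h1norm L u \<le> 1}"
  then have "norm (F u) \<le> C * h1norm L u" using b by blast
  also have "\<dots> \<le> C * 1" using u C by (intro mult_left_mono) auto
  finally show "norm (F u) \<le> C" by simp
qed

lemma h1norm_nonneg: "0 \<le> h1norm L u"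
  by (simp add: h1norm_def)

lemma norm_le_hm1norm:
  assumes L: "L > 0" and b: "\<And>u. u \<in> H10 L \<Longrightarrow> norm (F u) \<le> C * h1norm L u" and C: "C \<ge> 0"
    and that: "u \<in> H10 L" "h1norm L u \<le> 1"
  shows "norm (F u) \<le> hm1norm L F"
  unfolding hm1norm_def
proof (rule cSUP_upper)
  show "u \<in> {u \<in> H10 L. h1norm L u \<le> 1}" using that by blast
  show "bdd_above ((\<lambda>u. norm (F u)) ` {u \<in> H10 L. h1norm L u \<le> 1})"
  proof (rule bdd_aboveI2)
    fix u assume u: "u \<in> {u \<in> H10 L. h1norm L u \<le> 1}"
    then have "norm (F u) \<le> C * h1norm L u" using b by blast
    also have "\<dots> \<le> C * 1" using u C by (intro mult_left_mono) auto
    finally show "norm (F u) \<le> C" by simp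
  qed
qed

lemma continuous_path_Psi:
  assumes L: "L > 0" and X: "continuous_on {0..T} X"
  shows "continuous_path (Hm1 L) (hm1norm L) T (\<lambda>t. Psi L (X t))"
  unfolding continuous_path_def
proof (intro conjI ballI)
  show "Psi L (X t) \<in> Hm1 L" for t by (rule Psi_Hm1[OF L])
  fix t assume t: "t \<in> {0..T}"
  have b: "norm (Psi L (X s) u - Psi L (X t) u) \<le> norm (X s - X t) * h1norm L u" if "u \<in> H10 L" for s u
    unfolding Psi_diff[symmetric] by (rule Psi_bound[OF L that])
  have "((\<lambda>s. norm (X s - X t)) \<longlongrightarrow> norm (X t - X t)) (at t within {0..T})"
    using X t by (intro tendsto_intros) (auto simp: continuous_on_def)
  then have lim: "((\<lambda>s. norm (X s - X t)) \<longlongrightarrow> 0) (at t within {0..T})" by simp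
  show "((\<lambda>s. hm1norm L (\<lambda>x. Psi L (X s) x - Psi L (X t) x)) \<longlongrightarrow> 0) (at t within {0..T})"
  proof (rule tendsto_sandwich[OF _ _ tendsto_const lim]; intro always_eventually allI)
    fix s
    show "hm1norm L (\<lambda>x. Psi L (X s) x - Psi L (X t) x) \<le> norm (X s - X t)"
      by (rule hm1norm_le[OF L b]) auto
    show "0 \<le> hm1norm L (\<lambda>x. Psi L (X s) x - Psi L (X t) x)"
      using norm_le_hm1norm[OF L b norm_ge_zero H10_zero[OF L] h1norm_zero_le[OF L], of s] norm_ge_zero order_trans by blast
  qed
qed

text \<open>The frequencies cancel in the pairing, which leaves the sine series of F u from
  \<open>Hm1_sums\<close>.\<close>

lemma Psi_coords:
  assumes L: "L > 0" and F: "F \<in> Hm1 L" and u: "u \<in> H10 L"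
  shows "Psi L (coords L F) u = F u"
proof -
  have n: "nth (coords L F) n = F (\<lambda>x. of_real (es L n x)) / of_real (freq L n)" for n
    unfolding coords_def by (simp add: nth_Ell2[OF Hm1_square_summable[OF F L]])
  have "nth (coords L F) n * cnj (nth (hat L u) n) = F (\<lambda>x. of_real (es L n x)) * cnj (coef L n u)" for n
    using freq_pos[OF L, of n] by (simp add: n hat(1)[OF L u])
  then show ?thesis
    using sums_unique[OF Hm1_sums[OF F L u]] by (simp add: Psi_def cinner_def)
qed

lemma nth_coords:
  assumes L: "L > 0" and F: "F \<in> Hm1 L"
  shows "nth (coords L F) n = F (\<lambda>x. of_real (es L n x)) / of_real (freq L n)"
  unfolding coords_def by (simp add: nth_Ell2[OF Hm1_square_summable[OF F L]])

section \<open>The adjoint evolution\<close>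

lemma Hm1I:
  assumes "\<And>u v c. u \<in> H10 L \<Longrightarrow> v \<in> H10 L \<Longrightarrow> F (\<lambda>x. u x + c * v x) = F u + cnj c * F v"
    and "\<And>u. u \<in> H10 L \<Longrightarrow> norm (F u) \<le> C * h1norm L u" and L: "L > 0"
  shows "F \<in> Hm1 L"
proof -
  have z: "F (\<lambda>x. 0) = 0" using assms(1)[OF H10_zero[OF L] H10_zero[OF L], of 1] by simp
  have "F (\<lambda>x. u x + v x) = F u + F v" if "u \<in> H10 L" "v \<in> H10 L" for u v
    using assms(1)[OF that, of 1] by simp
  moreover have "F (\<lambda>x. c * v x) = cnj c * F v" if "v \<in> H10 L" for v c
    using assms(1)[OF H10_zero[OF L] that, of c] z by simp
  ultimately show ?thesis unfolding Hm1_def using assms(2) by blast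
qed

lemma coef_le_l2norm:
  assumes L: "L > 0" and u: "u \<in> L2 (Om L)"
  shows "norm (coef L n u) \<le> l2norm (Om L) u"
proof -
  have "(\<Sum>i\<in>{n}. (norm (\<integral>x. es L i x *\<^sub>R u x \<partial>Om L))\<^sup>2) \<le> (\<integral>x. (norm (u x))\<^sup>2 \<partial>Om L)"
    by (rule bessel[OF finite_measure_Om borel_measurable_es abs_es_le[OF L] es_orthonormal[OF L] u]) simp
  then have "(norm (coef L n u))\<^sup>2 \<le> (l2norm (Om L) u)\<^sup>2" by (simp add: coef_def l2norm_square)
  then show ?thesis by (rule power2_le_imp_le) (rule l2norm_nonneg)
qed

lemma coef_cmult: "L > 0 \<Longrightarrow> u \<in> L2 (Om L) \<Longrightarrow> coef L n (\<lambda>x. c * u x) = c * coef L n u"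
  using coef_lincomb[of L "\<lambda>x. 0" u n c] L2_zero[of "Om L"] by (simp add: coef_def)

lemma es_wderiv:
  assumes L: "L > 0"
  shows "AE x in Om L. wderiv L (\<lambda>x. complex_of_real (es L n x)) x = of_real (freq L n * ec L n x)"
proof (rule H10I(2)[OF L])
  have p: "prim (\<lambda>x. complex_of_real (freq L n * ec L n x)) x = of_real (es L n x)" if "0 \<le> x" for x
    using prim_es_deriv[OF that, of L n] unfolding prim_def by (simp only: integral_complex_of_real)
  show "AE x in Om L. complex_of_real (es L n x) = prim (\<lambda>x. complex_of_real (freq L n * ec L n x)) x"
    by (intro AE_I2 p[symmetric]) auto
  show "prim (\<lambda>x. complex_of_real (freq L n * ec L n x)) L = 0" using p[of L] L by (simp add: es_boundary)
qed (intro L2_continuous continuous_intros)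

lemma path_coef_continuous:
  assumes L: "L > 0" and z: "continuous_path (H10 L) (h1norm L) T z"
  shows "continuous_on {0..T} (\<lambda>t. coef L n (z t))"
  unfolding continuous_on_def
proof
  fix t assume t: "t \<in> {0..T}"
  have H: "z s \<in> H10 L" if "s \<in> {0..T}" for s using z that by (auto simp: continuous_path_def)
  have lim: "((\<lambda>s. h1norm L (\<lambda>x. z s x - z t x) / freq L n) \<longlongrightarrow> 0 / freq L n) (at t within {0..T})"
    using z t freq_pos[OF L, of n] by (intro tendsto_divide tendsto_const) (auto simp: continuous_path_def)
  have b: "norm (coef L n (z s) - coef L n (z t)) \<le> h1norm L (\<lambda>x. z s x - z t x) / freq L n" if s: "s \<in> {0..T}" for s
  proof -
    have "freq L n * norm (coef L n (\<lambda>x. z s x + (-1) * z t x)) \<le> h1norm L (\<lambda>x. z s x + (-1) * z t x)"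
      by (rule norm_coef_le[OF L H10_lincomb(1)[OF L H[OF s] H[OF t]]])
    moreover have "coef L n (\<lambda>x. z s x + (-1) * z t x) = coef L n (z s) - coef L n (z t)"
      using coef_lincomb[OF L H10E(2)[OF L H[OF s]] H10E(2)[OF L H[OF t]], of n "-1"] by simp
    ultimately show ?thesis
      using freq_pos[OF L, of n] by (simp add: pos_le_divide_eq mult.commute)
  qed
  show "((\<lambda>s. coef L n (z s)) \<longlongrightarrow> coef L n (z t)) (at t within {0..T})"
  proof (rule LIM_zero_cancel, rule Lim_null_comparison)
    show "\<forall>\<^sub>F s in at t within {0..T}. norm (coef L n (z s) - coef L n (z t)) \<le> h1norm L (\<lambda>x. z s x - z t x) / freq L n"
      unfolding eventually_at_filter using b by (intro always_eventually) auto
    show "((\<lambda>s. h1norm L (\<lambda>x. z s x - z t x) / freq L n) \<longlongrightarrow> 0) (at t within {0..T})"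
      using lim by simp
  qed
qed

lemma AE_lebesgue_on_subset:
  fixes S T :: "real set"
  assumes "AE x in lebesgue_on T. P x" "S \<subseteq> T" "S \<in> sets lebesgue" "T \<in> sets lebesgue"
  shows "AE x in lebesgue_on S. P x"
  using assms(1) unfolding AE_lebesgue_on_iff[OF assms(3)] AE_lebesgue_on_iff[OF assms(4)]
  by eventually_elim (use assms(2) in auto)

text \<open>An equation that holds for almost every time, integrated, has a continuous right-hand
  side, so the coefficient is differentiable at every time.\<close>

lemma coef_derivative:
  assumes L: "L > 0" and z: "continuous_path (H10 L) (h1norm L) T z" and zw: "has_time_derivative L T z w"
    and g: "continuous_on {0..T} g" and ae: "AE r in lebesgue_on {0<..<T}. coef L n (w r) = g r" and t: "t \<in> {0..T}"
  shows "((\<lambda>t. coef L n (z t)) has_vector_derivative g t) (at t within {0..T})"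
proof (rule integral_equation_derivative[OF g _ t])
  fix t assume t: "0 \<le> t" "t \<le> T"
  have z2: "z s \<in> L2 (Om L)" if "s \<in> {0..T}" for s
    using z that H10E(2)[OF L] by (auto simp: continuous_path_def)
  note pair = time_derivative_pairing[OF L zw continuous_on_es[of _ L n] z2]
  have "coef L n (z t) - coef L n (z 0) = (\<integral>r. coef L n (w r) \<partial>lebesgue_on {0<..<t})"
    unfolding coef_def using pair(3)[of 0 t] t by simp
  also have "\<dots> = (\<integral>r. g r \<partial>lebesgue_on {0<..<t})"
  proof (rule integral_cong_AE)
    have "integrable (lebesgue_on {0<..<t}) (\<lambda>r. \<integral>x. es L n x *\<^sub>R w r x \<partial>Om L)"
      by (rule integrable_lebesgue_on_subset[OF pair(2)]) (use t in auto)
    then show "(\<lambda>r. coef L n (w r)) \<in> borel_measurable (lebesgue_on {0<..<t})"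
      unfolding coef_def by (rule borel_measurable_integrable)
    have "continuous_on {0..t} g" using g t by (auto intro: continuous_on_subset)
    then show "g \<in> borel_measurable (lebesgue_on {0<..<t})"
      by (rule borel_measurable_integrable[OF integrable_continuous_Om])
    show "AE r in lebesgue_on {0<..<t}. coef L n (w r) = g r"
      by (rule AE_lebesgue_on_subset[OF ae]) (use t in auto)
  qed
  finally show "coef L n (z t) - coef L n (z 0) = (\<integral>r. g r \<partial>lebesgue_on {0<..<t})" .
qed

lemma cnj_kk: "cnj (kk L m n (of_real t)) = kk L m n (of_real t)"
  by (simp add: kk_def exp_cnj)

text \<open>The explicit solution of a damped mode driven by all modes at once, by termwise
  differentiation of the kernels \<open>kk\<close>.\<close>

lemma coupling_series_derivative:
  fixes b :: "nat \<Rightarrow> complex" and n :: nat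
  assumes L: "L > 0" and b: "summable (\<lambda>m. norm (b m))"
  defines "S \<equiv> \<lambda>s. \<Sum>m. b m * kk L m n (of_real s)" and "F \<equiv> \<lambda>s. \<Sum>m. b m * exp (- of_real (eigval L m) * of_real s)"
  shows "\<And>s. s \<ge> 0 \<Longrightarrow> (S has_vector_derivative F s - of_real (eigval L n) * S s) (at s within {0..})"
    "continuous_on {0..} F" "\<And>s. s \<ge> 0 \<Longrightarrow> summable (\<lambda>m. b m * kk L m n (of_real s))"
proof -
  let ?f = "\<lambda>m z. b m * kk L m n z"
  let ?f' = "\<lambda>m z. b m * (exp (- of_real (eigval L m) * z) - of_real (eigval L n) * kk L m n z)"
  have e1: "norm (exp (- of_real (eigval L m) * complex_of_real s)) \<le> 1" if "s \<ge> 0" for m s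
    by (rule exp_eigval_le_1[OF L that])
  have se: "summable (\<lambda>m. b m * exp (- of_real (eigval L m) * complex_of_real s))" if "s \<ge> 0" for s
    by (rule summable_comparison_test'[OF b]) (use e1[OF that] in \<open>simp add: norm_mult mult_left_le\<close>)
  have sk: "summable (\<lambda>m. b m * kk L m n (of_real s))" if "s \<ge> 0" for s
  proof (rule summable_comparison_test')
    show "summable (\<lambda>m. norm (b m) * (4 / eigval L n))" by (rule summable_mult2[OF b])
    show "norm (b m * kk L m n (of_real s)) \<le> norm (b m) * (4 / eigval L n)" for m
      unfolding norm_mult by (intro mult_left_mono kk_real_bound[OF L that]) simp
  qed
  then show "\<And>s. s \<ge> 0 \<Longrightarrow> summable (\<lambda>m. b m * kk L m n (of_real s))" .
  show "continuous_on {0..} F"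
    unfolding F_def
  proof (rule continuous_on_suminf[OF _ _ b])
    show "continuous_on {0..} (\<lambda>s. b m * exp (- of_real (eigval L m) * complex_of_real s))" for m
      by (intro continuous_intros)
    show "norm (b m * exp (- of_real (eigval L m) * complex_of_real s)) \<le> norm (b m)" if "s \<in> {0..}" for m s
      using e1[of s m] that by (simp add: norm_mult mult_left_le)
  qed
  \<comment> \<open>The theorem on series of derivatives works in a field, so the half line of times
    is viewed as a convex set of complex numbers.\<close>
  let ?R = "complex_of_real ` {0..}"
  have conv: "convex ?R"
    by (intro convex_linear_image bounded_linear.linear[OF bounded_linear_of_real]) simp
  have "uniform_limit ?R (\<lambda>N z. \<Sum>m<N. ?f' m z) (\<lambda>z. \<Sum>m. ?f' m z) sequentially"
  proof (rule Weierstrass_m_test)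
    \<comment> \<open>5 = 1 + 4: the exponential is at most 1, and \<open>kk\<close> times its
      eigenvalue is at most 4.\<close>
    show "summable (\<lambda>m. norm (b m) * 5)" by (rule summable_mult2[OF b])
    fix m z assume "z \<in> ?R"
    then obtain s where s: "s \<ge> 0" "z = of_real s" by auto
    have "norm (of_real (eigval L n) * kk L m n z) \<le> eigval L n * (4 / eigval L n)"
      unfolding norm_mult s(2) using kk_real_bound[OF L s(1), of m n] eigval_pos[OF L, of n] by (intro mult_mono) auto
    also have "\<dots> = 4" using eigval_pos[OF L, of n] by simp
    finally have "norm (exp (- of_real (eigval L m) * z) - of_real (eigval L n) * kk L m n z) \<le> 1 + 4"
      using norm_triangle_ineq4[of "exp (- of_real (eigval L m) * z)" "of_real (eigval L n) * kk L m n z"] e1[OF s(1), of m, folded s(2)] by linarith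
    then show "norm (?f' m z) \<le> norm (b m) * 5" unfolding norm_mult by (intro mult_left_mono) auto
  qed
  note unif = this
  have "\<exists>g. \<forall>z\<in>?R. (\<lambda>m. ?f m z) sums g z \<and> (g has_field_derivative (\<Sum>m. ?f' m z)) (at z within ?R)"
  proof (rule has_field_derivative_series[OF conv _ unif])
    show "(?f m has_field_derivative ?f' m z) (at z within ?R)" for m z
      by (rule DERIV_cmult[OF has_field_derivative_at_within[OF kk_deriv[OF L]]])
    show "0 \<in> ?R" by (auto simp: image_iff)
    show "summable (\<lambda>m. ?f m 0)" using sk[of 0] by simp
  qed
  then obtain g where g: "\<forall>z\<in>?R. (\<lambda>m. ?f m z) sums g z \<and> (g has_field_derivative (\<Sum>m. ?f' m z)) (at z within ?R)" ..
  fix s :: real assume s: "s \<ge> 0"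
  have sR: "of_real s \<in> ?R" using s by simp
  have "((g \<circ> complex_of_real) has_vector_derivative 1 * (\<Sum>m. ?f' m (of_real s))) (at s within {0..})"
    using conjunct2[OF bspec[OF g sR]] has_vector_derivative_of_real[OF DERIV_ident, of "at s within {0..}"]
    by (intro field_vector_diff_chain_within) auto
  moreover have "(\<Sum>m. ?f' m (of_real s)) = F s - of_real (eigval L n) * S s"
  proof -
    have "(\<Sum>m. ?f' m (of_real s)) = (\<Sum>m. b m * exp (- of_real (eigval L m) * of_real s) - of_real (eigval L n) * (b m * kk L m n (of_real s)))"
      by (intro suminf_cong) (simp add: algebra_simps)
    then show ?thesis
      using suminf_diff[OF se[OF s] summable_mult[OF sk[OF s], of "of_real (eigval L n)"]] suminf_mult[OF sk[OF s], of "of_real (eigval L n)"]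
      by (simp add: F_def S_def)
  qed
  ultimately have d: "((g \<circ> complex_of_real) has_vector_derivative F s - of_real (eigval L n) * S s) (at s within {0..})" by simp
  have eq: "S r = (g \<circ> complex_of_real) r" if "r \<in> {0..}" for r
    using sums_unique[OF conjunct1[OF bspec[OF g, of "of_real r"]]] that by (simp add: S_def)
  show "(S has_vector_derivative F s - of_real (eigval L n) * S s) (at s within {0..})"
    by (rule has_vector_derivative_transform[OF _ eq d]) (use s in auto)
qed

section \<open>The adjoint source in the sine basis\<close>

locale parabolic_system =
  fixes L M :: real and G A :: "real \<Rightarrow> real"
  assumes L: "L > 0"
    and Gm: "G \<in> borel_measurable (Om L)" and GM: "AE x in Om L. \<bar>G x\<bar> \<le> M"
    and Am: "A \<in> borel_measurable (Om L)" and AM: "AE x in Om L. \<bar>A x\<bar> \<le> M"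
begin

text \<open>The term by which the second adjoint component drives the first; A stands for a -
  G'.\<close>

definition src :: "(real \<Rightarrow> complex) \<Rightarrow> real \<Rightarrow> complex" where
  "src u x = - of_real (G x) * wderiv L u x + of_real (A x) * u x"

definition \<beta> :: "nat \<Rightarrow> nat \<Rightarrow> real" where
  "\<beta> m n = (\<integral>x. (- G x * (freq L m * ec L m x) + A x * es L m x) * es L n x \<partial>Om L)"

text \<open>A negative bound would make every statement hold almost everywhere on an interval of
  positive length.\<close>

lemma M_nonneg: "M \<ge> 0"
proof (rule ccontr)
  assume "\<not> M \<ge> 0"
  then have "AE x in Om L. (0::real) = 1" using GM by (auto elim!: AE_mp)
  then have "(0::real) = 1"
    using continuous_AE_eq_imp_eq[OF L, of "\<lambda>_. 0::real" "\<lambda>_. 1" 0] L by simp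
  then show False by simp
qed

lemma src_parts:
  assumes u: "u \<in> H10 L"
  shows "(\<lambda>x. - of_real (G x) * wderiv L u x) \<in> L2 (Om L)" "(\<lambda>x. of_real (A x) * u x) \<in> L2 (Om L)"
proof -
  have "(\<lambda>x. (-1) * (G x *\<^sub>R wderiv L u x)) \<in> L2 (Om L)"
    by (intro L2_cmult L2_bounded_scaleR[OF H10E(3)[OF L u] Gm GM])
  then show "(\<lambda>x. - of_real (G x) * wderiv L u x) \<in> L2 (Om L)" by (simp add: scaleR_conv_of_real)
  have "(\<lambda>x. A x *\<^sub>R u x) \<in> L2 (Om L)" by (rule L2_bounded_scaleR[OF H10E(2)[OF L u] Am AM])
  then show "(\<lambda>x. of_real (A x) * u x) \<in> L2 (Om L)" by (simp add: scaleR_conv_of_real)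
qed

lemma src_L2: "u \<in> H10 L \<Longrightarrow> src u \<in> L2 (Om L)"
  unfolding src_def[abs_def] by (intro L2_add src_parts)

lemma l2norm_src_le:
  assumes u: "u \<in> H10 L"
  shows "l2norm (Om L) (src u) \<le> 2 * M * h1norm L u"
proof -
  note U = H10E[OF L u]
  have "(l2norm (Om L) (src u))\<^sup>2 \<le> (\<integral>x. (2 * M\<^sup>2) * (norm (wderiv L u x))\<^sup>2 + (2 * M\<^sup>2) * (norm (u x))\<^sup>2 \<partial>Om L)"
    unfolding l2norm_square
  proof (rule integral_mono_AE)
    show "integrable (Om L) (\<lambda>x. (norm (src u x))\<^sup>2)" by (rule L2D(2)[OF src_L2[OF u]])
    show "integrable (Om L) (\<lambda>x. (2 * M\<^sup>2) * (norm (wderiv L u x))\<^sup>2 + (2 * M\<^sup>2) * (norm (u x))\<^sup>2)"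
      using L2D(2)[OF U(3)] L2D(2)[OF U(2)] by simp
    show "AE x in Om L. (norm (src u x))\<^sup>2 \<le> (2 * M\<^sup>2) * (norm (wderiv L u x))\<^sup>2 + (2 * M\<^sup>2) * (norm (u x))\<^sup>2"
      using GM AM
    proof eventually_elim
      case (elim x)
      have "norm (src u x) \<le> \<bar>G x\<bar> * norm (wderiv L u x) + \<bar>A x\<bar> * norm (u x)"
        using norm_triangle_ineq[of "- of_real (G x) * wderiv L u x" "of_real (A x) * u x"] by (simp add: src_def norm_mult)
      also have "\<dots> \<le> M * norm (wderiv L u x) + M * norm (u x)"
        using elim by (intro add_mono mult_right_mono) auto
      finally have "(norm (src u x))\<^sup>2 \<le> (M * norm (wderiv L u x) + M * norm (u x))\<^sup>2" by (intro power_mono) auto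
      also have "\<dots> \<le> 2 * (M * norm (wderiv L u x))\<^sup>2 + 2 * (M * norm (u x))\<^sup>2"
        using sum_squares_bound[of "M * norm (wderiv L u x)" "M * norm (u x)"] unfolding power2_sum by linarith
      finally show ?case by (simp add: power_mult_distrib)
    qed
  qed
  also have "\<dots> = 2 * M\<^sup>2 * (h1norm L u)\<^sup>2"
    using L2D(2)[OF U(3)] L2D(2)[OF U(2)] by (simp add: h1norm_def l2norm_square distrib_left)
  also have "\<dots> \<le> (2 * M * h1norm L u)\<^sup>2" by (simp add: power_mult_distrib mult_right_mono)
  finally show ?thesis by (rule power2_le_imp_le) (use M_nonneg h1norm_nonneg in simp)
qed

lemma src_es: "coef L n (src (\<lambda>x. of_real (es L m x))) = of_real (\<beta> m n)"
proof -
  have "coef L n (src (\<lambda>x. of_real (es L m x))) =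
     (\<integral>x. complex_of_real ((- G x * (freq L m * ec L m x) + A x * es L m x) * es L n x) \<partial>Om L)"
    unfolding coef_def
  proof (rule integral_Om_cong_AE)
    show "AE x in Om L. es L n x *\<^sub>R src (\<lambda>x. of_real (es L m x)) x = complex_of_real ((- G x * (freq L m * ec L m x) + A x * es L m x) * es L n x)"
      using es_wderiv[OF L, of m] by eventually_elim (simp add: src_def scaleR_conv_of_real algebra_simps)
    show "(\<lambda>x. es L n x *\<^sub>R src (\<lambda>x. of_real (es L m x)) x) \<in> borel_measurable (Om L)"
      by (intro borel_measurable_scaleR borel_measurable_es L2D(1)[OF src_L2[OF es_H10[OF L]]])
  qed
  then show ?thesis unfolding \<beta>_def by (simp only: integral_complex_of_real)
qed

text \<open>The coefficient of the source is a bounded linear functional of u, so its sine expansion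
  is \<open>Hm1_sums\<close>. The conjugation fits the convention that dual elements are conjugate
  linear.\<close>

lemma src_coef_sums:
  assumes u: "u \<in> H10 L"
  shows "(\<lambda>m. of_real (\<beta> m n) * coef L m u) sums coef L n (src u)"
proof -
  define F where "F u = cnj (coef L n (src u))" for u
  have "F \<in> Hm1 L"
  proof (rule Hm1I[OF _ _ L])
    fix u v c assume u: "u \<in> H10 L" and v: "v \<in> H10 L"
    have "coef L n (src (\<lambda>x. u x + c * v x)) = coef L n (\<lambda>x. src u x + c * src v x)"
    proof (rule coef_cong_AE)
      show "AE x in Om L. src (\<lambda>x. u x + c * v x) x = src u x + c * src v x"
        using H10_lincomb(2)[OF L u v, of c] by eventually_elim (simp add: src_def algebra_simps)
      show "src (\<lambda>x. u x + c * v x) \<in> L2 (Om L)" by (rule src_L2[OF H10_lincomb(1)[OF L u v]])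
      show "(\<lambda>x. src u x + c * src v x) \<in> L2 (Om L)" by (intro L2_add L2_cmult src_L2 u v)
    qed
    then show "F (\<lambda>x. u x + c * v x) = F u + cnj c * F v"
      by (simp add: F_def coef_lincomb[OF L src_L2[OF u] src_L2[OF v]])
  next
    fix u assume u: "u \<in> H10 L"
    show "norm (F u) \<le> (2 * M) * h1norm L u"
      using order_trans[OF coef_le_l2norm[OF L src_L2[OF u], of n] l2norm_src_le[OF u]] by (simp add: F_def)
  qed
  from Hm1_sums[OF this L u] have "(\<lambda>m. cnj (of_real (\<beta> m n) * coef L m u)) sums cnj (coef L n (src u))"
    by (simp add: F_def src_es)
  then show ?thesis by (simp only: sums_cnj)
qed

lemma bounded_times_orthonormal:
  fixes g e :: "real \<Rightarrow> real"
  assumes g: "g \<in> borel_measurable (Om L)" "AE x in Om L. \<bar>g x\<bar> \<le> M" and e: "continuous_on {0..L} e" "(\<integral>x. e x * e x \<partial>Om L) = 1"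
  shows "(\<lambda>x. complex_of_real (g x * e x)) \<in> L2 (Om L)" "(\<integral>x. (norm (complex_of_real (g x * e x)))\<^sup>2 \<partial>Om L) \<le> M\<^sup>2"
proof -
  have ec: "(\<lambda>x. complex_of_real (e x)) \<in> L2 (Om L)" by (intro L2_continuous continuous_intros e)
  have "(\<lambda>x. g x *\<^sub>R complex_of_real (e x)) \<in> L2 (Om L)" by (rule L2_bounded_scaleR[OF ec g])
  then show l: "(\<lambda>x. complex_of_real (g x * e x)) \<in> L2 (Om L)" by (simp add: scaleR_conv_of_real)
  have i: "integrable (Om L) (\<lambda>x. e x * e x)" by (intro integrable_continuous_Om continuous_intros e)
  have "(\<integral>x. (norm (complex_of_real (g x * e x)))\<^sup>2 \<partial>Om L) \<le> (\<integral>x. M\<^sup>2 * (e x * e x) \<partial>Om L)"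
  proof (rule integral_mono_AE[OF L2D(2)[OF l]])
    show "integrable (Om L) (\<lambda>x. M\<^sup>2 * (e x * e x))" using i by simp
    show "AE x in Om L. (norm (complex_of_real (g x * e x)))\<^sup>2 \<le> M\<^sup>2 * (e x * e x)"
      using g(2)
    proof eventually_elim
      case (elim x)
      then have "(g x)\<^sup>2 \<le> M\<^sup>2" by (rule abs_le_square_iff[THEN iffD1, of _ M, OF order_trans[OF _ abs_ge_self]])
      then have "(g x)\<^sup>2 * (e x)\<^sup>2 \<le> M\<^sup>2 * (e x)\<^sup>2" by (rule mult_right_mono) simp
      then show ?case by (simp only: norm_of_real power2_abs power_mult_distrib) (simp add: power2_eq_square)
    qed
  qed
  also have "\<dots> = M\<^sup>2" using e(2) by simp
  finally show "(\<integral>x. (norm (complex_of_real (g x * e x)))\<^sup>2 \<partial>Om L) \<le> M\<^sup>2" .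
qed

text \<open>The first integral is a cosine coefficient in m of - G times a sine, the second a sine
  coefficient in m damped by the frequency; this exposes both to Bessel's inequality.\<close>

lemma beta_split: "complex_of_real (\<beta> m n / freq L m) = (\<integral>x. complex_of_real (ec L m x * (- G x * es L n x)) \<partial>Om L) +
    of_real (1 / freq L m) * (\<integral>x. complex_of_real (es L m x * (A x * es L n x)) \<partial>Om L)"
  and beta_split_integrable: "integrable (Om L) (\<lambda>x. ec L m x * (- G x * es L n x))" "integrable (Om L) (\<lambda>x. es L m x * (A x * es L n x))"
proof -
  have b1: "AE x in Om L. \<bar>- G x\<bar> \<le> M" using GM by simp
  have m1: "(\<lambda>x. - G x) \<in> borel_measurable (Om L)" using Gm by simp
  note g1 = bounded_times_orthonormal[OF m1 b1 continuous_on_es[of _ L n]]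
  note g2 = bounded_times_orthonormal[OF Am AM continuous_on_es[of _ L n]]
  have on: "(\<integral>x. es L n x * es L n x \<partial>Om L) = 1" using es_orthonormal[OF L, of n n] by simp
  have "integrable (Om L) (\<lambda>x. ec L m x *\<^sub>R complex_of_real (- G x * es L n x))"
    by (rule ec_scaleR_integrable[OF L g1(1)[OF on]])
  from integrable_Re[OF this] show i1: "integrable (Om L) (\<lambda>x. ec L m x * (- G x * es L n x))" by simp
  have "integrable (Om L) (\<lambda>x. es L m x *\<^sub>R complex_of_real (A x * es L n x))"
    by (rule es_scaleR_integrable[OF L g2(1)[OF on]])
  from integrable_Re[OF this] show i2: "integrable (Om L) (\<lambda>x. es L m x * (A x * es L n x))" by simp
  have "\<beta> m n = (\<integral>x. freq L m * (ec L m x * (- G x * es L n x)) + es L m x * (A x * es L n x) \<partial>Om L)"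
    unfolding \<beta>_def by (intro Bochner_Integration.integral_cong) (simp_all add: algebra_simps)
  also have "\<dots> = freq L m * (\<integral>x. ec L m x * (- G x * es L n x) \<partial>Om L) + (\<integral>x. es L m x * (A x * es L n x) \<partial>Om L)"
    using i1 i2 by simp
  finally have "\<beta> m n / freq L m = (\<integral>x. ec L m x * (- G x * es L n x) \<partial>Om L) + (1 / freq L m) * (\<integral>x. es L m x * (A x * es L n x) \<partial>Om L)"
    using freq_pos[OF L, of m] by (simp add: field_simps)
  then show "complex_of_real (\<beta> m n / freq L m) = (\<integral>x. complex_of_real (ec L m x * (- G x * es L n x)) \<partial>Om L) +
    of_real (1 / freq L m) * (\<integral>x. complex_of_real (es L m x * (A x * es L n x)) \<partial>Om L)"
    unfolding integral_complex_of_real by (simp only: of_real_add of_real_mult)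
qed

lemma norm_sum_square_le: "(norm (a + b))\<^sup>2 \<le> 2 * (norm a)\<^sup>2 + 2 * (norm b)\<^sup>2" for a b :: complex
proof -
  have "(norm (a + b))\<^sup>2 \<le> (norm a + norm b)\<^sup>2" by (intro power_mono norm_triangle_ineq) auto
  then show ?thesis using sum_squares_bound[of "norm a" "norm b"] unfolding power2_sum by linarith
qed

lemma inverse_freq_le: "1 / freq L m \<le> 1 / freq L 0"
  using freq_pos[OF L, of 0] L by (intro divide_left_mono mult_pos_pos freq_pos) (auto simp: freq_def divide_right_mono)

text \<open>For fixed n, Bessel in m applies to - G \<open>es L n\<close> against cosines and to A
  \<open>es L n\<close> against sines. For fixed m, Bessel in n against sines applies to - G
  \<open>ec L m\<close> and A \<open>es L m\<close>. The factors 2 come from squaring a sum of two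
  terms.\<close>

sublocale coupling L "2 * M\<^sup>2 + 2 * (M / freq L 0)\<^sup>2" \<beta>
proof
  have sq: "(\<beta> m n / freq L m)\<^sup>2 = (norm (complex_of_real (\<beta> m n / freq L m)))\<^sup>2" for m n
    by (simp only: norm_of_real power2_abs)
  have ons: "(\<integral>x. es L n x * es L n x \<partial>Om L) = 1" "(\<integral>x. ec L n x * ec L n x \<partial>Om L) = 1" for n
    using es_orthonormal[OF L, of n n] ec_orthonormal[OF L, of n n] by simp_all
  have b1: "AE x in Om L. \<bar>- G x\<bar> \<le> M" using GM by simp
  have m1: "(\<lambda>x. - G x) \<in> borel_measurable (Om L)" using Gm by simp
  have if0: "0 \<le> 1 / freq L m" for m using freq_pos[OF L, of m] by simp
  have scale: "(norm (of_real (1 / freq L m) * z))\<^sup>2 \<le> (1 / freq L 0)\<^sup>2 * (norm z)\<^sup>2" for m and z :: complex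
    unfolding norm_mult norm_of_real power_mult_distrib power2_abs
    using power_mono[OF inverse_freq_le[of m] if0[of m], of 2] by (rule mult_right_mono) simp
  show "0 < L" by (rule L)
  show "(\<Sum>m<N. (\<beta> m n / freq L m)\<^sup>2) \<le> 2 * M\<^sup>2 + 2 * (M / freq L 0)\<^sup>2" for n N
  proof -
    note g1 = bounded_times_orthonormal[OF m1 b1 continuous_on_es[of _ L n] ons(1)[of n]]
    note g2 = bounded_times_orthonormal[OF Am AM continuous_on_es[of _ L n] ons(1)[of n]]
    let ?a = "\<lambda>m. \<integral>x. ec L m x *\<^sub>R complex_of_real (- G x * es L n x) \<partial>Om L"
    let ?b = "\<lambda>m. \<integral>x. es L m x *\<^sub>R complex_of_real (A x * es L n x) \<partial>Om L"
    have "(\<Sum>m<N. (\<beta> m n / freq L m)\<^sup>2) \<le> (\<Sum>m<N. 2 * (norm (?a m))\<^sup>2 + 2 * ((1 / freq L 0)\<^sup>2 * (norm (?b m))\<^sup>2))"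
    proof (rule sum_mono)
      fix m
      have "complex_of_real (\<beta> m n / freq L m) = ?a m + of_real (1 / freq L m) * ?b m"
        unfolding beta_split by (simp only: scaleR_conv_of_real of_real_mult)
      then show "(\<beta> m n / freq L m)\<^sup>2 \<le> 2 * (norm (?a m))\<^sup>2 + 2 * ((1 / freq L 0)\<^sup>2 * (norm (?b m))\<^sup>2)"
        unfolding sq using norm_sum_square_le[of "?a m" "of_real (1 / freq L m) * ?b m"] scale[of m "?b m"] by simp
    qed
    also have "\<dots> = 2 * (\<Sum>m<N. (norm (?a m))\<^sup>2) + 2 * (1 / freq L 0)\<^sup>2 * (\<Sum>m<N. (norm (?b m))\<^sup>2)"
      by (simp add: sum.distrib sum_distrib_left mult.assoc)
    also have "\<dots> \<le> 2 * M\<^sup>2 + 2 * (1 / freq L 0)\<^sup>2 * M\<^sup>2"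
    proof (intro add_mono mult_left_mono)
      have ecm: "ec L i \<in> borel_measurable (Om L)" for i
        by (intro borel_measurable_continuous_Om continuous_intros)
      show "(\<Sum>m<N. (norm (?a m))\<^sup>2) \<le> M\<^sup>2"
        using bessel[OF finite_measure_Om ecm abs_ec_le[OF L] ec_orthonormal[OF L] g1(1) finite_lessThan, of N] g1(2) by linarith
      show "(\<Sum>m<N. (norm (?b m))\<^sup>2) \<le> M\<^sup>2"
        using bessel[OF finite_measure_Om borel_measurable_es abs_es_le[OF L] es_orthonormal[OF L] g2(1) finite_lessThan, of N] g2(2) by linarith
    qed simp_all
    finally show ?thesis by (simp add: power_divide)
  qed
  show "(\<Sum>n<N. (\<beta> m n / freq L m)\<^sup>2) \<le> 2 * M\<^sup>2 + 2 * (M / freq L 0)\<^sup>2" for m N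
  proof -
    note g1 = bounded_times_orthonormal[OF m1 b1 continuous_on_ec[of _ L m] ons(2)[of m]]
    note g2 = bounded_times_orthonormal[OF Am AM continuous_on_es[of _ L m] ons(1)[of m]]
    let ?a = "\<lambda>n. \<integral>x. es L n x *\<^sub>R complex_of_real (- G x * ec L m x) \<partial>Om L"
    let ?b = "\<lambda>n. \<integral>x. es L n x *\<^sub>R complex_of_real (A x * es L m x) \<partial>Om L"
    have "(\<Sum>n<N. (\<beta> m n / freq L m)\<^sup>2) \<le> (\<Sum>n<N. 2 * (norm (?a n))\<^sup>2 + 2 * ((1 / freq L 0)\<^sup>2 * (norm (?b n))\<^sup>2))"
    proof (rule sum_mono)
      fix n
      have "complex_of_real (\<beta> m n / freq L m) = ?a n + of_real (1 / freq L m) * ?b n"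
        unfolding beta_split
        by (intro arg_cong2[where f="(+)"] arg_cong2[where f="(*)"] refl Bochner_Integration.integral_cong)
           (simp_all add: scaleR_conv_of_real)
      then show "(\<beta> m n / freq L m)\<^sup>2 \<le> 2 * (norm (?a n))\<^sup>2 + 2 * ((1 / freq L 0)\<^sup>2 * (norm (?b n))\<^sup>2)"
        unfolding sq using norm_sum_square_le[of "?a n" "of_real (1 / freq L m) * ?b n"] scale[of m "?b n"] by simp
    qed
    also have "\<dots> = 2 * (\<Sum>n<N. (norm (?a n))\<^sup>2) + 2 * (1 / freq L 0)\<^sup>2 * (\<Sum>n<N. (norm (?b n))\<^sup>2)"
      by (simp add: sum.distrib sum_distrib_left mult.assoc)
    also have "\<dots> \<le> 2 * M\<^sup>2 + 2 * (1 / freq L 0)\<^sup>2 * M\<^sup>2"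
    proof (intro add_mono mult_left_mono)
      show "(\<Sum>n<N. (norm (?a n))\<^sup>2) \<le> M\<^sup>2"
        using bessel[OF finite_measure_Om borel_measurable_es abs_es_le[OF L] es_orthonormal[OF L] g1(1) finite_lessThan, of N] g1(2) by linarith
      show "(\<Sum>n<N. (norm (?b n))\<^sup>2) \<le> M\<^sup>2"
        using bessel[OF finite_measure_Om borel_measurable_es abs_es_le[OF L] es_orthonormal[OF L] g2(1) finite_lessThan, of N] g2(2) by linarith
    qed simp_all
    finally show ?thesis by (simp add: power_divide)
  qed
qed

lemma beta_coef_summable:
  assumes "u \<in> H10 L"
  shows "summable (\<lambda>m. norm (of_real (\<beta> m n) * coef L m u))"
proof -
  have "(\<Sum>m. (norm (nth (hat L u) m))\<^sup>2) \<le> (\<Sum>m. (norm (nth (hat L u) m))\<^sup>2)" by simp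
  from suminf_Cauchy_Schwarz(1)[OF bb_row nth_summable[of "hat L u"] this, of n]
  show ?thesis using freq_pos[OF L] by (simp add: hat[OF L assms] bb_def norm_mult abs_mult less_imp_neq[symmetric])
qed

text \<open>Each sine coefficient solves a scalar equation, homogeneous for the second component and
  forced by the source for the first. Its difference from the explicit formula solves the
  homogeneous equation with final value zero.\<close>

lemma adjoint_coef:
  assumes sol: "adjoint_solution L G a \<tau> \<zeta>1 \<zeta>2 z1 z2" and A: "A = (\<lambda>x. a x - wderiv L G x)"
    and \<zeta>: "\<zeta>1 \<in> H10 L" "\<zeta>2 \<in> H10 L" and \<tau>: "\<tau> \<ge> 0" and c: "c \<in> {0..\<tau>}"
  shows "coef L n (z2 c) = exp (- of_real (eigval L n) * of_real (\<tau> - c)) * coef L n \<zeta>2" (is ?q)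
    "coef L n (z1 c) = exp (- of_real (eigval L n) * of_real (\<tau> - c)) * coef L n \<zeta>1 +
       (\<Sum>m. of_real (\<beta> m n) * coef L m \<zeta>2 * kk L m n (of_real (\<tau> - c)))" (is ?p)
proof -
  have p1: "continuous_path (H10 L) (h1norm L) \<tau> z1" and p2: "continuous_path (H10 L) (h1norm L) \<tau> z2"
    and f1: "AE x in Om L. z1 \<tau> x = \<zeta>1 x" and f2: "AE x in Om L. z2 \<tau> x = \<zeta>2 x"
    using sol by (auto simp: adjoint_solution_def)
  obtain w1 w2 where D: "has_time_derivative L \<tau> z1 w1" "has_time_derivative L \<tau> z2 w2"
    and E: "AE t in lebesgue_on {0<..<\<tau>}. z1 t \<in> H2 L \<and> z2 t \<in> H2 L \<and>
           (AE x in Om L. - w1 t x = laplacian L (z1 t) x - of_real (G x) * wderiv L (z2 t) x + of_real (a x - wderiv L G x) * z2 t x) \<and>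
           (AE x in Om L. - w2 t x = laplacian L (z2 t) x)"
    using sol unfolding adjoint_solution_def by blast
  have H: "z1 t \<in> H10 L" "z2 t \<in> H10 L" if "t \<in> {0..\<tau>}" for t
    using p1 p2 that by (auto simp: continuous_path_def)
  have l1: "z1 t \<in> L2 (Om L)" and l2: "z2 t \<in> L2 (Om L)" if "t \<in> {0..\<tau>}" for t
    using H10E(2)[OF L] H[OF that] by auto
  have w: "AE t in lebesgue_on {0<..<\<tau>}. w1 t \<in> L2 (Om L)" "AE t in lebesgue_on {0<..<\<tau>}. w2 t \<in> L2 (Om L)"
    using time_derivative_pairing(1)[OF L D(1) continuous_on_es l1] time_derivative_pairing(1)[OF L D(2) continuous_on_es l2] by auto
  have inI: "AE t in lebesgue_on {0<..<\<tau>}. t \<in> {0<..<\<tau>}" by (intro AE_I2) simp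
  have fin: "coef L n (z1 \<tau>) = coef L n \<zeta>1" "coef L n (z2 \<tau>) = coef L n \<zeta>2" for n
    using coef_cong_AE[OF f1 l1 H10E(2)[OF L \<zeta>(1)]] coef_cong_AE[OF f2 l2 H10E(2)[OF L \<zeta>(2)]] \<tau> by auto
  have q: "coef L n (z2 c) = exp (- of_real (eigval L n) * of_real (\<tau> - c)) * coef L n \<zeta>2" if c: "c \<in> {0..\<tau>}" for c n
  proof -
    have ae: "AE r in lebesgue_on {0<..<\<tau>}. coef L n (w2 r) = of_real (eigval L n) * coef L n (z2 r)"
      using E w(2) inI
    proof eventually_elim
      case (elim r)
      then have r: "r \<in> {0..\<tau>}" and h: "z2 r \<in> H2 L" and eq: "AE x in Om L. - w2 r x = laplacian L (z2 r) x" by auto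
      have lap: "laplacian L (z2 r) \<in> L2 (Om L)" by (rule H2_H1_deriv(1)[OF L h])
      have "AE x in Om L. w2 r x = (-1) * laplacian L (z2 r) x"
        using eq
      proof eventually_elim
        case (elim x)
        then show ?case by (simp flip: elim)
      qed
      from coef_cong_AE[OF this elim(2) L2_cmult[OF lap]] show ?case
        by (simp only: coef_cmult[OF L lap] H2_coef_laplacian[OF L h H(2)[OF r]]) simp
    qed
    have cq: "continuous_on {0..\<tau>} (\<lambda>r. of_real (eigval L n) * coef L n (z2 r))"
      by (intro continuous_intros path_coef_continuous[OF L p2])
    \<comment> \<open>The defect between the coefficient and its predicted exponential; it vanishes
      at \<tau> by construction.\<close>
    define d where "d r = coef L n (z2 r) - exp (- of_real (eigval L n) * of_real (\<tau> - r)) * coef L n (z2 \<tau>)" for r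
    have "d c = 0"
    proof (rule linear_ode_zero[where k="eigval L n", OF _ _ c])
      fix t assume t: "t \<in> {0..\<tau>}"
      have "((\<lambda>r. of_real (exp (- eigval L n * (\<tau> - r)))) has_vector_derivative of_real (eigval L n * exp (- eigval L n * (\<tau> - t)))) (at t within {0..\<tau>})"
        by (rule has_vector_derivative_of_real) (auto intro!: derivative_eq_intros)
      from has_vector_derivative_diff[OF coef_derivative[OF L p2 D(2) cq ae t] has_vector_derivative_mult_left[OF this, of "coef L n (z2 \<tau>)"]]
      show "(d has_vector_derivative of_real (eigval L n) * d t) (at t within {0..\<tau>})"
        by (simp add: d_def[abs_def] algebra_simps exp_of_real[symmetric])
    qed (simp add: d_def)
    then show ?thesis by (simp add: d_def fin)
  qed
  show ?q by (rule q[OF c])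
  define b where "b m = of_real (\<beta> m n) * coef L m \<zeta>2" for m
  have b: "summable (\<lambda>m. norm (b m))" unfolding b_def by (rule beta_coef_summable[OF \<zeta>(2)])
  define S where "S s = (\<Sum>m. b m * kk L m n (of_real s))" for s
  define F where "F s = (\<Sum>m. b m * exp (- of_real (eigval L m) * of_real s))" for s
  note ser = coupling_series_derivative(1)[OF L b, where n=n, folded S_def F_def] coupling_series_derivative(2)[OF L b, folded F_def]
  \<comment> \<open>With the second component known, the forcing is an explicit series in the
    remaining time \<tau> - r.\<close>
  have sF: "coef L n (src (z2 r)) = F (\<tau> - r)" if "r \<in> {0..\<tau>}" for r
    using sums_unique[OF src_coef_sums[OF H(2)[OF that], of n]] by (simp add: F_def b_def q[OF that] mult_ac)
  have ae: "AE r in lebesgue_on {0<..<\<tau>}. coef L n (w1 r) = of_real (eigval L n) * coef L n (z1 r) - F (\<tau> - r)"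
    using E w(1) inI
  proof eventually_elim
    case (elim r)
    then have r: "r \<in> {0..\<tau>}" and h: "z1 r \<in> H2 L"
      and eq: "AE x in Om L. - w1 r x = laplacian L (z1 r) x - of_real (G x) * wderiv L (z2 r) x + of_real (a x - wderiv L G x) * z2 r x" by auto
    have lap: "laplacian L (z1 r) \<in> L2 (Om L)" by (rule H2_H1_deriv(1)[OF L h])
    have s2: "src (z2 r) \<in> L2 (Om L)" by (rule src_L2[OF H(2)[OF r]])
    have "AE x in Om L. w1 r x = (-1) * laplacian L (z1 r) x + (-1) * src (z2 r) x"
      using eq
    proof eventually_elim
      case (elim x)
      have "w1 r x = - (- w1 r x)" by simp
      also have "\<dots> = (-1) * laplacian L (z1 r) x + (-1) * src (z2 r) x"
        unfolding elim by (simp add: src_def fun_cong[OF A])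
      finally show ?case .
    qed
    from coef_cong_AE[OF this elim(2) L2_add[OF L2_cmult[OF lap] L2_cmult[OF s2]]] show ?case
      by (simp only: coef_lincomb[OF L L2_cmult[OF lap] s2] coef_cmult[OF L lap] H2_coef_laplacian[OF L h H(1)[OF r]] sF[OF r]) simp
  qed
  have Fc: "continuous_on {0..\<tau>} (\<lambda>r. F (\<tau> - r))"
    by (rule continuous_on_compose2[OF ser(2)]) (auto intro!: continuous_intros)
  have cp: "continuous_on {0..\<tau>} (\<lambda>r. of_real (eigval L n) * coef L n (z1 r) - F (\<tau> - r))"
    by (intro continuous_intros path_coef_continuous[OF L p1] Fc)
  define d where "d r = coef L n (z1 r) - exp (- of_real (eigval L n) * of_real (\<tau> - r)) * coef L n (z1 \<tau>) - S (\<tau> - r)" for r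
  have "d c = 0"
  proof (rule linear_ode_zero[where k="eigval L n", OF _ _ c])
    fix t assume t: "t \<in> {0..\<tau>}"
    have e: "((\<lambda>r. of_real (exp (- eigval L n * (\<tau> - r)))) has_vector_derivative of_real (eigval L n * exp (- eigval L n * (\<tau> - t)))) (at t within {0..\<tau>})"
      by (rule has_vector_derivative_of_real) (auto intro!: derivative_eq_intros)
    have "((\<lambda>r. \<tau> - r) has_vector_derivative - 1) (at t within {0..\<tau>})"
      by (auto intro!: derivative_eq_intros)
    moreover have "(S has_vector_derivative F (\<tau> - t) - of_real (eigval L n) * S (\<tau> - t)) (at (\<tau> - t) within (\<lambda>r. \<tau> - r) ` {0..\<tau>})"
      by (rule has_vector_derivative_within_subset[OF ser(1)]) (use t in auto)
    ultimately have s: "((S \<circ> (\<lambda>r. \<tau> - r)) has_vector_derivative (- 1) *\<^sub>R (F (\<tau> - t) - of_real (eigval L n) * S (\<tau> - t))) (at t within {0..\<tau>})"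
      by (rule vector_diff_chain_within)
    from has_vector_derivative_diff[OF has_vector_derivative_diff[OF coef_derivative[OF L p1 D(1) cp ae t]
        has_vector_derivative_mult_left[OF e, of "coef L n (z1 \<tau>)"]] s]
    show "(d has_vector_derivative of_real (eigval L n) * d t) (at t within {0..\<tau>})"
      by (simp add: d_def[abs_def] algebra_simps exp_of_real[symmetric] o_def)
  qed (simp add: d_def S_def)
  then show ?p by (simp add: d_def fin S_def b_def diff_eq_eq add.commute)
qed

lemma cinner_diff_right: "cinner x (y - z) = cinner x y - cinner x z"
  unfolding cinner_def using cinner_summable[of x y] cinner_summable[of x z]
  by (subst suminf_diff) (auto simp: nth_simps right_diff_distrib dest: summable_norm_cancel)

lemma cinner_heat:
  assumes "s \<ge> 0"
  shows "cinner (heat L s x) y = cinner x (heat L s y)"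
  unfolding cinner_def nth_heat(1)[OF L assms] by (intro suminf_cong) (simp add: exp_cnj)

text \<open>The semigroup \<open>heat\<close>, \<open>K\<close> on the dual side is the transpose of the adjoint evolution.\<close>

lemma evolution:
  assumes sol: "adjoint_solution L G a \<tau> \<zeta>1 \<zeta>2 z1 z2" and A: "A = (\<lambda>x. a x - wderiv L G x)"
    and \<zeta>: "\<zeta>1 \<in> H10 L" "\<zeta>2 \<in> H10 L" and \<tau>: "\<tau> \<ge> 0" and c: "c \<in> {0..\<tau>}"
  shows "Psi L (heat L (\<tau> - c) x1) \<zeta>1 + Psi L (heat L (\<tau> - c) x2 + K (\<tau> - c) x1) \<zeta>2 = Psi L x1 (z1 c) + Psi L x2 (z2 c)"
proof -
  let ?s = "\<tau> - c"
  have s: "?s \<ge> 0" using c by simp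
  have H: "z1 c \<in> H10 L" "z2 c \<in> H10 L"
    using sol c by (auto simp: adjoint_solution_def continuous_path_def)
  note ac = adjoint_coef[OF sol A \<zeta> \<tau> c]
  have h2: "hat L (z2 c) = heat L ?s (hat L \<zeta>2)"
    by (rule ell2_eqI) (simp add: hat[OF L H(2)] hat[OF L \<zeta>(2)] nth_heat[OF L s] ac(1))
  let ?S = "\<lambda>n. \<Sum>m. of_real (\<beta> m n) * coef L m \<zeta>2 * kk L m n (of_real ?s)"
  have h1: "nth (hat L (z1 c) - heat L ?s (hat L \<zeta>1)) n = of_real (freq L n) * ?S n" for n
    by (simp add: nth_simps hat[OF L H(1)] hat[OF L \<zeta>(1)] nth_heat[OF L s] ac(2) algebra_simps)
  have "cinner (K ?s x1) (hat L \<zeta>2) = cinner x1 (hat L (z1 c) - heat L ?s (hat L \<zeta>1))"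
  proof (subst cinner_K[OF s], unfold cinner_def h1, rule suminf_cong, rule arg_cong2[where f="(*)", OF refl])
    fix n
    let ?g = "\<lambda>m. of_real (\<beta> m n) * coef L m \<zeta>2 * kk L m n (of_real ?s)"
    have g: "summable ?g" by (rule coupling_series_derivative(3)[OF L beta_coef_summable[OF \<zeta>(2)] s])
    have gc: "summable (\<lambda>m. cnj (?g m))" by (rule bounded_linear.summable[OF bounded_linear_cnj g])
    have "(\<Sum>m. of_real (bb m n * freq L n) * kk L m n (of_real ?s) * cnj (nth (hat L \<zeta>2) m)) = (\<Sum>m. of_real (freq L n) * cnj (?g m))"
    proof (rule suminf_cong)
      fix m
      \<comment> \<open>The frequency of the test function in \<open>hat\<close> restores the
        unnormalised coefficient, so the transpose of \<open>K\<close> is the coupling series of the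
        adjoint solution.\<close>
      have "bb m n * freq L m = \<beta> m n" using freq_pos[OF L, of m] by (simp add: bb_def)
      then have "complex_of_real (bb m n) * of_real (freq L m) = of_real (\<beta> m n)" by (simp flip: of_real_mult)
      then show "of_real (bb m n * freq L n) * kk L m n (of_real ?s) * cnj (nth (hat L \<zeta>2) m) = of_real (freq L n) * cnj (?g m)"
        by (simp add: hat[OF L \<zeta>(2)] cnj_kk[of L m n ?s, simplified] mult_ac)
    qed
    also have "\<dots> = of_real (freq L n) * (\<Sum>m. cnj (?g m))" by (rule suminf_mult[OF gc])
    also have "(\<Sum>m. cnj (?g m)) = cnj (\<Sum>m. ?g m)" by (rule bounded_linear.suminf[OF bounded_linear_cnj g, symmetric])
    finally show "(\<Sum>m. of_real (bb m n * freq L n) * kk L m n (of_real ?s) * cnj (nth (hat L \<zeta>2) m)) = cnj (of_real (freq L n) * ?S n)"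
      by simp
  qed
  then show ?thesis
    unfolding Psi_def cinner_add h2 cinner_heat[OF s] cinner_diff_right by simp
qed

end

section \<open>The stationary state\<close>

lemma continuous_scaleR_integrable:
  fixes f :: "real \<Rightarrow> 'a::euclidean_space"
  assumes e: "continuous_on {0..L} (e :: real \<Rightarrow> real)" and f: "integrable (Om L) f"
  shows "integrable (Om L) (\<lambda>x. e x *\<^sub>R f x)"
proof -
  obtain B where B: "\<forall>x\<in>{0..L}. \<bar>e x\<bar> \<le> B"
    using compact_imp_bounded[OF compact_continuous_image[OF e compact_Icc]] by (auto simp: bounded_iff)
  show ?thesis
  proof (rule Bochner_Integration.integrable_bound)
    show "integrable (Om L) (\<lambda>x. B *\<^sub>R f x)" using f by simp
    show "(\<lambda>x. e x *\<^sub>R f x) \<in> borel_measurable (Om L)"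
      by (intro borel_measurable_scaleR borel_measurable_integrable integrable_continuous_Om e f)
    show "AE x in Om L. norm (e x *\<^sub>R f x) \<le> norm (B *\<^sub>R f x)"
    proof (intro AE_I2)
      fix x assume "x \<in> space (Om L)"
      then have "\<bar>e x\<bar> \<le> \<bar>B\<bar>" using bspec[OF B, of x] by auto
      then show "norm (e x *\<^sub>R f x) \<le> norm (B *\<^sub>R f x)" by (simp add: mult_right_mono)
    qed
  qed
qed

text \<open>The product rule for absolutely continuous functions, read off from integration by parts
  on (0, x).\<close>

lemma prim_product:
  fixes f :: "real \<Rightarrow> real" and v :: "real \<Rightarrow> 'a::euclidean_space"
  assumes f: "integrable (Om L) f" and v: "integrable (Om L) v"
  shows "integrable (Om L) (\<lambda>y. (a + prim f y) *\<^sub>R v y + f y *\<^sub>R (b + prim v y))"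
    and "0 \<le> x \<Longrightarrow> x \<le> L \<Longrightarrow> (a + prim f x) *\<^sub>R (b + prim v x) =
      a *\<^sub>R b + prim (\<lambda>y. (a + prim f y) *\<^sub>R v y + f y *\<^sub>R (b + prim v y)) x"
proof -
  have i: "integrable (Om M) (\<lambda>y. (a + prim f y) *\<^sub>R v y)" "integrable (Om M) (\<lambda>y. f y *\<^sub>R (b + prim v y))"
    if f: "integrable (Om M) f" and v: "integrable (Om M) v" for M
    using f v prim_triangle(1,2)[OF f v] by (simp_all add: scaleR_add_left scaleR_add_right)
  show "integrable (Om L) (\<lambda>y. (a + prim f y) *\<^sub>R v y + f y *\<^sub>R (b + prim v y))"
    by (intro Bochner_Integration.integrable_add i f v)
  assume x: "0 \<le> x" "x \<le> L"
  have fx: "integrable (Om x) f" by (rule integrable_lebesgue_on_subset[OF f]) (use x in auto)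
  have vx: "integrable (Om x) v" by (rule integrable_lebesgue_on_subset[OF v]) (use x in auto)
  have "prim (\<lambda>y. (a + prim f y) *\<^sub>R v y + f y *\<^sub>R (b + prim v y)) x =
      (\<integral>y. (a + prim f y) *\<^sub>R v y \<partial>Om x) + (\<integral>y. f y *\<^sub>R (b + prim v y) \<partial>Om x)"
    unfolding prim_def[of "\<lambda>y. (a + prim f y) *\<^sub>R v y + f y *\<^sub>R (b + prim v y)"]
    by (rule Bochner_Integration.integral_add[OF i[OF fx vx]])
  then show "(a + prim f x) *\<^sub>R (b + prim v x) = a *\<^sub>R b + prim (\<lambda>y. (a + prim f y) *\<^sub>R v y + f y *\<^sub>R (b + prim v y)) x"
    using integration_by_parts[OF fx vx, of a b] by simp
qed

lemma integration_by_parts_H10: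
  assumes L: "L > 0" and u: "u \<in> H10 L" and f: "integrable (Om L) f"
  shows "(\<integral>x. (a + prim f x) *\<^sub>R wderiv L u x \<partial>Om L) = - (\<integral>x. f x *\<^sub>R prim (wderiv L u) x \<partial>Om L)"
proof -
  have "integrable (Om L) (wderiv L u)" by (rule L2_Om_integrable[OF H10E(3)[OF L u]])
  from integration_by_parts[OF f this, of a 0] show ?thesis
    by (simp add: H10E(5)[OF L u] eq_neg_iff_add_eq_0)
qed

lemma pairing_Hm1:
  assumes L: "L > 0" and e: "continuous_on {0..L} (e :: real \<Rightarrow> real)"
  shows "(\<lambda>u. cnj (\<integral>x. e x *\<^sub>R u x \<partial>Om L)) \<in> Hm1 L"
proof (rule Hm1I[OF _ _ L])
  have i: "integrable (Om L) (\<lambda>x. e x *\<^sub>R u x)" if "u \<in> H10 L" for u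
    by (rule continuous_scaleR_integrable[OF e L2_Om_integrable[OF H10E(2)[OF L that]]])
  fix u v c assume u: "u \<in> H10 L" and v: "v \<in> H10 L"
  have "(\<integral>x. e x *\<^sub>R (u x + c * v x) \<partial>Om L) = (\<integral>x. e x *\<^sub>R u x + c * (e x *\<^sub>R v x) \<partial>Om L)"
    by (intro Bochner_Integration.integral_cong) (simp_all add: algebra_simps)
  also have "\<dots> = (\<integral>x. e x *\<^sub>R u x \<partial>Om L) + c * (\<integral>x. e x *\<^sub>R v x \<partial>Om L)"
    using i[OF u] i[OF v]
    by (simp only: Bochner_Integration.integral_add integrable_mult_right integral_mult_right_zero)
  finally show "cnj (\<integral>x. e x *\<^sub>R (u x + c * v x) \<partial>Om L) = cnj (\<integral>x. e x *\<^sub>R u x \<partial>Om L) + cnj c * cnj (\<integral>x. e x *\<^sub>R v x \<partial>Om L)"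
    by simp
next
  fix u assume u: "u \<in> H10 L"
  have l: "(\<lambda>x. complex_of_real (e x)) \<in> L2 (Om L)" by (intro L2_continuous continuous_intros e)
  have "norm (\<integral>x. e x *\<^sub>R u x \<partial>Om L) \<le> l2norm (Om L) (\<lambda>x. complex_of_real (e x)) * l2norm (Om L) u"
    using L2_integral_mult_le[OF l H10E(2)[OF L u]] by (simp add: scaleR_conv_of_real)
  also have "\<dots> \<le> l2norm (Om L) (\<lambda>x. complex_of_real (e x)) * h1norm L u"
    by (intro mult_left_mono l2norm_nonneg) (simp add: h1norm_def real_le_rsqrt)
  finally show "norm (cnj (\<integral>x. e x *\<^sub>R u x \<partial>Om L)) \<le> l2norm (Om L) (\<lambda>x. complex_of_real (e x)) * h1norm L u"
    by simp
qed

lemma es_H2: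
  assumes L: "L > 0"
  shows "(\<lambda>x. complex_of_real (es L n x)) \<in> H2 L"
    "AE x in Om L. laplacian L (\<lambda>x. complex_of_real (es L n x)) x = - of_real (eigval L n) * of_real (es L n x)"
    "boundary_trace L (wderiv L (\<lambda>x. complex_of_real (es L n x))) 0 = of_real (freq L n * sqrt (2 / L))"
proof -
  let ?u = "\<lambda>x. complex_of_real (es L n x)" and ?v = "\<lambda>x. - complex_of_real (eigval L n) * of_real (es L n x)"
  have vl: "?v \<in> L2 (Om L)" by (intro L2_continuous continuous_intros)
  have p: "prim ?v x = of_real (freq L n * ec L n x) - of_real (freq L n * sqrt (2 / L))" if "0 \<le> x" for x
  proof -
    have "prim (\<lambda>y. - eigval L n * es L n y) x = freq L n * ec L n x - freq L n * ec L n 0"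
    proof (rule prim_FTC_real[OF that])
      show "((\<lambda>t. freq L n * ec L n t) has_real_derivative - eigval L n * es L n t) (at t)" for t
        using DERIV_cmult[OF ec_deriv[of L n t], of "freq L n"] by (simp add: eigval_def power2_eq_square mult.assoc)
    qed (intro continuous_intros)
    moreover have "prim ?v x = of_real (prim (\<lambda>y. - eigval L n * es L n y) x)"
      unfolding prim_def by (simp only: integral_complex_of_real[symmetric] of_real_mult of_real_minus)
    ultimately show ?thesis by (simp add: ec_def)
  qed
  have "AE x in Om L. wderiv L ?u x = of_real (freq L n * sqrt (2 / L)) + prim ?v x"
    using es_wderiv[OF L, of n] AE_space
  proof eventually_elim
    case (elim x)
    then have "0 \<le> x" by simp
    from p[OF this] elim(1) show ?case by simp
  qed
  note H = H1I[OF L vl this]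
  show "?u \<in> H2 L" using H10E(1)[OF L es_H10[OF L]] H(1) by (simp add: H2_def)
  show "AE x in Om L. laplacian L ?u x = ?v x" by (rule H(2))
  show "boundary_trace L (wderiv L ?u) 0 = of_real (freq L n * sqrt (2 / L))" by (rule H(3))
qed

text \<open>Membership of G in the Lipschitz class enters through its representation as a primitive,
  the form that integration by parts takes.\<close>

locale controlled_system = parabolic_system +
  fixes a :: "real \<Rightarrow> real" and g0 :: real
  assumes A_def: "A = (\<lambda>x. a x - wderiv L G x)" and G'_integrable: "integrable (Om L) (wderiv L G)"
    and G_prim: "AE x in Om L. G x = g0 + prim (wderiv L G) x"
begin

definition hh :: "real \<Rightarrow> real" where "hh x = 1 - x / L"

text \<open>This is - (G hh' + a hh), because hh' = - 1 / L.\<close>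

definition qq :: "real \<Rightarrow> real" where "qq x = G x / L - hh x * a x"

text \<open>The slope of the second stationary component; the additive constant is the one that
  makes its primitive vanish at L.\<close>

definition pp :: "real \<Rightarrow> real" where "pp x = - (prim (prim qq) L / L) + prim qq x"

text \<open>\<open>(hh, YY)\<close> is the stationary state driven by the constant boundary value \<open>1\<close>:
  \<open>YY'' = - (G hh' + a hh)\<close> with \<open>YY 0 = YY L = 0\<close>.\<close>

definition YY :: "real \<Rightarrow> real" where "YY = prim pp"

lemma hh_prim: "0 \<le> x \<Longrightarrow> hh x = 1 + prim (\<lambda>_. - (1 / L)) x"
  using prim_const[of x "- (1 / L)"] by (simp add: hh_def)

lemma continuous_on_hh: "continuous_on S hh"
  unfolding hh_def[abs_def] by (intro continuous_intros) (use L in auto)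

lemma A_integrable: "integrable (Om L) A" and G_integrable: "integrable (Om L) G"
proof -
  show "integrable (Om L) A"
    by (rule finite_measure.integrable_const_bound[OF finite_measure_Om _ Am, of M]) (use AM in simp)
  show "integrable (Om L) G"
    by (rule finite_measure.integrable_const_bound[OF finite_measure_Om _ Gm, of M]) (use GM in simp)
qed

lemma a_integrable: "integrable (Om L) a"
  using Bochner_Integration.integrable_add[OF A_integrable G'_integrable] by (simp add: A_def)

lemma qq_integrable: "integrable (Om L) qq"
  unfolding qq_def[abs_def]
  using G_integrable continuous_scaleR_integrable[OF continuous_on_hh a_integrable] by simp

lemma continuous_on_pp: "continuous_on {0..L} pp"
  unfolding pp_def[abs_def] by (intro continuous_intros continuous_on_prim qq_integrable)

lemma continuous_on_YY: "continuous_on {0..L} YY"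
  unfolding YY_def by (intro continuous_on_prim integrable_continuous_Om continuous_on_pp)

lemma YY_L: "YY L = 0"
proof -
  have "YY L = prim (\<lambda>_. - (prim (prim qq) L / L)) L + prim (prim qq) L"
    unfolding YY_def pp_def[abs_def]
    by (rule prim_add[OF _ _ order_refl])
       (intro integrable_continuous_Om continuous_intros continuous_on_prim qq_integrable)+
  also have "prim (\<lambda>_. - (prim (prim qq) L / L)) L = L * - (prim (prim qq) L / L)"
    using prim_const[of L "- (prim (prim qq) L / L)"] L by simp
  finally show ?thesis using L by simp
qed

text \<open>Paired with the stationary state, the adjoint equations leave only the boundary term.
  The first order term is integrated by parts onto \<open>hh\<close> times G, and what remains of
  order zero cancels against YY'' = \<open>qq\<close>.\<close>

lemma steady_state_pairing:
  assumes h: "u1 \<in> H2 L" "u1 \<in> H10 L" "u2 \<in> H2 L" "u2 \<in> H10 L"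
    and w1: "AE x in Om L. - w1 x = laplacian L u1 x - of_real (G x) * wderiv L u2 x + of_real (a x - wderiv L G x) * u2 x"
    and w2: "AE x in Om L. - w2 x = laplacian L u2 x"
    and w: "w1 \<in> L2 (Om L)" "w2 \<in> L2 (Om L)"
  shows "(\<integral>x. hh x *\<^sub>R w1 x \<partial>Om L) + (\<integral>x. YY x *\<^sub>R w2 x \<partial>Om L) = - normal_derivative_at_0 L u1"
proof -
  define D where "D = wderiv L u2"
  define V where "V = prim D"
  define Gp where "Gp x = g0 + prim (wderiv L G) x" for x
  \<comment> \<open>The derivative of \<open>hh\<close> times the continuous version of G.\<close>
  define r where "r x = hh x * wderiv L G x - Gp x / L" for x
  have Di: "integrable (Om L) D" unfolding D_def by (rule L2_Om_integrable[OF H10E(3)[OF L h(4)]])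
  have UV: "AE x in Om L. u2 x = V x" unfolding V_def D_def by (rule H10E(4)[OF L h(4)])
  have Gc: "continuous_on {0..L} Gp" unfolding Gp_def[abs_def] by (intro continuous_intros continuous_on_prim G'_integrable)
  have GpG: "AE x in Om L. G x = Gp x" unfolding Gp_def by (rule G_prim)
  have Vc: "continuous_on {0..L} V" unfolding V_def by (rule continuous_on_prim[OF Di])
  have lap1: "integrable (Om L) (laplacian L u1)" by (rule L2_Om_integrable[OF H2_H1_deriv(1)[OF L h(1)]])
  have lap2: "integrable (Om L) (laplacian L u2)" by (rule L2_Om_integrable[OF H2_H1_deriv(1)[OF L h(3)]])
  have ri: "integrable (Om L) r"
    unfolding r_def[abs_def]
    using continuous_scaleR_integrable[OF continuous_on_hh G'_integrable] integrable_continuous_Om[OF Gc] by simp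
  have AVi: "integrable (Om L) (\<lambda>x. A x *\<^sub>R V x)"
    by (rule L2_Om_integrable[OF L2_bounded_scaleR[OF L2_continuous[OF Vc] Am AM]])
  have hG: "hh x * Gp x = g0 + prim r x" if "0 \<le> x" "x \<le> L" for x
  proof -
    have c: "integrable (Om L) (\<lambda>_. - (1 / L))" by (rule integrable_continuous_Om) (intro continuous_intros)
    have "prim (\<lambda>y. (1 + prim (\<lambda>_. - (1 / L)) y) *\<^sub>R wderiv L G y + (- (1 / L)) *\<^sub>R (g0 + prim (wderiv L G) y)) x = prim r x"
      unfolding prim_def[of r] prim_def[of "\<lambda>y. (1 + prim (\<lambda>_. - (1 / L)) y) *\<^sub>R wderiv L G y + (- (1 / L)) *\<^sub>R (g0 + prim (wderiv L G) y)"]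
      by (intro Bochner_Integration.integral_cong) (auto simp: r_def Gp_def hh_prim)
    then show ?thesis
      using prim_product(2)[OF c G'_integrable that, of 1 g0] hh_prim[OF that(1)] by (simp add: Gp_def)
  qed
  have IG: "(\<integral>x. (hh x * Gp x) *\<^sub>R D x \<partial>Om L) = - (\<integral>x. r x *\<^sub>R V x \<partial>Om L)"
  proof -
    have "(\<integral>x. (hh x * Gp x) *\<^sub>R D x \<partial>Om L) = (\<integral>x. (g0 + prim r x) *\<^sub>R D x \<partial>Om L)"
      by (intro Bochner_Integration.integral_cong) (auto simp: hG)
    then show ?thesis unfolding D_def V_def using integration_by_parts_H10[OF L h(4) ri] by simp
  qed
  have i1: "integrable (Om L) (\<lambda>x. hh x *\<^sub>R laplacian L u1 x)" by (rule continuous_scaleR_integrable[OF continuous_on_hh lap1])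
  have i2: "integrable (Om L) (\<lambda>x. (hh x * Gp x) *\<^sub>R D x)"
    by (rule continuous_scaleR_integrable[OF _ Di]) (intro continuous_intros continuous_on_hh Gc)
  have i3: "integrable (Om L) (\<lambda>x. hh x *\<^sub>R (A x *\<^sub>R V x))" by (rule continuous_scaleR_integrable[OF continuous_on_hh AVi])
  have i4: "integrable (Om L) (\<lambda>x. r x *\<^sub>R V x)" unfolding V_def by (rule prim_triangle(1)[OF ri Di])
  have i5: "integrable (Om L) (\<lambda>x. qq x *\<^sub>R V x)" unfolding V_def by (rule prim_triangle(1)[OF qq_integrable Di])
  have "(\<integral>x. hh x *\<^sub>R w1 x \<partial>Om L) = (\<integral>x. - (hh x *\<^sub>R laplacian L u1 x) + (hh x * Gp x) *\<^sub>R D x - hh x *\<^sub>R (A x *\<^sub>R V x) \<partial>Om L)"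
  proof (rule integral_Om_cong_AE)
    show "AE x in Om L. hh x *\<^sub>R w1 x = - (hh x *\<^sub>R laplacian L u1 x) + (hh x * Gp x) *\<^sub>R D x - hh x *\<^sub>R (A x *\<^sub>R V x)"
      using w1 UV GpG
    proof eventually_elim
      case (elim x)
      have w: "w1 x = - (laplacian L u1 x - of_real (Gp x) * D x + of_real (A x) * V x)"
        using arg_cong[OF elim(1), of uminus] elim(2,3) by (simp only: minus_minus D_def A_def)
      show ?case unfolding w by (simp add: scaleR_conv_of_real algebra_simps)
    qed
    show "(\<lambda>x. hh x *\<^sub>R w1 x) \<in> borel_measurable (Om L)"
      by (rule borel_measurable_integrable[OF continuous_scaleR_integrable[OF continuous_on_hh L2_Om_integrable[OF w(1)]]])
  qed
  also have "\<dots> = - (\<integral>x. hh x *\<^sub>R laplacian L u1 x \<partial>Om L) + (\<integral>x. (hh x * Gp x) *\<^sub>R D x \<partial>Om L) - (\<integral>x. hh x *\<^sub>R (A x *\<^sub>R V x) \<partial>Om L)"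
    using i1 i2 i3 by simp
  also have "(\<integral>x. hh x *\<^sub>R laplacian L u1 x \<partial>Om L) = normal_derivative_at_0 L u1"
    unfolding hh_def by (rule H2_trace_pairing[OF L h(1,2)])
  finally have 1: "(\<integral>x. hh x *\<^sub>R w1 x \<partial>Om L) =
    - normal_derivative_at_0 L u1 - (\<integral>x. r x *\<^sub>R V x \<partial>Om L) - (\<integral>x. hh x *\<^sub>R (A x *\<^sub>R V x) \<partial>Om L)"
    unfolding IG by simp
  have "(\<integral>x. YY x *\<^sub>R w2 x \<partial>Om L) = (\<integral>x. - ((0 + prim pp x) *\<^sub>R laplacian L u2 x) \<partial>Om L)"
  proof (rule integral_Om_cong_AE)
    show "AE x in Om L. YY x *\<^sub>R w2 x = - ((0 + prim pp x) *\<^sub>R laplacian L u2 x)"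
      using w2
    proof eventually_elim
      case (elim x)
      have "YY x *\<^sub>R w2 x = - (YY x *\<^sub>R (- w2 x))" by simp
      then show ?case unfolding elim by (simp add: YY_def)
    qed
    show "(\<lambda>x. YY x *\<^sub>R w2 x) \<in> borel_measurable (Om L)"
      by (rule borel_measurable_integrable[OF continuous_scaleR_integrable[OF continuous_on_YY L2_Om_integrable[OF w(2)]]])
  qed
  also have "\<dots> = - (\<integral>x. (0 + prim pp x) *\<^sub>R laplacian L u2 x \<partial>Om L)" by (rule Bochner_Integration.integral_minus)
  \<comment> \<open>Green's formula with weight \<open>YY\<close>, which vanishes at both
    ends.\<close>
  also have "\<dots> = (\<integral>x. pp x *\<^sub>R D x \<partial>Om L)"
    using H2_pairing[OF L h(3) continuous_on_pp, of 0] YY_L unfolding YY_def D_def by (simp add: add_eq_0_iff)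
  also have "\<dots> = - (\<integral>x. qq x *\<^sub>R V x \<partial>Om L)"
    unfolding pp_def D_def V_def by (rule integration_by_parts_H10[OF L h(4) qq_integrable])
  finally have 2: "(\<integral>x. YY x *\<^sub>R w2 x \<partial>Om L) = - (\<integral>x. qq x *\<^sub>R V x \<partial>Om L)" .
  have "(\<integral>x. r x *\<^sub>R V x \<partial>Om L) + (\<integral>x. hh x *\<^sub>R (A x *\<^sub>R V x) \<partial>Om L) + (\<integral>x. qq x *\<^sub>R V x \<partial>Om L) =
      (\<integral>x. r x *\<^sub>R V x + hh x *\<^sub>R (A x *\<^sub>R V x) + qq x *\<^sub>R V x \<partial>Om L)"
    using i3 i4 i5 by simp
  also have "\<dots> = (\<integral>x. 0 \<partial>Om L)"
  proof (rule integral_Om_cong_AE)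
    show "AE x in Om L. r x *\<^sub>R V x + hh x *\<^sub>R (A x *\<^sub>R V x) + qq x *\<^sub>R V x = 0"
      using GpG
    proof eventually_elim
      case (elim x)
      have "r x *\<^sub>R V x + hh x *\<^sub>R (A x *\<^sub>R V x) + qq x *\<^sub>R V x = (r x + hh x * A x + qq x) *\<^sub>R V x"
        by (simp add: scaleR_add_left)
      \<comment> \<open>Here the G' in the derivative of \<open>hh\<close> G meets the - G' in A,
        while the remaining terms are those of \<open>qq\<close> with opposite sign.\<close>
      also have "r x + hh x * A x + qq x = 0" by (simp add: r_def qq_def A_def elim algebra_simps)
      finally show ?case by simp
    qed
    show "(\<lambda>x. r x *\<^sub>R V x + hh x *\<^sub>R (A x *\<^sub>R V x) + qq x *\<^sub>R V x) \<in> borel_measurable (Om L)"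
      by (intro borel_measurable_integrable Bochner_Integration.integrable_add i3 i4 i5)
  qed
  finally have 3: "(\<integral>x. r x *\<^sub>R V x \<partial>Om L) + (\<integral>x. hh x *\<^sub>R (A x *\<^sub>R V x) \<partial>Om L) + (\<integral>x. qq x *\<^sub>R V x \<partial>Om L) = 0" by simp
  show ?thesis unfolding 1 2 using 3 by (simp add: algebra_simps add_eq_0_iff2)
qed

end

section \<open>Step controls\<close>

lemma scl_scaleR: "scl (of_real r) x = r *\<^sub>R x"
  by (rule ell2_eqI) (simp add: nth_scl nth_simps scaleR_conv_of_real)

lemma scl_1: "scl 1 x = x"
  by (rule ell2_eqI) (simp add: nth_scl)

lemma norm_scl: "norm (scl c x) = norm c * norm x"
proof -
  have "(norm (scl c x))\<^sup>2 = (\<Sum>n. (norm c)\<^sup>2 * (norm (nth x n))\<^sup>2)"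
    unfolding norm_ell2_square nth_scl norm_mult power_mult_distrib ..
  also have "\<dots> = (norm c * norm x)\<^sup>2"
    unfolding suminf_mult[OF nth_summable] norm_ell2_square power_mult_distrib ..
  finally show ?thesis by (simp add: power2_eq_iff_nonneg)
qed

lemma bounded_linear_scl: "bounded_linear (scl c)"
proof (rule bounded_linear_intro[where K="norm c"])
  show "scl c (x + y) = scl c x + scl c y" for x y
    by (rule ell2_eqI) (simp add: nth_scl nth_simps distrib_left)
  show "scl c (r *\<^sub>R x) = r *\<^sub>R scl c x" for r x
    by (rule ell2_eqI) (simp add: nth_scl nth_simps)
  show "norm (scl c x) \<le> norm x * norm c" for x by (simp add: norm_scl)
qed

lemma Psi_zero: "Psi L 0 u = 0"
  using Psi_diff[of L 0 0 u] by simp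

context controlled_system
begin

definition V1 :: ell2 where "V1 = coords L (\<lambda>u. cnj (\<integral>x. hh x *\<^sub>R u x \<partial>Om L))"

definition V2 :: ell2 where "V2 = coords L (\<lambda>u. cnj (\<integral>x. YY x *\<^sub>R u x \<partial>Om L))"

lemma Psi_V:
  assumes "u \<in> H10 L"
  shows "Psi L V1 u = cnj (\<integral>x. hh x *\<^sub>R u x \<partial>Om L)" "Psi L V2 u = cnj (\<integral>x. YY x *\<^sub>R u x \<partial>Om L)"
  unfolding V1_def V2_def
  by (rule Psi_coords[OF L pairing_Hm1[OF L continuous_on_hh] assms] Psi_coords[OF L pairing_Hm1[OF L continuous_on_YY] assms])+

text \<open>The normal derivative of each sine at 0 is nonzero, so every mode is present in the
  stationary state; the proportionality to 1 / \<open>eigval\<close> is the form assumed in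
  \<open>annihilator_trivial\<close>.\<close>

lemma nth_V1: "nth V1 n = of_real (sqrt (2 / L) / eigval L n)"
proof -
  let ?u = "\<lambda>x. complex_of_real (es L n x)"
  let ?I = "\<integral>x. hh x *\<^sub>R ?u x \<partial>Om L"
  have i: "integrable (Om L) (\<lambda>x. hh x *\<^sub>R ?u x)"
    by (rule integrable_continuous_Om) (intro continuous_intros continuous_on_hh)
  have "- of_real (freq L n * sqrt (2 / L)) = (\<integral>x. hh x *\<^sub>R laplacian L ?u x \<partial>Om L)"
    unfolding hh_def using H2_trace_pairing[OF L es_H2(1)[OF L] es_H10[OF L], of n]
    by (simp only: normal_derivative_at_0_def es_H2(3)[OF L])
  also have "\<dots> = (\<integral>x. (- of_real (eigval L n)) * (hh x *\<^sub>R ?u x) \<partial>Om L)"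
  proof (rule integral_Om_cong_AE)
    show "AE x in Om L. hh x *\<^sub>R laplacian L ?u x = (- of_real (eigval L n)) * (hh x *\<^sub>R ?u x)"
      using es_H2(2)[OF L, of n] by eventually_elim simp
    show "(\<lambda>x. hh x *\<^sub>R laplacian L ?u x) \<in> borel_measurable (Om L)"
      by (rule borel_measurable_integrable[OF continuous_scaleR_integrable[OF continuous_on_hh L2_Om_integrable[OF H2_H1_deriv(1)[OF L es_H2(1)[OF L]]]]])
  qed
  also have "\<dots> = - of_real (eigval L n) * ?I" using i by (simp only: integral_mult_right_zero)
  finally have "of_real (eigval L n) * ?I = of_real (freq L n * sqrt (2 / L))" by simp
  then have "?I = of_real (freq L n * sqrt (2 / L) / eigval L n)"
    using eigval_pos[OF L, of n] by (simp add: field_simps)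
  moreover have "nth V1 n = cnj ?I / of_real (freq L n)"
    unfolding V1_def by (rule nth_coords[OF L pairing_Hm1[OF L continuous_on_hh]])
  ultimately show ?thesis using freq_pos[OF L, of n] by simp
qed

text \<open>\<open>steady_state_pairing\<close> integrated over time. It expresses that the
  stationary state is the solution by transposition with boundary value 1 from time c on.\<close>

lemma steady_state_identity:
  assumes sol: "adjoint_solution L G a \<tau> \<zeta>1 \<zeta>2 z1 z2" and \<zeta>: "\<zeta>1 \<in> H10 L" "\<zeta>2 \<in> H10 L"
  shows "integrable (lebesgue_on {0<..<\<tau>}) (\<lambda>t. normal_derivative_at_0 L (z1 t))"
    and "0 \<le> c \<Longrightarrow> c \<le> \<tau> \<Longrightarrow> Psi L V1 \<zeta>1 + Psi L V2 \<zeta>2 - (Psi L V1 (z1 c) + Psi L V2 (z2 c)) =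
      - (\<integral>t. cnj (normal_derivative_at_0 L (z1 t)) \<partial>lebesgue_on {c<..<\<tau>})"
proof -
  have p1: "continuous_path (H10 L) (h1norm L) \<tau> z1" and p2: "continuous_path (H10 L) (h1norm L) \<tau> z2"
    and f1: "AE x in Om L. z1 \<tau> x = \<zeta>1 x" and f2: "AE x in Om L. z2 \<tau> x = \<zeta>2 x"
    using sol by (auto simp: adjoint_solution_def)
  obtain w1 w2 where D: "has_time_derivative L \<tau> z1 w1" "has_time_derivative L \<tau> z2 w2"
    and E: "AE t in lebesgue_on {0<..<\<tau>}. z1 t \<in> H2 L \<and> z2 t \<in> H2 L \<and>
           (AE x in Om L. - w1 t x = laplacian L (z1 t) x - of_real (G x) * wderiv L (z2 t) x + of_real (a x - wderiv L G x) * z2 t x) \<and>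
           (AE x in Om L. - w2 t x = laplacian L (z2 t) x)"
    using sol unfolding adjoint_solution_def by blast
  have H: "z1 t \<in> H10 L" "z2 t \<in> H10 L" if "t \<in> {0..\<tau>}" for t
    using p1 p2 that by (auto simp: continuous_path_def)
  have l1: "z1 t \<in> L2 (Om L)" and l2: "z2 t \<in> L2 (Om L)" if "t \<in> {0..\<tau>}" for t
    using H10E(2)[OF L] H[OF that] by auto
  have w1: "AE t in lebesgue_on {0<..<\<tau>}. w1 t \<in> L2 (Om L)" by (rule time_derivative_pairing(1)[OF L D(1) continuous_on_hh l1])
  have w2: "AE t in lebesgue_on {0<..<\<tau>}. w2 t \<in> L2 (Om L)" by (rule time_derivative_pairing(1)[OF L D(2) continuous_on_YY l2])
  have i1: "integrable (lebesgue_on {0<..<\<tau>}) (\<lambda>t. \<integral>x. hh x *\<^sub>R w1 t x \<partial>Om L)" by (rule time_derivative_pairing(2)[OF L D(1) continuous_on_hh l1])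
  have i2: "integrable (lebesgue_on {0<..<\<tau>}) (\<lambda>t. \<integral>x. YY x *\<^sub>R w2 t x \<partial>Om L)" by (rule time_derivative_pairing(2)[OF L D(2) continuous_on_YY l2])
  let ?N = "\<lambda>t. normal_derivative_at_0 L (z1 t)"
  let ?W = "\<lambda>t. (\<integral>x. hh x *\<^sub>R w1 t x \<partial>Om L) + (\<integral>x. YY x *\<^sub>R w2 t x \<partial>Om L)"
  have inI: "AE t in lebesgue_on {0<..<\<tau>}. t \<in> {0<..<\<tau>}" by (intro AE_I2) simp
  \<comment> \<open>Integrability of the normal derivative in time is inherited from the pairings,
    with which it agrees almost everywhere up to sign.\<close>
  have WN: "AE t in lebesgue_on {0<..<\<tau>}. - ?W t = ?N t"
    using E w1 w2 inI
  proof eventually_elim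
    case (elim t)
    then have t: "t \<in> {0..\<tau>}" by simp
    from elim(1) have "?W t = - ?N t"
      by (intro steady_state_pairing[OF _ H(1)[OF t] _ H(2)[OF t] _ _ elim(2,3)]) auto
    then show ?case by simp
  qed
  have Wi: "integrable (lebesgue_on {0<..<\<tau>}) (\<lambda>t. - ?W t)"
    by (intro Bochner_Integration.integrable_minus Bochner_Integration.integrable_add i1 i2)
  show "integrable (lebesgue_on {0<..<\<tau>}) ?N" by (rule integrable_Om_AE[OF Wi WN])
  assume c: "0 \<le> c" "c \<le> \<tau>"
  have sub: "integrable (lebesgue_on {c<..<\<tau>}) f" if "integrable (lebesgue_on {0<..<\<tau>}) f" for f :: "real \<Rightarrow> complex"
    by (rule integrable_lebesgue_on_subset[OF that]) (use c in auto)
  have e1: "(\<integral>x. hh x *\<^sub>R z1 \<tau> x \<partial>Om L) = (\<integral>x. hh x *\<^sub>R \<zeta>1 x \<partial>Om L)"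
  proof (rule integral_Om_cong_AE)
    show "AE x in Om L. hh x *\<^sub>R z1 \<tau> x = hh x *\<^sub>R \<zeta>1 x" using f1 by eventually_elim simp
    show "(\<lambda>x. hh x *\<^sub>R z1 \<tau> x) \<in> borel_measurable (Om L)"
      by (rule borel_measurable_integrable[OF continuous_scaleR_integrable[OF continuous_on_hh L2_Om_integrable[OF l1]]]) (use c in auto)
  qed
  have e2: "(\<integral>x. YY x *\<^sub>R z2 \<tau> x \<partial>Om L) = (\<integral>x. YY x *\<^sub>R \<zeta>2 x \<partial>Om L)"
  proof (rule integral_Om_cong_AE)
    show "AE x in Om L. YY x *\<^sub>R z2 \<tau> x = YY x *\<^sub>R \<zeta>2 x" using f2 by eventually_elim simp
    show "(\<lambda>x. YY x *\<^sub>R z2 \<tau> x) \<in> borel_measurable (Om L)"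
      by (rule borel_measurable_integrable[OF continuous_scaleR_integrable[OF continuous_on_YY L2_Om_integrable[OF l2]]]) (use c in auto)
  qed
  have cc: "c \<in> {0..\<tau>}" using c by simp
  have p3: "(\<integral>x. hh x *\<^sub>R \<zeta>1 x \<partial>Om L) - (\<integral>x. hh x *\<^sub>R z1 c x \<partial>Om L) = (\<integral>t. (\<integral>x. hh x *\<^sub>R w1 t x \<partial>Om L) \<partial>lebesgue_on {c<..<\<tau>})"
    unfolding e1[symmetric] by (rule time_derivative_pairing(3)[OF L D(1) continuous_on_hh l1 c order_refl])
  have p4: "(\<integral>x. YY x *\<^sub>R \<zeta>2 x \<partial>Om L) - (\<integral>x. YY x *\<^sub>R z2 c x \<partial>Om L) = (\<integral>t. (\<integral>x. YY x *\<^sub>R w2 t x \<partial>Om L) \<partial>lebesgue_on {c<..<\<tau>})"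
    unfolding e2[symmetric] by (rule time_derivative_pairing(3)[OF L D(2) continuous_on_YY l2 c order_refl])
  have "(\<integral>t. cnj (?N t) \<partial>lebesgue_on {c<..<\<tau>}) = cnj (\<integral>t. ?N t \<partial>lebesgue_on {c<..<\<tau>})"
    by simp
  also have "(\<integral>t. ?N t \<partial>lebesgue_on {c<..<\<tau>}) = (\<integral>t. - ?W t \<partial>lebesgue_on {c<..<\<tau>})"
  proof (rule integral_cong_AE)
    show "?N \<in> borel_measurable (lebesgue_on {c<..<\<tau>})"
      by (rule borel_measurable_integrable[OF sub[OF integrable_Om_AE[OF Wi WN]]])
    show "(\<lambda>t. - ?W t) \<in> borel_measurable (lebesgue_on {c<..<\<tau>})"
      by (rule borel_measurable_integrable[OF sub[OF Wi]])
    have "AE t in lebesgue_on {0<..<\<tau>}. ?N t = - ?W t" using WN by eventually_elim simp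
    then show "AE t in lebesgue_on {c<..<\<tau>}. ?N t = - ?W t"
      by (rule AE_lebesgue_on_subset) (use c in auto)
  qed
  also have "\<dots> = - ((\<integral>t. (\<integral>x. hh x *\<^sub>R w1 t x \<partial>Om L) \<partial>lebesgue_on {c<..<\<tau>}) + (\<integral>t. (\<integral>x. YY x *\<^sub>R w2 t x \<partial>Om L) \<partial>lebesgue_on {c<..<\<tau>}))"
    using sub[OF i1] sub[OF i2] by simp
  also have "\<dots> = - (((\<integral>x. hh x *\<^sub>R \<zeta>1 x \<partial>Om L) - (\<integral>x. hh x *\<^sub>R z1 c x \<partial>Om L)) + ((\<integral>x. YY x *\<^sub>R \<zeta>2 x \<partial>Om L) - (\<integral>x. YY x *\<^sub>R z2 c x \<partial>Om L)))"
    using p3 p4 by simp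
  finally show "Psi L V1 \<zeta>1 + Psi L V2 \<zeta>2 - (Psi L V1 (z1 c) + Psi L V2 (z2 c)) = - (\<integral>t. cnj (?N t) \<partial>lebesgue_on {c<..<\<tau>})"
    by (simp add: Psi_V \<zeta> H[OF cc])
qed

text \<open>Final states, in coordinates, for zero initial datum. Integrability of the boundary term
  is recorded in the definition so that the integrals add up for sums of controls.\<close>

definition reachable :: "real \<Rightarrow> (ell2 \<times> ell2) set" where
  "reachable T = {(r1, r2). \<exists>g X1 X2. continuous_on {0..T} X1 \<and> continuous_on {0..T} X2 \<and> g \<in> L2 (lebesgue_on {0<..<T}) \<and>
     X1 T = r1 \<and> X2 T = r2 \<and> (\<forall>\<tau>\<in>{0..T}. \<forall>\<zeta>1\<in>H10 L. \<forall>\<zeta>2\<in>H10 L. \<forall>z1 z2. adjoint_solution L G a \<tau> \<zeta>1 \<zeta>2 z1 z2 \<longrightarrow>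
        integrable (lebesgue_on {0<..<\<tau>}) (\<lambda>t. g t * cnj (normal_derivative_at_0 L (z1 t))) \<and>
        Psi L (X1 \<tau>) \<zeta>1 + Psi L (X2 \<tau>) \<zeta>2 = - (\<integral>t. g t * cnj (normal_derivative_at_0 L (z1 t)) \<partial>lebesgue_on {0<..<\<tau>}))}"

text \<open>The control is 0 up to time c = T - s and 1 afterwards. The stationary part accounts for
  the boundary integral after c by \<open>steady_state_identity\<close>, and
  \<open>evolution\<close> transports the adjoint value from c to the test data.\<close>

lemma reachable_step:
  assumes s: "0 < s" "s \<le> T"
  shows "(V1 - heat L s V1, V2 - (heat L s V2 + K s V1)) \<in> reachable T"
proof -
  define c where "c = T - s"
  have c: "0 \<le> c" "c < T" using s by (auto simp: c_def)
  \<comment> \<open>The maximum with 0 covers the time before the jump, where the semigroup is the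
    identity and the state is zero.\<close>
  define X1 where "X1 t = V1 - heat L (max 0 (t - c)) V1" for t
  define X2 where "X2 t = V2 - (heat L (max 0 (t - c)) V2 + K (max 0 (t - c)) V1)" for t
  have h: "continuous_on {0..T} (\<lambda>t. heat L (max 0 (t - c)) x)" for x
    by (rule continuous_on_compose2[OF continuous_on_heat[OF L]]) (auto intro!: continuous_intros)
  have k: "continuous_on {0..T} (\<lambda>t. K (max 0 (t - c)) x)" for x
    by (rule continuous_on_compose2[OF continuous_on_K]) (auto intro!: continuous_intros)
  have cX: "continuous_on {0..T} X1" "continuous_on {0..T} X2"
    unfolding X1_def[abs_def] X2_def[abs_def] by (intro continuous_intros h k)+
  have gl: "(indicator {c<..} :: real \<Rightarrow> complex) \<in> L2 (lebesgue_on {0<..<T})"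
  proof (rule L2_bounded[OF finite_measure_Om, of _ _ 1])
    show "(indicator {c<..} :: real \<Rightarrow> complex) \<in> borel_measurable (lebesgue_on {0<..<T})"
      by (rule measurable_restrict_space1) (auto intro!: borel_measurable_indicator)
    show "AE t in lebesgue_on {0<..<T}. norm (indicator {c<..} t :: complex) \<le> 1" by (auto simp: indicator_def)
  qed
  have sol: "integrable (lebesgue_on {0<..<\<tau>}) (\<lambda>t. indicator {c<..} t * cnj (normal_derivative_at_0 L (z1 t))) \<and>
        Psi L (X1 \<tau>) \<zeta>1 + Psi L (X2 \<tau>) \<zeta>2 = - (\<integral>t. indicator {c<..} t * cnj (normal_derivative_at_0 L (z1 t)) \<partial>lebesgue_on {0<..<\<tau>})"
    if \<tau>: "\<tau> \<in> {0..T}" and \<zeta>: "\<zeta>1 \<in> H10 L" "\<zeta>2 \<in> H10 L" and a: "adjoint_solution L G a \<tau> \<zeta>1 \<zeta>2 z1 z2" for \<tau> \<zeta>1 \<zeta>2 z1 z2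
  proof (cases "c \<le> \<tau>")
    case True
    let ?N = "\<lambda>t. cnj (normal_derivative_at_0 L (z1 t))"
    note st = steady_state_identity[OF a \<zeta>]
    have e: "indicator {c<..} t * ?N t = indicator {c<..<\<tau>} t *\<^sub>R ?N t" if "t \<in> space (lebesgue_on {0<..<\<tau>})" for t
      using that by (auto simp: indicator_def)
    have sub: "{0<..<\<tau>} \<in> sets lebesgue" "{c<..<\<tau>} \<in> sets lebesgue" "{c<..<\<tau>} \<subseteq> {0<..<\<tau>}" using c by auto
    have Ni: "integrable (lebesgue_on {0<..<\<tau>}) ?N" using st(1) by simp
    have "integrable (lebesgue_on {0<..<\<tau>}) (\<lambda>t. indicator {c<..} t * ?N t) \<longleftrightarrow> integrable (lebesgue_on {0<..<\<tau>}) (\<lambda>t. indicator {c<..<\<tau>} t *\<^sub>R ?N t)"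
      by (rule Bochner_Integration.integrable_cong[OF refl e])
    then have "integrable (lebesgue_on {0<..<\<tau>}) (\<lambda>t. indicator {c<..} t * ?N t)"
      unfolding integral_lebesgue_on_indicator(2)[OF sub] using integrable_lebesgue_on_subset[OF Ni sub(3,1,2)] by blast
    moreover have "(\<integral>t. indicator {c<..} t * ?N t \<partial>lebesgue_on {0<..<\<tau>}) = (\<integral>t. indicator {c<..<\<tau>} t *\<^sub>R ?N t \<partial>lebesgue_on {0<..<\<tau>})"
      by (rule Bochner_Integration.integral_cong[OF refl e])
    then have "(\<integral>t. indicator {c<..} t * ?N t \<partial>lebesgue_on {0<..<\<tau>}) = (\<integral>t. ?N t \<partial>lebesgue_on {c<..<\<tau>})"
      unfolding integral_lebesgue_on_indicator(1)[OF sub] .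
    moreover have "max 0 (\<tau> - c) = \<tau> - c" using True by simp
    then have "Psi L (X1 \<tau>) \<zeta>1 + Psi L (X2 \<tau>) \<zeta>2 =
        Psi L V1 \<zeta>1 + Psi L V2 \<zeta>2 - (Psi L (heat L (\<tau> - c) V1) \<zeta>1 + Psi L (heat L (\<tau> - c) V2 + K (\<tau> - c) V1) \<zeta>2)"
      by (simp only: X1_def X2_def Psi_diff add_diff_add)
    moreover have "Psi L (heat L (\<tau> - c) V1) \<zeta>1 + Psi L (heat L (\<tau> - c) V2 + K (\<tau> - c) V1) \<zeta>2 = Psi L V1 (z1 c) + Psi L V2 (z2 c)"
      by (rule evolution[OF a A_def \<zeta>]) (use \<tau> c True in auto)
    ultimately show ?thesis
      using st(2)[OF c(1) True] by simp
  next
    case False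
    then have "max 0 (\<tau> - c) = 0" by simp
    moreover have "indicator {c<..} t * cnj (normal_derivative_at_0 L (z1 t)) = 0" if "t \<in> space (lebesgue_on {0<..<\<tau>})" for t
      using that False by (auto simp: indicator_def)
    then have "integrable (lebesgue_on {0<..<\<tau>}) (\<lambda>t. indicator {c<..} t * cnj (normal_derivative_at_0 L (z1 t))) \<longleftrightarrow> integrable (lebesgue_on {0<..<\<tau>}) (\<lambda>t. 0 :: complex)"
      "(\<integral>t. indicator {c<..} t * cnj (normal_derivative_at_0 L (z1 t)) \<partial>lebesgue_on {0<..<\<tau>}) = (\<integral>t. (0 :: complex) \<partial>lebesgue_on {0<..<\<tau>})"
      by (intro Bochner_Integration.integrable_cong Bochner_Integration.integral_cong refl; simp)+
    ultimately show ?thesis by (simp add: X1_def X2_def heat_0[OF L] K_0 Psi_diff Psi_zero)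
  qed
  have "X1 T = V1 - heat L s V1" "X2 T = V2 - (heat L s V2 + K s V1)" using s by (simp_all add: X1_def X2_def c_def)
  then show ?thesis unfolding reachable_def using cX gl sol by blast
qed

lemma reachable_lincomb:
  assumes "(r1, r2) \<in> reachable T" "(s1, s2) \<in> reachable T"
  shows "(r1 + scl c s1, r2 + scl c s2) \<in> reachable T"
proof -
  obtain g X1 X2 where X: "continuous_on {0..T} X1" "continuous_on {0..T} X2" "g \<in> L2 (lebesgue_on {0<..<T})" "X1 T = r1" "X2 T = r2"
     "\<forall>\<tau>\<in>{0..T}. \<forall>\<zeta>1\<in>H10 L. \<forall>\<zeta>2\<in>H10 L. \<forall>z1 z2. adjoint_solution L G a \<tau> \<zeta>1 \<zeta>2 z1 z2 \<longrightarrow>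
        integrable (lebesgue_on {0<..<\<tau>}) (\<lambda>t. g t * cnj (normal_derivative_at_0 L (z1 t))) \<and>
        Psi L (X1 \<tau>) \<zeta>1 + Psi L (X2 \<tau>) \<zeta>2 = - (\<integral>t. g t * cnj (normal_derivative_at_0 L (z1 t)) \<partial>lebesgue_on {0<..<\<tau>})"
    using assms(1) unfolding reachable_def by blast
  obtain h Z1 Z2 where Z: "continuous_on {0..T} Z1" "continuous_on {0..T} Z2" "h \<in> L2 (lebesgue_on {0<..<T})" "Z1 T = s1" "Z2 T = s2"
     "\<forall>\<tau>\<in>{0..T}. \<forall>\<zeta>1\<in>H10 L. \<forall>\<zeta>2\<in>H10 L. \<forall>z1 z2. adjoint_solution L G a \<tau> \<zeta>1 \<zeta>2 z1 z2 \<longrightarrow>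
        integrable (lebesgue_on {0<..<\<tau>}) (\<lambda>t. h t * cnj (normal_derivative_at_0 L (z1 t))) \<and>
        Psi L (Z1 \<tau>) \<zeta>1 + Psi L (Z2 \<tau>) \<zeta>2 = - (\<integral>t. h t * cnj (normal_derivative_at_0 L (z1 t)) \<partial>lebesgue_on {0<..<\<tau>})"
    using assms(2) unfolding reachable_def by blast
  let ?g = "\<lambda>t. g t + c * h t" and ?X1 = "\<lambda>t. X1 t + scl c (Z1 t)" and ?X2 = "\<lambda>t. X2 t + scl c (Z2 t)"
  have "continuous_on {0..T} ?X1" "continuous_on {0..T} ?X2"
    by (intro continuous_on_add X Z bounded_linear.continuous_on[OF bounded_linear_scl])+
  moreover have "?g \<in> L2 (lebesgue_on {0<..<T})" by (intro L2_add L2_cmult X Z)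
  moreover have "?X1 T = r1 + scl c s1" "?X2 T = r2 + scl c s2" using X Z by simp_all
  moreover have "integrable (lebesgue_on {0<..<\<tau>}) (\<lambda>t. ?g t * cnj (normal_derivative_at_0 L (z1 t))) \<and>
        Psi L (?X1 \<tau>) \<zeta>1 + Psi L (?X2 \<tau>) \<zeta>2 = - (\<integral>t. ?g t * cnj (normal_derivative_at_0 L (z1 t)) \<partial>lebesgue_on {0<..<\<tau>})"
    if \<tau>: "\<tau> \<in> {0..T}" and \<zeta>: "\<zeta>1 \<in> H10 L" "\<zeta>2 \<in> H10 L" and a: "adjoint_solution L G a \<tau> \<zeta>1 \<zeta>2 z1 z2" for \<tau> \<zeta>1 \<zeta>2 z1 z2
  proof -
    let ?N = "\<lambda>t. cnj (normal_derivative_at_0 L (z1 t))"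
    have ig: "integrable (lebesgue_on {0<..<\<tau>}) (\<lambda>t. g t * ?N t)" and pg: "Psi L (X1 \<tau>) \<zeta>1 + Psi L (X2 \<tau>) \<zeta>2 = - (\<integral>t. g t * ?N t \<partial>lebesgue_on {0<..<\<tau>})"
      using X(6) \<tau> \<zeta> a by blast+
    have ih: "integrable (lebesgue_on {0<..<\<tau>}) (\<lambda>t. h t * ?N t)" and ph: "Psi L (Z1 \<tau>) \<zeta>1 + Psi L (Z2 \<tau>) \<zeta>2 = - (\<integral>t. h t * ?N t \<partial>lebesgue_on {0<..<\<tau>})"
      using Z(6) \<tau> \<zeta> a by blast+
    have e: "?g t * ?N t = g t * ?N t + c * (h t * ?N t)" for t by (simp add: algebra_simps)
    have "Psi L (?X1 \<tau>) \<zeta>1 + Psi L (?X2 \<tau>) \<zeta>2 = (Psi L (X1 \<tau>) \<zeta>1 + Psi L (X2 \<tau>) \<zeta>2) + c * (Psi L (Z1 \<tau>) \<zeta>1 + Psi L (Z2 \<tau>) \<zeta>2)"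
      by (simp add: Psi_add Psi_scl algebra_simps)
    then show ?thesis unfolding e pg ph using ig ih by simp
  qed
  ultimately show ?thesis unfolding reachable_def by blast
qed

lemma zero_in_reachable: "(0, 0) \<in> reachable T"
  unfolding reachable_def by (auto intro!: exI[of _ "\<lambda>_. 0"] simp: L2_zero Psi_zero)

lemma subspace_reachable: "subspace (reachable T)"
  unfolding subspace_def
proof (intro conjI ballI allI)
  show "0 \<in> reachable T" using zero_in_reachable by (simp add: zero_prod_def)
  show "x + y \<in> reachable T" if "x \<in> reachable T" "y \<in> reachable T" for x y
    using reachable_lincomb[of "fst x" "snd x" T "fst y" "snd y" 1] that by (simp add: scl_1 plus_prod_def)
  show "r *\<^sub>R x \<in> reachable T" if "x \<in> reachable T" for r x
    using reachable_lincomb[OF zero_in_reachable, of "fst x" "snd x" T "of_real r"] that by (simp add: scl_scaleR scaleR_prod_def)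
qed

text \<open>The reachable set is stable under complex scalars, so real orthogonality to it supplies
  the hypothesis of \<open>annihilator_trivial\<close> for every c.\<close>

lemma reachable_dense:
  assumes T: "T > 0" and diag: "\<And>j. \<beta> j j \<noteq> 0" and e: "e > 0"
  obtains r1 r2 where "(r1, r2) \<in> reachable T" "norm ((x1, x2) - (r1, r2)) < e"
proof -
  have triv: "r = 0" if r: "\<And>v. v \<in> reachable T \<Longrightarrow> v \<bullet> r = 0" for r
  proof -
  have ann: "scl c (V1 - heat L s V1) \<bullet> fst r + scl c (V2 - (heat L s V2 + K s V1)) \<bullet> snd r = 0"
    if s: "0 < s" "s \<le> T" for c s
    using r[OF reachable_lincomb[OF zero_in_reachable reachable_step[OF s], of c]] by (simp add: inner_prod_def)
  have c0: "sqrt (2 / L) \<noteq> 0" using L by simp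
  show "r = 0"
    using annihilator_trivial[OF T diag c0 nth_V1 ann] by (simp add: prod_eq_iff)
  qed
  obtain v where "v \<in> reachable T" "norm ((x1, x2) - v) < e"
    using orthogonal_complement_trivial_imp_dense[OF subspace_reachable triv e] .
  then show thesis using that[of "fst v" "snd v"] by simp
qed

lemma hm1norm_Psi_diff_le:
  assumes F: "F \<in> Hm1 L"
  shows "hm1norm L (\<lambda>u. Psi L x u - F u) \<le> norm (x - coords L F)" "0 \<le> hm1norm L (\<lambda>u. Psi L x u - F u)"
proof -
  have b: "norm (Psi L x u - F u) \<le> norm (x - coords L F) * h1norm L u" if u: "u \<in> H10 L" for u
    using Psi_bound[OF L u, of "x - coords L F"] by (simp add: Psi_diff Psi_coords[OF L F u])
  show "hm1norm L (\<lambda>u. Psi L x u - F u) \<le> norm (x - coords L F)" by (rule hm1norm_le[OF L b]) auto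
  show "0 \<le> hm1norm L (\<lambda>u. Psi L x u - F u)"
    by (rule order_trans[OF norm_ge_zero norm_le_hm1norm[OF L b norm_ge_zero H10_zero[OF L] h1norm_zero_le[OF L]]])
qed

theorem approx_controllable_if:
  assumes diag: "\<And>j. \<beta> j j \<noteq> 0"
  shows "approx_controllable L G a"
  unfolding approx_controllable_def approx_controllable_at_def
proof (intro allI impI ballI)
  fix T :: real and y0 yT :: "functional \<times> functional" and \<epsilon> :: real
  assume T: "T > 0" and y0: "y0 \<in> Hm1 L \<times> Hm1 L" and yT: "yT \<in> Hm1 L \<times> Hm1 L" and \<epsilon>: "\<epsilon> > 0"
  define x1 where "x1 = coords L (fst y0)"
  define x2 where "x2 = coords L (snd y0)"
  have f0: "fst y0 \<in> Hm1 L" "snd y0 \<in> Hm1 L" and fT: "fst yT \<in> Hm1 L" "snd yT \<in> Hm1 L" using y0 yT by auto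
  \<comment> \<open>The free evolution of the initial state is subtracted from the target, which
    reduces the task to approximation by states reachable from zero.\<close>
  define t1 where "t1 = coords L (fst yT) - heat L T x1"
  define t2 where "t2 = coords L (snd yT) - (heat L T x2 + K T x1)"
  obtain r1 r2 where r: "(r1, r2) \<in> reachable T" and d: "norm ((t1, t2) - (r1, r2)) < \<epsilon>"
    using reachable_dense[OF T diag \<epsilon>] .
  obtain g X1 X2 where X: "continuous_on {0..T} X1" "continuous_on {0..T} X2" "g \<in> L2 (lebesgue_on {0<..<T})" "X1 T = r1" "X2 T = r2"
     "\<forall>\<tau>\<in>{0..T}. \<forall>\<zeta>1\<in>H10 L. \<forall>\<zeta>2\<in>H10 L. \<forall>z1 z2. adjoint_solution L G a \<tau> \<zeta>1 \<zeta>2 z1 z2 \<longrightarrow>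
        integrable (lebesgue_on {0<..<\<tau>}) (\<lambda>t. g t * cnj (normal_derivative_at_0 L (z1 t))) \<and>
        Psi L (X1 \<tau>) \<zeta>1 + Psi L (X2 \<tau>) \<zeta>2 = - (\<integral>t. g t * cnj (normal_derivative_at_0 L (z1 t)) \<partial>lebesgue_on {0<..<\<tau>})"
    using r unfolding reachable_def by blast
  let ?Z1 = "\<lambda>t. heat L t x1 + X1 t" and ?Z2 = "\<lambda>t. (heat L t x2 + K t x1) + X2 t"
  let ?y1 = "\<lambda>t. Psi L (?Z1 t)" and ?y2 = "\<lambda>t. Psi L (?Z2 t)"
  have h: "continuous_on {0..T} (\<lambda>t. heat L t x)" for x
    by (rule continuous_on_subset[OF continuous_on_heat[OF L]]) auto
  have k: "continuous_on {0..T} (\<lambda>t. K t x)" for x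
    by (rule continuous_on_subset[OF continuous_on_K]) auto
  have "transposition_solution L G a T y0 (\<lambda>t b. g t) ?y1 ?y2"
    unfolding transposition_solution_def
  proof (intro conjI ballI allI impI)
    show "continuous_path (Hm1 L) (hm1norm L) T ?y1" "continuous_path (Hm1 L) (hm1norm L) T ?y2"
      by (intro continuous_path_Psi[OF L] continuous_on_add h k X)+
    fix \<tau> \<zeta>1 \<zeta>2 z1 z2
    assume \<tau>: "\<tau> \<in> {0..T}" and \<zeta>: "\<zeta>1 \<in> H10 L" "\<zeta>2 \<in> H10 L" and a: "adjoint_solution L G a \<tau> \<zeta>1 \<zeta>2 z1 z2"
    have z: "z1 0 \<in> H10 L" "z2 0 \<in> H10 L" using a \<tau> by (auto simp: adjoint_solution_def continuous_path_def)
    have "Psi L (heat L (\<tau> - 0) x1) \<zeta>1 + Psi L (heat L (\<tau> - 0) x2 + K (\<tau> - 0) x1) \<zeta>2 = Psi L x1 (z1 0) + Psi L x2 (z2 0)"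
      by (rule evolution[OF a A_def \<zeta>]) (use \<tau> in auto)
    then have e: "Psi L (heat L \<tau> x1) \<zeta>1 + Psi L (heat L \<tau> x2 + K \<tau> x1) \<zeta>2 = fst y0 (z1 0) + snd y0 (z2 0)"
      unfolding x1_def x2_def Psi_coords[OF L f0(1) z(1)] Psi_coords[OF L f0(2) z(2)] by simp
    have "Psi L (X1 \<tau>) \<zeta>1 + Psi L (X2 \<tau>) \<zeta>2 = - (\<integral>t. g t * cnj (normal_derivative_at_0 L (z1 t)) \<partial>lebesgue_on {0<..<\<tau>})"
      using X(6) \<tau> \<zeta> a by blast
    with e show "?y1 \<tau> \<zeta>1 + ?y2 \<tau> \<zeta>2 - (fst y0 (z1 0) + snd y0 (z2 0)) = - (\<integral>t. g t * cnj (normal_derivative_at_0 L (z1 t)) \<partial>lebesgue_on {0<..<\<tau>})"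
      unfolding Psi_add[of L _ "X1 \<tau>"] Psi_add[of L _ "X2 \<tau>"] by (simp add: algebra_simps)
  qed
  moreover have "control L T (\<lambda>t b. g t)" using X(3) by (simp add: control_def)
  moreover have "hm1norm2 L (\<lambda>u. ?y1 T u - fst yT u, \<lambda>u. ?y2 T u - snd yT u) \<le> \<epsilon>"
  proof -
    have z: "?Z1 T - coords L (fst yT) = - (t1 - r1)" "?Z2 T - coords L (snd yT) = - (t2 - r2)"
      by (simp_all add: t1_def t2_def X(4,5))
    have n: "norm (?Z1 T - coords L (fst yT)) = norm (t1 - r1)" "norm (?Z2 T - coords L (snd yT)) = norm (t2 - r2)"
      unfolding z by (rule norm_minus_cancel)+
    have "hm1norm2 L (\<lambda>u. ?y1 T u - fst yT u, \<lambda>u. ?y2 T u - snd yT u) \<le> sqrt ((norm (t1 - r1))\<^sup>2 + (norm (t2 - r2))\<^sup>2)"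
      unfolding hm1norm2_def fst_conv snd_conv n[symmetric]
      by (intro real_sqrt_le_mono add_mono power_mono hm1norm_Psi_diff_le fT)
    also have "\<dots> = norm ((t1, t2) - (r1, r2))" by (simp add: norm_prod_def)
    finally show ?thesis using d by simp
  qed
  ultimately show "\<exists>g y1 y2. control L T g \<and> transposition_solution L G a T y0 g y1 y2 \<and>
      hm1norm2 L (\<lambda>u. y1 T u - fst yT u, \<lambda>u. y2 T u - snd yT u) \<le> \<epsilon>"
    by blast
qed

end

section \<open>The unobservable mode and the eigenfunctions\<close>

lemma H2_cmult:
  assumes L: "L > 0" and u: "u \<in> H2 L" "u \<in> H10 L"
  shows "(\<lambda>x. c * u x) \<in> H2 L" "AE x in Om L. laplacian L (\<lambda>x. c * u x) x = c * laplacian L u x"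
    "normal_derivative_at_0 L (\<lambda>x. c * u x) = c * normal_derivative_at_0 L u"
proof -
  note H = H2_H1_deriv[OF L u(1)]
  let ?b = "boundary_trace L (wderiv L u) 0"
  have p: "prim (\<lambda>x. c * laplacian L u x) x = c * prim (laplacian L u) x" for x
    unfolding prim_def by (rule integral_mult_right_zero)
  have "AE x in Om L. wderiv L (\<lambda>x. c * u x) x = c * ?b + prim (\<lambda>x. c * laplacian L u x) x"
    using H10_wderiv_cmult[OF L u(2), of c] H(2) by eventually_elim (simp add: p distrib_left)
  note W = H1I[OF L L2_cmult[OF H(1)] this]
  show "(\<lambda>x. c * u x) \<in> H2 L" using W(1) H10E(1)[OF L H10_cmult[OF L u(2)]] by (simp add: H2_def)
  show "AE x in Om L. laplacian L (\<lambda>x. c * u x) x = c * laplacian L u x" by (rule W(2))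
  show "normal_derivative_at_0 L (\<lambda>x. c * u x) = c * normal_derivative_at_0 L u"
    using W(3) by (simp add: normal_derivative_at_0_def)
qed

lemma l2norm_cmult: "l2norm M (\<lambda>x. c * u x) = norm c * l2norm M u"
  by (simp add: l2norm_def norm_mult power_mult_distrib real_sqrt_mult)

lemma h1norm_cmult:
  assumes L: "L > 0" and u: "u \<in> H10 L"
  shows "h1norm L (\<lambda>x. c * u x) = norm c * h1norm L u"
proof -
  have "l2norm (Om L) (wderiv L (\<lambda>x. c * u x)) = l2norm (Om L) (\<lambda>x. c * wderiv L u x)"
    by (rule l2norm_cong_AE[OF H10_wderiv_cmult[OF L u] L2D(1)[OF H10E(3)[OF L H10_cmult[OF L u]]] L2D(1)[OF L2_cmult[OF H10E(3)[OF L u]]]])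
  then have "h1norm L (\<lambda>x. c * u x) = sqrt ((norm c)\<^sup>2 * ((l2norm (Om L) u)\<^sup>2 + (l2norm (Om L) (wderiv L u))\<^sup>2))"
    by (simp add: h1norm_def l2norm_cmult power_mult_distrib distrib_left)
  then show ?thesis by (simp add: h1norm_def real_sqrt_mult)
qed

text \<open>Scaling to the unit sphere turns the supremum into an operator bound; where the norm of
  u is zero, boundedness of F gives F u = 0.\<close>

lemma norm_Hm1_le:
  assumes L: "L > 0" and F: "F \<in> Hm1 L" and u: "u \<in> H10 L"
  shows "norm (F u) \<le> hm1norm L F * h1norm L u" "0 \<le> hm1norm L F"
proof -
  obtain C where C: "\<And>u. u \<in> H10 L \<Longrightarrow> norm (F u) \<le> C * h1norm L u" using F unfolding Hm1_def by blast
  have b: "norm (F u) \<le> \<bar>C\<bar> * h1norm L u" if "u \<in> H10 L" for u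
    by (rule order_trans[OF C[OF that]]) (intro mult_right_mono h1norm_nonneg; simp)
  show "0 \<le> hm1norm L F"
    by (rule order_trans[OF norm_ge_zero norm_le_hm1norm[OF L b abs_ge_zero H10_zero[OF L] h1norm_zero_le[OF L]]])
  show "norm (F u) \<le> hm1norm L F * h1norm L u"
  proof (cases "h1norm L u = 0")
    case True
    then show ?thesis using b[OF u] by simp
  next
    case False
    then have pos: "h1norm L u > 0" using h1norm_nonneg[of L u] by simp
    let ?c = "complex_of_real (1 / h1norm L u)"
    have "h1norm L (\<lambda>x. ?c * u x) = norm ?c * h1norm L u" by (rule h1norm_cmult[OF L u])
    also have "\<dots> = 1" using pos by (simp add: norm_divide)
    finally have e: "h1norm L (\<lambda>x. ?c * u x) = 1" .
    have le: "norm (F (\<lambda>x. ?c * u x)) \<le> hm1norm L F"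
      by (rule norm_le_hm1norm[OF L b abs_ge_zero H10_cmult[OF L u] eq_refl[OF e]])
    have "F (\<lambda>x. ?c * u x) = cnj ?c * F u" using F u unfolding Hm1_def by blast
    from le[unfolded this] show ?thesis using pos by (simp add: norm_mult norm_divide field_simps)
  qed
qed

lemma Hm1_diff:
  assumes F: "F \<in> Hm1 L" and G: "G \<in> Hm1 L" and L: "L > 0"
  shows "(\<lambda>u. F u - G u) \<in> Hm1 L"
proof (rule Hm1I[OF _ _ L])
  fix u v c assume u: "u \<in> H10 L" and v: "v \<in> H10 L"
  show "F (\<lambda>x. u x + c * v x) - G (\<lambda>x. u x + c * v x) = F u - G u + cnj c * (F v - G v)"
    unfolding Hm1_lincomb[OF F u v L] Hm1_lincomb[OF G u v L] by (simp add: algebra_simps)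
next
  fix u assume u: "u \<in> H10 L"
  show "norm (F u - G u) \<le> (hm1norm L F + hm1norm L G) * h1norm L u"
    using norm_triangle_ineq4[of "F u" "G u"] norm_Hm1_le(1)[OF L F u] norm_Hm1_le(1)[OF L G u] by (simp add: distrib_right)
qed

section \<open>Dirichlet eigenfunctions and the invisible mode\<close>

lemma H10_coef_zero_imp_AE_zero:
  assumes L: "L > 0" and u: "u \<in> H10 L" and z: "\<And>n. coef L n u = 0"
  shows "AE x in Om L. u x = 0"
proof -
  have "(\<lambda>N::nat. l2norm (Om L) (wderiv L u)) \<longlonglongrightarrow> 0" using H10_parseval[OF L u] by (simp add: z)
  then have "l2norm (Om L) (wderiv L u) = 0" using LIMSEQ_unique[OF tendsto_const] by blast
  then have h: "h1norm L u \<le> 0" using h1norm_le_deriv(1)[OF L u] by simp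
  then have "(l2norm (Om L) u)\<^sup>2 + (l2norm (Om L) (wderiv L u))\<^sup>2 \<le> 0"
    unfolding h1norm_def by (simp only: real_sqrt_le_0_iff)
  then have "(l2norm (Om L) u)\<^sup>2 \<le> 0" using zero_le_power2[of "l2norm (Om L) (wderiv L u)"] by linarith
  then have "(\<integral>x. (norm (u x))\<^sup>2 \<partial>Om L) = 0"
    unfolding l2norm_square[symmetric] using zero_le_power2[of "l2norm (Om L) u"] by linarith
  then have "AE x in Om L. (norm (u x))\<^sup>2 = 0"
    using integral_nonneg_eq_0_iff_AE[OF L2D(2)[OF H10E(2)[OF L u]]] by simp
  then show ?thesis by eventually_elim simp
qed

lemma dirichlet_eigenfunction_es:
  assumes L: "L > 0"
  shows "dirichlet_eigenfunction L (- of_real (eigval L n)) (\<lambda>x. of_real (es L n x))"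
proof -
  let ?u = "\<lambda>x. complex_of_real (es L n x)"
  have "coef L n ?u = 1"
  proof -
    have "coef L n ?u = of_real (\<integral>x. es L n x * es L n x \<partial>Om L)"
      unfolding coef_def by (simp only: scaleR_conv_of_real of_real_mult[symmetric] integral_complex_of_real)
    then show ?thesis using es_orthonormal[OF L, of n n] by simp
  qed
  moreover have "coef L n ?u = 0" if "AE x in Om L. ?u x = 0"
    using coef_cong_AE[OF that H10E(2)[OF L es_H10[OF L]] L2_zero, of n] by (simp add: coef_def)
  ultimately have "\<not> (AE x in Om L. ?u x = 0)" by auto
  then show ?thesis
    using es_H2(1,2)[OF L, of n] es_H10[OF L, of n] unfolding dirichlet_eigenfunction_def by simp
qed

text \<open>Every sine coefficient of u satisfies (- \<open>eigval L n\<close> - \<mu>) times the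
  coefficient = 0. Distinct eigenvalues leave a single nonzero one, and u minus that mode has no
  coefficients at all.\<close>

lemma dirichlet_eigenfunction_imp_es:
  assumes L: "L > 0" and u: "dirichlet_eigenfunction L \<mu> u"
  shows "\<exists>n c. \<mu> = - of_real (eigval L n) \<and> (AE x in Om L. u x = c * of_real (es L n x))"
proof -
  have h: "u \<in> H2 L" "u \<in> H10 L" and nz: "\<not> (AE x in Om L. u x = 0)" and eq: "AE x in Om L. laplacian L u x = \<mu> * u x"
    using u by (auto simp: dirichlet_eigenfunction_def)
  have ul: "u \<in> L2 (Om L)" by (rule H10E(2)[OF L h(2)])
  have rel: "- of_real (eigval L n) * coef L n u = \<mu> * coef L n u" for n
    using coef_cong_AE[OF eq H2_H1_deriv(1)[OF L h(1)] L2_cmult[OF ul], of n]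
    by (simp only: H2_coef_laplacian[OF L h] coef_cmult[OF L ul])
  obtain n where n: "coef L n u \<noteq> 0" using H10_coef_zero_imp_AE_zero[OF L h(2)] nz by blast
  then have mu: "\<mu> = - of_real (eigval L n)" using rel[of n] by (metis mult_right_cancel)
  let ?e = "\<lambda>x. complex_of_real (es L n x)"
  have z: "coef L m (\<lambda>x. u x + (- coef L n u) * ?e x) = 0" for m
  proof -
    have o: "coef L m ?e = (if m = n then 1 else 0)"
    proof -
      have "coef L m ?e = of_real (\<integral>x. es L m x * es L n x \<partial>Om L)"
        unfolding coef_def by (simp only: scaleR_conv_of_real of_real_mult[symmetric] integral_complex_of_real)
      then show ?thesis using es_orthonormal[OF L, of m n] by simp
    qed
    have "coef L m u = 0" if "m \<noteq> n"
      using rel[of m] eigval_inj[OF L, of m n] that unfolding mu by (auto simp: mult_cancel_right)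
    then show ?thesis using coef_lincomb[OF L ul H10E(2)[OF L es_H10[OF L]], of m "- coef L n u" n] o by auto
  qed
  have "AE x in Om L. u x + (- coef L n u) * ?e x = 0"
    by (rule H10_coef_zero_imp_AE_zero[OF L H10_lincomb(1)[OF L h(2) es_H10[OF L]] z])
  then have "AE x in Om L. u x = coef L n u * ?e x" by eventually_elim simp
  then show ?thesis using mu by blast
qed

lemma continuous_path_cmult:
  assumes L: "L > 0" and u: "u \<in> H10 L" and k: "continuous_on {0..T} k"
  shows "continuous_path (H10 L) (h1norm L) T (\<lambda>t x. k t * u x)"
  unfolding continuous_path_def
proof (intro conjI ballI)
  show "(\<lambda>x. k t * u x) \<in> H10 L" for t by (rule H10_cmult[OF L u])
  fix t assume t: "t \<in> {0..T}"
  have "((\<lambda>s. norm (k s - k t) * h1norm L u) \<longlongrightarrow> norm (k t - k t) * h1norm L u) (at t within {0..T})"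
    using k t by (intro tendsto_intros) (auto simp: continuous_on_def)
  moreover have "h1norm L (\<lambda>x. k s * u x - k t * u x) = norm (k s - k t) * h1norm L u" for s
    using h1norm_cmult[OF L u, of "k s - k t"] by (simp add: left_diff_distrib)
  ultimately show "((\<lambda>s. h1norm L (\<lambda>x. k s * u x - k t * u x)) \<longlongrightarrow> 0) (at t within {0..T})" by simp
qed

lemma has_time_derivative_cmult:
  assumes T: "T > 0" and u: "continuous_on {0..L} u" and k': "continuous_on {0..T} k'"
    and kk: "\<And>t. (k has_vector_derivative k' t) (at t)"
  shows "has_time_derivative L T (\<lambda>t x. k t * u x) (\<lambda>t x. k' t * u x)"
  unfolding has_time_derivative_def
proof (intro conjI allI impI)
  let ?f = "\<lambda>(t, x). k' t * u x"
  have c: "continuous_on (cbox (0, 0) (T, L)) ?f"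
    unfolding split_beta
    by (intro continuous_intros continuous_on_compose2[OF k' continuous_on_fst[OF continuous_on_id]] continuous_on_compose2[OF u continuous_on_snd[OF continuous_on_id]])
       (auto simp: cbox_Pair_eq)
  have s: "{0<..<T} \<times> {0<..<L} \<subseteq> cbox (0, 0) (T, L)" by (auto simp: cbox_Pair_eq)
  have m: "{0<..<T} \<times> {0<..<L} \<in> sets lebesgue" by (intro lmeasurable_open fmeasurableD bounded_Times open_Times) auto
  have i: "integrable (lebesgue_on ({0<..<T} \<times> {0<..<L})) g" if "continuous_on (cbox (0, 0) (T, L)) g" for g :: "real \<times> real \<Rightarrow> 'c::euclidean_space"
    by (rule integrable_lebesgue_on_subset[OF continuous_imp_integrable[OF that] s _ m]) auto
  have "integrable (lebesgue_on ({0<..<T} \<times> {0<..<L})) (\<lambda>p. (norm (?f p))\<^sup>2)" by (rule i) (intro continuous_intros c)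
  then show "?f \<in> L2 (lebesgue_on ({0<..<T} \<times> {0<..<L}))"
    unfolding L2_def using borel_measurable_integrable[OF i[OF c]] by blast
  fix s t assume st: "0 \<le> s" "s \<le> t" "t \<le> T"
  show "AE x in Om L. k t * u x - k s * u x = (\<integral>r. k' r * u x \<partial>lebesgue_on {s<..<t})"
  proof (intro AE_I2)
    fix x
    have c: "continuous_on {0..T} (\<lambda>r. k' r * u x)" by (intro continuous_intros k')
    have p: "prim (\<lambda>r. k' r * u x) y = k y * u x - k 0 * u x" if "0 \<le> y" "y \<le> T" for y
    proof (rule prim_FTC[OF that(1)])
      show "((\<lambda>r. k r * u x) has_vector_derivative k' t * u x) (at t within {0..y})" for t
        by (rule has_vector_derivative_mult_left) (rule has_vector_derivative_at_within[OF kk])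
      show "continuous_on {0..y} (\<lambda>r. k' r * u x)" using c by (rule continuous_on_subset) (use that in auto)
    qed
    show "k t * u x - k s * u x = (\<integral>r. k' r * u x \<partial>lebesgue_on {s<..<t})"
      using prim_diff(1)[OF integrable_continuous_Om[OF c] st] p[of s] p[of t] st by simp
  qed
qed

context controlled_system
begin

text \<open>Variation of constants for the initial value problem. At L the sine vanishes, and the
  integral multiplying the cosine is proportional to \<beta> j j, so the hypothesis is precisely the
  boundary condition there.\<close>

lemma invisible_profile:
  assumes j: "\<beta> j j = 0"
  shows "\<exists>\<psi>. continuous_on {0..L} \<psi> \<and> \<psi> \<in> H2 L \<and> \<psi> \<in> H10 L \<and> normal_derivative_at_0 L \<psi> = 0 \<and>
    (AE x in Om L. laplacian L \<psi> x = of_real (G x * (freq L j * ec L j x) - A x * es L j x) - of_real (eigval L j) * \<psi> x)"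
proof -
  define w where "w = freq L j"
  have w: "w > 0" unfolding w_def by (rule freq_pos[OF L])
  define f where "f x = G x * (w * ec L j x) - A x * es L j x" for x
  have fi: "integrable (Om L) f"
    unfolding f_def[abs_def]
    using continuous_scaleR_integrable[OF _ G_integrable, of "\<lambda>x. w * ec L j x"] continuous_scaleR_integrable[OF _ A_integrable, of "es L j"]
    by (simp add: mult.commute continuous_intros)
  have fl: "(\<lambda>x. complex_of_real (f x)) \<in> L2 (Om L)"
  proof -
    have "(\<lambda>x. G x *\<^sub>R complex_of_real (w * ec L j x)) \<in> L2 (Om L)" "(\<lambda>x. A x *\<^sub>R complex_of_real (es L j x)) \<in> L2 (Om L)"
      by (intro L2_bounded_scaleR[OF _ Gm GM] L2_bounded_scaleR[OF _ Am AM] L2_continuous continuous_intros)+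
    from L2_diff[OF this] show ?thesis by (simp add: f_def scaleR_conv_of_real)
  qed
  define c where "c x = cos (w * x)" for x
  define s where "s x = sin (w * x)" for x
  have cc: "continuous_on S c" and sc: "continuous_on S s" for S unfolding c_def[abs_def] s_def[abs_def] by (intro continuous_intros)+
  have cp: "c x = 1 + prim (\<lambda>y. - w * s y) x" and sp: "s x = 0 + prim (\<lambda>y. w * c y) x" if "0 \<le> x" for x
  proof -
    have "prim (\<lambda>y. - w * s y) x = c x - c 0"
      by (rule prim_FTC_real[OF that]) (auto simp: c_def s_def intro!: derivative_eq_intros continuous_intros)
    then show "c x = 1 + prim (\<lambda>y. - w * s y) x" by (simp add: c_def)
    have "prim (\<lambda>y. w * c y) x = s x - s 0"
      by (rule prim_FTC_real[OF that]) (auto simp: c_def s_def intro!: derivative_eq_intros continuous_intros)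
    then show "s x = 0 + prim (\<lambda>y. w * c y) x" by (simp add: s_def)
  qed
  have ci: "integrable (Om L) (\<lambda>y. w * c y)" and si: "integrable (Om L) (\<lambda>y. - w * s y)"
    by (intro integrable_continuous_Om continuous_intros cc sc)+
  have cfi: "integrable (Om L) (\<lambda>x. c x * f x)" and sfi: "integrable (Om L) (\<lambda>x. s x * f x)"
    using continuous_scaleR_integrable[OF cc fi] continuous_scaleR_integrable[OF sc fi] by simp_all
  define C where "C = prim (\<lambda>x. c x * f x)"
  define D where "D = prim (\<lambda>x. s x * f x)"
  have Cc: "continuous_on {0..L} C" and Dc: "continuous_on {0..L} D"
    unfolding C_def D_def by (intro continuous_on_prim cfi sfi)+
  define \<psi> where "\<psi> x = (s x * C x - c x * D x) / w" for x
  define p where "p x = c x * C x + s x * D x" for x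
  have pc: "continuous_on {0..L} p" and \<psi>c: "continuous_on {0..L} \<psi>"
    unfolding p_def[abs_def] \<psi>_def[abs_def] by (intro continuous_intros cc sc Cc Dc; use w in simp)+
  have prod: "(\<lambda>y. (a + prim f y) * v y + f y * (b + prim v y)) \<in> {g. integrable (Om L) g}"
     "(a + prim f x) * (b + prim v x) = a * b + prim (\<lambda>y. (a + prim f y) * v y + f y * (b + prim v y)) x"
    if "integrable (Om L) f" "integrable (Om L) v" "0 \<le> x" "x \<le> L" for a b x :: real and f v
    using prim_product(1)[OF that(1,2), of a b] prim_product(2)[OF that, of a b] by simp_all
  have pcong: "prim g x = prim h x" if "\<And>y. 0 \<le> y \<Longrightarrow> y \<le> L \<Longrightarrow> g y = h y" "x \<le> L" for g h :: "real \<Rightarrow> real" and x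
    unfolding prim_def by (intro Bochner_Integration.integral_cong) (use that in auto)
  have i1: "integrable (Om L) (\<lambda>y. s y * (c y * f y) + w * c y * C y)"
    using continuous_scaleR_integrable[OF sc cfi] integrable_continuous_Om[of L "\<lambda>y. w * c y * C y"]
    by (simp add: continuous_intros cc Cc)
  have i2: "integrable (Om L) (\<lambda>y. c y * (s y * f y) - w * s y * D y)"
    using continuous_scaleR_integrable[OF cc sfi] integrable_continuous_Om[of L "\<lambda>y. w * s y * D y"]
    by (simp add: continuous_intros sc Dc)
  have i3: "integrable (Om L) (\<lambda>y. c y * (c y * f y) - w * s y * C y)"
    using continuous_scaleR_integrable[OF cc cfi] integrable_continuous_Om[of L "\<lambda>y. w * s y * C y"]
    by (simp add: continuous_intros sc Cc)
  have i4: "integrable (Om L) (\<lambda>y. s y * (s y * f y) + w * c y * D y)"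
    using continuous_scaleR_integrable[OF sc sfi] integrable_continuous_Om[of L "\<lambda>y. w * c y * D y"]
    by (simp add: continuous_intros cc Dc)
  have e1: "s x * C x = prim (\<lambda>y. s y * (c y * f y) + w * c y * C y) x" if x: "0 \<le> x" "x \<le> L" for x
    using prod(2)[OF ci cfi x, of 0 0] pcong[of "\<lambda>y. (0 + prim (\<lambda>y. w * c y) y) * (c y * f y) + w * c y * (0 + prim (\<lambda>x. c x * f x) y)" "\<lambda>y. s y * (c y * f y) + w * c y * C y" x] sp x
    by (simp add: C_def)
  have e2: "c x * D x = prim (\<lambda>y. c y * (s y * f y) - w * s y * D y) x" if x: "0 \<le> x" "x \<le> L" for x
    using prod(2)[OF si sfi x, of 1 0] pcong[of "\<lambda>y. (1 + prim (\<lambda>y. - w * s y) y) * (s y * f y) + - w * s y * (0 + prim (\<lambda>x. s x * f x) y)" "\<lambda>y. c y * (s y * f y) - w * s y * D y" x] cp x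
    by (simp add: D_def)
  have e3: "c x * C x = prim (\<lambda>y. c y * (c y * f y) - w * s y * C y) x" if x: "0 \<le> x" "x \<le> L" for x
    using prod(2)[OF si cfi x, of 1 0] pcong[of "\<lambda>y. (1 + prim (\<lambda>y. - w * s y) y) * (c y * f y) + - w * s y * (0 + prim (\<lambda>x. c x * f x) y)" "\<lambda>y. c y * (c y * f y) - w * s y * C y" x] cp x
    by (simp add: C_def)
  have e4: "s x * D x = prim (\<lambda>y. s y * (s y * f y) + w * c y * D y) x" if x: "0 \<le> x" "x \<le> L" for x
    using prod(2)[OF ci sfi x, of 0 0] pcong[of "\<lambda>y. (0 + prim (\<lambda>y. w * c y) y) * (s y * f y) + w * c y * (0 + prim (\<lambda>x. s x * f x) y)" "\<lambda>y. s y * (s y * f y) + w * c y * D y" x] sp x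
    by (simp add: D_def)
  have \<psi>p: "\<psi> x = prim p x" if x: "0 \<le> x" "x \<le> L" for x
  proof -
    \<comment> \<open>The products s c f occur in the derivatives of both s C and c D and cancel in
      the difference, which leaves w p.\<close>
    have "s x * C x = prim (\<lambda>y. (c y * (s y * f y) - w * s y * D y) + w * p y) x"
      unfolding e1[OF x] by (intro pcong x) (simp add: p_def algebra_simps)
    also have "\<dots> = c x * D x + prim (\<lambda>y. w * p y) x"
      unfolding e2[OF x] by (rule prim_add[OF i2 integrable_continuous_Om x(2)]) (intro continuous_intros pc)
    also have "prim (\<lambda>y. w * p y) x = w * prim p x" unfolding prim_def by (rule integral_mult_right_zero)
    finally show ?thesis using w by (simp add: \<psi>_def)
  qed
  have pf: "p x = prim (\<lambda>y. f y - eigval L j * \<psi> y) x" if x: "0 \<le> x" "x \<le> L" for x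
  proof -
    have "p x = prim (\<lambda>y. (c y * (c y * f y) - w * s y * C y) + (s y * (s y * f y) + w * c y * D y)) x"
      unfolding p_def e3[OF x] e4[OF x] by (rule prim_add[OF i3 i4 x(2), symmetric])
    also have "\<dots> = prim (\<lambda>y. f y - eigval L j * \<psi> y) x"
    proof (intro pcong x)
      fix y
      have "eigval L j * \<psi> y = w * (s y * C y - c y * D y)" using w by (simp add: eigval_def w_def[symmetric] \<psi>_def power2_eq_square)
      then have "eigval L j * \<psi> y = w * s y * C y - w * c y * D y" by (simp only: right_diff_distrib mult.assoc)
      moreover have "c y * (c y * f y) + s y * (s y * f y) = ((s y)\<^sup>2 + (c y)\<^sup>2) * f y" by (simp add: power2_eq_square algebra_simps)
      moreover have "(s y)\<^sup>2 + (c y)\<^sup>2 = 1" unfolding s_def c_def by (rule sin_cos_squared_add)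
      ultimately show "(c y * (c y * f y) - w * s y * C y) + (s y * (s y * f y) + w * c y * D y) = f y - eigval L j * \<psi> y"
        by simp
    qed
    finally show ?thesis .
  qed
  have "\<psi> L = 0"
  proof -
    have sL: "s L = 0" using es_boundary(2)[OF L, of j] L by (simp add: es_def s_def w_def)
    \<comment> \<open>The factor undoes the normalisation of \<open>es\<close>, and the sign is
      there because f is minus the source in \<beta>.\<close>
    have "D L = (\<integral>x. (- (1 / sqrt (2 / L))) * ((- G x * (freq L j * ec L j x) + A x * es L j x) * es L j x) \<partial>Om L)"
      unfolding D_def prim_def
      by (intro Bochner_Integration.integral_cong) (use L in \<open>simp_all add: s_def f_def es_def w_def algebra_simps\<close>)
    also have "\<dots> = (- (1 / sqrt (2 / L))) * \<beta> j j" unfolding \<beta>_def by (rule integral_mult_right_zero)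
    finally show ?thesis using sL by (simp add: \<psi>_def j)
  qed
  let ?\<psi> = "\<lambda>x. complex_of_real (\<psi> x)" and ?g = "\<lambda>x. complex_of_real (f x - eigval L j * \<psi> x)" and ?p = "\<lambda>x. complex_of_real (p x)"
  have cprim: "prim (\<lambda>x. complex_of_real (h x)) x = of_real (prim h x)" for h x
    unfolding prim_def by (rule integral_complex_of_real)
  have inI: "AE x in Om L. 0 \<le> x \<and> x \<le> L" by (intro AE_I2) simp
  have a1: "AE x in Om L. ?\<psi> x = prim ?p x" using inI by eventually_elim (simp add: cprim \<psi>p)
  have a2: "prim ?p L = 0" using \<psi>p[of L] \<open>\<psi> L = 0\<close> L by (simp add: cprim)
  have pl: "?p \<in> L2 (Om L)" by (intro L2_continuous continuous_intros pc)
  note H = H10I[OF L pl a1 a2]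
  have gl: "?g \<in> L2 (Om L)"
  proof -
    have "(\<lambda>x. of_real (eigval L j) * ?\<psi> x) \<in> L2 (Om L)" by (intro L2_continuous continuous_intros \<psi>c)
    from L2_diff[OF fl this] show ?thesis by simp
  qed
  have a3: "AE x in Om L. wderiv L ?\<psi> x = 0 + prim ?g x"
    using H(2) inI by eventually_elim (simp only: cprim add_0 pf[symmetric] simp_thms)
  note W = H1I[OF L gl a3]
  show ?thesis
  proof (intro exI conjI)
    show "continuous_on {0..L} ?\<psi>" by (intro continuous_intros \<psi>c)
    show "?\<psi> \<in> H10 L" by (rule H(1))
    show "?\<psi> \<in> H2 L" using W(1) H10E(1)[OF L H(1)] by (simp add: H2_def)
    show "normal_derivative_at_0 L ?\<psi> = 0" using W(3) by (simp add: normal_derivative_at_0_def)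
    show "AE x in Om L. laplacian L ?\<psi> x = of_real (G x * (freq L j * ec L j x) - A x * es L j x) - of_real (eigval L j) * ?\<psi> x"
      using W(2) by eventually_elim (simp add: f_def w_def)
  qed
qed

text \<open>At time 1 and from zero initial datum, every reachable state pairs to zero with (\<psi>,
  \<open>es L j\<close>), while the target chosen below pairs to 1; so the target cannot be
  approached.\<close>

theorem approx_controllable_only_if:
  assumes ctr: "approx_controllable L G a"
  shows "\<beta> j j \<noteq> 0"
proof
  assume "\<beta> j j = 0"
  from invisible_profile[OF this] obtain \<psi> where \<psi>c: "continuous_on {0..L} \<psi>" and \<psi>: "\<psi> \<in> H2 L" "\<psi> \<in> H10 L"
    and nd: "normal_derivative_at_0 L \<psi> = 0"
    and lap: "AE x in Om L. laplacian L \<psi> x = of_real (G x * (freq L j * ec L j x) - A x * es L j x) - of_real (eigval L j) * \<psi> x"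
    by blast
  let ?e = "\<lambda>x. complex_of_real (es L j x)"
  define k where "k t = complex_of_real (exp (- eigval L j * (1 - t)))" for t
  define k' where "k' t = complex_of_real (eigval L j * exp (- eigval L j * (1 - t)))" for t
  have kd: "(k has_vector_derivative k' t) (at t)" for t
    unfolding k_def[abs_def] k'_def by (rule has_vector_derivative_of_real) (auto intro!: derivative_eq_intros)
  have kc: "continuous_on {0..1} k" "continuous_on {0..1} k'"
    unfolding k_def[abs_def] k'_def[abs_def] by (intro continuous_intros)+
  have ec: "continuous_on {0..L} ?e" by (intro continuous_intros)
  have adj: "adjoint_solution L G a 1 \<psi> ?e (\<lambda>t x. k t * \<psi> x) (\<lambda>t x. k t * ?e x)"
    unfolding adjoint_solution_def
  proof (intro conjI exI)
    show "continuous_path (H10 L) (h1norm L) 1 (\<lambda>t x. k t * \<psi> x)" by (rule continuous_path_cmult[OF L \<psi>(2) kc(1)])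
    show "continuous_path (H10 L) (h1norm L) 1 (\<lambda>t x. k t * ?e x)" by (rule continuous_path_cmult[OF L es_H10[OF L] kc(1)])
    show "AE x in Om L. k 1 * \<psi> x = \<psi> x" "AE x in Om L. k 1 * ?e x = ?e x" by (simp_all add: k_def)
    show "has_time_derivative L 1 (\<lambda>t x. k t * \<psi> x) (\<lambda>t x. k' t * \<psi> x)"
      by (rule has_time_derivative_cmult[OF zero_less_one \<psi>c kc(2) kd])
    show "has_time_derivative L 1 (\<lambda>t x. k t * ?e x) (\<lambda>t x. k' t * ?e x)"
      by (rule has_time_derivative_cmult[OF zero_less_one ec kc(2) kd])
    show "AE t in lebesgue_on {0<..<1}. (\<lambda>x. k t * \<psi> x) \<in> H2 L \<and> (\<lambda>x. k t * ?e x) \<in> H2 L \<and>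
       (AE x in Om L. - (k' t * \<psi> x) = laplacian L (\<lambda>x. k t * \<psi> x) x - of_real (G x) * wderiv L (\<lambda>x. k t * ?e x) x
          + of_real (a x - wderiv L G x) * (k t * ?e x)) \<and>
       (AE x in Om L. - (k' t * ?e x) = laplacian L (\<lambda>x. k t * ?e x) x)"
    proof (rule AE_I2, intro conjI)
      fix t
      have k': "k' t = of_real (eigval L j) * k t" by (simp add: k_def k'_def)
      show "(\<lambda>x. k t * \<psi> x) \<in> H2 L" by (rule H2_cmult(1)[OF L \<psi>])
      show "(\<lambda>x. k t * ?e x) \<in> H2 L" by (rule H2_cmult(1)[OF L es_H2(1)[OF L] es_H10[OF L]])
      show "AE x in Om L. - (k' t * ?e x) = laplacian L (\<lambda>x. k t * ?e x) x"
        using H2_cmult(2)[OF L es_H2(1)[OF L] es_H10[OF L], of "k t" j] es_H2(2)[OF L, of j]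
        by eventually_elim (simp add: k')
      show "AE x in Om L. - (k' t * \<psi> x) = laplacian L (\<lambda>x. k t * \<psi> x) x - of_real (G x) * wderiv L (\<lambda>x. k t * ?e x) x
          + of_real (a x - wderiv L G x) * (k t * ?e x)"
        using H2_cmult(2)[OF L \<psi>, of "k t"] lap H10_wderiv_cmult[OF L es_H10[OF L], of "k t" j] es_wderiv[OF L, of j]
      proof eventually_elim
        case (elim x)
        show ?case unfolding elim k' fun_cong[OF A_def, symmetric] by (simp add: algebra_simps)
      qed
    qed
  qed
  let ?F = "\<lambda>u. cnj (\<integral>x. es L j x *\<^sub>R u x \<partial>Om L)"
  have F: "?F \<in> Hm1 L" by (rule pairing_Hm1[OF L]) (intro continuous_intros)
  have Z: "(\<lambda>_. 0) \<in> Hm1 L" by (rule Hm1I[OF _ _ L, where C=0]) auto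
  have Fe: "?F ?e = 1"
  proof -
    have "(\<integral>x. es L j x *\<^sub>R ?e x \<partial>Om L) = of_real (\<integral>x. es L j x * es L j x \<partial>Om L)"
      by (simp only: scaleR_conv_of_real of_real_mult[symmetric] integral_complex_of_real)
    then show ?thesis using es_orthonormal[OF L, of j j] by simp
  qed
  define H where "H = h1norm L \<psi> + h1norm L ?e"
  have H0: "H \<ge> 0" by (simp add: H_def h1norm_nonneg)
  have y0: "((\<lambda>_. 0), (\<lambda>_. 0)) \<in> Hm1 L \<times> Hm1 L" and yT: "((\<lambda>_. 0), ?F) \<in> Hm1 L \<times> Hm1 L" using Z F by auto
  \<comment> \<open>An error below this size in the dual norm changes the pairing with the adjoint
    data by less than 1, as their total norm is H.\<close>
  have \<epsilon>: "1 / (2 * (H + 1)) > 0" using H0 by simp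
  obtain g y1 y2 where ts: "transposition_solution L G a 1 ((\<lambda>_. 0), (\<lambda>_. 0)) g y1 y2"
    and d: "hm1norm2 L (\<lambda>u. y1 1 u - 0, \<lambda>u. y2 1 u - ?F u) \<le> 1 / (2 * (H + 1))"
    using ctr[unfolded approx_controllable_def approx_controllable_at_def, rule_format, OF zero_less_one y0 yT \<epsilon>, unfolded fst_conv snd_conv]
    by (elim exE conjE) (rule that)
  have y: "y1 1 \<in> Hm1 L" "y2 1 \<in> Hm1 L" using ts by (auto simp: transposition_solution_def continuous_path_def)
  have one: "(1 :: real) \<in> {0..1}" by simp
  have nd': "normal_derivative_at_0 L (\<lambda>x. k t * \<psi> x) = 0" for t using H2_cmult(3)[OF L \<psi>, of "k t"] nd by simp
  have "y1 1 \<psi> + y2 1 ?e - ((\<lambda>_. 0) (\<lambda>x. k 0 * \<psi> x) + (\<lambda>_. 0) (\<lambda>x. k 0 * ?e x)) =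
      - (\<integral>t. g t 0 * cnj (normal_derivative_at_0 L (\<lambda>x. k t * \<psi> x)) \<partial>lebesgue_on {0<..<1})"
    by (rule ts[unfolded transposition_solution_def fst_conv snd_conv, THEN conjunct2, THEN conjunct2, rule_format, OF one \<psi>(2) es_H10[OF L] adj])
  then have zero: "y1 1 \<psi> + y2 1 ?e = 0" by (simp add: nd')
  define \<delta> where "\<delta> = 1 / (2 * (H + 1))"
  note D1 = norm_Hm1_le[OF L Hm1_diff[OF y(1) Z L]] and D2 = norm_Hm1_le[OF L Hm1_diff[OF y(2) F L]]
  have hs: "sqrt ((hm1norm L (\<lambda>u. y1 1 u - 0))\<^sup>2 + (hm1norm L (\<lambda>u. y2 1 u - ?F u))\<^sup>2) \<le> \<delta>"
    using d unfolding hm1norm2_def fst_conv snd_conv \<delta>_def .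
  have b: "hm1norm L (\<lambda>u. y1 1 u - 0) \<le> \<delta>" "hm1norm L (\<lambda>u. y2 1 u - ?F u) \<le> \<delta>"
    using order_trans[OF real_sqrt_sum_squares_ge1 hs] order_trans[OF real_sqrt_sum_squares_ge2 hs] .
  have n1: "norm (y1 1 \<psi> - 0) \<le> \<delta> * h1norm L \<psi>"
    using D1(1)[OF \<psi>(2)] mult_right_mono[OF b(1) h1norm_nonneg[of L \<psi>]] by linarith
  have n2: "norm (y2 1 ?e - ?F ?e) \<le> \<delta> * h1norm L ?e"
    using D2(1)[OF es_H10[OF L, of j]] mult_right_mono[OF b(2) h1norm_nonneg[of L ?e]] by linarith
  have "(1 :: complex) = - ((y1 1 \<psi> - 0) + (y2 1 ?e - ?F ?e))" unfolding Fe using zero by (simp add: algebra_simps)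
  then have "norm (1 :: complex) = norm ((y1 1 \<psi> - 0) + (y2 1 ?e - ?F ?e))" by (metis norm_minus_cancel)
  also have "\<dots> \<le> \<delta> * h1norm L \<psi> + \<delta> * h1norm L ?e" by (rule order_trans[OF norm_triangle_ineq add_mono[OF n1 n2]])
  also have "\<dots> = H / (2 * (H + 1))" by (simp add: \<delta>_def H_def add_divide_distrib)
  also have "\<dots> < 1" using H0 by (simp add: field_simps)
  finally show False by simp
qed

text \<open>On the diagonal e' e is half the derivative of e^2, so integration by parts turns - G e'
  e into half of G' e^2. Added to (a - G') e^2 this gives the weight of the criterion.\<close>

lemma beta_diagonal: "\<beta> n n = (\<integral>x. (- (1/2) * wderiv L G x + a x) * (es L n x)\<^sup>2 \<partial>Om L)"
proof -
  let ?w = "\<lambda>x. freq L n * ec L n x" and ?e = "es L n"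
  let ?v = "\<lambda>x. 2 * (?w x * ?e x)" and ?g = "\<lambda>x. g0 + prim (wderiv L G) x"
  have gc: "continuous_on {0..L} ?g" by (intro continuous_intros continuous_on_prim G'_integrable)
  have vi: "integrable (Om L) ?v" by (rule integrable_continuous_Om) (intro continuous_intros)
  have v: "prim ?v x = (?e x)\<^sup>2" if "0 \<le> x" for x
  proof -
    have "prim ?v x = (?e x)\<^sup>2 - (?e 0)\<^sup>2"
    proof (rule prim_FTC_real[OF that])
      show "((\<lambda>x. (?e x)\<^sup>2) has_real_derivative ?v t) (at t)" for t
        using DERIV_power[OF es_deriv[of L n t], of 2] by (simp add: mult_ac)
    qed (intro continuous_intros)
    then show ?thesis by (simp add: es_boundary)
  qed
  have e2: "continuous_on {0..L} (\<lambda>x. (?e x)\<^sup>2)" by (intro continuous_intros)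
  have ge: "integrable (Om L) (\<lambda>x. wderiv L G x * (?e x)\<^sup>2)" and Ae: "integrable (Om L) (\<lambda>x. A x * (?e x)\<^sup>2)"
    using continuous_scaleR_integrable[OF e2 G'_integrable] continuous_scaleR_integrable[OF e2 A_integrable] by (simp_all add: mult.commute)
  have gv: "integrable (Om L) (\<lambda>x. ?g x * ?v x)" by (rule integrable_continuous_Om) (intro continuous_intros gc)
  have "(\<integral>x. ?g x * ?v x \<partial>Om L) + (\<integral>x. wderiv L G x * (0 + prim ?v x) \<partial>Om L) = ?g L * (0 + prim ?v L) - g0 * 0"
    using integration_by_parts[OF G'_integrable vi, of g0 0] by simp
  moreover have "(\<integral>x. wderiv L G x * (0 + prim ?v x) \<partial>Om L) = (\<integral>x. wderiv L G x * (?e x)\<^sup>2 \<partial>Om L)"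
    by (intro Bochner_Integration.integral_cong) (auto simp: v)
  moreover have "prim ?v L = 0" using v[of L] L by (simp add: es_boundary)
  ultimately have ibp: "(\<integral>x. ?g x * ?v x \<partial>Om L) = - (\<integral>x. wderiv L G x * (?e x)\<^sup>2 \<partial>Om L)" by simp
  have "\<beta> n n = (\<integral>x. (- 1 / 2) * (?g x * ?v x) + A x * (?e x)\<^sup>2 \<partial>Om L)"
    unfolding \<beta>_def
  proof (rule integral_Om_cong_AE)
    show "AE x in Om L. (- G x * ?w x + A x * ?e x) * ?e x = (- 1 / 2) * (?g x * ?v x) + A x * (?e x)\<^sup>2"
      using G_prim by eventually_elim (simp add: power2_eq_square algebra_simps)
    show "(\<lambda>x. (- G x * ?w x + A x * ?e x) * ?e x) \<in> borel_measurable (Om L)"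
      by (intro borel_measurable_times borel_measurable_add borel_measurable_uminus Gm Am borel_measurable_es borel_measurable_integrable[OF integrable_continuous_Om] continuous_intros)
  qed
  also have "\<dots> = (- 1 / 2) * (\<integral>x. ?g x * ?v x \<partial>Om L) + (\<integral>x. A x * (?e x)\<^sup>2 \<partial>Om L)"
    using gv Ae by (simp only: Bochner_Integration.integral_add integrable_mult_right integral_mult_right_zero)
  also have "\<dots> = (1 / 2) * (\<integral>x. wderiv L G x * (?e x)\<^sup>2 \<partial>Om L) + (\<integral>x. A x * (?e x)\<^sup>2 \<partial>Om L)" unfolding ibp by simp
  also have "\<dots> = (\<integral>x. (1 / 2) * (wderiv L G x * (?e x)\<^sup>2) + A x * (?e x)\<^sup>2 \<partial>Om L)"
    using ge Ae by (simp only: Bochner_Integration.integral_add integrable_mult_right integral_mult_right_zero)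
  also have "\<dots> = (\<integral>x. (- (1/2) * wderiv L G x + a x) * (?e x)\<^sup>2 \<partial>Om L)"
    by (intro Bochner_Integration.integral_cong) (simp_all add: A_def algebra_simps)
  finally show ?thesis .
qed

end

text \<open>The chosen \<open>wderiv L G\<close> agrees almost everywhere with the bounded weak
  derivative v, and so inherits its measurability and its bound.\<close>

lemma controlled_system_exists:
  assumes L: "L > 0" and G: "G \<in> W1inf L" and a: "a \<in> Linf (Om L)"
  shows "\<exists>M g0. controlled_system L M G (\<lambda>x. a x - wderiv L G x) a g0"
proof -
  obtain v where v: "v \<in> Linf (Om L)" "has_weak_derivative L G v" and GL: "G \<in> Linf (Om L)"
    using G unfolding W1inf_def by blast
  have w: "has_weak_derivative L G (wderiv L G)"
    unfolding wderiv_def by (rule someI[where P="has_weak_derivative L G", OF v(2)])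
  have vw: "AE x in Om L. v x = wderiv L G x" by (rule weak_derivative_unique[OF v(2) w])
  obtain C1 where C1: "AE x in Om L. \<bar>G x\<bar> \<le> C1" and Gm: "G \<in> borel_measurable (Om L)" using GL unfolding Linf_def by blast
  obtain C2 where C2: "AE x in Om L. \<bar>v x\<bar> \<le> C2" and vm: "v \<in> borel_measurable (Om L)" using v unfolding Linf_def by blast
  obtain C3 where C3: "AE x in Om L. \<bar>a x\<bar> \<le> C3" and am: "a \<in> borel_measurable (Om L)" using a unfolding Linf_def by blast
  have wm: "wderiv L G \<in> borel_measurable (Om L)" by (rule borel_measurable_Om_AE[OF vm vw])
  have vi: "integrable (Om L) v"
    by (rule finite_measure.integrable_const_bound[OF finite_measure_Om _ vm, of C2]) (use C2 in simp)
  have wi: "integrable (Om L) (wderiv L G)" by (rule integrable_Om_AE[OF vi vw])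
  obtain g0 where g0: "AE x in Om L. G x = g0 + prim (wderiv L G) x" using weak_derivative_imp_prim[OF L w wi] .
  have "controlled_system L (max C1 (C2 + C3)) G (\<lambda>x. a x - wderiv L G x) a g0"
  proof unfold_locales
    show "AE x in Om L. \<bar>G x\<bar> \<le> max C1 (C2 + C3)" using C1 by eventually_elim simp
    show "AE x in Om L. \<bar>a x - wderiv L G x\<bar> \<le> max C1 (C2 + C3)"
      using C2 C3 vw
    proof eventually_elim
      case (elim x)
      then have "\<bar>a x - wderiv L G x\<bar> \<le> C2 + C3" by simp
      then show ?case by simp
    qed
    show "(\<lambda>x. a x - wderiv L G x) \<in> borel_measurable (Om L)" by (intro borel_measurable_diff am wm)
  qed (use L Gm wi g0 in auto)
  then show ?thesis by blast
qed

text \<open>The normalisation forces the scalar c to have modulus 1, so the squared modulus is that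
  of the sine for every choice of phase.\<close>

lemma weighted_eigenfunction_integral:
  assumes L: "L > 0" and u: "AE x in Om L. u x = c * of_real (es L n x)" and n: "l2norm (Om L) u = 1" and ul: "u \<in> L2 (Om L)"
    and b: "b \<in> borel_measurable (Om L)"
  shows "(\<integral>x. b x * (norm (u x))\<^sup>2 \<partial>Om L) = (\<integral>x. b x * (es L n x)\<^sup>2 \<partial>Om L)"
proof -
  have um: "u \<in> borel_measurable (Om L)" by (rule L2D(1)[OF ul])
  have sq: "AE x in Om L. (norm (u x))\<^sup>2 = (norm c)\<^sup>2 * (es L n x * es L n x)"
    using u by eventually_elim (simp add: norm_mult power_mult_distrib power2_eq_square)
  have "1 = (\<integral>x. (norm (u x))\<^sup>2 \<partial>Om L)" using n l2norm_square[of "Om L" u] by simp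
  also have "\<dots> = (\<integral>x. (norm c)\<^sup>2 * (es L n x * es L n x) \<partial>Om L)"
    by (rule integral_Om_cong_AE[OF sq]) (use um in measurable)
  also have "\<dots> = (norm c)\<^sup>2" using es_orthonormal[OF L, of n n] by (simp only: integral_mult_right_zero) simp
  finally have c: "(norm c)\<^sup>2 = 1" by simp
  show ?thesis
  proof (rule integral_Om_cong_AE)
    show "AE x in Om L. b x * (norm (u x))\<^sup>2 = b x * (es L n x)\<^sup>2"
      using sq
    proof eventually_elim
      case (elim x)
      show ?case unfolding elim c by (simp add: power2_eq_square)
    qed
    show "(\<lambda>x. b x * (norm (u x))\<^sup>2) \<in> borel_measurable (Om L)" using um b by measurable
  qed
qed

theorem theorem3p3:
  fixes L :: real and G a :: "real \<Rightarrow> real"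
    and lam :: "nat \<Rightarrow> real" and \<phi> :: "nat \<Rightarrow> real \<Rightarrow> complex"
  assumes "L > 0"
    and "G \<in> W1inf L"
    and "a \<in> Linf (Om L)"
    and "bij_betw (\<lambda>l. complex_of_real (- lam l)) UNIV (dirichlet_eigenvalues L)"
    and "\<And>l. dirichlet_eigenfunction L (complex_of_real (- lam l)) (\<phi> l)"
    and "\<And>l. l2norm (Om L) (\<phi> l) = 1"
  shows "approx_controllable L G a \<longleftrightarrow>
    (\<forall>l. (\<integral>x. (- (1/2) * wderiv L G x + a x) * (norm (\<phi> l x))\<^sup>2 \<partial>Om L) \<noteq> 0)"
proof -
  obtain M g0 where "controlled_system L M G (\<lambda>x. a x - wderiv L G x) a g0"
    using controlled_system_exists[OF assms(1-3)] by blast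
  then interpret controlled_system L M G "\<lambda>x. a x - wderiv L G x" a g0 .
  let ?I = "\<lambda>l. \<integral>x. (- (1/2) * wderiv L G x + a x) * (norm (\<phi> l x))\<^sup>2 \<partial>Om L"
  have bm: "(\<lambda>x. - (1/2) * wderiv L G x + a x) \<in> borel_measurable (Om L)"
    by (intro borel_measurable_add borel_measurable_times borel_measurable_const borel_measurable_integrable G'_integrable a_integrable)
  have I: "\<exists>n. complex_of_real (- lam l) = - of_real (eigval L n) \<and> ?I l = \<beta> n n" for l
  proof -
    obtain n c where n: "complex_of_real (- lam l) = - of_real (eigval L n)" "AE x in Om L. \<phi> l x = c * of_real (es L n x)"
      using dirichlet_eigenfunction_imp_es[OF assms(1) assms(5)[of l]] by blast
    have "\<phi> l \<in> L2 (Om L)" using assms(5)[of l] H10E(2)[OF assms(1)] by (simp add: dirichlet_eigenfunction_def)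
    from weighted_eigenfunction_integral[OF assms(1) n(2) assms(6) this bm] n(1) show ?thesis
      by (auto simp: beta_diagonal)
  qed
  \<comment> \<open>The enumeration by l may order the spectrum differently from the sines; since it
    exhausts all eigenvalues, every diagonal coefficient occurs, as sufficiency demands.\<close>
  have surj: "\<exists>l. ?I l = \<beta> n n" for n
  proof -
    have "- of_real (eigval L n) \<in> dirichlet_eigenvalues L"
      using dirichlet_eigenfunction_es[OF assms(1), of n] by (auto simp: dirichlet_eigenvalues_def)
    then obtain l where l: "complex_of_real (- lam l) = - of_real (eigval L n)"
      using assms(4) by (metis (no_types, lifting) bij_betw_imp_surj_on imageE)
    obtain m where m: "complex_of_real (- lam l) = - of_real (eigval L m)" "?I l = \<beta> m m" using I by blast
    then have "eigval L m = eigval L n" using l by simp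
    then have mn: "m = n" by (simp only: eigval_inj[OF assms(1)])
    show ?thesis using m(2) unfolding mn by (rule exI)
  qed
  show ?thesis
  proof
    assume "approx_controllable L G a"
    then have "\<beta> n n \<noteq> 0" for n by (rule approx_controllable_only_if)
    then show "\<forall>l. ?I l \<noteq> 0" using I by metis
  next
    assume "\<forall>l. ?I l \<noteq> 0"
    then have "\<beta> n n \<noteq> 0" for n using surj by metis
    then show "approx_controllable L G a" by (rule approx_controllable_if)
  qed
qed

end
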